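(* Let $\mathcal V$ be an extensive, cartesian closed category with pullbacks, let $\mathcal G$ be a conservative family of objects in $\mathcal V$, and let $G\colon\mathcal I\to\mathcal C$ be a $\mathcal V$-functor. Given a pair $(L,\lambda)$ of an object $L\in\mathcal C$ and a $\mathcal V$-natural transformation $\lambda\colon\Delta L\Rightarrow G$ in $\mathcal V\text{-}\mathrm{Cat}(\mathcal I,\mathcal C)$, the following are equivalent: (i) the pair $(L,\lambda)$ is a $\mathcal V$-limit of $G$; (ii) the pair $(L,\lambda)$ is an internal terminal object in the internal category $\mathrm{Int}\,\Delta\downarrow G$; (iii) for every object $X\in\mathcal G$, the pair $(L,\lambda)$ is a $\mathcal V$-terminal object in the $\mathcal V$-category $\mathrm{Und}\llbracket\mathrm{cst}X,\mathrm{Int}\,\Delta\downarrow G\rrbracket$.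
   Context: Extensive: $\mathcal V$ has all small coproducts and for every set $I$ and family $\{X_i\}_{i\in I}$ the functor $\bigsqcup_{i\in I}\colon\prod_{i\in I}\mathcal V_{/X_i}\to\mathcal V_{/\bigsqcup_i X_i}$ is an equivalence. $\ast$ is the terminal object, $\emptyset$ the initial object of $\mathcal V$, $\iota$ denotes coproduct inclusions. A family $\mathcal G$ of objects is conservative if a map $f\colon Y\to Z$ in $\mathcal V$ is an isomorphism if and only if $f_*\colon\mathcal V(X,Y)\to\mathcal V(X,Z)$ is a bijection for every $X\in\mathcal G$. $\mathcal V$-categories are enriched over the cartesian structure and have a set of objects. $\mathcal C^{\mathcal I}$ is the $\mathcal V$-category of $\mathcal V$-functors $\mathcal I\to\mathcal C$ with hom-objects the ends $\int_{i}\mathcal C(Fi,F'i)$; $\Delta\colon\mathcal C\to\mathcal C^{\mathcal I}$ is the diagonal $\mathcal V$-functor. $(L,\lambda)$ is a (conical) $\mathcal V$-limit of $G$ if the $\mathcal V$-functor $\mathcal C^{\mathcal I}(\Delta(-),G)\colon\mathcal C^{\mathrm{op}}\to\mathcal V$ is $\mathcal V$-representable by $(L,\lambda)$, i.e. the $\mathcal V$-natural transformation $\mathcal C(-,L)\Rightarrow\mathcal C^{\mathcal I}(\Delta(-),G)$ corresponding to $\lambda\colon\ast\to\mathcal C^{\mathcal I}(\Delta L,G)$ by the enriched Yoneda lemma is an isomorphism. An object $T$ of a $\mathcal V$-category $\mathcal D$ is $\mathcal V$-terminal if $\mathcal D(A,T)\to\ast$ is an isomorphism for all $A\in\mathcal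 D$. An internal category $\mathbb A$ to $\mathcal V$ consists of objects $\mathbb A_0,\mathbb A_1$ with maps $s,t,i,c$ satisfying the usual axioms; with internal functors these form $\mathrm{Cat}(\mathcal V)$, cartesian closed with internal hom $\llbracket-,-\rrbracket$. $\mathrm{cst}X$ is the internal category with $(\mathrm{cst}X)_0=(\mathrm{cst}X)_1=X$ and identity structure maps; $\ast=\mathrm{cst}\ast$ is terminal; an element of $\mathbb A$ is an internal functor $\ast\to\mathbb A$, i.e. a map $\ast\to\mathbb A_0$. $\mathrm{Int}\,\mathcal C$ has $(\mathrm{Int}\,\mathcal C)_0=\bigsqcup_{A}\ast$, $(\mathrm{Int}\,\mathcal C)_1=\bigsqcup_{A,B}\mathcal C(A,B)$ with the evident structure maps; $\mathrm{Int}$ is a functor. $\mathrm{Und}\,\mathbb A$ is the $\mathcal V$-category with objects the maps $\ast\to\mathbb A_0$ and $\mathrm{Und}\,\mathbb A(A,B)$ the pullback of $(s,t)\colon\mathbb A_1\to\mathbb A_0\times\mathbb A_0$ along $(A,B)\colon\ast\to\mathbb A_0\times\mathbb A_0$. $\mathbb 2=\mathrm{Int}\,\mathbb 2$ for the $\mathcal V$-category with objects $0,1$, hom-objects $\mathbb 2(0,0)=\mathbb 2(0,1)=\mathbb 2(1,1)=\ast$, $\mathbb 2(1,0)=\emptyset$, with inclusion $\langle0,1\rangle\colon\ast\sqcup\ast\to\mathbb 2$. For $H\colon\mathbb A\to\mathbb B$ and an element $B$ of $\mathbb B$, the comma internal category $H\downarrow B$ is the pullback in $\mathrm{Cat}(\mathcal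 V)$ of $\langle0,1\rangle^*\colon\llbracket\mathbb 2,\mathbb B\rrbracket\to\mathbb B\times\mathbb B$ along $H\times B\colon\mathbb A\to\mathbb B\times\mathbb B$. The slice is $\mathbb A_{/T}=\mathrm{id}_{\mathbb A}\downarrow T$; $T$ is an internal terminal object of $\mathbb A$ if the projection $\mathbb A_{/T}\to\mathbb A$ is an isomorphism. $\mathrm{Int}\,\Delta\downarrow G$ is the comma internal category for $\mathrm{Int}\,\Delta\colon\mathrm{Int}\,\mathcal C\to\mathrm{Int}(\mathcal C^{\mathcal I})$ and the element $G\in\mathcal C^{\mathcal I}$. $(L,\lambda)$ is regarded as the element given by $\iota_L\colon\ast\to\mathrm{Int}\,\mathcal C$ and $\lambda\colon\ast\to\mathcal C^{\mathcal I}(\Delta L,G)$; it is regarded as an object of $\mathrm{Und}\llbracket\mathrm{cst}X,\mathbb A\rrbracket$, where $\mathbb A=\mathrm{Int}\,\Delta\downarrow G$, by post-composing with $!^*\colon\mathbb A\to\llbracket\mathrm{cst}X,\mathbb A\rrbracket$ induced by $\mathrm{cst}X\to\ast$. *)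

theory Defs
  imports "HOL-Library.FuncSet" "HOL-Library.Equipollence"
begin

section \<open>Smallness\<close>

text \<open>
  Smallness is relative to a set \<open>U\<close> of infinite, strongly inaccessible cardinality (countable
  \<open>U\<close> is also allowed): a set, of any type, is small if it has fewer elements than \<open>U\<close>.  The
  last two conditions are closure of small sets under power sets and under small unions.
\<close>

definition small :: "'u set \<Rightarrow> 'b set \<Rightarrow> bool" where
  "small U A \<longleftrightarrow> A \<prec> U"

definition universe :: "'u set \<Rightarrow> bool" where
  "universe U \<longleftrightarrow> infinite U \<and>
     (\<forall>A. A \<subseteq> U \<and> small U A \<longrightarrow> small U (Pow A)) \<and>
     (\<forall>A (f :: 'u \<Rightarrow> 'u set). A \<subseteq> U \<and> small U A \<and> (\<forall>a\<in>A. f a \<subseteq> U \<and> small U (f a)) \<longrightarrow>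
        small U (\<Union>a\<in>A. f a))"


section \<open>Categories and universal constructions\<close>

record ('o, 'm) cat =
  Obj :: "'o set"
  Arr :: "'m set"
  Dom :: "'m \<Rightarrow> 'o"
  Cod :: "'m \<Rightarrow> 'o"
  Ident :: "'o \<Rightarrow> 'm"
  Comp :: "'m \<Rightarrow> 'm \<Rightarrow> 'm" (infixr "\<cdot>\<index>" 70)

text \<open>
  Below, a universal object is first characterised by its universal property and then a fixed one
  is chosen by \<open>SOME\<close>, induced maps being given by \<open>THE\<close>.  \<open>Comp V g f\<close> is \<open>g\<close> after \<open>f\<close>.
\<close>

context
  fixes V :: "('o, 'm) cat" (structure)
begin

definition Hom :: "'o \<Rightarrow> 'o \<Rightarrow> 'm set" where
  "Hom X Y = {f \<in> Arr V. Dom V f = X \<and> Cod V f = Y}"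

definition category :: bool where
  "category \<longleftrightarrow>
     (\<forall>f\<in>Arr V. Dom V f \<in> Obj V \<and> Cod V f \<in> Obj V) \<and>
     (\<forall>X\<in>Obj V. Ident V X \<in> Hom X X) \<and>
     (\<forall>X Y Z. \<forall>f\<in>Hom X Y. \<forall>g\<in>Hom Y Z. g \<cdot> f \<in> Hom X Z) \<and>
     (\<forall>X Y. \<forall>f\<in>Hom X Y. Ident V Y \<cdot> f = f \<and> f \<cdot> Ident V X = f) \<and>
     (\<forall>W X Y Z. \<forall>f\<in>Hom W X. \<forall>g\<in>Hom X Y. \<forall>h\<in>Hom Y Z. (h \<cdot> g) \<cdot> f = h \<cdot> (g \<cdot> f))"

definition locally_small :: "'u set \<Rightarrow> bool" where
  "locally_small U \<longleftrightarrow> (\<forall>X\<in>Obj V. \<forall>Y\<in>Obj V. small U (Hom X Y))"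

definition iso :: "'m \<Rightarrow> bool" where
  "iso f \<longleftrightarrow> f \<in> Arr V \<and>
     (\<exists>g\<in>Hom (Cod V f) (Dom V f). g \<cdot> f = Ident V (Dom V f) \<and> f \<cdot> g = Ident V (Cod V f))"

definition is_terminal :: "'o \<Rightarrow> bool" where
  "is_terminal T \<longleftrightarrow> T \<in> Obj V \<and> (\<forall>X\<in>Obj V. \<exists>!f. f \<in> Hom X T)"

definition term_ob :: 'o where
  "term_ob = (SOME T. is_terminal T)"

definition bang :: "'o \<Rightarrow> 'm" where
  "bang X = (THE f. f \<in> Hom X term_ob)"

definition is_initial :: "'o \<Rightarrow> bool" where
  "is_initial T \<longleftrightarrow> T \<in> Obj V \<and> (\<forall>X\<in>Obj V. \<exists>!f. f \<in> Hom T X)"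

definition init_ob :: 'o where
  "init_ob = (SOME T. is_initial T)"

definition cobang :: "'o \<Rightarrow> 'm" where
  "cobang X = (THE f. f \<in> Hom init_ob X)"

definition is_product :: "'o \<Rightarrow> 'o \<Rightarrow> 'o \<times> 'm \<times> 'm \<Rightarrow> bool" where
  "is_product X Y = (\<lambda>(P, p, q). P \<in> Obj V \<and> p \<in> Hom P X \<and> q \<in> Hom P Y \<and>
     (\<forall>Z\<in>Obj V. \<forall>f\<in>Hom Z X. \<forall>g\<in>Hom Z Y. \<exists>!h. h \<in> Hom Z P \<and> p \<cdot> h = f \<and> q \<cdot> h = g))"

definition prd :: "'o \<Rightarrow> 'o \<Rightarrow> 'o" where
  "prd X Y = fst (SOME t. is_product X Y t)"

definition pr1 :: "'o \<Rightarrow> 'o \<Rightarrow> 'm" where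
  "pr1 X Y = fst (snd (SOME t. is_product X Y t))"

definition pr2 :: "'o \<Rightarrow> 'o \<Rightarrow> 'm" where
  "pr2 X Y = snd (snd (SOME t. is_product X Y t))"

definition pair :: "'m \<Rightarrow> 'm \<Rightarrow> 'm" where
  "pair f g = (THE h. h \<in> Hom (Dom V f) (prd (Cod V f) (Cod V g)) \<and>
     pr1 (Cod V f) (Cod V g) \<cdot> h = f \<and> pr2 (Cod V f) (Cod V g) \<cdot> h = g)"

definition is_pullback :: "'m \<Rightarrow> 'm \<Rightarrow> 'o \<times> 'm \<times> 'm \<Rightarrow> bool" where
  "is_pullback f g = (\<lambda>(P, p, q). P \<in> Obj V \<and> p \<in> Hom P (Dom V f) \<and> q \<in> Hom P (Dom V g) \<and>
     f \<cdot> p = g \<cdot> q \<and>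
     (\<forall>Z\<in>Obj V. \<forall>a\<in>Hom Z (Dom V f). \<forall>b\<in>Hom Z (Dom V g). f \<cdot> a = g \<cdot> b \<longrightarrow>
        (\<exists>!h. h \<in> Hom Z P \<and> p \<cdot> h = a \<and> q \<cdot> h = b)))"

definition pb :: "'m \<Rightarrow> 'm \<Rightarrow> 'o" where
  "pb f g = fst (SOME t. is_pullback f g t)"

definition pb1 :: "'m \<Rightarrow> 'm \<Rightarrow> 'm" where
  "pb1 f g = fst (snd (SOME t. is_pullback f g t))"

definition pb2 :: "'m \<Rightarrow> 'm \<Rightarrow> 'm" where
  "pb2 f g = snd (snd (SOME t. is_pullback f g t))"

definition pb_pair :: "'m \<Rightarrow> 'm \<Rightarrow> 'm \<Rightarrow> 'm \<Rightarrow> 'm" where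
  "pb_pair f g a b = (THE h. h \<in> Hom (Dom V a) (pb f g) \<and> pb1 f g \<cdot> h = a \<and> pb2 f g \<cdot> h = b)"

text \<open>Exponentials: \<open>expo X Y\<close> is \<open>Y\<^sup>X\<close>, with evaluation \<open>Y\<^sup>X \<times> X \<rightarrow> Y\<close>.\<close>

definition is_exponential :: "'o \<Rightarrow> 'o \<Rightarrow> 'o \<times> 'm \<Rightarrow> bool" where
  "is_exponential X Y = (\<lambda>(E, e). E \<in> Obj V \<and> e \<in> Hom (prd E X) Y \<and>
     (\<forall>Z\<in>Obj V. \<forall>f\<in>Hom (prd Z X) Y.
        \<exists>!g. g \<in> Hom Z E \<and> e \<cdot> pair (g \<cdot> pr1 Z X) (pr2 Z X) = f))"

definition expo :: "'o \<Rightarrow> 'o \<Rightarrow> 'o" where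
  "expo X Y = fst (SOME t. is_exponential X Y t)"

definition eval_map :: "'o \<Rightarrow> 'o \<Rightarrow> 'm" where
  "eval_map X Y = snd (SOME t. is_exponential X Y t)"

text \<open>The transpose of \<open>f : Z \<times> X \<rightarrow> Y\<close>.\<close>

definition curry_map :: "'o \<Rightarrow> 'o \<Rightarrow> 'm \<Rightarrow> 'm" where
  "curry_map Z X f = (THE g. g \<in> Hom Z (expo X (Cod V f)) \<and>
     eval_map X (Cod V f) \<cdot> pair (g \<cdot> pr1 Z X) (pr2 Z X) = f)"

definition has_pullbacks :: bool where
  "has_pullbacks \<longleftrightarrow>
     (\<forall>f\<in>Arr V. \<forall>g\<in>Arr V. Cod V f = Cod V g \<longrightarrow> (\<exists>t. is_pullback f g t))"

definition cartesian_closed :: bool where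
  "cartesian_closed \<longleftrightarrow> (\<exists>T. is_terminal T) \<and>
     (\<forall>X\<in>Obj V. \<forall>Y\<in>Obj V. \<exists>t. is_product X Y t) \<and>
     (\<forall>X\<in>Obj V. \<forall>Y\<in>Obj V. \<exists>t. is_exponential X Y t)"

definition is_coproduct :: "'k set \<Rightarrow> ('k \<Rightarrow> 'o) \<Rightarrow> 'o \<times> ('k \<Rightarrow> 'm) \<Rightarrow> bool" where
  "is_coproduct I X = (\<lambda>(S, j). S \<in> Obj V \<and> (\<forall>i\<in>I. j i \<in> Hom (X i) S) \<and>
     (\<forall>Z\<in>Obj V. \<forall>f. (\<forall>i\<in>I. f i \<in> Hom (X i) Z) \<longrightarrow>
        (\<exists>!h. h \<in> Hom S Z \<and> (\<forall>i\<in>I. h \<cdot> j i = f i))))"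

definition coprd :: "'k set \<Rightarrow> ('k \<Rightarrow> 'o) \<Rightarrow> 'o" where
  "coprd I X = fst (SOME t. is_coproduct I X t)"

definition coinj :: "'k set \<Rightarrow> ('k \<Rightarrow> 'o) \<Rightarrow> 'k \<Rightarrow> 'm" where
  "coinj I X = snd (SOME t. is_coproduct I X t)"

text \<open>The map \<open>\<Squnion>\<^sub>i X\<^sub>i \<rightarrow> Z\<close> induced by \<open>f\<^sub>i : X\<^sub>i \<rightarrow> Z\<close>.\<close>

definition copair :: "'k set \<Rightarrow> ('k \<Rightarrow> 'o) \<Rightarrow> 'o \<Rightarrow> ('k \<Rightarrow> 'm) \<Rightarrow> 'm" where
  "copair I X Z f = (THE h. h \<in> Hom (coprd I X) Z \<and> (\<forall>i\<in>I. h \<cdot> coinj I X i = f i))"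

definition conservative_family :: "'o set \<Rightarrow> bool" where
  "conservative_family \<G> \<longleftrightarrow> \<G> \<subseteq> Obj V \<and>
     (\<forall>Y\<in>Obj V. \<forall>Z\<in>Obj V. \<forall>f\<in>Hom Y Z.
        iso f \<longleftrightarrow> (\<forall>X\<in>\<G>. bij_betw (\<lambda>g. f \<cdot> g) (Hom X Y) (Hom X Z)))"

end


section \<open>Functors, equivalences and extensivity\<close>

record ('o, 'm, 'o2, 'm2) cfun =
  fo :: "'o \<Rightarrow> 'o2"
  fa :: "'m \<Rightarrow> 'm2"

definition is_functor :: "('o, 'm) cat \<Rightarrow> ('o2, 'm2) cat \<Rightarrow> ('o, 'm, 'o2, 'm2) cfun \<Rightarrow> bool" where
  "is_functor A B F \<longleftrightarrow>
     (\<forall>X\<in>Obj A. fo F X \<in> Obj B) \<and>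
     (\<forall>X\<in>Obj A. \<forall>Y\<in>Obj A. \<forall>f\<in>Hom A X Y. fa F f \<in> Hom B (fo F X) (fo F Y)) \<and>
     (\<forall>X\<in>Obj A. fa F (Ident A X) = Ident B (fo F X)) \<and>
     (\<forall>f\<in>Arr A. \<forall>g\<in>Arr A. Dom A g = Cod A f \<longrightarrow>
        fa F (g \<cdot>\<^bsub>A\<^esub> f) = fa F g \<cdot>\<^bsub>B\<^esub> fa F f)"

definition cfun_id :: "('o, 'm, 'o, 'm) cfun" where
  "cfun_id = \<lparr>fo = (\<lambda>X. X), fa = (\<lambda>f. f)\<rparr>"

definition cfun_comp ::
  "('o2, 'm2, 'o3, 'm3) cfun \<Rightarrow> ('o, 'm, 'o2, 'm2) cfun \<Rightarrow> ('o, 'm, 'o3, 'm3) cfun" where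
  "cfun_comp G F = \<lparr>fo = (\<lambda>X. fo G (fo F X)), fa = (\<lambda>f. fa G (fa F f))\<rparr>"

definition is_nat_iso :: "('o, 'm) cat \<Rightarrow> ('o2, 'm2) cat \<Rightarrow>
    ('o, 'm, 'o2, 'm2) cfun \<Rightarrow> ('o, 'm, 'o2, 'm2) cfun \<Rightarrow> ('o \<Rightarrow> 'm2) \<Rightarrow> bool" where
  "is_nat_iso A B F G \<eta> \<longleftrightarrow>
     (\<forall>X\<in>Obj A. \<eta> X \<in> Hom B (fo F X) (fo G X) \<and> iso B (\<eta> X)) \<and>
     (\<forall>X\<in>Obj A. \<forall>Y\<in>Obj A. \<forall>f\<in>Hom A X Y. \<eta> Y \<cdot>\<^bsub>B\<^esub> fa F f = fa G f \<cdot>\<^bsub>B\<^esub> \<eta> X)"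

definition is_equivalence ::
  "('o, 'm) cat \<Rightarrow> ('o2, 'm2) cat \<Rightarrow> ('o, 'm, 'o2, 'm2) cfun \<Rightarrow> bool" where
  "is_equivalence A B F \<longleftrightarrow> is_functor A B F \<and>
     (\<exists>G \<eta> \<epsilon>. is_functor B A G \<and>
        is_nat_iso A A cfun_id (cfun_comp G F) \<eta> \<and>
        is_nat_iso B B (cfun_comp F G) cfun_id \<epsilon>)"

text \<open>
  The slice over \<open>X\<close>: objects are the arrows \<open>f\<close> into \<open>X\<close>, and \<open>(f, h, g)\<close> is the arrow
  \<open>h : f \<rightarrow> g\<close>.
\<close>

definition slice_cat :: "('o, 'm) cat \<Rightarrow> 'o \<Rightarrow> ('m, 'm \<times> 'm \<times> 'm) cat" where
  "slice_cat V X = \<lparr>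
     Obj = {f \<in> Arr V. Cod V f = X},
     Arr = {(f, h, g). f \<in> Arr V \<and> Cod V f = X \<and> g \<in> Arr V \<and> Cod V g = X \<and>
              h \<in> Hom V (Dom V f) (Dom V g) \<and> g \<cdot>\<^bsub>V\<^esub> h = f},
     Dom = (\<lambda>(f, h, g). f),
     Cod = (\<lambda>(f, h, g). g),
     Ident = (\<lambda>f. (f, Ident V (Dom V f), f)),
     Comp = (\<lambda>(f', h', g') (f, h, g). (f, h' \<cdot>\<^bsub>V\<^esub> h, g'))\<rparr>"

definition product_cat :: "'k set \<Rightarrow> ('k \<Rightarrow> ('o, 'm) cat) \<Rightarrow> ('k \<Rightarrow> 'o, 'k \<Rightarrow> 'm) cat" where
  "product_cat I K = \<lparr>
     Obj = (\<Pi>\<^sub>E i\<in>I. Obj (K i)),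
     Arr = (\<Pi>\<^sub>E i\<in>I. Arr (K i)),
     Dom = (\<lambda>\<phi>. \<lambda>i\<in>I. Dom (K i) (\<phi> i)),
     Cod = (\<lambda>\<phi>. \<lambda>i\<in>I. Cod (K i) (\<phi> i)),
     Ident = (\<lambda>X. \<lambda>i\<in>I. Ident (K i) (X i)),
     Comp = (\<lambda>\<psi> \<phi>. \<lambda>i\<in>I. Comp (K i) (\<psi> i) (\<phi> i))\<rparr>"

definition coprd_over :: "('o, 'm) cat \<Rightarrow> 'k set \<Rightarrow> ('k \<Rightarrow> 'o) \<Rightarrow> ('k \<Rightarrow> 'm) \<Rightarrow> 'm" where
  "coprd_over V I X f =
     copair V I (\<lambda>i. Dom V (f i)) (coprd V I X) (\<lambda>i. coinj V I X i \<cdot>\<^bsub>V\<^esub> f i)"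

definition coprd_functor :: "('o, 'm) cat \<Rightarrow> 'k set \<Rightarrow> ('k \<Rightarrow> 'o) \<Rightarrow>
    ('k \<Rightarrow> 'm, 'k \<Rightarrow> 'm \<times> 'm \<times> 'm, 'm, 'm \<times> 'm \<times> 'm) cfun" where
  "coprd_functor V I X = \<lparr>
     fo = coprd_over V I X,
     fa = (\<lambda>\<phi>.
       let f = (\<lambda>i. fst (\<phi> i)); h = (\<lambda>i. fst (snd (\<phi> i))); g = (\<lambda>i. snd (snd (\<phi> i)));
           Y = (\<lambda>i. Dom V (f i)); Z = (\<lambda>i. Dom V (g i))
       in (coprd_over V I X f,
           copair V I Y (coprd V I Z) (\<lambda>i. coinj V I Z i \<cdot>\<^bsub>V\<^esub> h i),
           coprd_over V I X g))\<rparr>"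

text \<open>Up to bijection, the small sets are the small subsets of \<open>U\<close>.\<close>

definition extensive :: "'u set \<Rightarrow> ('o, 'm) cat \<Rightarrow> bool" where
  "extensive U V \<longleftrightarrow>
     (\<forall>I X. I \<subseteq> U \<and> small U I \<and> X ` I \<subseteq> Obj V \<longrightarrow>
        (\<exists>t. is_coproduct V I X t) \<and>
        is_equivalence (product_cat I (\<lambda>i. slice_cat V (X i))) (slice_cat V (coprd V I X))
          (coprd_functor V I X))"


section \<open>Enriched categories\<close>

text \<open>\<open>vcomp C A B D : C(B,D) \<times> C(A,B) \<rightarrow> C(A,D)\<close>\<close>

record ('c, 'o, 'm) vcat =
  vob :: "'c set"
  vhom :: "'c \<Rightarrow> 'c \<Rightarrow> 'o"
  vid :: "'c \<Rightarrow> 'm"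
  vcomp :: "'c \<Rightarrow> 'c \<Rightarrow> 'c \<Rightarrow> 'm"

record ('c, 'd, 'm) vfun =
  vfo :: "'c \<Rightarrow> 'd"
  vfa :: "'c \<Rightarrow> 'c \<Rightarrow> 'm"

text \<open>
  Both components of an enriched functor are made \<open>undefined\<close> outside the objects of its domain,
  so that equal functors are equal as records.
\<close>

definition mk_vfun :: "'c set \<Rightarrow> ('c \<Rightarrow> 'd) \<Rightarrow> ('c \<Rightarrow> 'c \<Rightarrow> 'm) \<Rightarrow> ('c, 'd, 'm) vfun" where
  "mk_vfun S f a = \<lparr>vfo = restrict f S, vfa = (\<lambda>i\<in>S. \<lambda>j\<in>S. a i j)\<rparr>"

context
  fixes V :: "('o, 'm) cat" (structure)
begin

definition vcategory :: "('c, 'o, 'm) vcat \<Rightarrow> bool" where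
  "vcategory C \<longleftrightarrow>
     (\<forall>A\<in>vob C. \<forall>B\<in>vob C. vhom C A B \<in> Obj V) \<and>
     (\<forall>A\<in>vob C. vid C A \<in> Hom V (term_ob V) (vhom C A A)) \<and>
     (\<forall>A\<in>vob C. \<forall>B\<in>vob C. \<forall>D\<in>vob C.
        vcomp C A B D \<in> Hom V (prd V (vhom C B D) (vhom C A B)) (vhom C A D)) \<and>
     (\<forall>A\<in>vob C. \<forall>B\<in>vob C. \<forall>D\<in>vob C. \<forall>E\<in>vob C.
        let DE = vhom C D E; BD = vhom C B D; AB = vhom C A B;
            P = prd V DE BD;
            h = pr1 V DE BD \<cdot> pr1 V P AB; g = pr2 V DE BD \<cdot> pr1 V P AB; f = pr2 V P AB
        in vcomp C A B E \<cdot> pair V (vcomp C B D E \<cdot> pair V h g) f =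
           vcomp C A D E \<cdot> pair V h (vcomp C A B D \<cdot> pair V g f)) \<and>
     (\<forall>A\<in>vob C. \<forall>B\<in>vob C.
        let AB = vhom C A B
        in vcomp C A B B \<cdot> pair V (vid C B \<cdot> bang V AB) (Ident V AB) = Ident V AB \<and>
           vcomp C A A B \<cdot> pair V (Ident V AB) (vid C A \<cdot> bang V AB) = Ident V AB)"

definition vfunctor :: "('c, 'o, 'm) vcat \<Rightarrow> ('d, 'o, 'm) vcat \<Rightarrow> ('c, 'd, 'm) vfun \<Rightarrow> bool" where
  "vfunctor C D F \<longleftrightarrow>
     mk_vfun (vob C) (vfo F) (vfa F) = F \<and>
     (\<forall>A\<in>vob C. vfo F A \<in> vob D) \<and>
     (\<forall>A\<in>vob C. \<forall>B\<in>vob C. vfa F A B \<in> Hom V (vhom C A B) (vhom D (vfo F A) (vfo F B))) \<and>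
     (\<forall>A\<in>vob C. vfa F A A \<cdot> vid C A = vid D (vfo F A)) \<and>
     (\<forall>A\<in>vob C. \<forall>B\<in>vob C. \<forall>E\<in>vob C.
        let g = pr1 V (vhom C B E) (vhom C A B); f = pr2 V (vhom C B E) (vhom C A B)
        in vfa F A E \<cdot> vcomp C A B E =
           vcomp D (vfo F A) (vfo F B) (vfo F E) \<cdot> pair V (vfa F B E \<cdot> g) (vfa F A B \<cdot> f))"

definition vnat :: "('c, 'o, 'm) vcat \<Rightarrow> ('d, 'o, 'm) vcat \<Rightarrow>
    ('c, 'd, 'm) vfun \<Rightarrow> ('c, 'd, 'm) vfun \<Rightarrow> ('c \<Rightarrow> 'm) \<Rightarrow> bool" where
  "vnat C D F F' \<alpha> \<longleftrightarrow>
     (\<forall>A\<in>vob C. \<alpha> A \<in> Hom V (term_ob V) (vhom D (vfo F A) (vfo F' A))) \<and>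
     (\<forall>A\<in>vob C. \<forall>B\<in>vob C.
        vcomp D (vfo F A) (vfo F' A) (vfo F' B) \<cdot>
          pair V (vfa F' A B) (\<alpha> A \<cdot> bang V (vhom C A B)) =
        vcomp D (vfo F A) (vfo F B) (vfo F' B) \<cdot>
          pair V (\<alpha> B \<cdot> bang V (vhom C A B)) (vfa F A B))"

text \<open>An isomorphism of \<open>V\<close>-functors: a \<open>V\<close>-natural transformation with a \<open>V\<close>-natural inverse.\<close>

definition vnat_iso :: "('c, 'o, 'm) vcat \<Rightarrow> ('d, 'o, 'm) vcat \<Rightarrow>
    ('c, 'd, 'm) vfun \<Rightarrow> ('c, 'd, 'm) vfun \<Rightarrow> ('c \<Rightarrow> 'm) \<Rightarrow> bool" where
  "vnat_iso C D F F' \<alpha> \<longleftrightarrow> vnat C D F F' \<alpha> \<and>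
     (\<exists>\<beta>. vnat C D F' F \<beta> \<and>
        (\<forall>A\<in>vob C.
           vcomp D (vfo F A) (vfo F' A) (vfo F A) \<cdot> pair V (\<beta> A) (\<alpha> A) = vid D (vfo F A) \<and>
           vcomp D (vfo F' A) (vfo F A) (vfo F' A) \<cdot> pair V (\<alpha> A) (\<beta> A) = vid D (vfo F' A)))"

definition vfun_comp :: "('c, 'o, 'm) vcat \<Rightarrow> ('d, 'e, 'm) vfun \<Rightarrow> ('c, 'd, 'm) vfun \<Rightarrow>
    ('c, 'e, 'm) vfun" where
  "vfun_comp C F' F = mk_vfun (vob C) (\<lambda>A. vfo F' (vfo F A))
     (\<lambda>A B. vfa F' (vfo F A) (vfo F B) \<cdot> vfa F A B)"

definition vop :: "('c, 'o, 'm) vcat \<Rightarrow> ('c, 'o, 'm) vcat" where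
  "vop C = \<lparr>vob = vob C, vhom = (\<lambda>A B. vhom C B A), vid = vid C,
     vcomp = (\<lambda>A B D. vcomp C D B A \<cdot>
       pair V (pr2 V (vhom C D B) (vhom C B A)) (pr1 V (vhom C D B) (vhom C B A)))\<rparr>"

definition vfun_op :: "('c, 'o, 'm) vcat \<Rightarrow> ('c, 'd, 'm) vfun \<Rightarrow> ('c, 'd, 'm) vfun" where
  "vfun_op C F = mk_vfun (vob C) (vfo F) (\<lambda>A B. vfa F B A)"

text \<open>\<open>V\<close> as a category enriched over itself.\<close>

definition vself :: "('o, 'o, 'm) vcat" where
  "vself = \<lparr>vob = Obj V, vhom = expo V,
     vid = (\<lambda>X. curry_map V (term_ob V) X (pr2 V (term_ob V) X)),
     vcomp = (\<lambda>X Y Z.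
       let YZ = expo V Y Z; XY = expo V X Y; P = prd V YZ XY;
           g = pr1 V YZ XY \<cdot> pr1 V P X; f = pr2 V YZ XY \<cdot> pr1 V P X; x = pr2 V P X
       in curry_map V P X (eval_map V Y Z \<cdot> pair V g (eval_map V X Y \<cdot> pair V f x)))\<rparr>"

text \<open>The representable \<open>V\<close>-functor \<open>D(-,T) : D\<^sup>o\<^sup>p \<rightarrow> V\<close>.\<close>

definition vhom_functor :: "('d, 'o, 'm) vcat \<Rightarrow> 'd \<Rightarrow> ('d, 'o, 'm) vfun" where
  "vhom_functor D T = mk_vfun (vob D) (\<lambda>A. vhom D A T)
     (\<lambda>A B. curry_map V (vhom D B A) (vhom D A T)
        (vcomp D B A T \<cdot> pair V (pr2 V (vhom D B A) (vhom D A T)) (pr1 V (vhom D B A) (vhom D A T))))"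

text \<open>
  The \<open>V\<close>-natural transformation \<open>C(-,L) \<Rightarrow> F\<close> corresponding to \<open>x : * \<rightarrow> F L\<close> by the enriched Yoneda
  lemma.  Its component at \<open>A\<close> is the name of
  \<open>C(A,L) \<rightarrow> [F L, F A] \<times> F L \<rightarrow> F A\<close>.
\<close>

definition vyoneda :: "('c, 'o, 'm) vcat \<Rightarrow> ('c, 'o, 'm) vfun \<Rightarrow> 'c \<Rightarrow> 'm \<Rightarrow> 'c \<Rightarrow> 'm" where
  "vyoneda C F L x A = curry_map V (term_ob V) (vhom C A L)
     (eval_map V (vfo F L) (vfo F A) \<cdot> pair V (vfa F L A) (x \<cdot> bang V (vhom C A L)) \<cdot>
      pr2 V (term_ob V) (vhom C A L))"

definition vrepresentable_by ::
  "('c, 'o, 'm) vcat \<Rightarrow> ('c, 'o, 'm) vfun \<Rightarrow> 'c \<Rightarrow> 'm \<Rightarrow> bool" where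
  "vrepresentable_by C F L x \<longleftrightarrow> L \<in> vob C \<and> x \<in> Hom V (term_ob V) (vfo F L) \<and>
     vnat_iso (vop C) vself (vhom_functor C L) F (vyoneda C F L x)"

definition vterminal :: "('d, 'o, 'm) vcat \<Rightarrow> 'd \<Rightarrow> bool" where
  "vterminal D T \<longleftrightarrow> T \<in> vob D \<and> (\<forall>A\<in>vob D. iso V (bang V (vhom D A T)))"


subsection \<open>Ends and functor categories\<close>

text \<open>Wedges from \<open>X\<close> to \<open>C(F-,F'-)\<close>, and the end \<open>\<integral>\<^sub>i C(F i, F' i)\<close>.\<close>

definition is_wedge :: "('i, 'o, 'm) vcat \<Rightarrow> ('c, 'o, 'm) vcat \<Rightarrow>
    ('i, 'c, 'm) vfun \<Rightarrow> ('i, 'c, 'm) vfun \<Rightarrow> 'o \<Rightarrow> ('i \<Rightarrow> 'm) \<Rightarrow> bool" where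
  "is_wedge I C F F' X w \<longleftrightarrow>
     (\<forall>i\<in>vob I. w i \<in> Hom V X (vhom C (vfo F i) (vfo F' i))) \<and>
     (\<forall>i\<in>vob I. \<forall>j\<in>vob I.
        let p = pr1 V (vhom I i j) X; q = pr2 V (vhom I i j) X
        in vcomp C (vfo F i) (vfo F' i) (vfo F' j) \<cdot> pair V (vfa F' i j \<cdot> p) (w i \<cdot> q) =
           vcomp C (vfo F i) (vfo F j) (vfo F' j) \<cdot> pair V (w j \<cdot> q) (vfa F i j \<cdot> p))"

definition is_end :: "('i, 'o, 'm) vcat \<Rightarrow> ('c, 'o, 'm) vcat \<Rightarrow>
    ('i, 'c, 'm) vfun \<Rightarrow> ('i, 'c, 'm) vfun \<Rightarrow> 'o \<times> ('i \<Rightarrow> 'm) \<Rightarrow> bool" where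
  "is_end I C F F' = (\<lambda>(E, \<pi>). E \<in> Obj V \<and> is_wedge I C F F' E \<pi> \<and>
     (\<forall>X\<in>Obj V. \<forall>w. is_wedge I C F F' X w \<longrightarrow>
        (\<exists>!h. h \<in> Hom V X E \<and> (\<forall>i\<in>vob I. \<pi> i \<cdot> h = w i))))"

definition vend :: "('i, 'o, 'm) vcat \<Rightarrow> ('c, 'o, 'm) vcat \<Rightarrow>
    ('i, 'c, 'm) vfun \<Rightarrow> ('i, 'c, 'm) vfun \<Rightarrow> 'o" where
  "vend I C F F' = fst (SOME t. is_end I C F F' t)"

definition vend_pr :: "('i, 'o, 'm) vcat \<Rightarrow> ('c, 'o, 'm) vcat \<Rightarrow>
    ('i, 'c, 'm) vfun \<Rightarrow> ('i, 'c, 'm) vfun \<Rightarrow> 'i \<Rightarrow> 'm" where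
  "vend_pr I C F F' = snd (SOME t. is_end I C F F' t)"

definition vend_lift :: "('i, 'o, 'm) vcat \<Rightarrow> ('c, 'o, 'm) vcat \<Rightarrow>
    ('i, 'c, 'm) vfun \<Rightarrow> ('i, 'c, 'm) vfun \<Rightarrow> 'o \<Rightarrow> ('i \<Rightarrow> 'm) \<Rightarrow> 'm" where
  "vend_lift I C F F' X w =
     (THE h. h \<in> Hom V X (vend I C F F') \<and> (\<forall>i\<in>vob I. vend_pr I C F F' i \<cdot> h = w i))"

definition vfun_cat :: "('i, 'o, 'm) vcat \<Rightarrow> ('c, 'o, 'm) vcat \<Rightarrow>
    (('i, 'c, 'm) vfun, 'o, 'm) vcat" where
  "vfun_cat I C = \<lparr>
     vob = {F. vfunctor I C F},
     vhom = vend I C,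
     vid = (\<lambda>F. vend_lift I C F F (term_ob V) (\<lambda>i. vid C (vfo F i))),
     vcomp = (\<lambda>F F' F''.
       let Q = vend I C F' F''; R = vend I C F F'
       in vend_lift I C F F'' (prd V Q R) (\<lambda>i.
            vcomp C (vfo F i) (vfo F' i) (vfo F'' i) \<cdot>
            pair V (vend_pr I C F' F'' i \<cdot> pr1 V Q R) (vend_pr I C F F' i \<cdot> pr2 V Q R)))\<rparr>"

definition const_vfun :: "('i, 'o, 'm) vcat \<Rightarrow> ('c, 'o, 'm) vcat \<Rightarrow> 'c \<Rightarrow> ('i, 'c, 'm) vfun" where
  "const_vfun I C A = mk_vfun (vob I) (\<lambda>_. A) (\<lambda>i j. vid C A \<cdot> bang V (vhom I i j))"

definition vdiag :: "('i, 'o, 'm) vcat \<Rightarrow> ('c, 'o, 'm) vcat \<Rightarrow>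
    ('c, ('i, 'c, 'm) vfun, 'm) vfun" where
  "vdiag I C = mk_vfun (vob C) (const_vfun I C)
     (\<lambda>A B. vend_lift I C (const_vfun I C A) (const_vfun I C B) (vhom C A B)
        (\<lambda>_. Ident V (vhom C A B)))"

text \<open>A \<open>V\<close>-natural transformation \<open>\<lambda> : F \<Rightarrow> F'\<close> as a map \<open>* \<rightarrow> C\<^sup>I(F, F')\<close>.\<close>

definition vnat_elem :: "('i, 'o, 'm) vcat \<Rightarrow> ('c, 'o, 'm) vcat \<Rightarrow>
    ('i, 'c, 'm) vfun \<Rightarrow> ('i, 'c, 'm) vfun \<Rightarrow> ('i \<Rightarrow> 'm) \<Rightarrow> 'm" where
  "vnat_elem I C F F' l = vend_lift I C F F' (term_ob V) l"

definition vlimit :: "('i, 'o, 'm) vcat \<Rightarrow> ('c, 'o, 'm) vcat \<Rightarrow>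
    ('i, 'c, 'm) vfun \<Rightarrow> 'c \<Rightarrow> ('i \<Rightarrow> 'm) \<Rightarrow> bool" where
  "vlimit I C G L l \<longleftrightarrow>
     vrepresentable_by C
       (vfun_comp (vop C) (vhom_functor (vfun_cat I C) G) (vfun_op C (vdiag I C)))
       L (vnat_elem I C (const_vfun I C L) G l)"

end


section \<open>Internal categories\<close>

text \<open>
  \<open>icomp\<close> is defined on the pullback of \<open>isrc\<close> along \<open>itgt\<close>, which consists of the pairs \<open>(g, f)\<close>
  with \<open>src g = tgt f\<close>.
\<close>

record ('o, 'm) icat =
  iob :: 'o
  iar :: 'o
  isrc :: 'm
  itgt :: 'm
  iid :: 'm
  icomp :: 'm

record ('o, 'm) ifun =
  idom :: "('o, 'm) icat"
  icod :: "('o, 'm) icat"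
  if0 :: 'm
  if1 :: 'm

context
  fixes V :: "('o, 'm) cat" (structure)
begin

definition icompose :: "('o, 'm) icat \<Rightarrow> 'm \<Rightarrow> 'm \<Rightarrow> 'm" where
  "icompose A g f = icomp A \<cdot> pb_pair V (isrc A) (itgt A) g f"

definition icategory :: "('o, 'm) icat \<Rightarrow> bool" where
  "icategory A \<longleftrightarrow>
     iob A \<in> Obj V \<and> iar A \<in> Obj V \<and>
     isrc A \<in> Hom V (iar A) (iob A) \<and> itgt A \<in> Hom V (iar A) (iob A) \<and>
     iid A \<in> Hom V (iob A) (iar A) \<and>
     icomp A \<in> Hom V (pb V (isrc A) (itgt A)) (iar A) \<and>
     isrc A \<cdot> iid A = Ident V (iob A) \<and> itgt A \<cdot> iid A = Ident V (iob A) \<and>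
     isrc A \<cdot> icomp A = isrc A \<cdot> pb2 V (isrc A) (itgt A) \<and>
     itgt A \<cdot> icomp A = itgt A \<cdot> pb1 V (isrc A) (itgt A) \<and>
     (let g' = pb1 V (isrc A) (itgt A); f' = pb2 V (isrc A) (itgt A);
          k = pb1 V (isrc A \<cdot> f') (itgt A); f = pb2 V (isrc A \<cdot> f') (itgt A);
          h = g' \<cdot> k; g = f' \<cdot> k
      in icompose A (icompose A h g) f = icompose A h (icompose A g f)) \<and>
     icompose A (iid A \<cdot> itgt A) (Ident V (iar A)) = Ident V (iar A) \<and>
     icompose A (Ident V (iar A)) (iid A \<cdot> isrc A) = Ident V (iar A)"

definition ifunctor :: "('o, 'm) ifun \<Rightarrow> bool" where
  "ifunctor F \<longleftrightarrow> icategory (idom F) \<and> icategory (icod F) \<and>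
     (let A = idom F; B = icod F
      in if0 F \<in> Hom V (iob A) (iob B) \<and> if1 F \<in> Hom V (iar A) (iar B) \<and>
         isrc B \<cdot> if1 F = if0 F \<cdot> isrc A \<and> itgt B \<cdot> if1 F = if0 F \<cdot> itgt A \<and>
         if1 F \<cdot> iid A = iid B \<cdot> if0 F \<and>
         if1 F \<cdot> icomp A =
           icompose B (if1 F \<cdot> pb1 V (isrc A) (itgt A)) (if1 F \<cdot> pb2 V (isrc A) (itgt A)))"

definition Cat :: "(('o, 'm) icat, ('o, 'm) ifun) cat" where
  "Cat = \<lparr>
     Obj = {A. icategory A},
     Arr = {F. ifunctor F},
     Dom = idom,
     Cod = icod,
     Ident = (\<lambda>A. \<lparr>idom = A, icod = A, if0 = Ident V (iob A), if1 = Ident V (iar A)\<rparr>),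
     Comp = (\<lambda>G F. \<lparr>idom = idom F, icod = icod G,
                     if0 = if0 G \<cdot> if0 F, if1 = if1 G \<cdot> if1 F\<rparr>)\<rparr>"

definition cst :: "'o \<Rightarrow> ('o, 'm) icat" where
  "cst X = \<lparr>iob = X, iar = X, isrc = Ident V X, itgt = Ident V X, iid = Ident V X,
     icomp = pb1 V (Ident V X) (Ident V X)\<rparr>"

definition ione :: "('o, 'm) icat" where
  "ione = cst (term_ob V)"

text \<open>The unique internal functor to \<open>ione\<close>, which need not be the terminal object \<open>term_ob Cat\<close>.\<close>

definition ibang :: "('o, 'm) icat \<Rightarrow> ('o, 'm) ifun" where
  "ibang A = \<lparr>idom = A, icod = ione, if0 = bang V (iob A), if1 = bang V (iar A)\<rparr>"

text \<open>The element of \<open>A\<close> given by a map \<open>a : * \<rightarrow> A\<^sub>0\<close>.\<close>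

definition ielem :: "('o, 'm) icat \<Rightarrow> 'm \<Rightarrow> ('o, 'm) ifun" where
  "ielem A a = \<lparr>idom = ione, icod = A, if0 = a, if1 = iid A \<cdot> a\<rparr>"

abbreviation ihom :: "('o, 'm) icat \<Rightarrow> ('o, 'm) icat \<Rightarrow> ('o, 'm) icat" where
  "ihom A B \<equiv> expo Cat A B"


subsection \<open>Internalisation and underlying enriched category\<close>

definition int_ob :: "('c, 'o, 'm) vcat \<Rightarrow> 'o" where
  "int_ob C = coprd V (vob C) (\<lambda>_. term_ob V)"

definition int_ar :: "('c, 'o, 'm) vcat \<Rightarrow> 'o" where
  "int_ar C = coprd V (vob C \<times> vob C) (\<lambda>(A, B). vhom C A B)"

definition int_ob_inj :: "('c, 'o, 'm) vcat \<Rightarrow> 'c \<Rightarrow> 'm" where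
  "int_ob_inj C A = coinj V (vob C) (\<lambda>_. term_ob V) A"

definition int_ar_inj :: "('c, 'o, 'm) vcat \<Rightarrow> 'c \<Rightarrow> 'c \<Rightarrow> 'm" where
  "int_ar_inj C A B = coinj V (vob C \<times> vob C) (\<lambda>(A, B). vhom C A B) (A, B)"

definition int_src :: "('c, 'o, 'm) vcat \<Rightarrow> 'm" where
  "int_src C = copair V (vob C \<times> vob C) (\<lambda>(A, B). vhom C A B) (int_ob C)
     (\<lambda>(A, B). int_ob_inj C A \<cdot> bang V (vhom C A B))"

definition int_tgt :: "('c, 'o, 'm) vcat \<Rightarrow> 'm" where
  "int_tgt C = copair V (vob C \<times> vob C) (\<lambda>(A, B). vhom C A B) (int_ob C)
     (\<lambda>(A, B). int_ob_inj C B \<cdot> bang V (vhom C A B))"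

text \<open>
  By extensivity the object of composable arrows is the coproduct of the \<open>C(B,D) \<times> C(A,B)\<close>, so the
  composition is determined by its restrictions to these.
\<close>

definition int_comp :: "('c, 'o, 'm) vcat \<Rightarrow> 'm" where
  "int_comp C = (THE c. c \<in> Hom V (pb V (int_src C) (int_tgt C)) (int_ar C) \<and>
     (\<forall>A\<in>vob C. \<forall>B\<in>vob C. \<forall>D\<in>vob C.
        c \<cdot> pb_pair V (int_src C) (int_tgt C)
              (int_ar_inj C B D \<cdot> pr1 V (vhom C B D) (vhom C A B))
              (int_ar_inj C A B \<cdot> pr2 V (vhom C B D) (vhom C A B)) =
        int_ar_inj C A D \<cdot> vcomp C A B D))"

definition Internal :: "('c, 'o, 'm) vcat \<Rightarrow> ('o, 'm) icat" where
  "Internal C = \<lparr>iob = int_ob C, iar = int_ar C, isrc = int_src C, itgt = int_tgt C,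
     iid = copair V (vob C) (\<lambda>_. term_ob V) (int_ar C) (\<lambda>A. int_ar_inj C A A \<cdot> vid C A),
     icomp = int_comp C\<rparr>"

definition Internal_fun :: "('c, 'o, 'm) vcat \<Rightarrow> ('d, 'o, 'm) vcat \<Rightarrow> ('c, 'd, 'm) vfun \<Rightarrow>
    ('o, 'm) ifun" where
  "Internal_fun C D F = \<lparr>idom = Internal C, icod = Internal D,
     if0 = copair V (vob C) (\<lambda>_. term_ob V) (int_ob D) (\<lambda>A. int_ob_inj D (vfo F A)),
     if1 = copair V (vob C \<times> vob C) (\<lambda>(A, B). vhom C A B) (int_ar D)
             (\<lambda>(A, B). int_ar_inj D (vfo F A) (vfo F B) \<cdot> vfa F A B)\<rparr>"

definition Und :: "('o, 'm) icat \<Rightarrow> ('m, 'o, 'm) vcat" where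
  "Und A =
     (let st = pair V (isrc A) (itgt A);
          H = (\<lambda>a b. pb V st (pair V a b));
          m = (\<lambda>a b. pb1 V st (pair V a b))
      in \<lparr>vob = Hom V (term_ob V) (iob A),
          vhom = H,
          vid = (\<lambda>a. pb_pair V st (pair V a a) (iid A \<cdot> a) (Ident V (term_ob V))),
          vcomp = (\<lambda>a b d. pb_pair V st (pair V a d)
            (icompose A (m b d \<cdot> pr1 V (H b d) (H a b)) (m a b \<cdot> pr2 V (H b d) (H a b)))
            (bang V (prd V (H b d) (H a b))))\<rparr>)"


subsection \<open>The walking arrow, comma categories and internal terminal objects\<close>

text \<open>
  The \<open>V\<close>-category with objects \<open>0 = False\<close> and \<open>1 = True\<close>.  Its composition is the unique map
  into \<open>*\<close>, or, if the target is \<open>two(1,0)\<close>, the projection to the factor equal to \<open>two(1,0)\<close>.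
\<close>

definition vtwo :: "(bool, 'o, 'm) vcat" where
  "vtwo =
     (let H = (\<lambda>a b. if a \<le> b then term_ob V else init_ob V)
      in \<lparr>vob = UNIV, vhom = H,
          vid = (\<lambda>a. Ident V (term_ob V)),
          vcomp = (\<lambda>a b d.
            if a \<le> d then bang V (prd V (H b d) (H a b))
            else if a \<le> b then pr1 V (H b d) (H a b) else pr2 V (H b d) (H a b))\<rparr>)"

definition itwo :: "('o, 'm) icat" where
  "itwo = Internal vtwo"

definition itwo_elem :: "bool \<Rightarrow> ('o, 'm) ifun" where
  "itwo_elem b = ielem itwo (int_ob_inj vtwo b)"

text \<open>The internal functor \<open>itwo \<rightarrow> B\<close> classifying an arrow \<open>f : * \<rightarrow> B\<^sub>1\<close> of \<open>B\<close>.\<close>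

definition iarrow :: "('o, 'm) icat \<Rightarrow> 'm \<Rightarrow> ('o, 'm) ifun" where
  "iarrow B f = \<lparr>idom = itwo, icod = B,
     if0 = copair V UNIV (\<lambda>_. term_ob V) (iob B) (\<lambda>a. (if a then itgt B else isrc B) \<cdot> f),
     if1 = copair V (UNIV \<times> UNIV) (\<lambda>(a, b). vhom vtwo a b) (iar B)
             (\<lambda>(a, b). if a \<and> \<not> b then cobang V (iar B)
                       else if \<not> a \<and> b then f
                       else iid B \<cdot> (if a then itgt B else isrc B) \<cdot> f)\<rparr>"

text \<open>
  \<open>\<langle>0,1\<rangle>\<^sup>* : [itwo, B] \<rightarrow> B \<times> B\<close>, where the internal hom from \<open>ione\<close> coproduct \<open>ione\<close> to \<open>B\<close> is
  identified with \<open>B \<times> B\<close>: its components are the evaluations at the elements \<open>0\<close> and \<open>1\<close>.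
\<close>

definition ieval_at :: "('o, 'm) icat \<Rightarrow> bool \<Rightarrow> ('o, 'm) ifun" where
  "ieval_at B b =
     (let E = ihom itwo B
      in eval_map Cat itwo B \<cdot>\<^bsub>Cat\<^esub> pair Cat (Ident Cat E) (itwo_elem b \<cdot>\<^bsub>Cat\<^esub> ibang E))"

definition endpoints :: "('o, 'm) icat \<Rightarrow> ('o, 'm) ifun" where
  "endpoints B = pair Cat (ieval_at B False) (ieval_at B True)"

text \<open>The functor \<open>H \<times> b : A \<rightarrow> B \<times> B\<close>, for \<open>H : A \<rightarrow> B\<close> and an element \<open>b : * \<rightarrow> B\<close>.\<close>

definition comma_leg :: "('o, 'm) ifun \<Rightarrow> ('o, 'm) ifun \<Rightarrow> ('o, 'm) ifun" where
  "comma_leg H b = pair Cat H (b \<cdot>\<^bsub>Cat\<^esub> ibang (idom H))"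

definition comma :: "('o, 'm) ifun \<Rightarrow> ('o, 'm) ifun \<Rightarrow> ('o, 'm) icat" where
  "comma H b = pb Cat (comma_leg H b) (endpoints (icod H))"

definition comma_proj :: "('o, 'm) ifun \<Rightarrow> ('o, 'm) ifun \<Rightarrow> ('o, 'm) ifun" where
  "comma_proj H b = pb1 Cat (comma_leg H b) (endpoints (icod H))"

text \<open>
  The element of \<open>comma H b\<close> given by an element \<open>a\<close> of \<open>A\<close> and a map \<open>f : * \<rightarrow> B\<^sub>1\<close> which is an
  arrow of \<open>B\<close> from \<open>H a\<close> to \<open>b\<close>.
\<close>

definition comma_elem :: "('o, 'm) ifun \<Rightarrow> ('o, 'm) ifun \<Rightarrow> ('o, 'm) ifun \<Rightarrow> 'm \<Rightarrow> ('o, 'm) ifun" where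
  "comma_elem H b a f = pb_pair Cat (comma_leg H b) (endpoints (icod H)) a
     (curry_map Cat ione itwo (iarrow (icod H) f \<cdot>\<^bsub>Cat\<^esub> pr2 Cat ione itwo))"

definition internal_terminal :: "('o, 'm) icat \<Rightarrow> ('o, 'm) ifun \<Rightarrow> bool" where
  "internal_terminal A t \<longleftrightarrow> t \<in> Hom Cat ione A \<and> iso Cat (comma_proj (Ident Cat A) t)"


subsection \<open>The comma category of cones over \<open>G\<close>\<close>

definition cone_cat :: "('i, 'o, 'm) vcat \<Rightarrow> ('c, 'o, 'm) vcat \<Rightarrow> ('i, 'c, 'm) vfun \<Rightarrow>
    ('o, 'm) icat" where
  "cone_cat I C G =
     comma (Internal_fun C (vfun_cat V I C) (vdiag V I C))
           (ielem (Internal (vfun_cat V I C)) (int_ob_inj (vfun_cat V I C) G))"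

definition cone_elem :: "('i, 'o, 'm) vcat \<Rightarrow> ('c, 'o, 'm) vcat \<Rightarrow> ('i, 'c, 'm) vfun \<Rightarrow>
    'c \<Rightarrow> ('i \<Rightarrow> 'm) \<Rightarrow> ('o, 'm) ifun" where
  "cone_elem I C G L l =
     comma_elem (Internal_fun C (vfun_cat V I C) (vdiag V I C))
           (ielem (Internal (vfun_cat V I C)) (int_ob_inj (vfun_cat V I C) G))
           (ielem (Internal C) (int_ob_inj C L))
           (int_ar_inj (vfun_cat V I C) (const_vfun V I C L) G \<cdot>
            vnat_elem V I C (const_vfun V I C L) G l)"

text \<open>\<open>!\<^sup>* : A \<rightarrow> [cst X, A]\<close>, and the resulting object of \<open>Und [cst X, A]\<close> for an element of \<open>A\<close>.\<close>

definition const_ifun :: "'o \<Rightarrow> ('o, 'm) icat \<Rightarrow> ('o, 'm) ifun" where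
  "const_ifun X A = curry_map Cat A (cst X) (pr1 Cat A (cst X))"

definition und_elem :: "'o \<Rightarrow> ('o, 'm) icat \<Rightarrow> ('o, 'm) ifun \<Rightarrow> 'm" where
  "und_elem X A t = if0 (const_ifun X A \<cdot>\<^bsub>Cat\<^esub> t)"

end

end

theory Submission imports Defs begin

text \<open>
  All three conditions are compared with one statement about the internal category \<open>K = Int \<Delta> \<down> G\<close> of cones: for
  every stage \<open>W\<close> and every object \<open>k : W \<rightarrow> K\<^sub>0\<close> there is exactly one arrow \<open>W \<rightarrow> K\<^sub>1\<close> from \<open>k\<close> to the constant
  object \<open>(L, \<lambda>)\<close>; this is \<open>elementwise_terminal\<close>.

  It expresses (ii), because an object of the slice over \<open>(L, \<lambda>)\<close> is an arrow into \<open>(L, \<lambda>)\<close>.  The projection of the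
  slice is therefore an isomorphism on objects if and only if the statement holds, and then it is an isomorphism on
  arrows as well (\<open>internal_terminal_iff\<close>).

  It expresses (iii), because objects and arrows of \<open>[cst X, K]\<close> at stage \<open>W\<close> are objects and arrows of \<open>K\<close> at stage
  \<open>W \<times> X\<close>.  So (iii) is the statement for the stages \<open>W \<times> X\<close> and those objects \<open>k\<close> that come from the factor \<open>X\<close>
  (\<open>und_terminal_iff\<close>).  With \<open>W = *\<close> this contains the statement for the stages \<open>X \<in> \<G>\<close>.  They suffice, since the
  statement for all stages says that the object of arrows into \<open>(L, \<lambda>)\<close> maps isomorphically to \<open>K\<^sub>0\<close> by the source
  (\<open>terminal_iff_conservative\<close>).

  It expresses (i).  By the enriched Yoneda lemma, \<open>(L, \<lambda>)\<close> is a limit if and only if composition with \<open>\<lambda>\<close> is an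
  isomorphism \<open>C(A,L) \<rightarrow> C\<^sup>I(\<Delta>A,G)\<close> for all \<open>A\<close> (\<open>vlimit_iff\<close>), which is the statement for the objects \<open>k\<close> whose
  vertex is constantly \<open>A\<close>.  An arbitrary \<open>k\<close> has a vertex \<open>W \<rightarrow> \<Squnion>\<^sub>A *\<close>.  By extensivity, \<open>W\<close> is the coproduct of the
  parts on which this is constant (\<open>decompose\<close>), and over such a part the arrows of \<open>Int C\<close> and \<open>Int(C\<^sup>I)\<close> are elements
  of hom-objects (\<open>ja_factor\<close>).  The unique factorisations over the parts are glued (\<open>limit_iff_terminal\<close>).

  For this the generalised elements of all constructions involved must be known.  Small products
  exist as objects of sections (\<open>small_product_exists\<close>), and ends are equalizers of maps between products.  Limits of internal categories are formed componentwise.  The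
  exponential \<open>[2, B]\<close> is the internal category of arrows and commutative squares of \<open>B\<close> (\<open>arrows_exponential\<close>),
  whence the description of comma categories, and \<open>[cst X, B]\<close> has the components \<open>B\<^sub>0\<^sup>X\<close> and \<open>B\<^sub>1\<^sup>X\<close>
  (\<open>power_exponential\<close>).
\<close>


section \<open>Categories with finite limits\<close>

lemma Hom_iff [simp]: "f \<in> Hom V X Y \<longleftrightarrow> f \<in> Arr V \<and> Dom V f = X \<and> Cod V f = Y"
  by (auto simp: Hom_def)

lemma ex1_unique: "\<exists>!x. P x \<Longrightarrow> P a \<Longrightarrow> P b \<Longrightarrow> a = b"
  by blast

locale cat =
  fixes V :: "('o, 'm) cat" (structure)
  assumes category: "category V"
begin

lemma Dom_Obj [simp]: "f \<in> Arr V \<Longrightarrow> Dom V f \<in> Obj V"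
  and Cod_Obj [simp]: "f \<in> Arr V \<Longrightarrow> Cod V f \<in> Obj V"
  using category by (auto simp: category_def)

lemma Hom_Obj1: "f \<in> Hom V X Y \<Longrightarrow> X \<in> Obj V"
  and Hom_Obj2: "f \<in> Hom V X Y \<Longrightarrow> Y \<in> Obj V"
  by auto

lemma Ident_arr [simp]:
  assumes "X \<in> Obj V"
  shows "Ident V X \<in> Arr V" "Dom V (Ident V X) = X" "Cod V (Ident V X) = X"
  using category assms by (auto simp: category_def)

lemma comp_arr [simp]:
  assumes "f \<in> Arr V" "g \<in> Arr V" "Dom V g = Cod V f"
  shows "g \<cdot> f \<in> Arr V" "Dom V (g \<cdot> f) = Dom V f" "Cod V (g \<cdot> f) = Cod V g"
  using category assms by (auto simp: category_def)

lemma id_left [simp]: "f \<in> Arr V \<Longrightarrow> Cod V f = Y \<Longrightarrow> Ident V Y \<cdot> f = f"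
  and id_right [simp]: "f \<in> Arr V \<Longrightarrow> Dom V f = X \<Longrightarrow> f \<cdot> Ident V X = f"
  using category by (auto simp: category_def)

lemma assoc [simp]:
  "f \<in> Arr V \<Longrightarrow> g \<in> Arr V \<Longrightarrow> h \<in> Arr V \<Longrightarrow> Dom V g = Cod V f \<Longrightarrow> Dom V h = Cod V g \<Longrightarrow>
    (h \<cdot> g) \<cdot> f = h \<cdot> (g \<cdot> f)"
  using category by (auto simp: category_def)

text \<open>Lets an equation between composites be used under a further precomposition.\<close>

lemma comp_ext:
  assumes "g \<cdot> f = k" and "f \<in> Arr V" "g \<in> Arr V" "h \<in> Arr V" "Dom V g = Cod V f" "Dom V f = Cod V h"
  shows "g \<cdot> (f \<cdot> h) = k \<cdot> h"
  using assms by (metis assoc)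

lemma isoI:
  assumes "f \<in> Hom V X Y" "g \<in> Hom V Y X" "g \<cdot> f = Ident V X" "f \<cdot> g = Ident V Y"
  shows "iso V f"
  using assms unfolding iso_def by auto

lemma isoE:
  assumes "iso V f" "f \<in> Hom V X Y"
  obtains g where "g \<in> Hom V Y X" "g \<cdot> f = Ident V X" "f \<cdot> g = Ident V Y"
  using assms unfolding iso_def by auto

lemma iso_bij:
  assumes "iso V f" "f \<in> Hom V Y Z" "W \<in> Obj V"
  shows "bij_betw (\<lambda>g. f \<cdot> g) (Hom V W Y) (Hom V W Z)"
proof -
  obtain k where k: "k \<in> Hom V Z Y" "k \<cdot> f = Ident V Y" "f \<cdot> k = Ident V Z"
    using assms isoE by metis
  have "k \<cdot> (f \<cdot> g) = g" if "g \<in> Hom V W Y" for g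
    using comp_ext [OF k(2), of g] k assms that by auto
  moreover have "f \<cdot> (k \<cdot> g) = g" if "g \<in> Hom V W Z" for g
    using comp_ext [OF k(3), of g] k assms that by auto
  ultimately show ?thesis
    using k assms by (intro bij_betw_byWitness [where f' = "\<lambda>g. k \<cdot> g"]) auto
qed

text \<open>Yoneda: if composition with \<open>f\<close> is bijective at all stages, the inverse is the preimage of the identity.\<close>

lemma iso_iff_bij:
  assumes f: "f \<in> Hom V Y Z"
  shows "iso V f \<longleftrightarrow> (\<forall>W\<in>Obj V. bij_betw (\<lambda>g. f \<cdot> g) (Hom V W Y) (Hom V W Z))"
proof
  assume "iso V f" then show "\<forall>W\<in>Obj V. bij_betw (\<lambda>g. f \<cdot> g) (Hom V W Y) (Hom V W Z)"
    using iso_bij f by blast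
next
  assume b: "\<forall>W\<in>Obj V. bij_betw (\<lambda>g. f \<cdot> g) (Hom V W Y) (Hom V W Z)"
  have o: "Y \<in> Obj V" "Z \<in> Obj V" using f by auto
  have "Ident V Z \<in> (\<lambda>g. f \<cdot> g) ` Hom V Z Y"
    using bspec [OF b o(2)] o by (auto simp: bij_betw_def)
  then obtain g where g: "g \<in> Hom V Z Y" "f \<cdot> g = Ident V Z" by auto
  have "f \<cdot> (g \<cdot> f) = f \<cdot> Ident V Y"
    using comp_ext [OF g(2), of f] f g by auto
  moreover have "inj_on (\<lambda>g. f \<cdot> g) (Hom V Y Y)"
    using bspec [OF b o(1)] by (auto simp: bij_betw_def)
  ultimately have "g \<cdot> f = Ident V Y" using f g o by (auto simp: inj_on_def)
  then show "iso V f" using f g isoI by blast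
qed

lemma iso_iff_ex1:
  assumes f: "f \<in> Hom V Y Z"
  shows "iso V f \<longleftrightarrow> (\<forall>W\<in>Obj V. \<forall>z\<in>Hom V W Z. \<exists>!y. y \<in> Hom V W Y \<and> f \<cdot> y = z)"
proof -
  have *: "bij_betw h A B \<longleftrightarrow> (\<forall>z\<in>B. \<exists>!y. y \<in> A \<and> h y = z)" if "\<And>y. y \<in> A \<Longrightarrow> h y \<in> B"
    for h :: "'m \<Rightarrow> 'm" and A B
  proof
    assume b: "bij_betw h A B"
    show "\<forall>z\<in>B. \<exists>!y. y \<in> A \<and> h y = z"
    proof
      fix z assume "z \<in> B"
      then obtain y where y: "y \<in> A" "h y = z" using bij_betw_imp_surj_on [OF b] by blast
      show "\<exists>!y. y \<in> A \<and> h y = z"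
        using y inj_onD [OF bij_betw_imp_inj_on [OF b]] by (intro ex1I [of _ y]) auto
    qed
  next
    assume u: "\<forall>z\<in>B. \<exists>!y. y \<in> A \<and> h y = z"
    have "inj_on h A"
    proof (rule inj_onI)
      fix x y assume xy: "x \<in> A" "y \<in> A" "h x = h y"
      have "\<exists>!w. w \<in> A \<and> h w = h y" using u that [OF xy(2)] by blast
      then show "x = y" using xy by (metis (no_types))
    qed
    moreover have "h ` A = B"
    proof
      show "B \<subseteq> h ` A"
      proof
        fix z assume "z \<in> B"
        then obtain y where "y \<in> A \<and> h y = z" using ex1_implies_ex [OF bspec [OF u]] by auto
        then show "z \<in> h ` A" by auto
      qed
    qed (use that in auto)
    ultimately show "bij_betw h A B" by (simp add: bij_betw_def)
  qed
  show ?thesis unfolding iso_iff_bij [OF f]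
    by (intro ball_cong refl *) (use f in auto)
qed

subsection \<open>Coproducts\<close>

lemma coproductD:
  assumes "is_coproduct V K X (S, j)"
  shows "S \<in> Obj V" "\<And>i. i \<in> K \<Longrightarrow> j i \<in> Arr V" "\<And>i. i \<in> K \<Longrightarrow> Dom V (j i) = X i"
    "\<And>i. i \<in> K \<Longrightarrow> Cod V (j i) = S"
  using assms by (auto simp: is_coproduct_def)

lemma coproduct_universal:
  assumes "is_coproduct V K X (S, j)" "Z \<in> Obj V" "\<And>i. i \<in> K \<Longrightarrow> f i \<in> Hom V (X i) Z"
  shows "\<exists>!h. h \<in> Hom V S Z \<and> (\<forall>i\<in>K. h \<cdot> j i = f i)"
  using assms unfolding is_coproduct_def by blast

lemma coproduct_eqI:
  assumes "is_coproduct V K X (S, j)" "f \<in> Hom V S Z" "g \<in> Hom V S Z"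
    and "\<And>i. i \<in> K \<Longrightarrow> f \<cdot> j i = g \<cdot> j i"
  shows "f = g"
proof -
  have "\<exists>!h. h \<in> Hom V S Z \<and> (\<forall>i\<in>K. h \<cdot> j i = f \<cdot> j i)"
    using assms(2,3) coproductD [OF assms(1)] by (intro coproduct_universal [OF assms(1)]) auto
  then show ?thesis using assms(2-4) by (metis (no_types))
qed

lemma coproduct_obtain:
  assumes "is_coproduct V K X (S, j)" "\<And>i. i \<in> K \<Longrightarrow> f i \<in> Hom V (X i) Z" "Z \<in> Obj V"
  obtains h where "h \<in> Hom V S Z" "\<And>i. i \<in> K \<Longrightarrow> h \<cdot> j i = f i"
proof -
  show ?thesis using ex1_implies_ex [OF coproduct_universal [OF assms(1,3,2)]] that by blast
qed

lemma coproductI: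
  assumes "S \<in> Obj V" "\<And>i. i \<in> K \<Longrightarrow> j i \<in> Hom V (X i) S"
    and "\<And>Z f. Z \<in> Obj V \<Longrightarrow> (\<And>i. i \<in> K \<Longrightarrow> f i \<in> Hom V (X i) Z) \<Longrightarrow>
      \<exists>h\<in>Hom V S Z. \<forall>i\<in>K. h \<cdot> j i = f i"
    and "\<And>Z f g. Z \<in> Obj V \<Longrightarrow> f \<in> Hom V S Z \<Longrightarrow> g \<in> Hom V S Z \<Longrightarrow>
      (\<And>i. i \<in> K \<Longrightarrow> f \<cdot> j i = g \<cdot> j i) \<Longrightarrow> f = g"
  shows "is_coproduct V K X (S, j)"
  unfolding is_coproduct_def prod.case
proof (intro conjI ballI allI impI)
  fix Z f assume Z: "Z \<in> Obj V" and f: "\<forall>i\<in>K. f i \<in> Hom V (X i) Z"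
  obtain h where h: "h \<in> Hom V S Z" "\<forall>i\<in>K. h \<cdot> j i = f i"
    using assms(3) [OF Z, of f] f by blast
  show "\<exists>!h. h \<in> Hom V S Z \<and> (\<forall>i\<in>K. h \<cdot> j i = f i)"
  proof (rule ex1I [of _ h])
    fix h' assume "h' \<in> Hom V S Z \<and> (\<forall>i\<in>K. h' \<cdot> j i = f i)"
    then show "h' = h" using h(2) by (intro assms(4) [OF Z _ h(1)]) (simp_all del: Hom_iff)
  qed (use h in auto)
qed (use assms in auto)

lemma coprd_is_coproduct:
  assumes "\<exists>t. is_coproduct V K X t"
  shows "is_coproduct V K X (coprd V K X, coinj V K X)"
  using someI_ex [OF assms] by (simp add: coprd_def coinj_def)

lemma copair_props:
  assumes "\<exists>t. is_coproduct V K X t" "\<And>i. i \<in> K \<Longrightarrow> f i \<in> Hom V (X i) Z" "Z \<in> Obj V"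
  shows "copair V K X Z f \<in> Hom V (coprd V K X) Z"
    and "\<And>i. i \<in> K \<Longrightarrow> copair V K X Z f \<cdot> coinj V K X i = f i"
proof -
  have "\<exists>!h. h \<in> Hom V (coprd V K X) Z \<and> (\<forall>i\<in>K. h \<cdot> coinj V K X i = f i)"
    by (rule coproduct_universal [OF coprd_is_coproduct [OF assms(1)] assms(3,2)])
  from theI' [OF this]
  show "copair V K X Z f \<in> Hom V (coprd V K X) Z"
    and "\<And>i. i \<in> K \<Longrightarrow> copair V K X Z f \<cdot> coinj V K X i = f i"
    unfolding copair_def by auto
qed

lemma coproduct_along_iso:
  assumes c: "is_coproduct V K X (S, j)" and h: "iso V h" "h \<in> Hom V S T"
  shows "is_coproduct V K X (T, \<lambda>i. h \<cdot> j i)"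
proof -
  obtain k where k: "k \<in> Hom V T S" "k \<cdot> h = Ident V S" "h \<cdot> k = Ident V T"
    using h isoE by metis
  note cd = coproductD [OF c]
  show ?thesis
  proof (rule coproductI)
    fix Z f assume Z: "Z \<in> Obj V" "\<And>i. i \<in> K \<Longrightarrow> f i \<in> Hom V (X i) Z"
    then obtain m where m: "m \<in> Hom V S Z" "\<And>i. i \<in> K \<Longrightarrow> m \<cdot> j i = f i"
      using coproduct_obtain [OF c] by metis
    have "(m \<cdot> k) \<cdot> (h \<cdot> j i) = f i" if "i \<in> K" for i
      using comp_ext [OF k(2), of "j i"] k h cd m that by auto
    then show "\<exists>n\<in>Hom V T Z. \<forall>i\<in>K. n \<cdot> (h \<cdot> j i) = f i"
      using m k by (intro bexI [of _ "m \<cdot> k"]) auto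
  next
    fix Z f g assume fg: "Z \<in> Obj V" "f \<in> Hom V T Z" "g \<in> Hom V T Z"
      "\<And>i. i \<in> K \<Longrightarrow> f \<cdot> (h \<cdot> j i) = g \<cdot> (h \<cdot> j i)"
    have "f \<cdot> h = g \<cdot> h"
    proof (rule coproduct_eqI [OF c])
      fix i assume i: "i \<in> K"
      show "(f \<cdot> h) \<cdot> j i = (g \<cdot> h) \<cdot> j i" using fg(1-3) fg(4) [OF i] h cd i by simp
    qed (use fg(1-3) h in simp_all)
    then have "(f \<cdot> h) \<cdot> k = (g \<cdot> h) \<cdot> k" by simp
    then show "f = g" using fg h k by auto
  qed (use h cd in auto)
qed

lemma coproduct_iso_pieces:
  assumes c: "is_coproduct V K X (S, j)"
    and h: "\<And>i. i \<in> K \<Longrightarrow> iso V (h i)" "\<And>i. i \<in> K \<Longrightarrow> h i \<in> Hom V (Y i) (X i)"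
  shows "is_coproduct V K Y (S, \<lambda>i. j i \<cdot> h i)"
proof -
  have "\<exists>k. k \<in> Hom V (X i) (Y i) \<and> k \<cdot> h i = Ident V (Y i) \<and> h i \<cdot> k = Ident V (X i)" if "i \<in> K" for i
    using isoE [OF h(1) [OF that] h(2) [OF that]] by metis
  then obtain k where k: "\<And>i. i \<in> K \<Longrightarrow> k i \<in> Hom V (X i) (Y i)"
    "\<And>i. i \<in> K \<Longrightarrow> k i \<cdot> h i = Ident V (Y i)" "\<And>i. i \<in> K \<Longrightarrow> h i \<cdot> k i = Ident V (X i)"
    by metis
  note cd = coproductD [OF c]
  have hd: "h i \<in> Arr V" "Dom V (h i) = Y i" "Cod V (h i) = X i" if "i \<in> K" for i
    using h that by auto
  show ?thesis
  proof (rule coproductI)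
    fix Z f assume Z: "Z \<in> Obj V" and f: "\<And>i. i \<in> K \<Longrightarrow> f i \<in> Hom V (Y i) Z"
    have "\<And>i. i \<in> K \<Longrightarrow> f i \<cdot> k i \<in> Hom V (X i) Z" using f k by auto
    then obtain m where m: "m \<in> Hom V S Z" "\<And>i. i \<in> K \<Longrightarrow> m \<cdot> j i = f i \<cdot> k i"
      using coproduct_obtain [OF c, of "\<lambda>i. f i \<cdot> k i" Z] Z by metis
    have "m \<cdot> (j i \<cdot> h i) = f i" if "i \<in> K" for i
      using comp_ext [OF m(2) [OF that], of "h i"] hd k f cd m that by auto
    then show "\<exists>n\<in>Hom V S Z. \<forall>i\<in>K. n \<cdot> (j i \<cdot> h i) = f i" using m(1) by blast
  next
    fix Z f g assume fg: "Z \<in> Obj V" "f \<in> Hom V S Z" "g \<in> Hom V S Z"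
      "\<And>i. i \<in> K \<Longrightarrow> f \<cdot> (j i \<cdot> h i) = g \<cdot> (j i \<cdot> h i)"
    have "f \<cdot> j i = g \<cdot> j i" if "i \<in> K" for i
    proof -
      have "(f \<cdot> (j i \<cdot> h i)) \<cdot> k i = (g \<cdot> (j i \<cdot> h i)) \<cdot> k i" using fg(4) that by simp
      then show ?thesis using fg(1-3) hd k cd that by simp
    qed
    then show "f = g" by (rule coproduct_eqI [OF c fg(2,3)])
  qed (use hd cd in auto)
qed

text \<open>
  Extensivity speaks of index sets inside the universe only; families with other small index sets are
  transferred there.
\<close>

lemma coproduct_reindex:
  assumes c: "is_coproduct V J (\<lambda>i. X (b i)) (S, j)" and b: "bij_betw a K J" "\<And>k. k \<in> K \<Longrightarrow> b (a k) = k"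
  shows "is_coproduct V K X (S, \<lambda>k. j (a k))"
proof -
  have aK: "\<And>k. k \<in> K \<Longrightarrow> a k \<in> J" and ex: "\<And>i. i \<in> J \<Longrightarrow> b i \<in> K \<and> a (b i) = i"
    using b by (auto simp: bij_betw_def)
  note cd = coproductD [OF c]
  show ?thesis
  proof (rule coproductI)
    fix Z f assume Z: "Z \<in> Obj V" and f: "\<And>i. i \<in> K \<Longrightarrow> f i \<in> Hom V (X i) Z"
    obtain m where "m \<in> Hom V S Z" "\<And>i. i \<in> J \<Longrightarrow> m \<cdot> j i = f (b i)"
      using coproduct_obtain [OF c, of "\<lambda>i. f (b i)" Z] Z f ex by metis
    then show "\<exists>n\<in>Hom V S Z. \<forall>i\<in>K. n \<cdot> j (a i) = f i" using aK b(2) by (metis (no_types))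
  next
    fix Z f g assume fg: "Z \<in> Obj V" "f \<in> Hom V S Z" "g \<in> Hom V S Z"
      "\<And>i. i \<in> K \<Longrightarrow> f \<cdot> j (a i) = g \<cdot> j (a i)"
    have "f \<cdot> j i = g \<cdot> j i" if "i \<in> J" for i using fg(4) [of "b i"] ex that by simp
    then show "f = g" by (rule coproduct_eqI [OF c fg(2,3)])
  qed (use cd aK b in auto)
qed

end

subsection \<open>Products, pullbacks and exponentials\<close>

locale lcat = cat V for V :: "('o, 'm) cat" (structure) +
  assumes has_products: "\<And>X Y. X \<in> Obj V \<Longrightarrow> Y \<in> Obj V \<Longrightarrow> \<exists>t. is_product V X Y t"
    and has_pb: "\<And>f g. f \<in> Arr V \<Longrightarrow> g \<in> Arr V \<Longrightarrow> Cod V f = Cod V g \<Longrightarrow> \<exists>t. is_pullback V f g t"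
begin

lemma prd_is_product:
  assumes "X \<in> Obj V" "Y \<in> Obj V"
  shows "is_product V X Y (prd V X Y, pr1 V X Y, pr2 V X Y)"
  using someI_ex [OF has_products [OF assms]] by (simp add: prd_def pr1_def pr2_def)

lemma prd_simps [simp]:
  assumes "X \<in> Obj V" "Y \<in> Obj V"
  shows "prd V X Y \<in> Obj V" "pr1 V X Y \<in> Arr V" "pr2 V X Y \<in> Arr V"
    "Dom V (pr1 V X Y) = prd V X Y" "Dom V (pr2 V X Y) = prd V X Y"
    "Cod V (pr1 V X Y) = X" "Cod V (pr2 V X Y) = Y"
  using prd_is_product [OF assms] by (auto simp: is_product_def)

lemma pair_props:
  assumes "f \<in> Arr V" "g \<in> Arr V" "Dom V f = Dom V g"
  shows "pair V f g \<in> Hom V (Dom V f) (prd V (Cod V f) (Cod V g)) \<and>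
     pr1 V (Cod V f) (Cod V g) \<cdot> pair V f g = f \<and> pr2 V (Cod V f) (Cod V g) \<cdot> pair V f g = g"
proof -
  have "\<exists>!h. h \<in> Hom V (Dom V f) (prd V (Cod V f) (Cod V g)) \<and>
     pr1 V (Cod V f) (Cod V g) \<cdot> h = f \<and> pr2 V (Cod V f) (Cod V g) \<cdot> h = g"
    using prd_is_product [of "Cod V f" "Cod V g"] assms by (auto simp: is_product_def)
  from theI' [OF this] show ?thesis unfolding pair_def .
qed

lemma pair_simps [simp]:
  assumes "f \<in> Arr V" "g \<in> Arr V" "Dom V f = Dom V g"
  shows "pair V f g \<in> Arr V" "Dom V (pair V f g) = Dom V g" "Cod V (pair V f g) = prd V (Cod V f) (Cod V g)"
    "\<And>X Y. Cod V f = X \<Longrightarrow> Cod V g = Y \<Longrightarrow> pr1 V X Y \<cdot> pair V f g = f"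
    "\<And>X Y. Cod V f = X \<Longrightarrow> Cod V g = Y \<Longrightarrow> pr2 V X Y \<cdot> pair V f g = g"
  using pair_props [OF assms] assms by auto

lemma prod_eqI:
  assumes "f \<in> Hom V W (prd V X Y)" "g \<in> Hom V W (prd V X Y)" "X \<in> Obj V" "Y \<in> Obj V"
    "pr1 V X Y \<cdot> f = pr1 V X Y \<cdot> g" "pr2 V X Y \<cdot> f = pr2 V X Y \<cdot> g"
  shows "f = g"
proof -
  have W: "W \<in> Obj V" using assms by auto
  have "\<exists>!h. h \<in> Hom V W (prd V X Y) \<and> pr1 V X Y \<cdot> h = pr1 V X Y \<cdot> f \<and> pr2 V X Y \<cdot> h = pr2 V X Y \<cdot> f"
    using prd_is_product [of X Y] assms W by (auto simp: is_product_def)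
  then show ?thesis using assms by metis
qed

lemma pair_comp [simp]:
  assumes "f \<in> Arr V" "g \<in> Arr V" "Dom V f = Dom V g" "h \<in> Arr V" "Cod V h = Dom V g"
  shows "pair V f g \<cdot> h = pair V (f \<cdot> h) (g \<cdot> h)"
proof -
  have o: "Cod V f \<in> Obj V" "Cod V g \<in> Obj V" using assms by auto
  have "pr1 V (Cod V f) (Cod V g) \<cdot> (pair V f g \<cdot> h) = f \<cdot> h"
    "pr2 V (Cod V f) (Cod V g) \<cdot> (pair V f g \<cdot> h) = g \<cdot> h"
    using assms by (auto simp: comp_ext [of _ "pair V f g"])
  then show ?thesis
    by - (rule prod_eqI [OF _ _ o, of _ "Dom V h"], use assms o in simp_all)
qed

lemma pair_eta [simp]:
  assumes "h \<in> Arr V" "Cod V h = prd V X Y" "X \<in> Obj V" "Y \<in> Obj V"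
  shows "pair V (pr1 V X Y \<cdot> h) (pr2 V X Y \<cdot> h) = h"
  by (rule prod_eqI [OF _ _ assms(3,4)]) (use assms in \<open>simp_all\<close>)

lemma pair_pr [simp]:
  assumes "X \<in> Obj V" "Y \<in> Obj V"
  shows "pair V (pr1 V X Y) (pr2 V X Y) = Ident V (prd V X Y)"
  by (rule prod_eqI [OF _ _ assms]) (use assms in \<open>simp_all\<close>)

lemma pair_eq_iff:
  assumes "f \<in> Arr V" "g \<in> Arr V" "Dom V f = Dom V g" "f' \<in> Arr V" "g' \<in> Arr V" "Dom V f' = Dom V g'"
    "Cod V f = Cod V f'" "Cod V g = Cod V g'"
  shows "pair V f g = pair V f' g' \<longleftrightarrow> f = f' \<and> g = g'"
  using assms pair_props by metis

lemma pb_is_pullback: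
  assumes "f \<in> Arr V" "g \<in> Arr V" "Cod V f = Cod V g"
  shows "is_pullback V f g (pb V f g, pb1 V f g, pb2 V f g)"
  using someI_ex [OF has_pb [OF assms]] by (simp add: pb_def pb1_def pb2_def)

lemma pb_simps [simp]:
  assumes "f \<in> Arr V" "g \<in> Arr V" "Cod V f = Cod V g"
  shows "pb V f g \<in> Obj V" "pb1 V f g \<in> Arr V" "pb2 V f g \<in> Arr V"
    "Dom V (pb1 V f g) = pb V f g" "Dom V (pb2 V f g) = pb V f g"
    "Cod V (pb1 V f g) = Dom V f" "Cod V (pb2 V f g) = Dom V g"
  using pb_is_pullback [OF assms] by (auto simp: is_pullback_def)

lemma pb_comm:
  assumes "f \<in> Arr V" "g \<in> Arr V" "Cod V f = Cod V g"
  shows "f \<cdot> pb1 V f g = g \<cdot> pb2 V f g"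
  using pb_is_pullback [OF assms] by (auto simp: is_pullback_def)

lemma pb_comm_comp:
  assumes "f \<in> Arr V" "g \<in> Arr V" "Cod V f = Cod V g" "h \<in> Arr V" "Cod V h = pb V f g"
  shows "f \<cdot> (pb1 V f g \<cdot> h) = g \<cdot> (pb2 V f g \<cdot> h)"
  using comp_ext [OF pb_comm, of f g h] assms by auto

lemma pb_pair_props:
  assumes "f \<in> Arr V" "g \<in> Arr V" "Cod V f = Cod V g" "a \<in> Arr V" "b \<in> Arr V" "Dom V a = Dom V b"
    "Cod V a = Dom V f" "Cod V b = Dom V g" "f \<cdot> a = g \<cdot> b"
  shows "pb_pair V f g a b \<in> Hom V (Dom V a) (pb V f g) \<and>
    pb1 V f g \<cdot> pb_pair V f g a b = a \<and> pb2 V f g \<cdot> pb_pair V f g a b = b"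
proof -
  have "Dom V a \<in> Obj V" using assms by auto
  then have "\<exists>!h. h \<in> Hom V (Dom V a) (pb V f g) \<and> pb1 V f g \<cdot> h = a \<and> pb2 V f g \<cdot> h = b"
    using pb_is_pullback [OF assms(1-3)] assms unfolding is_pullback_def prod.case by auto
  from theI' [OF this] show ?thesis unfolding pb_pair_def .
qed

lemma pb_pair_simps [simp]:
  assumes "f \<in> Arr V" "g \<in> Arr V" "Cod V f = Cod V g" "a \<in> Arr V" "b \<in> Arr V" "Dom V a = Dom V b"
    "Cod V a = Dom V f" "Cod V b = Dom V g" "f \<cdot> a = g \<cdot> b"
  shows "pb_pair V f g a b \<in> Arr V" "Dom V (pb_pair V f g a b) = Dom V b"
    "Cod V (pb_pair V f g a b) = pb V f g"
    "pb1 V f g \<cdot> pb_pair V f g a b = a" "pb2 V f g \<cdot> pb_pair V f g a b = b"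
  using pb_pair_props [OF assms] assms by auto

lemma pb_eqI:
  assumes "f \<in> Arr V" "g \<in> Arr V" "Cod V f = Cod V g" "h \<in> Hom V W (pb V f g)" "k \<in> Hom V W (pb V f g)"
    "pb1 V f g \<cdot> h = pb1 V f g \<cdot> k" "pb2 V f g \<cdot> h = pb2 V f g \<cdot> k"
  shows "h = k"
proof -
  have W: "W \<in> Obj V" using assms by auto
  have "f \<cdot> (pb1 V f g \<cdot> h) = g \<cdot> (pb2 V f g \<cdot> h)" using assms pb_comm_comp by auto
  then have "\<exists>!m. m \<in> Hom V W (pb V f g) \<and> pb1 V f g \<cdot> m = pb1 V f g \<cdot> h \<and> pb2 V f g \<cdot> m = pb2 V f g \<cdot> h"
    using pb_is_pullback [OF assms(1-3)] assms W unfolding is_pullback_def prod.case by auto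
  then show ?thesis using assms by metis
qed

lemma pb_pair_comp [simp]:
  assumes "f \<in> Arr V" "g \<in> Arr V" "Cod V f = Cod V g" "a \<in> Arr V" "b \<in> Arr V" "Dom V a = Dom V b"
    "Cod V a = Dom V f" "Cod V b = Dom V g" "f \<cdot> a = g \<cdot> b" "h \<in> Arr V" "Cod V h = Dom V b"
  shows "pb_pair V f g a b \<cdot> h = pb_pair V f g (a \<cdot> h) (b \<cdot> h)"
proof -
  have e: "f \<cdot> (a \<cdot> h) = g \<cdot> (b \<cdot> h)"
    using comp_ext [OF assms(9), of h] assms by auto
  show ?thesis by (rule pb_eqI [OF assms(1-3), of _ "Dom V h"]) (use assms e in \<open>simp_all add: comp_ext [of _ "pb_pair V f g a b"]\<close>)
qed

lemma pb_pair_eta [simp]: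
  assumes "f \<in> Arr V" "g \<in> Arr V" "Cod V f = Cod V g" "h \<in> Arr V" "Cod V h = pb V f g"
  shows "pb_pair V f g (pb1 V f g \<cdot> h) (pb2 V f g \<cdot> h) = h"
  by (rule pb_eqI [OF assms(1-3), of _ "Dom V h"]) (use assms pb_comm_comp in \<open>simp_all\<close>)

lemma pb_pair_pb [simp]:
  assumes "f \<in> Arr V" "g \<in> Arr V" "Cod V f = Cod V g"
  shows "pb_pair V f g (pb1 V f g) (pb2 V f g) = Ident V (pb V f g)"
  by (rule pb_eqI [OF assms(1-3), of _ "pb V f g"]) (use assms pb_comm in \<open>simp_all\<close>)

text \<open>
  Only some exponentials of internal categories are constructed, so that the existence of an exponential
  has to be a property of the two objects.
\<close>

definition has_expo :: "'o \<Rightarrow> 'o \<Rightarrow> bool" where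
  "has_expo X Y \<longleftrightarrow> X \<in> Obj V \<and> Y \<in> Obj V \<and> (\<exists>t. is_exponential V X Y t)"

lemma expo_is_exponential:
  "has_expo X Y \<Longrightarrow> is_exponential V X Y (expo V X Y, eval_map V X Y)"
  unfolding has_expo_def expo_def eval_map_def by (metis someI_ex prod.collapse)

lemma expo_simps [simp]:
  assumes "has_expo X Y"
  shows "expo V X Y \<in> Obj V" "eval_map V X Y \<in> Arr V"
    "Dom V (eval_map V X Y) = prd V (expo V X Y) X" "Cod V (eval_map V X Y) = Y"
  using expo_is_exponential [OF assms] by (auto simp: is_exponential_def)

lemma curry_props:
  assumes "has_expo X (Cod V f)" "Z \<in> Obj V" "f \<in> Arr V" "Dom V f = prd V Z X"
  shows "curry_map V Z X f \<in> Hom V Z (expo V X (Cod V f)) \<and>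
    eval_map V X (Cod V f) \<cdot> pair V (curry_map V Z X f \<cdot> pr1 V Z X) (pr2 V Z X) = f"
proof -
  have "\<exists>!g. g \<in> Hom V Z (expo V X (Cod V f)) \<and>
      eval_map V X (Cod V f) \<cdot> pair V (g \<cdot> pr1 V Z X) (pr2 V Z X) = f"
    using expo_is_exponential [OF assms(1)] assms unfolding is_exponential_def by auto
  from theI' [OF this] show ?thesis unfolding curry_map_def .
qed

lemma curry_simps [simp]:
  assumes "has_expo X (Cod V f)" "Z \<in> Obj V" "f \<in> Arr V" "Dom V f = prd V Z X"
  shows "curry_map V Z X f \<in> Arr V" "Dom V (curry_map V Z X f) = Z"
    "Cod V (curry_map V Z X f) = expo V X (Cod V f)"
  using curry_props [OF assms] by auto

lemma eval_curry [simp]: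
  assumes "has_expo X Y" "Z \<in> Obj V" "f \<in> Arr V" "Dom V f = prd V Z X" "Cod V f = Y"
    "h \<in> Arr V" "Cod V h = Z" "x \<in> Arr V" "Cod V x = X" "Dom V x = Dom V h"
  shows "eval_map V X Y \<cdot> pair V (curry_map V Z X f \<cdot> h) x = f \<cdot> pair V h x"
proof -
  have X: "X \<in> Obj V" using assms(1) by (simp add: has_expo_def)
  have e: "eval_map V X Y \<cdot> pair V (curry_map V Z X f \<cdot> pr1 V Z X) (pr2 V Z X) = f"
    using curry_props assms by auto
  show ?thesis using comp_ext [OF e, of "pair V h x"] X assms by auto
qed

lemma expo_eqI:
  assumes "has_expo X Y" "g \<in> Hom V Z (expo V X Y)" "h \<in> Hom V Z (expo V X Y)"
    "eval_map V X Y \<cdot> pair V (g \<cdot> pr1 V Z X) (pr2 V Z X) = eval_map V X Y \<cdot> pair V (h \<cdot> pr1 V Z X) (pr2 V Z X)"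
  shows "g = h"
proof -
  have o: "X \<in> Obj V" "Z \<in> Obj V" using assms(1,2) by (auto simp: has_expo_def)
  have "\<exists>!m. m \<in> Hom V Z (expo V X Y) \<and> eval_map V X Y \<cdot> pair V (m \<cdot> pr1 V Z X) (pr2 V Z X) =
     eval_map V X Y \<cdot> pair V (g \<cdot> pr1 V Z X) (pr2 V Z X)"
    using expo_is_exponential [OF assms(1)] assms o unfolding is_exponential_def by auto
  then show ?thesis using assms by metis
qed

text \<open>The comparison through which the chosen exponential inherits the description of one that is constructed.\<close>

lemma exponential_unique:
  assumes E: "is_exponential V X Y (E, e)" and XY: "X \<in> Obj V" "Y \<in> Obj V"
  obtains h where "h \<in> Hom V (expo V X Y) E" "iso V h"
    "e \<cdot> pair V (h \<cdot> pr1 V (expo V X Y) X) (pr2 V (expo V X Y) X) = eval_map V X Y"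
proof -
  let ?F = "expo V X Y" and ?ev = "eval_map V X Y"
  have hx: "has_expo X Y" using E XY by (auto simp: has_expo_def)
  have Eo: "E \<in> Obj V" "e \<in> Arr V" "Dom V e = prd V E X" "Cod V e = Y"
    using E by (auto simp: is_exponential_def)
  have U: "\<exists>!g. g \<in> Hom V Z E \<and> e \<cdot> pair V (g \<cdot> pr1 V Z X) (pr2 V Z X) = f"
    if "Z \<in> Obj V" "f \<in> Hom V (prd V Z X) Y" for Z f using E that by (auto simp: is_exponential_def)
  obtain h where h: "h \<in> Hom V ?F E" "e \<cdot> pair V (h \<cdot> pr1 V ?F X) (pr2 V ?F X) = ?ev"
    using U [of ?F ?ev] hx by auto
  define k where "k = curry_map V E X e"
  have k: "k \<in> Hom V E ?F" using hx Eo by (auto simp: k_def)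
  have hk: "e \<cdot> pair V (h \<cdot> a) x = ?ev \<cdot> pair V a x"
    if "a \<in> Arr V" "Cod V a = ?F" "x \<in> Arr V" "Cod V x = X" "Dom V a = Dom V x" for a x
    using comp_ext [OF h(2), of "pair V a x"] h(1) hx XY Eo that by auto
  have ke: "?ev \<cdot> pair V (k \<cdot> a) x = e \<cdot> pair V a x"
    if "a \<in> Arr V" "Cod V a = E" "x \<in> Arr V" "Cod V x = X" "Dom V a = Dom V x" for a x
    unfolding k_def using that Eo hx by auto
  have 1: "k \<cdot> h = Ident V ?F"
    by (rule expo_eqI [OF hx, of _ ?F]) (use h(1) k hx XY Eo in \<open>simp_all add: hk ke\<close>)
  have "h \<cdot> k \<in> Hom V E E \<and> e \<cdot> pair V ((h \<cdot> k) \<cdot> pr1 V E X) (pr2 V E X) = e"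
    "Ident V E \<in> Hom V E E \<and> e \<cdot> pair V (Ident V E \<cdot> pr1 V E X) (pr2 V E X) = e"
    using h(1) k hx XY Eo by (auto simp: hk ke)
  then have 2: "h \<cdot> k = Ident V E" by (rule ex1_unique [OF U [of E e], rotated 2]) (use Eo in simp_all)
  show ?thesis using that h 1 2 k isoI by blast
qed

text \<open>The analogous comparison for pullbacks.\<close>

lemma pullback_unique:
  assumes P: "is_pullback V f g (P, p, q)" and fg: "f \<in> Arr V" "g \<in> Arr V" "Cod V f = Cod V g"
  obtains h where "h \<in> Hom V (pb V f g) P" "iso V h" "p \<cdot> h = pb1 V f g" "q \<cdot> h = pb2 V f g"
proof -
  have Po: "P \<in> Obj V" "p \<in> Arr V" "Dom V p = P" "Cod V p = Dom V f" "q \<in> Arr V" "Dom V q = P"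
    "Cod V q = Dom V g" and Pc: "f \<cdot> p = g \<cdot> q" using P by (auto simp: is_pullback_def)
  have U: "\<exists>!h. h \<in> Hom V Z P \<and> p \<cdot> h = a \<and> q \<cdot> h = b"
    if "Z \<in> Obj V" "a \<in> Hom V Z (Dom V f)" "b \<in> Hom V Z (Dom V g)" "f \<cdot> a = g \<cdot> b" for Z a b
    using P that unfolding is_pullback_def by simp
  obtain h where h: "h \<in> Hom V (pb V f g) P" "p \<cdot> h = pb1 V f g" "q \<cdot> h = pb2 V f g"
    using U [of "pb V f g" "pb1 V f g" "pb2 V f g"] fg pb_comm by auto
  define k where "k = pb_pair V f g p q"
  have k: "k \<in> Hom V P (pb V f g)" "pb1 V f g \<cdot> k = p" "pb2 V f g \<cdot> k = q"
    using fg Po Pc by (auto simp: k_def)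
  have 1: "k \<cdot> h = Ident V (pb V f g)"
    by (rule pb_eqI [OF fg, of _ "pb V f g"]) (use h k fg Po in \<open>simp_all add: comp_ext [OF k(2)] comp_ext [OF k(3)]\<close>)
  have "h \<cdot> k \<in> Hom V P P \<and> p \<cdot> (h \<cdot> k) = p \<and> q \<cdot> (h \<cdot> k) = q"
    "Ident V P \<in> Hom V P P \<and> p \<cdot> Ident V P = p \<and> q \<cdot> Ident V P = q"
    using h k fg Po by (auto simp: comp_ext [OF h(2)] comp_ext [OF h(3)])
  then have 2: "h \<cdot> k = Ident V P" by (rule ex1_unique [OF U [of P p q], rotated 4]) (use Po Pc in simp_all)
  show ?thesis using that h 1 2 k isoI by blast
qed

lemma product_unique:
  assumes P: "is_product V X Y (P, p, q)" and XY: "X \<in> Obj V" "Y \<in> Obj V"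
  obtains h where "h \<in> Hom V (prd V X Y) P" "iso V h" "p \<cdot> h = pr1 V X Y" "q \<cdot> h = pr2 V X Y"
proof -
  have Po: "P \<in> Obj V" "p \<in> Arr V" "Dom V p = P" "Cod V p = X" "q \<in> Arr V" "Dom V q = P"
    "Cod V q = Y" using P by (auto simp: is_product_def)
  have U: "\<exists>!h. h \<in> Hom V Z P \<and> p \<cdot> h = a \<and> q \<cdot> h = b"
    if "Z \<in> Obj V" "a \<in> Hom V Z X" "b \<in> Hom V Z Y" for Z a b
    using P that unfolding is_product_def by simp
  obtain h where h: "h \<in> Hom V (prd V X Y) P" "p \<cdot> h = pr1 V X Y" "q \<cdot> h = pr2 V X Y"
    using U [of "prd V X Y" "pr1 V X Y" "pr2 V X Y"] XY by auto
  define k where "k = pair V p q"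
  have k: "k \<in> Hom V P (prd V X Y)" "pr1 V X Y \<cdot> k = p" "pr2 V X Y \<cdot> k = q"
    using Po by (auto simp: k_def)
  have 1: "k \<cdot> h = Ident V (prd V X Y)"
    by (rule prod_eqI [OF _ _ XY, of _ "prd V X Y"]) (use h k XY Po in \<open>simp_all add: comp_ext [OF k(2)] comp_ext [OF k(3)]\<close>)
  have "h \<cdot> k \<in> Hom V P P \<and> p \<cdot> (h \<cdot> k) = p \<and> q \<cdot> (h \<cdot> k) = q"
    "Ident V P \<in> Hom V P P \<and> p \<cdot> Ident V P = p \<and> q \<cdot> Ident V P = q"
    using h k XY Po by (auto simp: comp_ext [OF h(2)] comp_ext [OF h(3)])
  then have 2: "h \<cdot> k = Ident V P" by (rule ex1_unique [OF U [of P p q], rotated 3]) (use Po in simp_all)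
  show ?thesis using that h 1 2 k isoI by blast
qed

end

subsection \<open>Cartesian closed categories\<close>

locale ccc = lcat V for V :: "('o, 'm) cat" (structure) +
  assumes closed: "cartesian_closed V"
begin

text \<open>Short notation is introduced for \<open>V\<close> alone, so that it cannot be confused with that of the category of internal categories.\<close>

abbreviation hom_set (infix "~>" 60) where
  "X ~> Y \<equiv> Hom V X Y"

abbreviation comp_of (infixr "**" 70) where
  "g ** f \<equiv> g \<cdot> f"

abbreviation "ic \<equiv> icompose V"

abbreviation "pt \<equiv> term_ob V"

abbreviation "CV \<equiv> Cat V"

abbreviation Cat_comp (infixr "\<odot>" 70) where
  "G \<odot> F \<equiv> G \<cdot>\<^bsub>Cat V\<^esub> F"

lemma term_ob_terminal: "is_terminal V pt"
  using closed unfolding cartesian_closed_def term_ob_def by (metis someI_ex)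

lemma term_ob_Obj [simp]: "pt \<in> Obj V"
  using term_ob_terminal by (simp add: is_terminal_def)

lemma bang_props: "X \<in> Obj V \<Longrightarrow> bang V X \<in> X ~> pt"
  using term_ob_terminal theI' [of "\<lambda>f. f \<in> X ~> pt"]
  unfolding is_terminal_def bang_def by blast

lemma bang_simps [simp]:
  assumes "X \<in> Obj V"
  shows "bang V X \<in> Arr V" "Dom V (bang V X) = X" "Cod V (bang V X) = pt"
  using bang_props [OF assms] by auto

lemma bang_unique: "f \<in> Arr V \<Longrightarrow> Cod V f = pt \<Longrightarrow> Dom V f = X \<Longrightarrow> f = bang V X"
proof -
  assume f: "f \<in> Arr V" "Cod V f = pt" "Dom V f = X"
  then have X: "X \<in> Obj V" by auto
  then have "\<exists>!g. g \<in> X ~> pt"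
    using term_ob_terminal by (simp add: is_terminal_def del: Hom_iff)
  then show "f = bang V X" by (rule ex1_unique) (use f bang_props [OF X] in auto)
qed

lemma term_eqI: "f \<in> Arr V \<Longrightarrow> g \<in> Arr V \<Longrightarrow> Dom V f = Dom V g \<Longrightarrow> Cod V f = pt \<Longrightarrow>
    Cod V g = pt \<Longrightarrow> f = g"
  using bang_unique by metis

lemma bang_comp [simp]: "f \<in> Arr V \<Longrightarrow> Cod V f = Y \<Longrightarrow> bang V Y ** f = bang V (Dom V f)"
  by (rule bang_unique) auto

lemma bang_term [simp]: "bang V pt = Ident V pt"
  by (rule bang_unique [symmetric]) auto

lemma has_expo [simp]: "X \<in> Obj V \<Longrightarrow> Y \<in> Obj V \<Longrightarrow> has_expo X Y"
  using closed by (auto simp: has_expo_def cartesian_closed_def)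

lemma iso_bang_iff:
  assumes "Z \<in> Obj V"
  shows "iso V (bang V Z) \<longleftrightarrow> (\<forall>W\<in>Obj V. \<exists>!z. z \<in> W ~> Z)"
proof -
  have "(\<forall>z\<in>W ~> pt. \<exists>!y. y \<in> W ~> Z \<and> bang V Z ** y = z) \<longleftrightarrow> (\<exists>!z. z \<in> W ~> Z)"
    if W: "W \<in> Obj V" for W
  proof -
    have "W ~> pt = {bang V W}" using W bang_unique bang_props by auto
    moreover have "y \<in> W ~> Z \<and> bang V Z ** y = bang V W \<longleftrightarrow> y \<in> W ~> Z" for y
      using assms by auto
    ultimately show ?thesis by auto
  qed
  then show ?thesis using iso_iff_ex1 [of "bang V Z" Z "pt"] assms by auto
qed

text \<open>
  A functor with a right adjoint preserves coproducts: the coproduct is pulled out of the first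
  factor of a product.
\<close>

lemma coproduct_times:
  assumes c: "is_coproduct V K X (S, j)" and P: "P \<in> Obj V" and X: "\<And>i. i \<in> K \<Longrightarrow> X i \<in> Obj V"
  shows "is_coproduct V K (\<lambda>i. prd V (X i) P)
    (prd V S P, \<lambda>i. pair V (j i ** pr1 V (X i) P) (pr2 V (X i) P))"
proof -
  note cd = coproductD [OF c]
  show ?thesis
  proof (rule coproductI)
    fix Z f assume Z: "Z \<in> Obj V" and f: "\<And>i. i \<in> K \<Longrightarrow> f i \<in> prd V (X i) P ~> Z"
    have fd: "f i \<in> Arr V" "Dom V (f i) = prd V (X i) P" "Cod V (f i) = Z" if "i \<in> K" for i
      using f that by auto
    have "\<And>i. i \<in> K \<Longrightarrow> curry_map V (X i) P (f i) \<in> X i ~> expo V P Z"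
      using fd P Z X by auto
    then obtain m where m: "m \<in> S ~> expo V P Z" "\<And>i. i \<in> K \<Longrightarrow> m ** j i = curry_map V (X i) P (f i)"
      using coproduct_obtain [OF c, of "\<lambda>i. curry_map V (X i) P (f i)"] P Z by (metis expo_simps(1) has_expo)
    define n where "n = eval_map V P Z ** pair V (m ** pr1 V S P) (pr2 V S P)"
    have "n \<in> prd V S P ~> Z" using m cd P Z by (auto simp: n_def)
    moreover have "n ** pair V (j i ** pr1 V (X i) P) (pr2 V (X i) P) = f i" if "i \<in> K" for i
      using m(1) cd P Z X fd that by (auto simp: n_def comp_ext [OF m(2)])
    ultimately show "\<exists>h\<in>prd V S P ~> Z. \<forall>i\<in>K. h ** pair V (j i ** pr1 V (X i) P) (pr2 V (X i) P) = f i"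
      by blast
  next
    fix Z f g assume Z: "Z \<in> Obj V" and fg: "f \<in> prd V S P ~> Z" "g \<in> prd V S P ~> Z"
      "\<And>i. i \<in> K \<Longrightarrow> f ** pair V (j i ** pr1 V (X i) P) (pr2 V (X i) P) = g ** pair V (j i ** pr1 V (X i) P) (pr2 V (X i) P)"
    have "curry_map V S P f = curry_map V S P g"
    proof (rule coproduct_eqI [OF c])
      fix i assume i: "i \<in> K"
      show "curry_map V S P f ** j i = curry_map V S P g ** j i"
        by (rule expo_eqI [of P Z _ "X i"]) (use fg(1,2) fg(3) [OF i] cd i P Z X in \<open>simp_all\<close>)
    qed (use fg Z P cd in auto)
    then show "f = g" using curry_props [of P f S] curry_props [of P g S] fg P Z cd by auto
  qed (use cd P X in auto)
qed

end


section \<open>Small sets\<close>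

lemma small_lepoll: "A \<lesssim> B \<Longrightarrow> small U B \<Longrightarrow> small U A"
  unfolding small_def by (rule lesspoll_trans1)

lemma small_image: "small U A \<Longrightarrow> small U (f ` A)"
  using image_lepoll small_lepoll by blast

lemma small_subset: "small U B \<Longrightarrow> A \<subseteq> B \<Longrightarrow> small U A"
  using subset_imp_lepoll small_lepoll by blast

lemma small_embed:
  assumes "small U A"
  obtains f where "inj_on f A" "f ` A \<subseteq> U"
  using lesspoll_imp_lepoll assms unfolding small_def lepoll_def by blast

lemma small_finite: "universe U \<Longrightarrow> finite A \<Longrightarrow> small U A"
  unfolding small_def universe_def by (simp add: finite_lesspoll_infinite)

lemma small_Pow:
  assumes "universe U" "small U A"
  shows "small U (Pow A)"
proof -
  obtain f where f: "inj_on f A" "f ` A \<subseteq> U" using small_embed assms by blast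
  have "small U (Pow (f ` A))"
    using assms(1) f(2) small_image [OF assms(2), of f] unfolding universe_def by simp
  moreover have "Pow A \<lesssim> Pow (f ` A)"
    unfolding lepoll_def using inj_on_image_Pow [OF f(1)] by (intro exI [of _ "image f"]) auto
  ultimately show ?thesis using small_lepoll by blast
qed

text \<open>
  An infinite set absorbs its square, so a small union of small sets of any type can be carried out
  inside \<open>U\<close> once the pieces have been made disjoint.
\<close>

lemma small_Sigma:
  fixes U :: "'u set"
  assumes U: "universe U" and K: "small U K" and F: "\<And>k. k \<in> K \<Longrightarrow> small U (F k)"
  shows "small U (Sigma K F)"
proof -
  have "infinite U" using U by (simp add: universe_def)
  then have "ordIso2 (card_of (U \<times> U)) (card_of U)" by (rule card_of_Times_same_infinite)
  then obtain p where p: "bij_betw p (U \<times> U) U" using card_of_ordIso by blast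
  obtain g where g: "inj_on g K" "g ` K \<subseteq> U" using small_embed K by blast
  have "\<exists>h. inj_on h (F k) \<and> h ` F k \<subseteq> U" if "k \<in> K" for k
    by (rule small_embed [OF F [OF that]]) blast
  then obtain h where h: "\<And>k. k \<in> K \<Longrightarrow> inj_on (h k) (F k) \<and> h k ` F k \<subseteq> U" by metis
  define H where "H = (\<lambda>k. (\<lambda>x. p (g k, h k x)) ` F k)"
  define H' where "H' = (\<lambda>a. H (the_inv_into K g a))"
  have H': "H' (g k) = H k" if "k \<in> K" for k
    using the_inv_into_f_f [OF g(1) that] by (simp add: H'_def)
  have pU: "p (a, b) \<in> U" if "a \<in> U" "b \<in> U" for a b using p that by (auto simp: bij_betw_def)
  have HU: "H k \<subseteq> U \<and> small U (H k)" if "k \<in> K" for k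
  proof -
    have "g k \<in> U" "h k ` F k \<subseteq> U" using g h that by auto
    then show ?thesis using small_image [OF F [OF that]] by (auto simp: H_def intro!: pU)
  qed
  have "small U (\<Union>a\<in>g ` K. H' a)"
  proof -
    have "\<forall>a\<in>g ` K. H' a \<subseteq> U \<and> small U (H' a)" using HU H' by auto
    moreover have "small U (\<Union>a\<in>A. f a)"
      if "A \<subseteq> U" "small U A" "\<forall>a\<in>A. f a \<subseteq> U \<and> small U (f a)" for A and f :: "'u \<Rightarrow> 'u set"
      using U that unfolding universe_def by blast
    ultimately show ?thesis using g(2) small_image [OF K, of g] by blast
  qed
  moreover have "Sigma K F \<lesssim> (\<Union>a\<in>g ` K. H' a)"
    unfolding lepoll_def
  proof (intro exI conjI)
    show "inj_on (\<lambda>(k, x). p (g k, h k x)) (Sigma K F)"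
    proof (rule inj_onI, clarify)
      fix k x k' x' assume k: "k \<in> K" "x \<in> F k" "k' \<in> K" "x' \<in> F k'"
        and e: "p (g k, h k x) = p (g k', h k' x')"
      have "(g k, h k x) = (g k', h k' x')"
        using k g h e p by (intro inj_onD [OF bij_betw_imp_inj_on [OF p] e]) auto
      then show "k = k' \<and> x = x'" using k g h by (auto simp: inj_on_def)
    qed
    show "(\<lambda>(k, x). p (g k, h k x)) ` Sigma K F \<subseteq> (\<Union>a\<in>g ` K. H' a)"
      using H' by (auto simp: H_def)
  qed
  ultimately show ?thesis using small_lepoll by blast
qed

lemma small_Times: "universe U \<Longrightarrow> small U A \<Longrightarrow> small U B \<Longrightarrow> small U (A \<times> B)"
  by (rule small_Sigma) auto

lemma small_UN:
  assumes "universe U" "small U K" "\<And>k. k \<in> K \<Longrightarrow> small U (F k)"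
  shows "small U (\<Union>k\<in>K. F k)"
proof -
  have "(\<Union>k\<in>K. F k) \<subseteq> snd ` Sigma K F" by force
  moreover have "small U (Sigma K F)" using assms by (intro small_Sigma) auto
  ultimately show ?thesis using small_subset small_image by metis
qed

text \<open>Sections are subsets of the total space, hence few.\<close>

lemma small_PiE:
  assumes "universe U" "small U K" "\<And>k. k \<in> K \<Longrightarrow> small U (F k)"
  shows "small U (PiE K F)"
proof -
  have "PiE K F \<lesssim> Pow (Sigma K F)"
    unfolding lepoll_def
  proof (intro exI conjI)
    show "inj_on (\<lambda>f. (\<lambda>k. (k, f k)) ` K) (PiE K F)"
    proof (rule inj_onI)
      fix f g assume f: "f \<in> PiE K F" and g: "g \<in> PiE K F"
        and e: "(\<lambda>k. (k, f k)) ` K = (\<lambda>k. (k, g k)) ` K"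
      have "f k = g k" if "k \<in> K" for k
      proof -
        have "(k, f k) \<in> (\<lambda>k. (k, g k)) ` K" using e that by blast
        then show ?thesis by auto
      qed
      then show "f = g" using f g by (intro PiE_ext)
    qed
    show "(\<lambda>f. (\<lambda>k. (k, f k)) ` K) ` PiE K F \<subseteq> Pow (Sigma K F)" by auto
  qed
  moreover have "small U (Pow (Sigma K F))" using assms by (intro small_Pow small_Sigma) auto
  ultimately show ?thesis by (rule small_lepoll)
qed


section \<open>Equivalences of categories\<close>

lemma slice_Hom_iff: "t \<in> Hom (slice_cat V X) a b \<longleftrightarrow> (\<exists>h. t = (a, h, b) \<and> a \<in> Arr V \<and> Cod V a = X \<and>
    b \<in> Arr V \<and> Cod V b = X \<and> h \<in> Hom V (Dom V a) (Dom V b) \<and> Comp V b h = a)"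
  by (cases t) (auto simp: slice_cat_def)

lemma slice_Comp [simp]: "Comp (slice_cat V X) (f', h', g') (f, h, g) = (f, Comp V h' h, g')"
  and slice_Ident [simp]: "Ident (slice_cat V X) f = (f, Ident V (Dom V f), f)"
  and slice_Obj_iff [simp]: "f \<in> Obj (slice_cat V X) \<longleftrightarrow> f \<in> Arr V \<and> Cod V f = X"
  by (auto simp: slice_cat_def)

lemma slice_category:
  assumes "category V"
  shows "category (slice_cat V X)"
proof -
  interpret cat V using assms by unfold_locales
  show ?thesis unfolding category_def
  proof (intro conjI ballI allI)
    fix f assume "f \<in> Arr (slice_cat V X)"
    then show "Dom (slice_cat V X) f \<in> Obj (slice_cat V X)" "Cod (slice_cat V X) f \<in> Obj (slice_cat V X)"
      by (auto simp: slice_cat_def)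
  next
    fix a assume "a \<in> Obj (slice_cat V X)"
    then show "Ident (slice_cat V X) a \<in> Hom (slice_cat V X) a a" by (simp add: slice_Hom_iff del: Hom_iff) simp
  next
    fix a b c f g assume "f \<in> Hom (slice_cat V X) a b" "g \<in> Hom (slice_cat V X) b c"
    then obtain h k where f: "f = (a, h, b)" "a \<in> Arr V" "Cod V a = X" "h \<in> Hom V (Dom V a) (Dom V b)"
        "Comp V b h = a" and g: "g = (b, k, c)" "c \<in> Arr V" "Cod V c = X"
        "k \<in> Hom V (Dom V b) (Dom V c)" "Comp V c k = b"
      unfolding slice_Hom_iff by blast
    have "Comp V c (Comp V k h) = a"
      using comp_ext [OF g(5), of h] f(4,5) g(2,4) by simp
    moreover have "Comp V k h \<in> Hom V (Dom V a) (Dom V c)" using f(4) g(4) by simp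
    ultimately show "Comp (slice_cat V X) g f \<in> Hom (slice_cat V X) a c"
      unfolding slice_Hom_iff using f(1-3) g(1-3) by auto
  next
    fix a b f assume "f \<in> Hom (slice_cat V X) a b"
    then obtain h where "f = (a, h, b)" "h \<in> Hom V (Dom V a) (Dom V b)" unfolding slice_Hom_iff by blast
    then show "Comp (slice_cat V X) (Ident (slice_cat V X) b) f = f"
      "Comp (slice_cat V X) f (Ident (slice_cat V X) a) = f" by simp_all
  next
    fix a b c d f g h assume "f \<in> Hom (slice_cat V X) a b" "g \<in> Hom (slice_cat V X) b c"
      "h \<in> Hom (slice_cat V X) c d"
    then obtain f' g' h' where "f = (a, f', b)" "f' \<in> Hom V (Dom V a) (Dom V b)"
      "g = (b, g', c)" "g' \<in> Hom V (Dom V b) (Dom V c)" "h = (c, h', d)" "h' \<in> Hom V (Dom V c) (Dom V d)"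
      unfolding slice_Hom_iff by blast
    then show "Comp (slice_cat V X) (Comp (slice_cat V X) h g) f =
        Comp (slice_cat V X) h (Comp (slice_cat V X) g f)" by simp
  qed
qed

lemma product_category:
  assumes "\<And>i. i \<in> I \<Longrightarrow> category (K i)"
  shows "category (product_cat I K)"
proof -
  have c: "cat (K i)" if "i \<in> I" for i using assms that by unfold_locales
  show ?thesis unfolding category_def
  proof (intro conjI ballI allI)
    fix f assume f: "f \<in> Arr (product_cat I K)"
    then show "Dom (product_cat I K) f \<in> Obj (product_cat I K)" "Cod (product_cat I K) f \<in> Obj (product_cat I K)"
      by (auto simp: product_cat_def intro!: cat.Dom_Obj [OF c] cat.Cod_Obj [OF c])
  next
    fix X assume X: "X \<in> Obj (product_cat I K)"
    have X': "X i \<in> Obj (K i)" if "i \<in> I" for i using X that by (auto simp: product_cat_def)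
    have "X \<in> extensional I" using X by (auto simp: product_cat_def PiE_def)
    then show "Ident (product_cat I K) X \<in> Hom (product_cat I K) X X"
      by (simp add: product_cat_def cat.Ident_arr [OF c X'] fun_eq_iff extensional_def)
  next
    fix X Y Z f g assume fg: "f \<in> Hom (product_cat I K) X Y" "g \<in> Hom (product_cat I K) Y Z"
    then have "g i \<in> Arr (K i)" "f i \<in> Arr (K i)" "Dom (K i) (g i) = Cod (K i) (f i)" if "i \<in> I" for i
      using that by (auto simp: product_cat_def PiE_mem restrict_def dest: fun_cong [of _ _ i])
    then show "Comp (product_cat I K) g f \<in> Hom (product_cat I K) X Z"
      using fg cat.comp_arr [OF c] by (auto simp: product_cat_def intro!: restrict_ext)
  next
    fix X Y f assume f: "f \<in> Hom (product_cat I K) X Y"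
    then have f': "f i \<in> Arr (K i)" "X i = Dom (K i) (f i)" "Y i = Cod (K i) (f i)" if "i \<in> I" for i
      using that by (auto simp: product_cat_def PiE_mem)
    have fe: "f \<in> extensional I" using f by (auto simp: product_cat_def PiE_def)
    show "Comp (product_cat I K) (Ident (product_cat I K) Y) f = f"
      "Comp (product_cat I K) f (Ident (product_cat I K) X) = f"
      using f' cat.id_left [OF c] cat.id_right [OF c] fe
      by (auto simp: product_cat_def fun_eq_iff extensional_def)
  next
    fix W X Y Z f g h assume fg: "f \<in> Hom (product_cat I K) W X" "g \<in> Hom (product_cat I K) X Y"
      "h \<in> Hom (product_cat I K) Y Z"
    then have "g i \<in> Arr (K i)" "f i \<in> Arr (K i)" "h i \<in> Arr (K i)" "Dom (K i) (g i) = Cod (K i) (f i)"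
      "Dom (K i) (h i) = Cod (K i) (g i)" if "i \<in> I" for i
      using that by (auto simp: product_cat_def PiE_mem restrict_def dest: fun_cong [of _ _ i])
    then show "Comp (product_cat I K) (Comp (product_cat I K) h g) f =
        Comp (product_cat I K) h (Comp (product_cat I K) g f)"
      using cat.assoc [OF c] by (auto simp: product_cat_def intro!: restrict_ext)
  qed
qed

context cat
begin

lemma iso_cancel_left:
  assumes "iso V m" "m \<cdot> a = m \<cdot> b" "a \<in> Hom V X (Dom V m)" "b \<in> Hom V X (Dom V m)"
  shows "a = b"
proof -
  have m: "m \<in> Hom V (Dom V m) (Cod V m)" using assms(1) by (simp add: iso_def)
  obtain n where n: "n \<in> Hom V (Cod V m) (Dom V m)" "n \<cdot> m = Ident V (Dom V m)"
    using assms(1) by (auto simp: iso_def)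
  have "n \<cdot> (m \<cdot> a) = a" "n \<cdot> (m \<cdot> b) = b"
    using comp_ext [OF n(2), of a] comp_ext [OF n(2), of b] m n assms(3,4) by simp_all
  then show ?thesis using assms(2) by metis
qed

lemma iso_cancel_right:
  assumes "iso V m" "a \<cdot> m = b \<cdot> m" "a \<in> Hom V (Cod V m) X" "b \<in> Hom V (Cod V m) X"
  shows "a = b"
proof -
  have m: "m \<in> Hom V (Dom V m) (Cod V m)" using assms(1) by (simp add: iso_def)
  obtain n where n: "n \<in> Hom V (Cod V m) (Dom V m)" "m \<cdot> n = Ident V (Cod V m)"
    using assms(1) by (auto simp: iso_def)
  have "(a \<cdot> m) \<cdot> n = a" "(b \<cdot> m) \<cdot> n = b" using m n assms(3,4) by simp_all
  then show ?thesis using assms(2) by metis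
qed

end

text \<open>
  Both functors are faithful by the naturality of \<open>\<eta>\<close> and \<open>\<epsilon>\<close>.  Then \<open>\<theta>\<close> is the image of
  \<open>\<eta>\<^sub>Y\<close> inverse after \<open>G \<theta>\<close> after \<open>\<eta>\<^sub>X\<close>, since \<open>\<theta>\<close> and
  that image agree under \<open>G\<close>.
\<close>

lemma equivalence_full_faithful:
  assumes A: "category A" and B: "category B" and e: "is_equivalence A B F"
    and X: "X \<in> Obj A" and Y: "Y \<in> Obj A" and t: "\<theta> \<in> Hom B (fo F X) (fo F Y)"
  shows "\<exists>!\<phi>. \<phi> \<in> Hom A X Y \<and> fa F \<phi> = \<theta>"
proof -
  interpret A: cat A by (rule cat.intro [OF A])
  interpret B: cat B by (rule cat.intro [OF B])
  obtain G \<eta> \<epsilon> where F: "is_functor A B F" and G: "is_functor B A G"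
    and n: "is_nat_iso A A cfun_id (cfun_comp G F) \<eta>" and c: "is_nat_iso B B (cfun_comp F G) cfun_id \<epsilon>"
    using e unfolding is_equivalence_def by blast
  have Fa: "fa F f \<in> Hom B (fo F X) (fo F Y)" if "f \<in> Hom A X Y" for f X Y
    using F that unfolding is_functor_def by (metis A.Dom_Obj A.Cod_Obj Hom_iff)
  have Ga: "fa G f \<in> Hom A (fo G X) (fo G Y)" if "f \<in> Hom B X Y" for f X Y
    using G that unfolding is_functor_def by (metis B.Dom_Obj B.Cod_Obj Hom_iff)
  have eta: "\<eta> X \<in> Hom A X (fo G (fo F X))" "iso A (\<eta> X)" if "X \<in> Obj A" for X
    using n that by (auto simp: is_nat_iso_def cfun_id_def cfun_comp_def)
  have etan: "Comp A (\<eta> Y) f = Comp A (fa G (fa F f)) (\<eta> X)" if "f \<in> Hom A X Y" for f X Y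
    using n that unfolding is_nat_iso_def cfun_id_def cfun_comp_def by (auto)
  have eps: "\<epsilon> X \<in> Hom B (fo F (fo G X)) X" "iso B (\<epsilon> X)" if "X \<in> Obj B" for X
    using c that by (auto simp: is_nat_iso_def cfun_id_def cfun_comp_def)
  have epsn: "Comp B (\<epsilon> Y) (fa F (fa G f)) = Comp B f (\<epsilon> X)" if "f \<in> Hom B X Y" for f X Y
    using c that unfolding is_nat_iso_def cfun_id_def cfun_comp_def by (auto)
  have Ff: "f = g" if "f \<in> Hom A X Y" "g \<in> Hom A X Y" "fa F f = fa F g" for f g X Y
  proof -
    have "Comp A (\<eta> Y) f = Comp A (\<eta> Y) g" using etan [OF that(1)] etan [OF that(2)] that(3) by simp
    moreover have "Y \<in> Obj A" using that by auto
    ultimately show ?thesis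
      by - (rule A.iso_cancel_left [OF eta(2), of Y], use eta that in simp_all)
  qed
  have Gf: "f = g" if "f \<in> Hom B X Y" "g \<in> Hom B X Y" "fa G f = fa G g" for f g X Y
  proof -
    have "Comp B f (\<epsilon> X) = Comp B g (\<epsilon> X)" using epsn [OF that(1)] epsn [OF that(2)] that(3) by simp
    moreover have "X \<in> Obj B" using that by auto
    ultimately show ?thesis
      by - (rule B.iso_cancel_right [OF eps(2), of X], use eps that in simp_all)
  qed
  obtain k where k: "k \<in> Hom A (fo G (fo F Y)) Y" "Comp A (\<eta> Y) k = Ident A (fo G (fo F Y))"
    using A.isoE [OF eta(2) [OF Y] eta(1) [OF Y]] by metis
  define \<phi> where "\<phi> = Comp A k (Comp A (fa G \<theta>) (\<eta> X))"
  have ph: "\<phi> \<in> Hom A X Y" using k eta(1) [OF X] Ga [OF t] by (simp add: \<phi>_def)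
  have "Comp A (fa G (fa F \<phi>)) (\<eta> X) = Comp A (\<eta> Y) \<phi>" using etan [OF ph] by simp
  also have "\<dots> = Comp A (fa G \<theta>) (\<eta> X)"
    unfolding \<phi>_def using k(1) eta(1) [OF X] eta(1) [OF Y] Ga [OF t]
    by (subst A.comp_ext [OF k(2)]) simp_all
  finally have "fa G (fa F \<phi>) = fa G \<theta>"
    by - (rule A.iso_cancel_right [OF eta(2) [OF X]], use eta(1) [OF X] Ga [OF t] Ga [OF Fa [OF ph]] in simp_all)
  then have "fa F \<phi> = \<theta>" using Gf Fa [OF ph] t by blast
  then show ?thesis using ph Ff by blast
qed

lemma equivalence_ess_surj:
  assumes e: "is_equivalence A B F" and Y: "Y \<in> Obj B"
  obtains X h where "X \<in> Obj A" "h \<in> Hom B (fo F X) Y" "iso B h"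
proof -
  obtain G \<epsilon> where G: "is_functor B A G" and c: "is_nat_iso B B (cfun_comp F G) cfun_id \<epsilon>"
    using e unfolding is_equivalence_def by blast
  have "fo G Y \<in> Obj A" "\<epsilon> Y \<in> Hom B (fo F (fo G Y)) Y" "iso B (\<epsilon> Y)"
    using G c Y by (auto simp: is_functor_def is_nat_iso_def cfun_id_def cfun_comp_def)
  then show ?thesis using that by blast
qed


section \<open>Extensive categories\<close>

locale ext_ccc = ccc V for V :: "('o, 'm) cat" (structure) +
  fixes U :: "'u set"
  assumes universe: "universe U" and locally_small: "locally_small V U" and extensive: "extensive U V"
begin

lemma coproduct_unique:
  assumes c: "is_coproduct V K X (S, j)" and d: "is_coproduct V K X (T, k)"
  obtains h where "h \<in> S ~> T" "iso V h" "\<And>i. i \<in> K \<Longrightarrow> h ** j i = k i"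
proof -
  note cd = coproductD [OF c] and dd = coproductD [OF d]
  have "\<And>i. i \<in> K \<Longrightarrow> k i \<in> X i ~> T" "\<And>i. i \<in> K \<Longrightarrow> j i \<in> X i ~> S" using cd dd by simp_all
  then obtain h g where h: "h \<in> S ~> T" "\<And>i. i \<in> K \<Longrightarrow> h ** j i = k i"
    and g: "g \<in> T ~> S" "\<And>i. i \<in> K \<Longrightarrow> g ** k i = j i"
    using coproduct_obtain [OF c, of k T] coproduct_obtain [OF d, of j S] cd(1) dd(1) by metis
  have "g ** h = Ident V S"
    by (rule coproduct_eqI [OF c, of _ S]) (use h g cd in \<open>simp_all\<close>)
  moreover have "h ** g = Ident V T"
    by (rule coproduct_eqI [OF d, of _ T]) (use h g dd in \<open>simp_all\<close>)
  ultimately show ?thesis using that h g isoI by blast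
qed

lemma small_index:
  assumes "small U K"
  obtains J a b where "J \<subseteq> U" "small U J" "bij_betw a K J" "\<And>k. k \<in> K \<Longrightarrow> b (a k) = k"
    "bij_betw b J K" "\<And>i. i \<in> J \<Longrightarrow> a (b i) = i"
proof -
  obtain a where a: "inj_on a K" "a ` K \<subseteq> U" using small_embed assms by blast
  show ?thesis
  proof (rule that [of "a ` K" a "the_inv_into K a"])
    show "small U (a ` K)" using assms by (rule small_image)
    show "bij_betw a K (a ` K)" using a by (simp add: bij_betw_def)
    show "bij_betw (the_inv_into K a) (a ` K) K" using a by (intro bij_betw_the_inv_into) (simp add: bij_betw_def)
  qed (use a in \<open>auto simp: the_inv_into_f_f f_the_inv_into_f\<close>)
qed

lemma small_coproduct_exists:
  assumes K: "small U K" and X: "\<And>k. k \<in> K \<Longrightarrow> X k \<in> Obj V"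
  shows "\<exists>t. is_coproduct V K X t"
proof -
  obtain J a b where J: "J \<subseteq> U" "small U J" and ab: "bij_betw a K J" "\<And>k. k \<in> K \<Longrightarrow> b (a k) = k"
    "bij_betw b J K" using small_index K by metis
  have "(\<lambda>i. X (b i)) ` J \<subseteq> Obj V" using X ab by (auto simp: bij_betw_def)
  then have "\<exists>t. is_coproduct V J (\<lambda>i. X (b i)) t" using extensive J unfolding extensive_def by blast
  then obtain S j where c: "is_coproduct V J (\<lambda>i. X (b i)) (S, j)" by auto
  show ?thesis using coproduct_reindex [OF c ab(1,2)] by blast
qed

lemma coprd_simps [simp]:
  assumes "small U K" "\<And>k. k \<in> K \<Longrightarrow> X k \<in> Obj V"
  shows "coprd V K X \<in> Obj V" "\<And>k. k \<in> K \<Longrightarrow> coinj V K X k \<in> Arr V"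
    "\<And>k. k \<in> K \<Longrightarrow> Dom V (coinj V K X k) = X k" "\<And>k. k \<in> K \<Longrightarrow> Cod V (coinj V K X k) = coprd V K X"
  using coproductD [OF coprd_is_coproduct [OF small_coproduct_exists [of K X, OF assms]]] by blast+

text \<open>The summands of the fibres over a subset of \<open>U\<close>, read off from the equivalence of extensivity.\<close>

lemma decompose_in_U:
  assumes J: "J \<subseteq> U" "small U J" and k: "\<kappa> \<in> W ~> coprd V J (\<lambda>_. pt)"
  shows "\<exists>Z j. is_coproduct V J Z (W, j) \<and>
    (\<forall>i\<in>J. \<kappa> ** j i = coinj V J (\<lambda>_. pt) i ** bang V (Z i))"
proof -
  let ?T = "coprd V J (\<lambda>_. pt)" and ?i = "coinj V J (\<lambda>_. pt)"
  let ?F = "coprd_functor V J (\<lambda>_. pt)"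
  have "(\<lambda>_. pt) ` J \<subseteq> Obj V" by auto
  then have e: "is_equivalence (product_cat J (\<lambda>i. slice_cat V pt)) (slice_cat V ?T) ?F"
    using extensive J unfolding extensive_def by blast
  have "\<kappa> \<in> Obj (slice_cat V ?T)" using k by simp
  then obtain f t where f: "f \<in> Obj (product_cat J (\<lambda>i. slice_cat V pt))"
    and t: "t \<in> Hom (slice_cat V ?T) (fo ?F f) \<kappa>" "iso (slice_cat V ?T) t"
    by (rule equivalence_ess_surj [OF e])
  have fi: "f i \<in> Arr V" "Cod V (f i) = pt" if "i \<in> J" for i
    using f that by (auto simp: product_cat_def)
  define Z where "Z = (\<lambda>i. Dom V (f i))"
  have Z: "\<And>i. i \<in> J \<Longrightarrow> Z i \<in> Obj V" using fi by (simp add: Z_def)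
  have fb: "f i = bang V (Z i)" if "i \<in> J" for i using fi that by (simp add: Z_def bang_unique)
  have c: "is_coproduct V J Z (coprd V J Z, coinj V J Z)"
    using coprd_is_coproduct [OF small_coproduct_exists [OF J(2) Z]] .
  have "fo ?F f = coprd_over V J (\<lambda>_. pt) f" by (simp add: coprd_functor_def)
  also have "\<dots> = copair V J Z ?T (\<lambda>i. ?i i ** f i)" by (simp add: coprd_over_def Z_def)
  finally have Ff: "fo ?F f = copair V J Z ?T (\<lambda>i. ?i i ** f i)" .
  have cp: "copair V J Z ?T (\<lambda>i. ?i i ** f i) \<in> coprd V J Z ~> ?T"
    "\<And>i. i \<in> J \<Longrightarrow> copair V J Z ?T (\<lambda>i. ?i i ** f i) ** coinj V J Z i = ?i i ** f i"
  proof -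
    have "\<And>i. i \<in> J \<Longrightarrow> ?i i ** f i \<in> Z i ~> ?T" using J fi by (simp add: Z_def)
    moreover have "\<exists>t. is_coproduct V J Z t" using c by blast
    ultimately show "copair V J Z ?T (\<lambda>i. ?i i ** f i) \<in> coprd V J Z ~> ?T"
      "\<And>i. i \<in> J \<Longrightarrow> copair V J Z ?T (\<lambda>i. ?i i ** f i) ** coinj V J Z i = ?i i ** f i"
      using copair_props [of J Z "\<lambda>i. ?i i ** f i" ?T] J by simp_all
  qed
  obtain h where h: "t = (fo ?F f, h, \<kappa>)" "h \<in> Dom V (fo ?F f) ~> Dom V \<kappa>" "\<kappa> ** h = fo ?F f"
    using t(1) unfolding slice_Hom_iff by blast
  have hW: "h \<in> coprd V J Z ~> W" using h(2) cp(1) k Ff by simp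
  obtain s where s: "s \<in> Hom (slice_cat V ?T) \<kappa> (fo ?F f)"
    "Comp (slice_cat V ?T) s t = Ident (slice_cat V ?T) (fo ?F f)"
    "Comp (slice_cat V ?T) t s = Ident (slice_cat V ?T) \<kappa>"
    using cat.isoE [OF cat.intro [OF slice_category [OF category]] t(2,1)] by metis
  obtain g where g: "s = (\<kappa>, g, fo ?F f)" "g \<in> Dom V \<kappa> ~> Dom V (fo ?F f)"
    using s(1) unfolding slice_Hom_iff by blast
  have "iso V h"
    using s(2,3) g h(1) cp(1) k Ff by (intro isoI [OF hW, of g]) simp_all
  then have "is_coproduct V J Z (W, \<lambda>i. h ** coinj V J Z i)" using coproduct_along_iso [OF c] hW by blast
  moreover have "\<kappa> ** (h ** coinj V J Z i) = ?i i ** bang V (Z i)" if "i \<in> J" for i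
    using comp_ext [OF h(3), of "coinj V J Z i"] cp(2) [OF that] hW k J Z that Ff fb by simp
  ultimately show ?thesis by blast
qed

lemma init_ob_initial: "is_initial V (init_ob V)"
proof -
  have "\<exists>t. is_coproduct V {} (\<lambda>_::nat. pt) t"
    by (intro small_coproduct_exists small_finite [OF universe]) auto
  then obtain S j where "is_coproduct V {} (\<lambda>_::nat. pt) (S, j)" by auto
  then have "is_initial V S" by (simp add: is_coproduct_def is_initial_def)
  then show ?thesis unfolding init_ob_def by (rule someI)
qed

lemma init_ob_Obj [simp]: "init_ob V \<in> Obj V"
  using init_ob_initial by (simp add: is_initial_def)

lemma cobang_simps [simp]:
  assumes "X \<in> Obj V"
  shows "cobang V X \<in> Arr V" "Dom V (cobang V X) = init_ob V" "Cod V (cobang V X) = X"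
proof -
  have "\<exists>!f. f \<in> init_ob V ~> X" using init_ob_initial assms unfolding is_initial_def by blast
  from theI' [OF this]
  show "cobang V X \<in> Arr V" "Dom V (cobang V X) = init_ob V" "Cod V (cobang V X) = X"
    by (simp_all add: cobang_def)
qed

lemma init_eqI: "f \<in> init_ob V ~> X \<Longrightarrow> g \<in> init_ob V ~> X \<Longrightarrow> f = g"
proof -
  assume f: "f \<in> init_ob V ~> X" and g: "g \<in> init_ob V ~> X"
  then have "X \<in> Obj V" by auto
  then have "\<exists>!f. f \<in> init_ob V ~> X"
    using init_ob_initial by (simp add: is_initial_def del: Hom_iff)
  then show "f = g" using f g by (rule ex1_unique)
qed

text \<open>
  The initial object is strict: \<open>\<emptyset> \<times> W\<close> is initial by cartesian closedness, and an object \<open>W\<close>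
  with a map to \<open>\<emptyset>\<close> is a retract of it.
\<close>

lemma init_strict:
  assumes h: "h \<in> W ~> init_ob V" and f: "f \<in> W ~> X" and g: "g \<in> W ~> X"
  shows "f = g"
proof -
  let ?p = "pr2 V (init_ob V) W"
  have o: "W \<in> Obj V" "X \<in> Obj V" using f by auto
  have "curry_map V (init_ob V) W (f ** ?p) = curry_map V (init_ob V) W (g ** ?p)"
    by (rule init_eqI [of _ "expo V W X"]) (use f g o in simp_all)
  then have "f ** ?p = g ** ?p"
    using curry_props [of W "f ** ?p" "init_ob V"] curry_props [of W "g ** ?p" "init_ob V"] f g o by simp
  then have "(f ** ?p) ** pair V h (Ident V W) = (g ** ?p) ** pair V h (Ident V W)" by simp
  then show ?thesis using f g h o by simp
qed


text \<open>Outside the index set, the families produced by \<open>coprd_functor\<close> have unspecified values.\<close>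

lemma coproduct_cong: "(\<And>k. k \<in> K \<Longrightarrow> X k = Y k) \<Longrightarrow> is_coproduct V K X = is_coproduct V K Y"
  by (auto simp: is_coproduct_def fun_eq_iff)

lemma coprd_cong:
  assumes "\<And>k. k \<in> K \<Longrightarrow> X k = Y k"
  shows "coprd V K X = coprd V K Y" "coinj V K X = coinj V K Y"
  using coproduct_cong [of K X Y] assms by (simp_all add: coprd_def coinj_def)

lemma copair_cong:
  assumes "\<And>k. k \<in> K \<Longrightarrow> X k = Y k" "\<And>k. k \<in> K \<Longrightarrow> f k = g k"
  shows "copair V K X Z f = copair V K Y Z g"
proof -
  have "coprd V K X = coprd V K Y" "coinj V K X = coinj V K Y" using coprd_cong assms by blast+
  then show ?thesis unfolding copair_def using assms(2) by (auto intro!: arg_cong [of _ _ The])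
qed

text \<open>
  Fullness and faithfulness in extensivity, tested on the family that is \<open>W\<close> at one index and
  initial elsewhere: a map into a coproduct with constant index factors uniquely through the summand.
\<close>

lemma factor_in_U:
  assumes J: "J \<subseteq> U" "small U J" and Z: "\<And>k. k \<in> J \<Longrightarrow> Z k \<in> Obj V" and i: "i \<in> J"
    and k: "\<kappa> \<in> coprd V J Z ~> coprd V J (\<lambda>_. pt)"
      "\<And>k. k \<in> J \<Longrightarrow> \<kappa> ** coinj V J Z k = coinj V J (\<lambda>_. pt) k ** bang V (Z k)"
    and h: "h \<in> W ~> coprd V J Z" "\<kappa> ** h = coinj V J (\<lambda>_. pt) i ** bang V W"
  shows "\<exists>!w. w \<in> W ~> Z i \<and> coinj V J Z i ** w = h"
proof -
  let ?T = "coprd V J (\<lambda>_. pt)" and ?i = "coinj V J (\<lambda>_. pt)"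
  let ?F = "coprd_functor V J (\<lambda>_. pt)"
  let ?A = "product_cat J (\<lambda>i. slice_cat V pt)" and ?B = "slice_cat V ?T"
  have W: "W \<in> Obj V" using h by auto
  have "(\<lambda>_. pt) ` J \<subseteq> Obj V" by auto
  then have e: "is_equivalence ?A ?B ?F" using extensive J unfolding extensive_def by blast
  define Y where "Y = (\<lambda>k. if k = i then W else init_ob V)"
  have Y: "Y k \<in> Obj V" for k using W by (simp add: Y_def)
  note cZ = coprd_is_coproduct [OF small_coproduct_exists [of J Z, OF J(2) Z]]
  note cY = coprd_is_coproduct [OF small_coproduct_exists [of J Y, OF J(2) Y]]
  define c where "c = (\<lambda>X. copair V J X ?T (\<lambda>k. ?i k ** bang V (X k)))"
  have c: "c X \<in> coprd V J X ~> ?T" "\<And>k. k \<in> J \<Longrightarrow> c X ** coinj V J X k = ?i k ** bang V (X k)"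
    if X: "\<And>k. k \<in> J \<Longrightarrow> X k \<in> Obj V" for X
    using copair_props [OF small_coproduct_exists [of J X, OF J(2) X], of "\<lambda>k. ?i k ** bang V (X k)" ?T] X J
    unfolding c_def by simp_all
  have ck: "c Z = \<kappa>"
    by (rule coproduct_eqI [OF cZ c(1) k(1)]) (use Z c(2) k(2) in simp_all)
  define f where "f = (\<lambda>X. \<lambda>k\<in>J. bang V (X k))"
  have fO: "f X \<in> Obj ?A" if "\<And>k. k \<in> J \<Longrightarrow> X k \<in> Obj V" for X
    using that by (simp add: f_def product_cat_def)
  have Ff: "fo ?F (f X) = c X" if "\<And>k. k \<in> J \<Longrightarrow> X k \<in> Obj V" for X
    unfolding coprd_functor_def coprd_over_def c_def cfun.simps
    by (rule copair_cong) (use that in \<open>simp_all add: f_def\<close>)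
  define M where "M = (\<lambda>m. copair V J Y (coprd V J Z) (\<lambda>k. coinj V J Z k ** m k))"
  have M: "M m \<in> coprd V J Y ~> coprd V J Z"
    "\<And>k. k \<in> J \<Longrightarrow> M m ** coinj V J Y k = coinj V J Z k ** m k"
    if m: "\<And>k. k \<in> J \<Longrightarrow> m k \<in> Y k ~> Z k" for m
  proof -
    have "\<And>k. k \<in> J \<Longrightarrow> coinj V J Z k ** m k \<in> Y k ~> coprd V J Z" using m Z J by simp
    note copair_props [OF small_coproduct_exists [of J Y, OF J(2) Y] this]
    then show "M m \<in> coprd V J Y ~> coprd V J Z"
      "\<And>k. k \<in> J \<Longrightarrow> M m ** coinj V J Y k = coinj V J Z k ** m k"
      unfolding M_def using Z J by simp_all
  qed
  have Fa: "fa ?F \<phi> = (c Y, M (\<lambda>k. fst (snd (\<phi> k))), c Z)"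
    if ph: "\<And>k. k \<in> J \<Longrightarrow> \<exists>m. \<phi> k = (bang V (Y k), m, bang V (Z k))" for \<phi>
  proof -
    have 1: "fst (\<phi> k) = bang V (Y k)" "snd (snd (\<phi> k)) = bang V (Z k)" if "k \<in> J" for k
      using ph [OF that] by auto
    have 2: "Dom V (fst (\<phi> k)) = Y k" "Dom V (snd (snd (\<phi> k))) = Z k" if "k \<in> J" for k
      using 1 [OF that] Y Z that by simp_all
    have 3: "coprd V J (\<lambda>i. Dom V (snd (snd (\<phi> i)))) = coprd V J Z"
      "coinj V J (\<lambda>i. Dom V (snd (snd (\<phi> i)))) = coinj V J Z"
      by (rule coprd_cong, simp add: 2)+
    have "copair V J (\<lambda>i. Dom V (fst (\<phi> i))) (coprd V J Z) (\<lambda>i. coinj V J Z i ** fst (snd (\<phi> i))) =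
        M (\<lambda>k. fst (snd (\<phi> k)))"
      unfolding M_def by (rule copair_cong) (simp_all add: 2)
    moreover have "coprd_over V J (\<lambda>_. pt) (\<lambda>i. fst (\<phi> i)) = c Y"
      unfolding coprd_over_def c_def by (rule copair_cong) (simp_all add: 1 Y)
    moreover have "coprd_over V J (\<lambda>_. pt) (\<lambda>i. snd (snd (\<phi> i))) = c Z"
      unfolding coprd_over_def c_def by (rule copair_cong) (simp_all add: 1 Z)
    ultimately show ?thesis by (simp add: coprd_functor_def Let_def 3)
  qed
  define hh where "hh = copair V J Y (coprd V J Z) (\<lambda>k. if k = i then h else cobang V (coprd V J Z))"
  have hh: "hh \<in> coprd V J Y ~> coprd V J Z"
    "\<And>k. k \<in> J \<Longrightarrow> hh ** coinj V J Y k = (if k = i then h else cobang V (coprd V J Z))"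
    using copair_props [OF small_coproduct_exists [of J Y, OF J(2) Y],
        of "\<lambda>k. if k = i then h else cobang V (coprd V J Z)" "coprd V J Z"] h Z J
    unfolding hh_def by (simp_all add: Y_def)
  have hT: "c Z ** hh = c Y"
  proof (rule coproduct_eqI [OF cY])
    fix l assume l: "l \<in> J"
    show "(c Z ** hh) ** coinj V J Y l = c Y ** coinj V J Y l"
    proof (cases "l = i")
      case True then show ?thesis using hh c [of Y] c [of Z] Y Z h l ck J by (simp add: Y_def)
    next
      case False
      then have "Y l = init_ob V" by (simp add: Y_def)
      then show ?thesis using hh(1) c [of Y] c [of Z] Y Z l J
        by (intro init_eqI [of _ ?T]) simp_all
    qed
  qed (use hh c Y Z in simp_all)
  have "(c Y, hh, c Z) \<in> Hom ?B (fo ?F (f Y)) (fo ?F (f Z))"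
    unfolding slice_Hom_iff using hT hh(1) c [of Y] c [of Z] Y Z Ff [of Y] Ff [of Z] by simp
  then have ex1: "\<exists>!\<phi>. \<phi> \<in> Hom ?A (f Y) (f Z) \<and> fa ?F \<phi> = (c Y, hh, c Z)"
    using equivalence_full_faithful [OF product_category [OF slice_category [OF category]]
        slice_category [OF category] e, of "f Y" "f Z"] fO Y Z by blast
  have phD: "\<exists>m. \<phi> k = (bang V (Y k), m, bang V (Z k)) \<and> m \<in> Y k ~> Z k"
    if "\<phi> \<in> Hom ?A (f Y) (f Z)" "k \<in> J" for \<phi> k
  proof -
    have "\<phi> k \<in> Arr (slice_cat V pt)" "Dom (slice_cat V pt) (\<phi> k) = f Y k"
      "Cod (slice_cat V pt) (\<phi> k) = f Z k"
      using that by (auto simp: product_cat_def dest!: fun_cong [of _ _ k])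
    then have "\<phi> k \<in> Hom (slice_cat V pt) (f Y k) (f Z k)" by simp
    then show ?thesis unfolding slice_Hom_iff using Y Z that(2) by (auto simp: f_def)
  qed
  have phI: "(\<lambda>k\<in>J. (bang V (Y k), m k, bang V (Z k))) \<in> Hom ?A (f Y) (f Z)"
    if m: "\<And>k. k \<in> J \<Longrightarrow> m k \<in> Y k ~> Z k" for m
    using m Y Z by (auto simp: product_cat_def f_def slice_cat_def intro!: restrict_ext)
  obtain \<phi> where ph: "\<phi> \<in> Hom ?A (f Y) (f Z)" "fa ?F \<phi> = (c Y, hh, c Z)" using ex1 by blast
  define m where "m = (\<lambda>k. fst (snd (\<phi> k)))"
  have m: "m k \<in> Y k ~> Z k" if "k \<in> J" for k using phD [OF ph(1) that] by (auto simp: m_def)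
  have "fa ?F \<phi> = (c Y, M m, c Z)" unfolding m_def by (rule Fa) (use phD [OF ph(1)] in blast)
  then have "M m = hh" using ph(2) by simp
  then have ex: "m i \<in> W ~> Z i \<and> coinj V J Z i ** m i = h"
    using M(2) [of m, OF m i] hh(2) [OF i] m [OF i] by (simp add: Y_def)
  moreover have "v = w" if v: "v \<in> W ~> Z i" "coinj V J Z i ** v = h"
    and w: "w \<in> W ~> Z i" "coinj V J Z i ** w = h" for v w
  proof -
    define N where "N = (\<lambda>v k. if k = i then v else cobang V (Z k))"
    have N: "N u k \<in> Y k ~> Z k" if "k \<in> J" "u \<in> W ~> Z i" for k u
      using that Z by (simp add: N_def Y_def)
    have MN: "M (N u) = hh" if u: "u \<in> W ~> Z i" "coinj V J Z i ** u = h" for u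
    proof (rule coproduct_eqI [OF cY])
      fix l assume l: "l \<in> J"
      show "M (N u) ** coinj V J Y l = hh ** coinj V J Y l"
      proof (cases "l = i")
        case True then show ?thesis using M(2) [of "N u", OF N l] hh(2) [OF l] u by (simp add: N_def)
      next
        case False
        then have "Y l = init_ob V" by (simp add: Y_def)
        then show ?thesis using hh(1) M(1) [of "N u", OF N] u Y l J
          by (intro init_eqI [of _ "coprd V J Z"]) simp_all
      qed
    qed (use hh M(1) [of "N u", OF N] u in simp_all)
    define P where "P = (\<lambda>u. \<lambda>k\<in>J. (bang V (Y k), N u k, bang V (Z k)))"
    have "P u \<in> Hom ?A (f Y) (f Z) \<and> fa ?F (P u) = (c Y, hh, c Z)"
      if u: "u \<in> W ~> Z i" "coinj V J Z i ** u = h" for u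
    proof -
      have "fa ?F (P u) = (c Y, M (\<lambda>k. fst (snd (P u k))), c Z)" by (rule Fa) (simp add: P_def)
      moreover have "M (\<lambda>k. fst (snd (P u k))) = M (N u)"
        unfolding M_def by (rule copair_cong) (simp_all add: P_def)
      ultimately show ?thesis using MN [OF u] phI [of "N u", OF N] u(1) by (simp add: P_def del: Hom_iff)
    qed
    then have "P v = P w" using ex1_unique [OF ex1] v w by blast
    then have "P v i = P w i" by simp
    then show ?thesis using i by (simp add: P_def N_def)
  qed
  ultimately show ?thesis by blast
qed

lemma coproduct_to_U:
  assumes "small U K" and c: "is_coproduct V K X (S, j)" and J: "J \<subseteq> U" "small U J"
    and ab: "bij_betw b J K" "\<And>k. k \<in> K \<Longrightarrow> b (a k) = k" "\<And>i. i \<in> J \<Longrightarrow> a (b i) = i"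
  obtains e d where "e \<in> coprd V J (\<lambda>i. X (b i)) ~> S" "d \<in> S ~> coprd V J (\<lambda>i. X (b i))"
    "d ** e = Ident V (coprd V J (\<lambda>i. X (b i)))" "e ** d = Ident V S"
    "\<And>i. i \<in> J \<Longrightarrow> e ** coinj V J (\<lambda>i. X (b i)) i = j (b i)"
proof -
  have bK: "b i \<in> K" if "i \<in> J" for i using ab that by (auto simp: bij_betw_def)
  have "is_coproduct V K (\<lambda>k. X (b (a k))) (S, j)"
    using c coproduct_cong [of K "\<lambda>k. X (b (a k))" X] ab(2) by simp
  then have c': "is_coproduct V J (\<lambda>i. X (b i)) (S, \<lambda>i. j (b i))"
    using coproduct_reindex [of K "\<lambda>i. X (b i)" a S j b J] ab by blast
  note cd = coproductD [OF c']
  have "is_coproduct V J (\<lambda>i. X (b i)) (coprd V J (\<lambda>i. X (b i)), coinj V J (\<lambda>i. X (b i)))"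
    using coprd_is_coproduct c' by blast
  from coproduct_unique [OF this c'] obtain e where e: "e \<in> coprd V J (\<lambda>i. X (b i)) ~> S" "iso V e"
    "\<And>i. i \<in> J \<Longrightarrow> e ** coinj V J (\<lambda>i. X (b i)) i = j (b i)" by blast
  then show ?thesis using that isoE [OF e(2,1)] by metis
qed

text \<open>Every map to a copower of the terminal object splits its domain into fibres.\<close>

lemma decompose:
  assumes K: "small U K" and T: "is_coproduct V K (\<lambda>_. pt) (T, \<tau>)" and k: "\<kappa> \<in> W ~> T"
  obtains Z j where "is_coproduct V K Z (W, j)" "\<And>i. i \<in> K \<Longrightarrow> \<kappa> ** j i = \<tau> i ** bang V (Z i)"
proof -
  obtain J a b where J: "J \<subseteq> U" "small U J" and ab: "bij_betw a K J" "\<And>k. k \<in> K \<Longrightarrow> b (a k) = k"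
    "bij_betw b J K" "\<And>i. i \<in> J \<Longrightarrow> a (b i) = i" using small_index K by metis
  have aK: "a i \<in> J" if "i \<in> K" for i using ab that by (auto simp: bij_betw_def)
  let ?T = "coprd V J (\<lambda>_. pt)" and ?i = "coinj V J (\<lambda>_. pt)"
  obtain e d where e: "e \<in> ?T ~> T" "d \<in> T ~> ?T" "d ** e = Ident V ?T" "e ** d = Ident V T"
    "\<And>i. i \<in> J \<Longrightarrow> e ** ?i i = \<tau> (b i)"
    using coproduct_to_U [OF K T J ab(3,2,4)] by metis
  obtain Z j where Z: "is_coproduct V J Z (W, j)" "\<And>i. i \<in> J \<Longrightarrow> (d ** \<kappa>) ** j i = ?i i ** bang V (Z i)"
    using decompose_in_U [OF J, of "d ** \<kappa>" W] e(2) k by auto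
  note cd = coproductD [OF Z(1)]
  have "is_coproduct V J (\<lambda>i. Z (a (b i))) (W, j)"
    using Z coproduct_cong [of J "\<lambda>i. Z (a (b i))" Z] ab(4) by simp
  then have "is_coproduct V K (\<lambda>k. Z (a k)) (W, \<lambda>k. j (a k))"
    using coproduct_reindex [of J "\<lambda>k. Z (a k)" b W j a K] ab by blast
  moreover have "\<kappa> ** j (a i) = \<tau> i ** bang V (Z (a i))" if i: "i \<in> K" for i
  proof -
    have o: "Z (a i) \<in> Obj V" using cd aK [OF i] by (metis Dom_Obj)
    have "e ** (d ** (\<kappa> ** j (a i))) = e ** (?i (a i) ** bang V (Z (a i)))"
      using Z(2) [OF aK [OF i]] cd aK [OF i] e k by simp
    moreover have "e ** (d ** (\<kappa> ** j (a i))) = \<kappa> ** j (a i)"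
      using comp_ext [OF e(4), of "\<kappa> ** j (a i)"] cd aK [OF i] e(1,2) k by simp
    moreover have "e ** (?i (a i) ** bang V (Z (a i))) = \<tau> i ** bang V (Z (a i))"
      using comp_ext [OF e(5) [OF aK [OF i]], of "bang V (Z (a i))"] ab(2) [OF i] aK [OF i] e(1) o J by simp
    ultimately show ?thesis by simp
  qed
  ultimately show ?thesis using that by blast
qed

text \<open>Extends the factorisation through a summand to all small index sets and all coproduct cocones.\<close>

lemma factor_through_summand:
  assumes K: "small U K" and c: "is_coproduct V K Z (S, \<zeta>)" and T: "is_coproduct V K (\<lambda>_. pt) (T, \<tau>)"
    and k: "\<kappa> \<in> S ~> T" "\<And>k. k \<in> K \<Longrightarrow> \<kappa> ** \<zeta> k = \<tau> k ** bang V (Z k)"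
    and h: "i \<in> K" "h \<in> W ~> S" "\<kappa> ** h = \<tau> i ** bang V W"
  shows "\<exists>!w. w \<in> W ~> Z i \<and> \<zeta> i ** w = h"
proof -
  obtain J a b where J: "J \<subseteq> U" "small U J" and ab: "bij_betw a K J" "\<And>k. k \<in> K \<Longrightarrow> b (a k) = k"
    "bij_betw b J K" "\<And>i. i \<in> J \<Longrightarrow> a (b i) = i" using small_index K by metis
  have aK: "a i \<in> J" if "i \<in> K" for i using ab that by (auto simp: bij_betw_def)
  have bK: "b i \<in> K" if "i \<in> J" for i using ab that by (auto simp: bij_betw_def)
  have W: "W \<in> Obj V" using h(2) by auto
  note cd = coproductD [OF c] and td = coproductD [OF T]
  have Zo: "Z k \<in> Obj V" if "k \<in> K" for k using cd that by (metis Dom_Obj)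
  let ?T = "coprd V J (\<lambda>_. pt)" and ?i = "coinj V J (\<lambda>_. pt)"
  let ?S = "coprd V J (\<lambda>i. Z (b i))" and ?j = "coinj V J (\<lambda>i. Z (b i))"
  obtain e d where e: "e \<in> ?T ~> T" "d \<in> T ~> ?T" "d ** e = Ident V ?T" "e ** d = Ident V T"
    "\<And>i. i \<in> J \<Longrightarrow> e ** ?i i = \<tau> (b i)"
    using coproduct_to_U [OF K T J ab(3,2,4)] by metis
  obtain e' d' where e': "e' \<in> ?S ~> S" "d' \<in> S ~> ?S" "d' ** e' = Ident V ?S" "e' ** d' = Ident V S"
    "\<And>i. i \<in> J \<Longrightarrow> e' ** ?j i = \<zeta> (b i)"
    using coproduct_to_U [OF K c J ab(3,2,4)] by metis
  have jd: "?j x \<in> Z (b x) ~> ?S" "?i x \<in> pt ~> ?T" if "x \<in> J" for x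
    using coprd_simps [OF J(2), of "\<lambda>i. Z (b i)"] that J Zo bK by simp_all
  have dt: "d ** \<tau> (b x) = ?i x" if "x \<in> J" for x
    using comp_ext [OF e(3), of "?i x"] e(5) [OF that] e(1,2) jd(2) [OF that] by simp
  have "\<exists>!w. w \<in> W ~> Z (b (a i)) \<and> ?j (a i) ** w = d' ** h"
  proof (rule factor_in_U [OF J, of "\<lambda>i. Z (b i)" "a i" "d ** (\<kappa> ** e')" "d' ** h" W])
    fix x assume x: "x \<in> J"
    show "Z (b x) \<in> Obj V" using Zo bK x by simp
    have "(d ** (\<kappa> ** e')) ** ?j x = d ** (\<tau> (b x) ** bang V (Z (b x)))"
      using e'(5) [OF x] k(2) [OF bK [OF x]] k(1) e(2) e'(1) jd [OF x] by simp
    also have "\<dots> = ?i x ** bang V (Z (b x))"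
      using comp_ext [OF dt [OF x], of "bang V (Z (b x))"] e(2) td bK [OF x] Zo by simp
    finally show "(d ** (\<kappa> ** e')) ** ?j x = ?i x ** bang V (Z (b x))" .
  next
    have "(d ** (\<kappa> ** e')) ** (d' ** h) = d ** (\<tau> i ** bang V W)"
      using comp_ext [OF e'(4), of h] h k(1) e(2) e'(1,2) by simp
    also have "\<dots> = ?i (a i) ** bang V W"
      using comp_ext [OF dt [OF aK [OF h(1)]], of "bang V W"] ab(2) [OF h(1)] e(2) td h(1) W by simp
    finally show "(d ** (\<kappa> ** e')) ** (d' ** h) = ?i (a i) ** bang V W" .
  qed (use aK h e e' k in simp_all)
  moreover have "?j (a i) ** w = d' ** h \<longleftrightarrow> \<zeta> i ** w = h" if w: "w \<in> W ~> Z i" for w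
  proof -
    have ji: "e' ** ?j (a i) = \<zeta> i" using e'(5) [OF aK [OF h(1)]] ab(2) [OF h(1)] by simp
    have jw: "?j (a i) \<in> Z i ~> ?S" using jd(1) [OF aK [OF h(1)]] ab(2) [OF h(1)] by simp
    have 1: "e' ** (?j (a i) ** w) = \<zeta> i ** w" using comp_ext [OF ji, of w] jw e'(1) w by simp
    have 2: "e' ** (d' ** h) = h" using comp_ext [OF e'(4), of h] h e'(1,2) by simp
    have 3: "d' ** (e' ** (?j (a i) ** w)) = ?j (a i) ** w"
      using comp_ext [OF e'(3), of "?j (a i) ** w"] jw e'(1,2) w by simp
    show ?thesis using 1 2 3 by metis
  qed
  ultimately show ?thesis using ab(2) [OF h(1)] by metis
qed

end


context ccc
begin

lemma pr_term [simp]: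
  assumes "X \<in> Obj V"
  shows "pr1 V pt X = bang V (prd V pt X)"
    "pr2 V X pt = bang V (prd V X pt)"
  using assms by (simp_all add: bang_unique)

end

context ext_ccc
begin

subsection \<open>Coproducts in an extensive category\<close>

lemma copower_exists:
  assumes "small U K"
  obtains T \<tau> where "is_coproduct V K (\<lambda>_. pt) (T, \<tau>)"
proof -
  have "\<exists>t. is_coproduct V K (\<lambda>_. pt) t" using assms by (intro small_coproduct_exists) auto
  then show ?thesis using that by auto
qed

text \<open>Equations may be checked where a map to a copower of the terminal object is constant.\<close>

lemma eq_by_cover:
  assumes K: "small U K" and T: "is_coproduct V K (\<lambda>_. pt) (T, \<tau>)" and k: "\<kappa> \<in> W ~> T"
    and xy: "x \<in> W ~> Y" "y \<in> W ~> Y"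
    and e: "\<And>i Z j. i \<in> K \<Longrightarrow> j \<in> Z ~> W \<Longrightarrow> \<kappa> ** j = \<tau> i ** bang V Z \<Longrightarrow> x ** j = y ** j"
  shows "x = y"
proof -
  obtain Z j where c: "is_coproduct V K Z (W, j)" and j: "\<And>i. i \<in> K \<Longrightarrow> \<kappa> ** j i = \<tau> i ** bang V (Z i)"
    using decompose [OF K T k] by metis
  note cd = coproductD [OF c]
  show ?thesis
  proof (rule coproduct_eqI [OF c xy])
    fix i assume i: "i \<in> K"
    show "x ** j i = y ** j i" by (rule e [OF i _ j [OF i]]) (use cd i in simp)
  qed
qed

text \<open>
  A family of maps into \<open>P\<close> is a coproduct cocone if it represents the generalised elements of \<open>P\<close>
  of constant index.
\<close>

lemma coproduct_by_elements:
  assumes K: "small U K" and T: "is_coproduct V K (\<lambda>_. pt) (T, \<tau>)" and k: "\<kappa> \<in> P ~> T"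
    and q: "\<And>i. i \<in> K \<Longrightarrow> q i \<in> Q i ~> P" "\<And>i. i \<in> K \<Longrightarrow> \<kappa> ** q i = \<tau> i ** bang V (Q i)"
    and u: "\<And>i W h. i \<in> K \<Longrightarrow> h \<in> W ~> P \<Longrightarrow> \<kappa> ** h = \<tau> i ** bang V W \<Longrightarrow>
      \<exists>!w. w \<in> W ~> Q i \<and> q i ** w = h"
  shows "is_coproduct V K Q (P, q)"
proof -
  obtain Z j where c: "is_coproduct V K Z (P, j)" and j: "\<And>i. i \<in> K \<Longrightarrow> \<kappa> ** j i = \<tau> i ** bang V (Z i)"
    using decompose [OF K T k] by metis
  note cd = coproductD [OF c] and td = coproductD [OF T]
  have "\<exists>v. v \<in> Q i ~> Z i \<and> iso V v \<and> j i ** v = q i" if i: "i \<in> K" for i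
  proof -
    have jq: "j i \<in> Z i ~> P" "q i \<in> Q i ~> P" using cd i q by simp_all
    then have o: "Z i \<in> Obj V" "Q i \<in> Obj V" using Hom_Obj1 by blast+
    obtain a where a: "a \<in> Z i ~> Q i" "q i ** a = j i"
      using u [OF i jq(1) j [OF i]] by blast
    have f: "\<exists>!w. w \<in> W ~> Z i \<and> j i ** w = h"
      if "h \<in> W ~> P" "\<kappa> ** h = \<tau> i ** bang V W" for h W
      by (rule factor_through_summand [OF K c T k _ i that]) (rule j)
    obtain v where v: "v \<in> Q i ~> Z i" "j i ** v = q i"
      using f [OF jq(2) q(2) [OF i]] by blast
    have "v ** a = Ident V (Z i)"
    proof (rule ex1_unique [OF f [OF jq(1) j [OF i]]])
      show "v ** a \<in> Z i ~> Z i \<and> j i ** (v ** a) = j i"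
        using comp_ext [OF v(2), of a] a v jq by simp
      show "Ident V (Z i) \<in> Z i ~> Z i \<and> j i ** Ident V (Z i) = j i" using jq o by simp
    qed
    moreover have "a ** v = Ident V (Q i)"
    proof (rule ex1_unique [OF u [OF i jq(2) q(2) [OF i]]])
      show "a ** v \<in> Q i ~> Q i \<and> q i ** (a ** v) = q i"
        using comp_ext [OF a(2), of v] a v jq by simp
      show "Ident V (Q i) \<in> Q i ~> Q i \<and> q i ** Ident V (Q i) = q i" using jq o by simp
    qed
    ultimately show ?thesis using isoI [OF v(1) a(1)] v by blast
  qed
  then obtain v where v: "\<And>i. i \<in> K \<Longrightarrow> v i \<in> Q i ~> Z i" "\<And>i. i \<in> K \<Longrightarrow> iso V (v i)"
    "\<And>i. i \<in> K \<Longrightarrow> j i ** v i = q i" by metis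
  have "is_coproduct V K Q (P, \<lambda>i. j i ** v i)" by (rule coproduct_iso_pieces [OF c v(2,1)])
  moreover have "is_coproduct V K Q (P, \<lambda>i. j i ** v i) = is_coproduct V K Q (P, q)"
    using v(3) by (simp add: is_coproduct_def)
  ultimately show ?thesis by simp
qed

lemma coproduct_index:
  assumes K: "small U K" and c: "is_coproduct V K Z (S, \<zeta>)" and T: "is_coproduct V K (\<lambda>_. pt) (T, \<tau>)"
  obtains \<kappa> where "\<kappa> \<in> S ~> T" "\<And>k. k \<in> K \<Longrightarrow> \<kappa> ** \<zeta> k = \<tau> k ** bang V (Z k)"
proof -
  note cd = coproductD [OF c] and td = coproductD [OF T]
  have Zo: "Z k \<in> Obj V" if "k \<in> K" for k using cd that by (metis Dom_Obj)
  have "\<And>k. k \<in> K \<Longrightarrow> \<tau> k ** bang V (Z k) \<in> Z k ~> T" using td Zo by simp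
  then show ?thesis using coproduct_obtain [OF c, of "\<lambda>k. \<tau> k ** bang V (Z k)" T] td(1) that by metis
qed

lemma summand_mono:
  assumes K: "small U K" and c: "is_coproduct V K Z (S, \<zeta>)" and i: "i \<in> K"
    and w: "v \<in> W ~> Z i" "w \<in> W ~> Z i" "\<zeta> i ** v = \<zeta> i ** w"
  shows "v = w"
proof -
  obtain T \<tau> where T: "is_coproduct V K (\<lambda>_. pt) (T, \<tau>)" using copower_exists K by blast
  obtain \<kappa> where k: "\<kappa> \<in> S ~> T" "\<And>k. k \<in> K \<Longrightarrow> \<kappa> ** \<zeta> k = \<tau> k ** bang V (Z k)"
    using coproduct_index [OF K c T] by metis
  note cd = coproductD [OF c] and td = coproductD [OF T]
  have Zo: "Z i \<in> Obj V" using w(1) Hom_Obj2 by blast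
  have "\<kappa> ** (\<zeta> i ** w) = \<tau> i ** bang V W"
    using comp_ext [OF k(2) [OF i], of w] k(1) cd td i w Zo by simp
  then have "\<exists>!u. u \<in> W ~> Z i \<and> \<zeta> i ** u = \<zeta> i ** w"
    by (rule factor_through_summand [OF K c T k i, rotated 2]) (use cd i w in simp_all)
  then show ?thesis by (rule ex1_unique) (use w in simp_all)
qed

lemma coproduct_of_coproducts:
  assumes c: "is_coproduct V K X (S, j)" and d: "\<And>k. k \<in> K \<Longrightarrow> is_coproduct V L (Y k) (X k, jj k)"
  shows "is_coproduct V (K \<times> L) (\<lambda>(k, l). Y k l) (S, \<lambda>(k, l). j k ** jj k l)"
proof -
  note cd = coproductD [OF c]
  have dd: "jj k l \<in> Arr V" "Dom V (jj k l) = Y k l" "Cod V (jj k l) = X k" if "k \<in> K" "l \<in> L" for k l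
    using coproductD [OF d] that by blast+
  show ?thesis
  proof (rule coproductI)
    fix Z f assume Z: "Z \<in> Obj V" and f: "\<And>i. i \<in> K \<times> L \<Longrightarrow> f i \<in> (case i of (k, l) \<Rightarrow> Y k l) ~> Z"
    have "\<exists>h. h \<in> X k ~> Z \<and> (\<forall>l\<in>L. h ** jj k l = f (k, l))" if k: "k \<in> K" for k
    proof (rule coproduct_obtain [OF d [OF k], of "\<lambda>l. f (k, l)" Z])
      show "f (k, l) \<in> Y k l ~> Z" if "l \<in> L" for l using f [of "(k, l)"] k that by simp
    qed (use Z in blast)+
    then obtain h where h: "\<And>k. k \<in> K \<Longrightarrow> h k \<in> X k ~> Z"
      "\<And>k l. k \<in> K \<Longrightarrow> l \<in> L \<Longrightarrow> h k ** jj k l = f (k, l)" by metis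
    obtain m where m: "m \<in> S ~> Z" "\<And>k. k \<in> K \<Longrightarrow> m ** j k = h k"
      using coproduct_obtain [OF c, of h Z] h Z by metis
    have "m ** (j k ** jj k l) = f (k, l)" if "k \<in> K" "l \<in> L" for k l
      using comp_ext [OF m(2), of k "jj k l"] h(2) m(1) cd dd that by simp
    then show "\<exists>h\<in>S ~> Z. \<forall>i\<in>K \<times> L. h ** (case i of (k, l) \<Rightarrow> j k ** jj k l) = f i"
      using m(1) by (intro bexI [of _ m]) auto
  next
    fix Z f g assume Z: "Z \<in> Obj V" and fg: "f \<in> S ~> Z" "g \<in> S ~> Z"
      "\<And>i. i \<in> K \<times> L \<Longrightarrow> f ** (case i of (k, l) \<Rightarrow> j k ** jj k l) = g ** (case i of (k, l) \<Rightarrow> j k ** jj k l)"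
    show "f = g"
    proof (rule coproduct_eqI [OF c fg(1,2)])
      fix k assume k: "k \<in> K"
      show "f ** j k = g ** j k"
      proof (rule coproduct_eqI [OF d [OF k]])
        fix l assume l: "l \<in> L"
        show "(f ** j k) ** jj k l = (g ** j k) ** jj k l"
          using fg(1,2) fg(3) [of "(k, l)"] k l cd dd by simp
      qed (use fg(1,2) cd k in simp_all)
    qed
  qed (use cd dd in auto)
qed

lemma copower_product:
  assumes T: "is_coproduct V K (\<lambda>_. pt) (T, \<tau>)" and R: "is_coproduct V L (\<lambda>_. pt) (R, \<rho>)"
  shows "is_coproduct V (K \<times> L) (\<lambda>_. pt) (prd V T R, \<lambda>(k, l). pair V (\<tau> k) (\<rho> l))"
proof -
  note td = coproductD [OF T] and rd = coproductD [OF R]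
  let ?h = "pair V (bang V R) (Ident V R)"
  have h: "?h \<in> R ~> prd V pt R" using rd(1) by simp
  have "iso V ?h"
    by (rule isoI [OF h, of "pr2 V pt R"], use rd(1) in simp_all)
      (rule prod_eqI [of _ "prd V pt R" "pt" R], use rd(1) in \<open>simp_all add: bang_unique [symmetric]\<close>)
  then have "is_coproduct V L (\<lambda>_. pt) (prd V pt R, \<lambda>l. ?h ** \<rho> l)"
    using coproduct_along_iso [OF R] h by blast
  then have "is_coproduct V (K \<times> L) (\<lambda>(k, l). pt) (prd V T R,
      \<lambda>(k, l). pair V (\<tau> k ** pr1 V pt R) (pr2 V pt R) ** (?h ** \<rho> l))"
    using coproduct_of_coproducts [OF coproduct_times [OF T rd(1)]] by simp
  moreover have "pair V (\<tau> k ** pr1 V pt R) (pr2 V pt R) ** (?h ** \<rho> l) = pair V (\<tau> k) (\<rho> l)"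
    if "k \<in> K" "l \<in> L" for k l using td rd that by simp
  ultimately show ?thesis by (auto simp: is_coproduct_def)
qed

subsection \<open>Limits in an extensive cartesian closed category\<close>

text \<open>
  The product of a small family is the object of sections of \<open>\<Squnion>\<^sub>k X\<^sub>k \<rightarrow> \<Squnion>\<^sub>k *\<close>, cut out of an
  exponential by a pullback.
\<close>

lemma small_product_exists:
  assumes K: "small U K" and X: "\<And>k. k \<in> K \<Longrightarrow> X k \<in> Obj V"
  obtains P \<pi> where "P \<in> Obj V" "\<And>k. k \<in> K \<Longrightarrow> \<pi> k \<in> P ~> X k"
    "\<And>W w. W \<in> Obj V \<Longrightarrow> (\<And>k. k \<in> K \<Longrightarrow> w k \<in> W ~> X k) \<Longrightarrow>
      \<exists>!h. h \<in> W ~> P \<and> (\<forall>k\<in>K. \<pi> k ** h = w k)"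
proof -
  obtain S \<zeta> where c: "is_coproduct V K X (S, \<zeta>)" using small_coproduct_exists [of K X, OF K X] by auto
  obtain T \<tau> where T: "is_coproduct V K (\<lambda>_. pt) (T, \<tau>)" using copower_exists K by blast
  obtain \<sigma> where s: "\<sigma> \<in> S ~> T" "\<And>k. k \<in> K \<Longrightarrow> \<sigma> ** \<zeta> k = \<tau> k ** bang V (X k)"
    using coproduct_index [OF K c T] by metis
  note cd = coproductD [OF c] and td = coproductD [OF T]
  let ?ev = "eval_map V T S" and ?E = "expo V T S" and ?F = "expo V T T"
  \<comment> \<open>\<open>\<sigma>'\<close> composes with \<open>\<sigma>\<close>, and \<open>n\<close> names the identity of \<open>T\<close>\<close>
  define \<sigma>' where "\<sigma>' = curry_map V ?E T (\<sigma> ** ?ev)"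
  define n where "n = curry_map V pt T (pr2 V pt T)"
  have sn: "\<sigma>' \<in> ?E ~> ?F" "n \<in> pt ~> ?F"
    using s(1) cd(1) td(1) by (simp_all add: \<sigma>'_def n_def)
  have evs: "eval_map V T T ** pair V (\<sigma>' ** e) t = \<sigma> ** (?ev ** pair V e t)"
    if "e \<in> W ~> ?E" "t \<in> W ~> T" for e t W
    using that s(1) cd(1) td(1) by (simp add: \<sigma>'_def)
  have evn: "eval_map V T T ** pair V (n ** e) t = t" if "e \<in> W ~> pt" "t \<in> W ~> T" for e t W
    using that td(1) by (simp add: n_def)
  \<comment> \<open>a map \<open>W \<rightarrow> ?P\<close> is a map \<open>W \<rightarrow> S\<^sup>T\<close> whose transpose \<open>T \<times> W \<rightarrow> S\<close> is a section of \<open>\<sigma>\<close> at each element of \<open>W\<close>\<close>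
  let ?P = "pb V \<sigma>' n" and ?a = "pb1 V \<sigma>' n"
  have P: "?P \<in> Obj V" "?a \<in> ?P ~> ?E" using sn by simp_all
  have sec: "\<sigma> ** (?ev ** pair V (?a ** h) t) = t" if "h \<in> W ~> ?P" "t \<in> W ~> T" for h t W
  proof -
    have "\<sigma>' ** (?a ** h) = n ** (pb2 V \<sigma>' n ** h)" using pb_comm_comp [of \<sigma>' n h] sn that by simp
    then show ?thesis using evs [of "?a ** h" W t] evn [of "pb2 V \<sigma>' n ** h" W t] that sn P by simp
  qed
  have "\<exists>p. p \<in> ?P ~> X k \<and> \<zeta> k ** p = ?ev ** pair V ?a (\<tau> k ** bang V ?P)" if k: "k \<in> K" for k
  proof -
    have "\<sigma> ** (?ev ** pair V ?a (\<tau> k ** bang V ?P)) = \<tau> k ** bang V ?P"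
      using sec [of "Ident V ?P" ?P "\<tau> k ** bang V ?P"] P td k by simp
    then have "\<exists>!p. p \<in> ?P ~> X k \<and> \<zeta> k ** p = ?ev ** pair V ?a (\<tau> k ** bang V ?P)"
      by (rule factor_through_summand [OF K c T s k, rotated 2]) (use P td cd k in simp_all)
    then show ?thesis by (rule ex1_implies_ex)
  qed
  then obtain \<pi> where p: "\<And>k. k \<in> K \<Longrightarrow> \<pi> k \<in> ?P ~> X k"
    "\<And>k. k \<in> K \<Longrightarrow> \<zeta> k ** \<pi> k = ?ev ** pair V ?a (\<tau> k ** bang V ?P)" by metis
  have pe: "\<zeta> k ** (\<pi> k ** h) = ?ev ** pair V (?a ** h) (\<tau> k ** bang V W)" if "k \<in> K" "h \<in> W ~> ?P" for k h W
    using comp_ext [OF p(2) [OF that(1)], of h] p(1) [OF that(1)] P td cd that by simp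
  show ?thesis
  proof (rule that [OF P(1) p(1)])
    fix W w assume W: "W \<in> Obj V" and w: "\<And>k. k \<in> K \<Longrightarrow> w k \<in> W ~> X k"
    have cW: "is_coproduct V K (\<lambda>_. prd V pt W)
      (prd V T W, \<lambda>k. pair V (\<tau> k ** pr1 V pt W) (pr2 V pt W))"
      using coproduct_times [OF T W] by simp
    have "\<And>k. k \<in> K \<Longrightarrow> \<zeta> k ** (w k ** pr2 V pt W) \<in> prd V pt W ~> S"
      using cd w W by simp
    then obtain g where g: "g \<in> prd V T W ~> S"
      "\<And>k. k \<in> K \<Longrightarrow> g ** pair V (\<tau> k ** pr1 V pt W) (pr2 V pt W) =
         \<zeta> k ** (w k ** pr2 V pt W)"
      using coproduct_obtain [OF cW, of "\<lambda>k. \<zeta> k ** (w k ** pr2 V pt W)" S] cd(1) by auto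
    have gt: "g ** pair V (\<tau> k ** bang V Z) x = \<zeta> k ** (w k ** x)" if "k \<in> K" "x \<in> Z ~> W" for k x Z
    proof -
      have o: "Z \<in> Obj V" using that by auto
      show ?thesis
        using comp_ext [OF g(2) [OF that(1)], of "pair V (bang V Z) x"] g(1) td cd w [OF that(1)] W o that
        by simp
    qed
    have sg: "\<sigma> ** g = pr1 V T W"
    proof (rule coproduct_eqI [OF cW])
      fix k assume k: "k \<in> K"
      show "(\<sigma> ** g) ** pair V (\<tau> k ** pr1 V pt W) (pr2 V pt W) =
        pr1 V T W ** pair V (\<tau> k ** pr1 V pt W) (pr2 V pt W)"
        using g(1) g(2) [OF k] comp_ext [OF s(2) [OF k], of "w k ** pr2 V pt W"] s(1) td cd w [OF k] W k
        by simp
    qed (use g(1) s(1) td(1) W in simp_all)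
    define e where "e = curry_map V W T (g ** pair V (pr2 V W T) (pr1 V W T))"
    have e: "e \<in> W ~> ?E" using g(1) W td(1) cd(1) by (simp add: e_def)
    have ee: "?ev ** pair V (e ** x) t = g ** pair V t x" if "x \<in> Z ~> W" "t \<in> Z ~> T" for x t Z
      using g(1) W td(1) cd(1) that by (simp add: e_def)
    have "\<sigma>' ** e = n ** bang V W"
    proof (rule expo_eqI [of T T _ W])
      have "\<sigma> ** (g ** pair V (pr2 V W T) (pr1 V W T)) = pr2 V W T"
        using comp_ext [OF sg, of "pair V (pr2 V W T) (pr1 V W T)"] s(1) g(1) td(1) W by simp
      then show "eval_map V T T ** pair V ((\<sigma>' ** e) ** pr1 V W T) (pr2 V W T) =
          eval_map V T T ** pair V ((n ** bang V W) ** pr1 V W T) (pr2 V W T)"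
        using evs [of "e ** pr1 V W T" "prd V W T" "pr2 V W T"] evn [of "bang V (prd V W T)" "prd V W T" "pr2 V W T"]
          ee [of "pr1 V W T" "prd V W T" "pr2 V W T"] e sn W td(1) by simp
    qed (use sn e W td(1) in simp_all)
    then have h: "pb_pair V \<sigma>' n e (bang V W) \<in> W ~> ?P" "?a ** pb_pair V \<sigma>' n e (bang V W) = e"
      using sn e W by simp_all
    have "\<pi> k ** pb_pair V \<sigma>' n e (bang V W) = w k" if k: "k \<in> K" for k
      by (rule summand_mono [OF K c k, of _ W])
        (use pe [OF k h(1)] h ee [of "Ident V W" W "\<tau> k ** bang V W"] gt [OF k, of "Ident V W" W]
          p(1) [OF k] w [OF k] e W td k in simp_all)
    moreover have "h = h'" if hh: "h \<in> W ~> ?P" "h' \<in> W ~> ?P" "\<And>k. k \<in> K \<Longrightarrow> \<pi> k ** h = \<pi> k ** h'" for h h'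
    proof -
      let ?m = "\<lambda>h. ?ev ** pair V (?a ** (h ** pr2 V T W)) (pr1 V T W)"
      have mc: "?m h ** pair V (\<tau> k ** pr1 V pt W) (pr2 V pt W) =
          \<zeta> k ** (\<pi> k ** (h ** pr2 V pt W))" if "k \<in> K" "h \<in> W ~> ?P" for k h
        using pe [OF that(1), of "h ** pr2 V pt W" "prd V pt W"] td cd W P that
        by simp
      have "?m h = ?m h'"
      proof (rule coproduct_eqI [OF cW])
        fix k assume k: "k \<in> K"
        have "\<pi> k ** (h ** pr2 V pt W) = \<pi> k ** (h' ** pr2 V pt W)"
          using comp_ext [OF hh(3) [OF k], of "pr2 V pt W"] hh p(1) [OF k] W by simp
        then show "?m h ** pair V (\<tau> k ** pr1 V pt W) (pr2 V pt W) =
          ?m h' ** pair V (\<tau> k ** pr1 V pt W) (pr2 V pt W)"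
          unfolding mc [OF k hh(1)] mc [OF k hh(2)] by simp
      qed (use hh P W td(1) cd(1) in simp_all)
      then have m: "?m h ** pair V (pr2 V W T) (pr1 V W T) = ?m h' ** pair V (pr2 V W T) (pr1 V W T)" by simp
      have "?a ** h = ?a ** h'"
        by (rule expo_eqI [of T S _ W]) (use m hh P W td(1) cd(1) in simp_all)
      then show ?thesis
        by - (rule pb_eqI [of \<sigma>' n _ W], use hh sn in \<open>simp_all add: term_eqI\<close>)
    qed
    ultimately show "\<exists>!h. h \<in> W ~> ?P \<and> (\<forall>k\<in>K. \<pi> k ** h = w k)"
      using h(1) by (intro ex1I [of _ "pb_pair V \<sigma>' n e (bang V W)"]) (simp_all del: Hom_iff)
  qed
qed

lemma equalizer_exists:
  assumes f: "f \<in> X ~> Y" and g: "g \<in> X ~> Y"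
  obtains E e where "e \<in> E ~> X" "f ** e = g ** e"
    "\<And>W x. x \<in> W ~> X \<Longrightarrow> f ** x = g ** x \<Longrightarrow> \<exists>!h. h \<in> W ~> E \<and> e ** h = x"
proof -
  have o: "X \<in> Obj V" "Y \<in> Obj V" using f by auto
  define f' where "f' = pair V (Ident V X) f"
  define g' where "g' = pair V (Ident V X) g"
  have fg: "f' \<in> Arr V" "g' \<in> Arr V" "Cod V f' = Cod V g'" "Dom V f' = X" "Dom V g' = X" "Cod V g' = prd V X Y"
    using f g o by (simp_all add: f'_def g'_def)
  have fx: "f' ** x = pair V x (f ** x)" "g' ** x = pair V x (g ** x)" if "x \<in> W ~> X" for x W
    using that f g o by (simp_all add: f'_def g'_def)
  let ?e = "pb1 V f' g'"
  have p: "?e \<in> pb V f' g' ~> X" "pb2 V f' g' \<in> pb V f' g' ~> X"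
    using pb_simps [OF fg(1-3)] fg by simp_all
  have "pair V ?e (f ** ?e) = pair V (pb2 V f' g') (g ** pb2 V f' g')"
    using pb_comm [OF fg(1-3)] unfolding fx(1) [OF p(1)] fx(2) [OF p(2)] .
  then have "?e = pb2 V f' g' \<and> f ** ?e = g ** pb2 V f' g'"
    by (rule iffD1 [OF pair_eq_iff, rotated 8]) (use p f g in simp_all)
  then have e12: "?e = pb2 V f' g'" and fe: "f ** ?e = g ** pb2 V f' g'" by blast+
  show ?thesis
  proof (rule that [of ?e "pb V f' g'"])
    fix W x assume x: "x \<in> W ~> X" "f ** x = g ** x"
    have e: "f' ** x = g' ** x" using x(2) unfolding fx [OF x(1)] by simp
    have p': "pb_pair V f' g' x x \<in> W ~> pb V f' g'" "?e ** pb_pair V f' g' x x = x"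
      "pb2 V f' g' ** pb_pair V f' g' x x = x" using pb_pair_simps [of f' g' x x] e x(1) fg by simp_all
    show "\<exists>!h. h \<in> W ~> pb V f' g' \<and> ?e ** h = x"
    proof (rule ex1I [of _ "pb_pair V f' g' x x"])
      show "pb_pair V f' g' x x \<in> W ~> pb V f' g' \<and> ?e ** pb_pair V f' g' x x = x"
        using p' by blast
      fix h assume h: "h \<in> W ~> pb V f' g' \<and> ?e ** h = x"
      show "h = pb_pair V f' g' x x"
        by (rule pb_eqI [OF fg(1-3), of _ W]) (use h p' e12 in metis)+
    qed
  qed (use fe e12 p in metis)+
qed

end


section \<open>Enriched categories, elementwise\<close>

locale vcat = ccc V for V :: "('o, 'm) cat" (structure) +
  fixes C :: "('c, 'o, 'm) vcat"
  assumes vcategory: "vcategory V C"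
begin

lemma vhom_Obj [simp]: "A \<in> vob C \<Longrightarrow> B \<in> vob C \<Longrightarrow> vhom C A B \<in> Obj V"
  using vcategory by (simp add: vcategory_def)

lemma vid_simps [simp]:
  assumes "A \<in> vob C"
  shows "vid C A \<in> Arr V" "Dom V (vid C A) = pt" "Cod V (vid C A) = vhom C A A"
  using vcategory assms by (simp_all add: vcategory_def)

lemma vcomp_simps [simp]:
  assumes "A \<in> vob C" "B \<in> vob C" "D \<in> vob C"
  shows "vcomp C A B D \<in> Arr V" "Dom V (vcomp C A B D) = prd V (vhom C B D) (vhom C A B)"
    "Cod V (vcomp C A B D) = vhom C A D"
  using vcategory assms by (simp_all add: vcategory_def)

text \<open>
  The axioms of an enriched category speak of the universal elements of products of hom-objects; all later
  arguments use composites of elements at arbitrary stages.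
\<close>

definition vc :: "'c \<Rightarrow> 'c \<Rightarrow> 'c \<Rightarrow> 'm \<Rightarrow> 'm \<Rightarrow> 'm" where
  "vc A B D g f = vcomp C A B D ** pair V g f"

lemma vc_simps [simp]:
  assumes "A \<in> vob C" "B \<in> vob C" "D \<in> vob C" "f \<in> Arr V" "g \<in> Arr V" "Dom V g = Dom V f"
    "Cod V f = vhom C A B" "Cod V g = vhom C B D"
  shows "vc A B D g f \<in> Arr V" "Dom V (vc A B D g f) = Dom V f" "Cod V (vc A B D g f) = vhom C A D"
    "\<And>h. h \<in> Arr V \<Longrightarrow> Cod V h = Dom V f \<Longrightarrow> vc A B D g f ** h = vc A B D (g ** h) (f ** h)"
  using assms by (simp_all add: vc_def)

lemma vc_assoc:
  assumes "A \<in> vob C" "B \<in> vob C" "D \<in> vob C" "E \<in> vob C"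
    and f: "f \<in> W ~> vhom C A B" and g: "g \<in> W ~> vhom C B D" and h: "h \<in> W ~> vhom C D E"
  shows "vc A B E (vc B D E h g) f = vc A D E h (vc A B D g f)"
proof -
  let ?DE = "vhom C D E" and ?BD = "vhom C B D" and ?AB = "vhom C A B"
  let ?P = "prd V ?DE ?BD"
  let ?h = "pr1 V ?DE ?BD ** pr1 V ?P ?AB" and ?g = "pr2 V ?DE ?BD ** pr1 V ?P ?AB" and ?f = "pr2 V ?P ?AB"
  have "vc A B E (vc B D E ?h ?g) ?f = vc A D E ?h (vc A B D ?g ?f)"
    using vcategory assms(1-4) unfolding vcategory_def vc_def Let_def by blast
  then have "vc A B E (vc B D E ?h ?g) ?f ** pair V (pair V h g) f =
      vc A D E ?h (vc A B D ?g ?f) ** pair V (pair V h g) f" by simp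
  then show ?thesis using assms by simp
qed

lemma vc_id_left:
  assumes "A \<in> vob C" "B \<in> vob C" and f: "f \<in> W ~> vhom C A B"
  shows "vc A B B (vid C B ** bang V W) f = f"
proof -
  let ?AB = "vhom C A B"
  have W: "W \<in> Obj V" using f by auto
  have "vc A B B (vid C B ** bang V ?AB) (Ident V ?AB) = Ident V ?AB"
    using vcategory assms(1,2) unfolding vcategory_def vc_def Let_def by blast
  then have "vc A B B (vid C B ** bang V ?AB) (Ident V ?AB) ** f = Ident V ?AB ** f" by simp
  then show ?thesis using assms W by simp
qed

lemma vc_id_right:
  assumes "A \<in> vob C" "B \<in> vob C" and f: "f \<in> W ~> vhom C A B"
  shows "vc A A B f (vid C A ** bang V W) = f"
proof -
  let ?AB = "vhom C A B"
  have W: "W \<in> Obj V" using f by auto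
  have "vc A A B (Ident V ?AB) (vid C A ** bang V ?AB) = Ident V ?AB"
    using vcategory assms(1,2) unfolding vcategory_def vc_def Let_def by blast
  then have "vc A A B (Ident V ?AB) (vid C A ** bang V ?AB) ** f = Ident V ?AB ** f" by simp
  then show ?thesis using assms W by simp
qed

end

context ccc
begin

lemma vcategoryI:
  fixes C :: "('c, 'o, 'm) vcat"
  defines "vc \<equiv> \<lambda>A B D g f. vcomp C A B D ** pair V g f"
  assumes o: "\<And>A B. A \<in> vob C \<Longrightarrow> B \<in> vob C \<Longrightarrow> vhom C A B \<in> Obj V"
    and i: "\<And>A. A \<in> vob C \<Longrightarrow> vid C A \<in> pt ~> vhom C A A"
    and c: "\<And>A B D. A \<in> vob C \<Longrightarrow> B \<in> vob C \<Longrightarrow> D \<in> vob C \<Longrightarrow>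
      vcomp C A B D \<in> prd V (vhom C B D) (vhom C A B) ~> vhom C A D"
    and a: "\<And>A B D E W f g h. A \<in> vob C \<Longrightarrow> B \<in> vob C \<Longrightarrow> D \<in> vob C \<Longrightarrow> E \<in> vob C \<Longrightarrow>
      f \<in> W ~> vhom C A B \<Longrightarrow> g \<in> W ~> vhom C B D \<Longrightarrow> h \<in> W ~> vhom C D E \<Longrightarrow>
      vc A B E (vc B D E h g) f = vc A D E h (vc A B D g f)"
    and l: "\<And>A B W f. A \<in> vob C \<Longrightarrow> B \<in> vob C \<Longrightarrow> f \<in> W ~> vhom C A B \<Longrightarrow>
      vc A B B (vid C B ** bang V W) f = f"
    and r: "\<And>A B W f. A \<in> vob C \<Longrightarrow> B \<in> vob C \<Longrightarrow> f \<in> W ~> vhom C A B \<Longrightarrow>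
      vc A A B f (vid C A ** bang V W) = f"
  shows "vcategory V C"
  unfolding vcategory_def Let_def
proof (intro conjI ballI)
  fix A B D E assume A: "A \<in> vob C" "B \<in> vob C" "D \<in> vob C" "E \<in> vob C"
  let ?DE = "vhom C D E" and ?BD = "vhom C B D" and ?AB = "vhom C A B"
  let ?P = "prd V ?DE ?BD"
  let ?h = "pr1 V ?DE ?BD ** pr1 V ?P ?AB" and ?g = "pr2 V ?DE ?BD ** pr1 V ?P ?AB" and ?f = "pr2 V ?P ?AB"
  show "vcomp C A B E ** pair V (vcomp C B D E ** pair V ?h ?g) ?f =
      vcomp C A D E ** pair V ?h (vcomp C A B D ** pair V ?g ?f)"
    using a [OF A, of ?f "prd V ?P ?AB" ?g ?h] A o by (simp add: vc_def)
next
  fix A B assume A: "A \<in> vob C" "B \<in> vob C"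
  let ?AB = "vhom C A B"
  show "vcomp C A B B ** pair V (vid C B ** bang V ?AB) (Ident V ?AB) = Ident V ?AB"
    "vcomp C A A B ** pair V (Ident V ?AB) (vid C A ** bang V ?AB) = Ident V ?AB"
    using l [OF A, of "Ident V ?AB" ?AB] r [OF A, of "Ident V ?AB" ?AB] o [OF A] by (simp_all add: vc_def)
qed (use o i c in auto)

end

locale two_vcats = B: vcat V B + C: vcat V C for V :: "('o, 'm) cat" (structure)
  and B :: "('b, 'o, 'm) vcat" and C :: "('c, 'o, 'm) vcat"
begin

lemma vfunctor_simps:
  assumes F: "vfunctor V B C F" and "i \<in> vob B"
  shows "vfo F i \<in> vob C" "vfa F i i ** vid B i = vid C (vfo F i)"
    "\<And>j. j \<in> vob B \<Longrightarrow> vfa F i j \<in> Arr V" "\<And>j. j \<in> vob B \<Longrightarrow> Dom V (vfa F i j) = vhom B i j"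
    "\<And>j. j \<in> vob B \<Longrightarrow> Cod V (vfa F i j) = vhom C (vfo F i) (vfo F j)"
  using assms unfolding vfunctor_def by simp_all

lemma vfunctor_comp:
  assumes F: "vfunctor V B C F" and i: "i \<in> vob B" "j \<in> vob B" "k \<in> vob B"
    and u: "u \<in> W ~> vhom B i j" "v \<in> W ~> vhom B j k"
  shows "vfa F i k ** B.vc i j k v u = C.vc (vfo F i) (vfo F j) (vfo F k) (vfa F j k ** v) (vfa F i j ** u)"
proof -
  let ?g = "pr1 V (vhom B j k) (vhom B i j)" and ?f = "pr2 V (vhom B j k) (vhom B i j)"
  note Fs = vfunctor_simps [OF F]
  have "vfa F i k ** vcomp B i j k = C.vc (vfo F i) (vfo F j) (vfo F k) (vfa F j k ** ?g) (vfa F i j ** ?f)"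
    using F i unfolding vfunctor_def C.vc_def Let_def by blast
  from B.comp_ext [OF this, of "pair V v u"] show ?thesis
    using i u Fs by (simp add: B.vc_def)
qed

lemma vfunctorI:
  assumes m: "mk_vfun (vob B) (vfo F) (vfa F) = F"
    and o: "\<And>i. i \<in> vob B \<Longrightarrow> vfo F i \<in> vob C"
    and a: "\<And>i j. i \<in> vob B \<Longrightarrow> j \<in> vob B \<Longrightarrow> vfa F i j \<in> vhom B i j ~> vhom C (vfo F i) (vfo F j)"
    and d: "\<And>i. i \<in> vob B \<Longrightarrow> vfa F i i ** vid B i = vid C (vfo F i)"
    and c: "\<And>i j k W u v. i \<in> vob B \<Longrightarrow> j \<in> vob B \<Longrightarrow> k \<in> vob B \<Longrightarrow> u \<in> W ~> vhom B i j \<Longrightarrow>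
      v \<in> W ~> vhom B j k \<Longrightarrow>
      vfa F i k ** B.vc i j k v u = C.vc (vfo F i) (vfo F j) (vfo F k) (vfa F j k ** v) (vfa F i j ** u)"
  shows "vfunctor V B C F"
  unfolding vfunctor_def Let_def
proof (intro conjI ballI)
  fix i j k assume i: "i \<in> vob B" "j \<in> vob B" "k \<in> vob B"
  let ?g = "pr1 V (vhom B j k) (vhom B i j)" and ?f = "pr2 V (vhom B j k) (vhom B i j)"
  show "vfa F i k ** vcomp B i j k = vcomp C (vfo F i) (vfo F j) (vfo F k) ** pair V (vfa F j k ** ?g) (vfa F i j ** ?f)"
    using c [OF i, of ?f "prd V (vhom B j k) (vhom B i j)" ?g] i by (simp add: C.vc_def B.vc_def)
qed (use m o a d in blast)+

subsection \<open>Ends\<close>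

lemma wedge_iff:
  assumes F: "vfunctor V B C F" and F': "vfunctor V B C F'" and X: "X \<in> Obj V"
  shows "is_wedge V B C F F' X w \<longleftrightarrow>
    (\<forall>i\<in>vob B. w i \<in> X ~> vhom C (vfo F i) (vfo F' i)) \<and>
    (\<forall>i\<in>vob B. \<forall>j\<in>vob B. \<forall>W u k. u \<in> W ~> vhom B i j \<longrightarrow> k \<in> W ~> X \<longrightarrow>
      C.vc (vfo F i) (vfo F' i) (vfo F' j) (vfa F' i j ** u) (w i ** k) =
      C.vc (vfo F i) (vfo F j) (vfo F' j) (w j ** k) (vfa F i j ** u))" (is "_ \<longleftrightarrow> ?a \<and> ?b")
proof -
  note Fs = vfunctor_simps [OF F] vfunctor_simps [OF F']
  let ?c = "\<forall>i\<in>vob B. \<forall>j\<in>vob B.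
      C.vc (vfo F i) (vfo F' i) (vfo F' j) (vfa F' i j ** pr1 V (vhom B i j) X) (w i ** pr2 V (vhom B i j) X) =
      C.vc (vfo F i) (vfo F j) (vfo F' j) (w j ** pr2 V (vhom B i j) X) (vfa F i j ** pr1 V (vhom B i j) X)"
  have "is_wedge V B C F F' X w \<longleftrightarrow> ?a \<and> ?c"
    unfolding is_wedge_def C.vc_def Let_def by blast
  moreover have "?c \<longleftrightarrow> ?b" if a: "?a"
  proof
    assume c: "?c"
    show "?b"
    proof (intro ballI allI impI)
      fix i j W u k assume i: "i \<in> vob B" "j \<in> vob B" and u: "u \<in> W ~> vhom B i j" "k \<in> W ~> X"
      let ?p = "pr1 V (vhom B i j) X" and ?q = "pr2 V (vhom B i j) X"
      have "C.vc (vfo F i) (vfo F' i) (vfo F' j) (vfa F' i j ** ?p) (w i ** ?q) ** pair V u k =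
        C.vc (vfo F i) (vfo F j) (vfo F' j) (w j ** ?q) (vfa F i j ** ?p) ** pair V u k"
        using c i by simp
      then show "C.vc (vfo F i) (vfo F' i) (vfo F' j) (vfa F' i j ** u) (w i ** k) =
        C.vc (vfo F i) (vfo F j) (vfo F' j) (w j ** k) (vfa F i j ** u)"
        using i u X Fs bspec [OF a i(1)] bspec [OF a i(2)] by simp
    qed
  next
    assume b: "?b"
    show "?c" by (intro ballI b [rule_format]) (use X in simp_all)
  qed
  ultimately show ?thesis by blast
qed

end

locale funcat = ext_ccc V U + two_vcats V I C
  for V :: "('o, 'm) cat" (structure) and U :: "'u set"
    and I :: "('i, 'o, 'm) vcat" and C :: "('c, 'o, 'm) vcat" +
  assumes smallI: "small U (vob I)" and smallC: "small U (vob C)"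
begin

text \<open>
  The end is the equalizer of the two maps from the product of the \<open>C(F i,F' i)\<close> to the product of the
  exponentials of \<open>C(F i,F' j)\<close> by \<open>I(i,j)\<close>.
\<close>

lemma end_exists:
  assumes F: "vfunctor V I C F" and F': "vfunctor V I C F'"
  shows "\<exists>t. is_end V I C F F' t"
proof -
  note Fs = vfunctor_simps [OF F] vfunctor_simps [OF F']
  let ?X = "\<lambda>i. vhom C (vfo F i) (vfo F' i)"
  let ?Y = "\<lambda>i j. vhom C (vfo F i) (vfo F' j)"
  let ?E = "\<lambda>i j. expo V (vhom I i j) (?Y i j)"
  have Xo: "\<And>i. i \<in> vob I \<Longrightarrow> ?X i \<in> Obj V" and
    Eo: "\<And>k. k \<in> vob I \<times> vob I \<Longrightarrow> (case k of (i, j) \<Rightarrow> ?E i j) \<in> Obj V" using Fs by auto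
  obtain P \<pi> where P: "P \<in> Obj V" "\<And>i. i \<in> vob I \<Longrightarrow> \<pi> i \<in> P ~> ?X i"
    "\<And>W w. W \<in> Obj V \<Longrightarrow> (\<And>i. i \<in> vob I \<Longrightarrow> w i \<in> W ~> ?X i) \<Longrightarrow>
      \<exists>!h. h \<in> W ~> P \<and> (\<forall>i\<in>vob I. \<pi> i ** h = w i)"
    using small_product_exists [OF smallI, of ?X] Xo by blast
  have sI: "small U (vob I \<times> vob I)" by (rule small_Times [OF universe smallI smallI])
  obtain Q \<rho> where Q: "Q \<in> Obj V" "\<And>k. k \<in> vob I \<times> vob I \<Longrightarrow> \<rho> k \<in> Q ~> (case k of (i, j) \<Rightarrow> ?E i j)"
    "\<And>W w. W \<in> Obj V \<Longrightarrow> (\<And>k. k \<in> vob I \<times> vob I \<Longrightarrow> w k \<in> W ~> (case k of (i, j) \<Rightarrow> ?E i j)) \<Longrightarrow>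
      \<exists>!h. h \<in> W ~> Q \<and> (\<forall>k\<in>vob I \<times> vob I. \<rho> k ** h = w k)"
    using small_product_exists [OF sI, of "\<lambda>k. case k of (i, j) \<Rightarrow> ?E i j"] Eo by blast
  have Q2: "\<rho> (i, j) \<in> Q ~> ?E i j" if "i \<in> vob I" "j \<in> vob I" for i j using Q(2) [of "(i, j)"] that by simp
  have Qex: "\<exists>h. h \<in> P ~> Q \<and> (\<forall>i\<in>vob I. \<forall>j\<in>vob I. \<rho> (i, j) ** h = curry_map V P (vhom I i j) (w i j))"
    if w: "\<And>i j. i \<in> vob I \<Longrightarrow> j \<in> vob I \<Longrightarrow> w i j \<in> prd V P (vhom I i j) ~> ?Y i j" for w
  proof -
    have "\<exists>!h. h \<in> P ~> Q \<and> (\<forall>k\<in>vob I \<times> vob I. \<rho> k ** h = (case k of (i, j) \<Rightarrow> curry_map V P (vhom I i j) (w i j)))"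
      by (rule Q(3) [OF P(1)]) (use w P(1) Fs in auto)
    then show ?thesis by auto
  qed
  define \<alpha> where "\<alpha> = (\<lambda>i j. C.vc (vfo F i) (vfo F' i) (vfo F' j) (vfa F' i j ** pr2 V P (vhom I i j)) (\<pi> i ** pr1 V P (vhom I i j)))"
  define \<beta> where "\<beta> = (\<lambda>i j. C.vc (vfo F i) (vfo F j) (vfo F' j) (\<pi> j ** pr1 V P (vhom I i j)) (vfa F i j ** pr2 V P (vhom I i j)))"
  have ab: "\<alpha> i j \<in> prd V P (vhom I i j) ~> ?Y i j" "\<beta> i j \<in> prd V P (vhom I i j) ~> ?Y i j"
    if "i \<in> vob I" "j \<in> vob I" for i j
    using that P(1) P(2) [OF that(1)] P(2) [OF that(2)] Fs by (simp_all add: \<alpha>_def \<beta>_def)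
  have ab2: "\<alpha> i j ** pair V k u = C.vc (vfo F i) (vfo F' i) (vfo F' j) (vfa F' i j ** u) (\<pi> i ** k)"
    "\<beta> i j ** pair V k u = C.vc (vfo F i) (vfo F j) (vfo F' j) (\<pi> j ** k) (vfa F i j ** u)"
    if "i \<in> vob I" "j \<in> vob I" "k \<in> W ~> P" "u \<in> W ~> vhom I i j" for i j k u W
    using that P(1) P(2) [OF that(1)] P(2) [OF that(2)] Fs by (simp_all add: \<alpha>_def \<beta>_def)
  obtain a where a: "a \<in> P ~> Q" "\<And>i j. i \<in> vob I \<Longrightarrow> j \<in> vob I \<Longrightarrow> \<rho> (i, j) ** a = curry_map V P (vhom I i j) (\<alpha> i j)"
    using Qex [of \<alpha>] ab(1) by blast
  obtain b where b: "b \<in> P ~> Q" "\<And>i j. i \<in> vob I \<Longrightarrow> j \<in> vob I \<Longrightarrow> \<rho> (i, j) ** b = curry_map V P (vhom I i j) (\<beta> i j)"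
    using Qex [of \<beta>] ab(2) by blast
  have eva: "eval_map V (vhom I i j) (?Y i j) ** pair V (\<rho> (i, j) ** (a ** k)) u = \<alpha> i j ** pair V k u"
    and evb: "eval_map V (vhom I i j) (?Y i j) ** pair V (\<rho> (i, j) ** (b ** k)) u = \<beta> i j ** pair V k u"
    if "i \<in> vob I" "j \<in> vob I" "k \<in> W ~> P" "u \<in> W ~> vhom I i j" for i j k u W
    using comp_ext [OF a(2) [OF that(1,2)], of k] comp_ext [OF b(2) [OF that(1,2)], of k]
      a(1) b(1) Q2 [OF that(1,2)] ab [OF that(1,2)] P(1) Fs that by simp_all
  obtain E e where e: "e \<in> E ~> P" "a ** e = b ** e"
    "\<And>W x. x \<in> W ~> P \<Longrightarrow> a ** x = b ** x \<Longrightarrow> \<exists>!h. h \<in> W ~> E \<and> e ** h = x"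
    using equalizer_exists [OF a(1) b(1)] by metis
  have Eo: "E \<in> Obj V" using e(1) Hom_Obj1 by blast
  have pe: "\<pi> i ** e \<in> E ~> ?X i" if "i \<in> vob I" for i using P(2) [OF that] e(1) by simp
  have "is_wedge V I C F F' E (\<lambda>i. \<pi> i ** e)"
    unfolding wedge_iff [OF F F' Eo]
  proof (intro conjI ballI allI impI)
    fix i j W u k assume i: "i \<in> vob I" "j \<in> vob I" and u: "u \<in> W ~> vhom I i j" "k \<in> W ~> E"
    have ek: "e ** k \<in> W ~> P" using e(1) u(2) by simp
    have "a ** (e ** k) = b ** (e ** k)"
      using comp_ext [OF e(2), of k] e(1) a(1) b(1) u(2) by simp
    then have "\<alpha> i j ** pair V (e ** k) u = \<beta> i j ** pair V (e ** k) u"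
      using eva [OF i ek u(1)] evb [OF i ek u(1)] by simp
    then show "C.vc (vfo F i) (vfo F' i) (vfo F' j) (vfa F' i j ** u) ((\<pi> i ** e) ** k) =
      C.vc (vfo F i) (vfo F j) (vfo F' j) ((\<pi> j ** e) ** k) (vfa F i j ** u)"
      using ab2 [OF i ek u(1)] P(2) [OF i(1)] P(2) [OF i(2)] e(1) u(2) by simp
  qed (use pe in blast)
  moreover have "\<exists>!h. h \<in> X ~> E \<and> (\<forall>i\<in>vob I. (\<pi> i ** e) ** h = w i)"
    if X: "X \<in> Obj V" and w: "is_wedge V I C F F' X w" for X w
  proof -
    have w1: "\<And>i. i \<in> vob I \<Longrightarrow> w i \<in> X ~> ?X i" and w2: "\<And>i j W u k. i \<in> vob I \<Longrightarrow> j \<in> vob I \<Longrightarrow>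
      u \<in> W ~> vhom I i j \<Longrightarrow> k \<in> W ~> X \<Longrightarrow>
      C.vc (vfo F i) (vfo F' i) (vfo F' j) (vfa F' i j ** u) (w i ** k) =
      C.vc (vfo F i) (vfo F j) (vfo F' j) (w j ** k) (vfa F i j ** u)"
      using w unfolding wedge_iff [OF F F' X] by blast+
    obtain h where h: "h \<in> X ~> P" "\<And>i. i \<in> vob I \<Longrightarrow> \<pi> i ** h = w i"
      using ex1_implies_ex [OF P(3) [of X w, OF X w1]] by blast
    have "a ** h = b ** h"
    proof -
      have "\<exists>!g. g \<in> X ~> Q \<and> (\<forall>k\<in>vob I \<times> vob I. \<rho> k ** g = \<rho> k ** (a ** h))"
      proof (rule Q(3) [OF X])
        show "\<rho> k ** (a ** h) \<in> X ~> (case k of (i, j) \<Rightarrow> ?E i j)" if "k \<in> vob I \<times> vob I" for k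
          using Q(2) [OF that] a(1) h(1) by simp
      qed
      moreover have "\<rho> (i, j) ** (b ** h) = \<rho> (i, j) ** (a ** h)" if i: "i \<in> vob I" "j \<in> vob I" for i j
      proof (rule expo_eqI [of "vhom I i j" "?Y i j" _ X])
        let ?p = "pr1 V X (vhom I i j)" and ?q = "pr2 V X (vhom I i j)"
        have hp: "h ** ?p \<in> prd V X (vhom I i j) ~> P" "?q \<in> prd V X (vhom I i j) ~> vhom I i j"
          "?p \<in> prd V X (vhom I i j) ~> X"
          using h(1) X i by simp_all
        have "\<pi> l ** (h ** ?p) = w l ** ?p" if "l \<in> vob I" for l
          using comp_ext [OF h(2) [OF that], of ?p] h(1) P(2) [OF that] X i by simp
        then have "\<alpha> i j ** pair V (h ** ?p) ?q = \<beta> i j ** pair V (h ** ?p) ?q"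
          unfolding ab2 [OF i hp(1,2)] using w2 [OF i hp(2,3)] i by simp
        then show "eval_map V (vhom I i j) (?Y i j) ** pair V ((\<rho> (i, j) ** (b ** h)) ** ?p) ?q =
          eval_map V (vhom I i j) (?Y i j) ** pair V ((\<rho> (i, j) ** (a ** h)) ** ?p) ?q"
          using eva [OF i hp(1,2)] evb [OF i hp(1,2)] Q2 [OF i] a(1) b(1) h(1) X i by simp
      qed (use Q2 [OF i] a b h X i Fs in simp_all)
      ultimately show ?thesis
        by - (erule ex1_unique, use a(1) b(1) h(1) in auto)
    qed
    then obtain g where g: "g \<in> X ~> E" "e ** g = h" using e(3) [OF h(1)] by blast
    show ?thesis
    proof (rule ex1I [of _ g])
      show "g \<in> X ~> E \<and> (\<forall>i\<in>vob I. (\<pi> i ** e) ** g = w i)"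
        using g h(2) P(2) e(1) by simp
      fix g' assume g': "g' \<in> X ~> E \<and> (\<forall>i\<in>vob I. (\<pi> i ** e) ** g' = w i)"
      have 1: "\<pi> i ** (e ** g') = w i" if "i \<in> vob I" for i
        using g' that P(2) [OF that] e(1) by (metis Hom_iff assoc)
      have "e ** g' = h"
        by (rule ex1_unique [OF P(3) [of X w, OF X w1]]) (use 1 g' h e(1) in auto)
      then show "g' = g"
        by - (rule ex1_unique [OF e(3) [OF h(1) \<open>a ** h = b ** h\<close>]], use g g' in \<open>blast+\<close>)
    qed
  qed
  ultimately have "is_end V I C F F' (E, \<lambda>i. \<pi> i ** e)" unfolding is_end_def using Eo by blast
  then show ?thesis by blast
qed

subsection \<open>The functor category\<close>

abbreviation "D \<equiv> vfun_cat V I C"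
abbreviation "cdiag \<equiv> const_vfun V I C"
abbreviation "vpr \<equiv> vend_pr V I C"

lemma vob_D [simp]: "F \<in> vob D \<longleftrightarrow> vfunctor V I C F"
  by (simp add: vfun_cat_def)

lemma vhom_D: "vhom D F F' = vend V I C F F'"
  by (simp add: vfun_cat_def)

lemma vend_is_end:
  "vfunctor V I C F \<Longrightarrow> vfunctor V I C F' \<Longrightarrow> is_end V I C F F' (vhom D F F', vpr F F')"
  using someI_ex [OF end_exists [of F F']] by (simp add: vend_def vend_pr_def vhom_D)

lemma vhom_D_Obj [simp]: "vfunctor V I C F \<Longrightarrow> vfunctor V I C F' \<Longrightarrow> vhom D F F' \<in> Obj V"
  using vend_is_end [of F F'] by (auto simp: is_end_def)

lemma vend_wedge:
  assumes "vfunctor V I C F" "vfunctor V I C F'"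
  shows "is_wedge V I C F F' (vhom D F F') (vpr F F')"
  using vend_is_end [OF assms] by (auto simp: is_end_def)

lemma vend_pr_simps [simp]:
  assumes F: "vfunctor V I C F" "vfunctor V I C F'" and i: "i \<in> vob I"
  shows "vpr F F' i \<in> Arr V" "Dom V (vpr F F' i) = vhom D F F'"
    "Cod V (vpr F F' i) = vhom C (vfo F i) (vfo F' i)"
  using vend_wedge [OF F] i unfolding wedge_iff [OF F vhom_D_Obj [OF F]] by simp_all

lemma vend_natural:
  assumes F: "vfunctor V I C F" "vfunctor V I C F'" and i: "i \<in> vob I" "j \<in> vob I"
    and u: "u \<in> W ~> vhom I i j" and k: "k \<in> W ~> vhom D F F'"
  shows "C.vc (vfo F i) (vfo F' i) (vfo F' j) (vfa F' i j ** u) (vpr F F' i ** k) =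
      C.vc (vfo F i) (vfo F j) (vfo F' j) (vpr F F' j ** k) (vfa F i j ** u)"
  using vend_wedge [OF F] i u k unfolding wedge_iff [OF F vhom_D_Obj [OF F]] by blast

lemma vend_universal:
  assumes F: "vfunctor V I C F" "vfunctor V I C F'" and X: "X \<in> Obj V" and w: "is_wedge V I C F F' X w"
  shows "\<exists>!h. h \<in> X ~> vhom D F F' \<and> (\<forall>i\<in>vob I. vpr F F' i ** h = w i)"
  using vend_is_end [OF F] X w by (simp add: is_end_def del: Hom_iff)

lemma vend_lift:
  assumes F: "vfunctor V I C F" "vfunctor V I C F'" and X: "X \<in> Obj V" and w: "is_wedge V I C F F' X w"
  shows "vend_lift V I C F F' X w \<in> X ~> vhom D F F'"
    "\<And>i. i \<in> vob I \<Longrightarrow> vpr F F' i ** vend_lift V I C F F' X w = w i"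
  using theI' [OF vend_universal [OF assms]] by (simp_all add: vend_lift_def vhom_D del: Hom_iff)

lemma vend_eqI:
  assumes F: "vfunctor V I C F" "vfunctor V I C F'"
    and h: "h \<in> X ~> vhom D F F'" and g: "g \<in> X ~> vhom D F F'"
    and e: "\<And>i. i \<in> vob I \<Longrightarrow> vpr F F' i ** h = vpr F F' i ** g"
  shows "h = g"
proof -
  have X: "X \<in> Obj V" using h Hom_Obj1 by blast
  note Fs = vfunctor_simps [OF F(1)] vfunctor_simps [OF F(2)]
  have "is_wedge V I C F F' X (\<lambda>i. vpr F F' i ** h)"
    unfolding wedge_iff [OF F X]
  proof (intro conjI ballI allI impI)
    fix i j W u k assume i: "i \<in> vob I" "j \<in> vob I" and u: "u \<in> W ~> vhom I i j" "k \<in> W ~> X"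
    show "C.vc (vfo F i) (vfo F' i) (vfo F' j) (vfa F' i j ** u) ((vpr F F' i ** h) ** k) =
      C.vc (vfo F i) (vfo F j) (vfo F' j) ((vpr F F' j ** h) ** k) (vfa F i j ** u)"
      using vend_natural [OF F i u(1), of "h ** k"] h u(2) F i by simp
  qed (use F h in simp)
  from vend_universal [OF F X this] show ?thesis
    by (rule ex1_unique) (use h g e in simp_all)
qed

lemma vid_D:
  assumes F: "vfunctor V I C F"
  shows "vid D F \<in> pt ~> vhom D F F"
    "\<And>i. i \<in> vob I \<Longrightarrow> vpr F F i ** vid D F = vid C (vfo F i)"
proof -
  note Fs = vfunctor_simps [OF F]
  have "is_wedge V I C F F pt (\<lambda>i. vid C (vfo F i))"
    unfolding wedge_iff [OF F F term_ob_Obj]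
  proof (intro conjI ballI allI impI)
    fix i j W u k assume i: "i \<in> vob I" "j \<in> vob I" and u: "u \<in> W ~> vhom I i j" "k \<in> W ~> pt"
    have k: "k = bang V W" using u(2) by (simp add: bang_unique)
    have "vfa F i j ** u \<in> W ~> vhom C (vfo F i) (vfo F j)" using u(1) Fs i by simp
    then show "C.vc (vfo F i) (vfo F i) (vfo F j) (vfa F i j ** u) (vid C (vfo F i) ** k) =
        C.vc (vfo F i) (vfo F j) (vfo F j) (vid C (vfo F j) ** k) (vfa F i j ** u)"
      unfolding k using C.vc_id_left C.vc_id_right Fs(1) i by metis
  qed (use Fs in simp)
  from vend_lift [OF F F term_ob_Obj this]
  show "vid D F \<in> pt ~> vhom D F F"
    "\<And>i. i \<in> vob I \<Longrightarrow> vpr F F i ** vid D F = vid C (vfo F i)"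
    by (simp_all add: vfun_cat_def del: Hom_iff)
qed

lemma vcomp_D:
  assumes F: "vfunctor V I C F" "vfunctor V I C F'" "vfunctor V I C F''"
  shows "vcomp D F F' F'' \<in> prd V (vhom D F' F'') (vhom D F F') ~> vhom D F F''"
    "\<And>i g f W. i \<in> vob I \<Longrightarrow> g \<in> W ~> vhom D F' F'' \<Longrightarrow> f \<in> W ~> vhom D F F' \<Longrightarrow>
      vpr F F'' i ** (vcomp D F F' F'' ** pair V g f) =
      C.vc (vfo F i) (vfo F' i) (vfo F'' i) (vpr F' F'' i ** g) (vpr F F' i ** f)"
proof -
  note Fs = vfunctor_simps [OF F(1)] vfunctor_simps [OF F(2)] vfunctor_simps [OF F(3)]
  let ?Q = "vhom D F' F''" and ?R = "vhom D F F'"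
  let ?X = "prd V ?Q ?R"
  have X: "?X \<in> Obj V" using F by simp
  define w where "w = (\<lambda>i. C.vc (vfo F i) (vfo F' i) (vfo F'' i)
    (vpr F' F'' i ** pr1 V ?Q ?R) (vpr F F' i ** pr2 V ?Q ?R))"
  have "is_wedge V I C F F'' ?X w"
    unfolding wedge_iff [OF F(1,3) X]
  proof (intro conjI ballI allI impI)
    fix i j W u k assume i: "i \<in> vob I" "j \<in> vob I" and u: "u \<in> W ~> vhom I i j" and k: "k \<in> W ~> ?X"
    let ?g = "\<lambda>i. vpr F' F'' i ** (pr1 V ?Q ?R ** k)" and ?f = "\<lambda>i. vpr F F' i ** (pr2 V ?Q ?R ** k)"
    have g: "?g i \<in> W ~> vhom C (vfo F' i) (vfo F'' i)" "?g j \<in> W ~> vhom C (vfo F' j) (vfo F'' j)"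
      and f: "?f i \<in> W ~> vhom C (vfo F i) (vfo F' i)" "?f j \<in> W ~> vhom C (vfo F j) (vfo F' j)"
      and Fu: "vfa F i j ** u \<in> W ~> vhom C (vfo F i) (vfo F j)"
        "vfa F' i j ** u \<in> W ~> vhom C (vfo F' i) (vfo F' j)"
        "vfa F'' i j ** u \<in> W ~> vhom C (vfo F'' i) (vfo F'' j)"
      using k u i F Fs by simp_all
    have kk: "pr1 V ?Q ?R ** k \<in> W ~> ?Q" "pr2 V ?Q ?R ** k \<in> W ~> ?R" using k F by simp_all
    have wk: "w l ** k = C.vc (vfo F l) (vfo F' l) (vfo F'' l) (?g l) (?f l)" if "l \<in> vob I" for l
      using that k F Fs by (simp add: w_def)
    have "C.vc (vfo F i) (vfo F'' i) (vfo F'' j) (vfa F'' i j ** u) (C.vc (vfo F i) (vfo F' i) (vfo F'' i) (?g i) (?f i)) =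
      C.vc (vfo F i) (vfo F' i) (vfo F'' j) (C.vc (vfo F' i) (vfo F'' i) (vfo F'' j) (vfa F'' i j ** u) (?g i)) (?f i)"
      by (rule C.vc_assoc [symmetric, OF _ _ _ _ f(1) g(1) Fu(3)]) (use Fs i in simp_all)
    also have "\<dots> = C.vc (vfo F i) (vfo F' i) (vfo F'' j) (C.vc (vfo F' i) (vfo F' j) (vfo F'' j) (?g j) (vfa F' i j ** u)) (?f i)"
      unfolding vend_natural [OF F(2,3) i u kk(1)] ..
    also have "\<dots> = C.vc (vfo F i) (vfo F' j) (vfo F'' j) (?g j) (C.vc (vfo F i) (vfo F' i) (vfo F' j) (vfa F' i j ** u) (?f i))"
      by (rule C.vc_assoc [OF _ _ _ _ f(1) Fu(2) g(2)]) (use Fs i in simp_all)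
    also have "\<dots> = C.vc (vfo F i) (vfo F' j) (vfo F'' j) (?g j) (C.vc (vfo F i) (vfo F j) (vfo F' j) (?f j) (vfa F i j ** u))"
      unfolding vend_natural [OF F(1,2) i u kk(2)] ..
    also have "\<dots> = C.vc (vfo F i) (vfo F j) (vfo F'' j) (C.vc (vfo F j) (vfo F' j) (vfo F'' j) (?g j) (?f j)) (vfa F i j ** u)"
      by (rule C.vc_assoc [symmetric, OF _ _ _ _ Fu(1) f(2) g(2)]) (use Fs i in simp_all)
    finally show "C.vc (vfo F i) (vfo F'' i) (vfo F'' j) (vfa F'' i j ** u) (w i ** k) =
      C.vc (vfo F i) (vfo F j) (vfo F'' j) (w j ** k) (vfa F i j ** u)"
      unfolding wk [OF i(1)] wk [OF i(2)] .
  qed (use F Fs in \<open>simp add: w_def\<close>)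
  note l = vend_lift [OF F(1,3) X this]
  have c: "vcomp D F F' F'' = vend_lift V I C F F'' ?X w"
    unfolding w_def C.vc_def by (simp add: vfun_cat_def Let_def)
  show "vcomp D F F' F'' \<in> ?X ~> vhom D F F''" unfolding c by (rule l(1))
  fix i g f W assume i: "i \<in> vob I" and g: "g \<in> W ~> ?Q" and f: "f \<in> W ~> ?R"
  have "vpr F F'' i ** (vcomp D F F' F'' ** pair V g f) = w i ** pair V g f"
    using comp_ext [OF l(2) [OF i], of "pair V g f"] l(1) i g f F by (simp add: c)
  then show "vpr F F'' i ** (vcomp D F F' F'' ** pair V g f) =
      C.vc (vfo F i) (vfo F' i) (vfo F'' i) (vpr F' F'' i ** g) (vpr F F' i ** f)"
    using i g f F Fs by (simp add: w_def)
qed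

lemma vcategory_D: "vcategory V D"
proof (rule vcategoryI, unfold vob_D)
  fix F F' F'' K W f g h assume F: "vfunctor V I C F" "vfunctor V I C F'" "vfunctor V I C F''" "vfunctor V I C K"
    and f: "f \<in> W ~> vhom D F F'" and g: "g \<in> W ~> vhom D F' F''" and h: "h \<in> W ~> vhom D F'' K"
  note Fs = vfunctor_simps(1) [OF F(1)] vfunctor_simps(1) [OF F(2)] vfunctor_simps(1) [OF F(3)] vfunctor_simps(1) [OF F(4)]
  have c: "vcomp D F F' F'' ** pair V g f \<in> W ~> vhom D F F''"
    "vcomp D F' F'' K ** pair V h g \<in> W ~> vhom D F' K"
    using vcomp_D(1) [OF F(1,2,3)] vcomp_D(1) [OF F(2,3,4)] f g h F by simp_all
  show "vcomp D F F' K ** pair V (vcomp D F' F'' K ** pair V h g) f =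
      vcomp D F F'' K ** pair V h (vcomp D F F' F'' ** pair V g f)"
  proof (rule vend_eqI [OF F(1,4)])
    fix i assume i: "i \<in> vob I"
    show "vpr F K i ** (vcomp D F F' K ** pair V (vcomp D F' F'' K ** pair V h g) f) =
      vpr F K i ** (vcomp D F F'' K ** pair V h (vcomp D F F' F'' ** pair V g f))"
      unfolding vcomp_D(2) [OF F(1,2,4) i c(2) f] vcomp_D(2) [OF F(1,3,4) i h c(1)]
        vcomp_D(2) [OF F(1,2,3) i g f] vcomp_D(2) [OF F(2,3,4) i h g]
      by (rule C.vc_assoc) (use Fs i f g h F in simp_all)
  qed (use vcomp_D(1) [OF F(1,2,4)] vcomp_D(1) [OF F(1,3,4)] c f h F in simp_all)
next
  fix F F' W f assume F: "vfunctor V I C F" "vfunctor V I C F'" and f: "f \<in> W ~> vhom D F F'"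
  have W: "W \<in> Obj V" using f Hom_Obj1 by blast
  note Fs = vfunctor_simps(1) [OF F(1)] vfunctor_simps(1) [OF F(2)]
  have v: "vid D F ** bang V W \<in> W ~> vhom D F F" "vid D F' ** bang V W \<in> W ~> vhom D F' F'"
    using vid_D(1) [OF F(1)] vid_D(1) [OF F(2)] W by simp_all
  have vp: "vpr F F i ** (vid D F ** bang V W) = vid C (vfo F i) ** bang V W"
    "vpr F' F' i ** (vid D F' ** bang V W) = vid C (vfo F' i) ** bang V W" if "i \<in> vob I" for i
    using comp_ext [OF vid_D(2) [OF F(1) that], of "bang V W"]
      comp_ext [OF vid_D(2) [OF F(2) that], of "bang V W"] vid_D(1) [OF F(1)] vid_D(1) [OF F(2)] F W that
    by simp_all
  show "vcomp D F F' F' ** pair V (vid D F' ** bang V W) f = f"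
  proof (rule vend_eqI [OF F])
    fix i assume i: "i \<in> vob I"
    show "vpr F F' i ** (vcomp D F F' F' ** pair V (vid D F' ** bang V W) f) = vpr F F' i ** f"
      unfolding vcomp_D(2) [OF F(1,2,2) i v(2) f] vp [OF i]
      by (rule C.vc_id_left) (use Fs i f F in simp_all)
  qed (use vcomp_D(1) [OF F(1,2,2)] v f F in simp_all)
  show "vcomp D F F F' ** pair V f (vid D F ** bang V W) = f"
  proof (rule vend_eqI [OF F])
    fix i assume i: "i \<in> vob I"
    show "vpr F F' i ** (vcomp D F F F' ** pair V f (vid D F ** bang V W)) = vpr F F' i ** f"
      unfolding vcomp_D(2) [OF F(1,1,2) i f v(1)] vp [OF i]
      by (rule C.vc_id_right) (use Fs i f F in simp_all)
  qed (use vcomp_D(1) [OF F(1,1,2)] v f F in simp_all)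
qed (use vid_D vcomp_D in \<open>simp_all del: Hom_iff\<close>)

end

sublocale funcat \<subseteq> D: vcat V "vfun_cat V I C"
  by unfold_locales (rule vcategory_D)

context funcat
begin

lemma vend_pr_vc [simp]:
  assumes F: "vfunctor V I C F" "vfunctor V I C F'" "vfunctor V I C F''"
    and i: "i \<in> vob I" and g: "g \<in> Arr V" "Cod V g = vhom D F' F''" "Dom V g = Dom V f"
    and f: "f \<in> Arr V" "Cod V f = vhom D F F'"
  shows "vpr F F'' i ** D.vc F F' F'' g f =
      C.vc (vfo F i) (vfo F' i) (vfo F'' i) (vpr F' F'' i ** g) (vpr F F' i ** f)"
  unfolding D.vc_def using vcomp_D(2) [OF F i, of g "Dom V f" f] g f by simp

lemma const_vfun_simps [simp]:
  "i \<in> vob I \<Longrightarrow> vfo (cdiag A) i = A"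
  "i \<in> vob I \<Longrightarrow> j \<in> vob I \<Longrightarrow> vfa (cdiag A) i j = vid C A ** bang V (vhom I i j)"
  by (simp_all add: const_vfun_def mk_vfun_def)

lemma const_vfunctor [simp]:
  assumes A: "A \<in> vob C"
  shows "vfunctor V I C (cdiag A)"
proof (rule vfunctorI)
  show "mk_vfun (vob I) (vfo (cdiag A)) (vfa (cdiag A)) = cdiag A"
    by (simp add: const_vfun_def mk_vfun_def restrict_def fun_eq_iff)
next
  fix i assume i: "i \<in> vob I"
  show "vfa (cdiag A) i i ** vid I i = vid C (vfo (cdiag A) i)"
    using i A by simp
next
  fix i j k W u v assume i: "i \<in> vob I" "j \<in> vob I" "k \<in> vob I" and u: "u \<in> W ~> vhom I i j"
    and v: "v \<in> W ~> vhom I j k"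
  have W: "W \<in> Obj V" using u Hom_Obj1 by blast
  have "C.vc A A A (vid C A ** bang V W) (vid C A ** bang V W) = vid C A ** bang V W"
    by (rule C.vc_id_left) (use A W in simp_all)
  then show "vfa (cdiag A) i k ** B.vc i j k v u =
    C.vc (vfo (cdiag A) i) (vfo (cdiag A) j) (vfo (cdiag A) k)
      (vfa (cdiag A) j k ** v) (vfa (cdiag A) i j ** u)"
    using i u v A W by simp
qed (use A in simp_all)

lemma vdiag_simps [simp]:
  assumes "A \<in> vob C"
  shows "vfo (vdiag V I C) A = cdiag A"
  using assms by (simp add: vdiag_def mk_vfun_def)

lemma vdiag_arr:
  assumes A: "A \<in> vob C" and B: "B \<in> vob C"
  shows "vfa (vdiag V I C) A B \<in> vhom C A B ~> vhom D (cdiag A) (cdiag B)" (is ?P)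
    "\<And>i. i \<in> vob I \<Longrightarrow> vpr (cdiag A) (cdiag B) i ** vfa (vdiag V I C) A B = Ident V (vhom C A B)"
proof -
  have "is_wedge V I C (cdiag A) (cdiag B) (vhom C A B) (\<lambda>_. Ident V (vhom C A B))"
    unfolding wedge_iff [OF const_vfunctor [OF A] const_vfunctor [OF B] C.vhom_Obj [OF A B]]
  proof (intro conjI ballI allI impI)
    fix i j W u k assume i: "i \<in> vob I" "j \<in> vob I" and u: "u \<in> W ~> vhom I i j" "k \<in> W ~> vhom C A B"
    have "C.vc A B B (vid C B ** bang V W) k = C.vc A A B k (vid C A ** bang V W)"
      using C.vc_id_left [OF A B u(2)] C.vc_id_right [OF A B u(2)] by simp
    then show "C.vc (vfo (cdiag A) i) (vfo (cdiag B) i) (vfo (cdiag B) j)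
         (vfa (cdiag B) i j ** u) (Ident V (vhom C A B) ** k) =
       C.vc (vfo (cdiag A) i) (vfo (cdiag A) j) (vfo (cdiag B) j)
         (Ident V (vhom C A B) ** k) (vfa (cdiag A) i j ** u)"
      using i u A B by simp
  qed (use A B in simp_all)
  from vend_lift [OF const_vfunctor [OF A] const_vfunctor [OF B] C.vhom_Obj [OF A B] this]
  show ?P
    "\<And>i. i \<in> vob I \<Longrightarrow> vpr (cdiag A) (cdiag B) i ** vfa (vdiag V I C) A B = Ident V (vhom C A B)"
    using A B by (simp_all add: vdiag_def mk_vfun_def del: Hom_iff)
qed

lemma vdiag_pr [simp]:
  assumes A: "A \<in> vob C" and B: "B \<in> vob C" and i: "i \<in> vob I" and f: "f \<in> Arr V" "Cod V f = vhom C A B"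
  shows "vpr (cdiag A) (cdiag B) i ** (vfa (vdiag V I C) A B ** f) = f"
  using comp_ext [OF vdiag_arr(2) [OF A B i], of f] vdiag_arr(1) [OF A B] assms by simp

end

sublocale funcat \<subseteq> Dg: two_vcats V C "vfun_cat V I C"
  by unfold_locales

context funcat
begin

lemma vdiag_vfunctor: "vfunctor V C D (vdiag V I C)"
proof (rule Dg.vfunctorI)
  show "mk_vfun (vob C) (vfo (vdiag V I C)) (vfa (vdiag V I C)) = vdiag V I C"
    by (simp add: vdiag_def mk_vfun_def restrict_def fun_eq_iff)
next
  fix A assume A: "A \<in> vob C"
  show "vfa (vdiag V I C) A A ** vid C A = vid D (vfo (vdiag V I C) A)"
    unfolding vdiag_simps [OF A]
    by (rule vend_eqI [of "cdiag A" "cdiag A" _ "pt"])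
      (use A vdiag_arr [OF A A] vid_D [of "cdiag A"] in simp_all)
next
  fix A B E W u v assume A: "A \<in> vob C" "B \<in> vob C" "E \<in> vob C" and u: "u \<in> W ~> vhom C A B"
    and v: "v \<in> W ~> vhom C B E"
  show "vfa (vdiag V I C) A E ** C.vc A B E v u = D.vc (vfo (vdiag V I C) A) (vfo (vdiag V I C) B) (vfo (vdiag V I C) E)
      (vfa (vdiag V I C) B E ** v) (vfa (vdiag V I C) A B ** u)"
    unfolding vdiag_simps [OF A(1)] vdiag_simps [OF A(2)] vdiag_simps [OF A(3)]
    by (rule vend_eqI [of "cdiag A" "cdiag E" _ W])
      (use A u v vdiag_arr(1) [OF A(1,2)] vdiag_arr(1) [OF A(2,3)] vdiag_arr(1) [OF A(1,3)] in simp_all)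
qed (use vdiag_arr in simp_all)

text \<open>
  The coproducts that define \<open>Int(C\<^sup>I)\<close> are indexed by functors, and these are families of maps between
  objects of \<open>V\<close>, which is locally small.
\<close>

lemma small_vfunctors: "small U (vob D)"
proof -
  define M where "M = (\<lambda>i j. \<Union>(A, B)\<in>vob C \<times> vob C. vhom I i j ~> vhom C A B)"
  have M: "small U (M i j)" if "i \<in> vob I" "j \<in> vob I" for i j
    unfolding M_def
  proof (rule small_UN [OF universe small_Times [OF universe smallC smallC]], clarify)
    fix A B assume "A \<in> vob C" "B \<in> vob C"
    then show "small U (vhom I i j ~> vhom C A B)"
      using locally_small that unfolding locally_small_def by (metis B.vhom_Obj C.vhom_Obj)
  qed
  define S where "S = PiE (vob I) (\<lambda>_. vob C) \<times> PiE (vob I) (\<lambda>i. PiE (vob I) (M i))"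
  have "small U S" unfolding S_def
    by (intro small_Times small_PiE universe smallI smallC M)
  moreover have "vob D \<lesssim> S"
    unfolding lepoll_def
  proof (intro exI conjI)
    show "inj_on (\<lambda>F. (vfo F, vfa F)) (vob D)" by (auto simp: inj_on_def intro: vfun.equality)
    show "(\<lambda>F. (vfo F, vfa F)) ` vob D \<subseteq> S"
    proof (clarify, unfold vob_D)
      fix F assume F: "vfunctor V I C F"
      note Fs = vfunctor_simps [OF F]
      have m: "mk_vfun (vob I) (vfo F) (vfa F) = F" using F by (simp add: vfunctor_def)
      then have "vfo F = restrict (vfo F) (vob I)" "vfa F = (\<lambda>i\<in>vob I. \<lambda>j\<in>vob I. vfa F i j)"
        by (metis mk_vfun_def vfun.select_convs)+
      moreover have "restrict (vfo F) (vob I) \<in> PiE (vob I) (\<lambda>_. vob C)" using Fs by auto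
      moreover have "(\<lambda>i\<in>vob I. \<lambda>j\<in>vob I. vfa F i j) \<in> PiE (vob I) (\<lambda>i. PiE (vob I) (M i))"
      proof -
        have "vfa F i j \<in> M i j" if "i \<in> vob I" "j \<in> vob I" for i j
          unfolding M_def using Fs that by (intro UN_I [of "(vfo F i, vfo F j)"]) simp_all
        then show ?thesis by auto
      qed
      ultimately show "(vfo F, vfa F) \<in> S" unfolding S_def by (metis mem_Sigma_iff)
    qed
  qed
  ultimately show ?thesis by (rule small_lepoll [rotated])
qed

end


subsection \<open>Limits\<close>

context ccc
begin

text \<open>The element of \<open>Y\<^sup>X\<close> that names a map \<open>X \<rightarrow> Y\<close>.\<close>

definition name_of :: "'o \<Rightarrow> 'm \<Rightarrow> 'm" where
  "name_of X f = curry_map V pt X (f ** pr2 V pt X)"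

lemma name_of_simps [simp]:
  assumes "f \<in> Arr V" "Dom V f = X"
  shows "name_of X f \<in> Arr V" "Dom V (name_of X f) = pt" "Cod V (name_of X f) = expo V X (Cod V f)"
    "\<And>w x Y. Cod V f = Y \<Longrightarrow> w \<in> Arr V \<Longrightarrow> Cod V w = pt \<Longrightarrow> x \<in> Arr V \<Longrightarrow> Cod V x = X \<Longrightarrow> Dom V w = Dom V x \<Longrightarrow>
      eval_map V X Y ** pair V (name_of X f ** w) x = f ** x"
  using assms Dom_Obj [OF assms(1)] by (simp_all add: name_of_def)

lemma name_of_inj:
  assumes "f \<in> X ~> Y" "g \<in> X ~> Y" "name_of X f = name_of X g"
  shows "f = g"
proof -
  have X: "X \<in> Obj V" using assms(1) Hom_Obj1 by blast
  have "eval_map V X Y ** pair V (name_of X f ** bang V X) (Ident V X) =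
    eval_map V X Y ** pair V (name_of X g ** bang V X) (Ident V X)" using assms by simp
  then show ?thesis using assms(1,2) X by simp
qed

lemma name_of_surj:
  assumes b: "b \<in> pt ~> expo V X Y" and o: "X \<in> Obj V" "Y \<in> Obj V"
  obtains f where "f \<in> X ~> Y" "b = name_of X f"
proof -
  define f where "f = eval_map V X Y ** pair V (b ** bang V X) (Ident V X)"
  have f: "f \<in> X ~> Y" using b o by (simp add: f_def)
  have "b = name_of X f"
    by (rule expo_eqI [of X Y _ "pt"]) (use f b o in \<open>simp_all add: f_def\<close>)
  then show ?thesis using that f by blast
qed

lemma vself_comp:
  assumes o: "X \<in> Obj V" "Y \<in> Obj V" "Z \<in> Obj V"
    and g: "g \<in> W ~> expo V Y Z" and f: "f \<in> W ~> expo V X Y"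
  shows "vcomp (vself V) X Y Z ** pair V g f \<in> W ~> expo V X Z"
    "\<And>a x T. a \<in> T ~> W \<Longrightarrow> x \<in> T ~> X \<Longrightarrow>
      eval_map V X Z ** pair V ((vcomp (vself V) X Y Z ** pair V g f) ** a) x =
      eval_map V Y Z ** pair V (g ** a) (eval_map V X Y ** pair V (f ** a) x)"
proof -
  let ?YZ = "expo V Y Z" and ?XY = "expo V X Y"
  let ?P = "prd V ?YZ ?XY"
  let ?m = "eval_map V Y Z ** pair V (pr1 V ?YZ ?XY ** pr1 V ?P X)
    (eval_map V X Y ** pair V (pr2 V ?YZ ?XY ** pr1 V ?P X) (pr2 V ?P X))"
  have m: "?m \<in> prd V ?P X ~> Z" using o by simp
  have c: "vcomp (vself V) X Y Z = curry_map V ?P X ?m" by (simp add: vself_def Let_def)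
  obtain n where n: "n = ?m" by blast
  have n1: "n \<in> prd V ?P X ~> Z" using m n by blast
  have n2: "n ** pair V (pair V g' f') x = eval_map V Y Z ** pair V g' (eval_map V X Y ** pair V f' x)"
    if "g' \<in> T ~> ?YZ" "f' \<in> T ~> ?XY" "x \<in> T ~> X" for T g' f' x
    unfolding n using that o by simp
  show "vcomp (vself V) X Y Z ** pair V g f \<in> W ~> expo V X Z"
    unfolding c n [symmetric] using n1 o g f by simp
  fix a x T assume ax: "a \<in> T ~> W" "x \<in> T ~> X"
  then show "eval_map V X Z ** pair V ((vcomp (vself V) X Y Z ** pair V g f) ** a) x =
      eval_map V Y Z ** pair V (g ** a) (eval_map V X Y ** pair V (f ** a) x)"
    unfolding c n [symmetric] using n1 n2 [of "g ** a" T "f ** a" x] o g f by simp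
qed

lemma vself_comp_names:
  assumes f: "f \<in> X ~> Y" and g: "g \<in> Y ~> Z"
  shows "vcomp (vself V) X Y Z ** pair V (name_of Y g) (name_of X f) = name_of X (g ** f)"
proof -
  have o: "X \<in> Obj V" "Y \<in> Obj V" "Z \<in> Obj V" using f g Hom_Obj1 Hom_Obj2 by blast+
  have n: "name_of Y g \<in> pt ~> expo V Y Z" "name_of X f \<in> pt ~> expo V X Y"
    using f g by simp_all
  note c = vself_comp [OF o n]
  let ?p = "pr1 V pt X" and ?q = "pr2 V pt X"
  have pq: "?p \<in> prd V pt X ~> pt" "?q \<in> prd V pt X ~> X"
    using o by simp_all
  show ?thesis
  proof (rule expo_eqI [of X Z _ "pt"])
    show "eval_map V X Z ** pair V ((vcomp (vself V) X Y Z ** pair V (name_of Y g) (name_of X f)) ** ?p) ?q =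
      eval_map V X Z ** pair V (name_of X (g ** f) ** ?p) ?q"
      unfolding c(2) [OF pq] using f g o by simp
  qed (use c(1) f g o in simp_all)
qed

end

context vcat
begin

text \<open>
  A family of maps is enriched natural between contravariant \<open>V\<close>-valued functors if it commutes with
  the actions of the generalised elements of the hom-objects.
\<close>

lemma vnat_names:
  assumes P: "\<And>A. A \<in> vob C \<Longrightarrow> vfo P A \<in> Obj V"
      "\<And>A B. A \<in> vob C \<Longrightarrow> B \<in> vob C \<Longrightarrow> vfa P A B \<in> vhom C B A ~> expo V (vfo P A) (vfo P B)"
    and Q: "\<And>A. A \<in> vob C \<Longrightarrow> vfo Q A \<in> Obj V"
      "\<And>A B. A \<in> vob C \<Longrightarrow> B \<in> vob C \<Longrightarrow> vfa Q A B \<in> vhom C B A ~> expo V (vfo Q A) (vfo Q B)"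
    and t: "\<And>A. A \<in> vob C \<Longrightarrow> t A \<in> vfo P A ~> vfo Q A"
    and n: "\<And>A B W u v. A \<in> vob C \<Longrightarrow> B \<in> vob C \<Longrightarrow> u \<in> W ~> vhom C B A \<Longrightarrow> v \<in> W ~> vfo P A \<Longrightarrow>
      eval_map V (vfo Q A) (vfo Q B) ** pair V (vfa Q A B ** u) (t A ** v) =
      t B ** (eval_map V (vfo P A) (vfo P B) ** pair V (vfa P A B ** u) v)"
  shows "vnat V (vop V C) (vself V) P Q (\<lambda>A. name_of (vfo P A) (t A))"
proof -
  have vo: "vob (vop V C) = vob C" "\<And>A B. vhom (vop V C) A B = vhom C B A" "vhom (vself V) = expo V"
    by (simp_all add: vop_def vself_def)
  show ?thesis unfolding vnat_def vo
  proof (intro conjI ballI)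
    fix A assume A: "A \<in> vob C"
    show "name_of (vfo P A) (t A) \<in> pt ~> expo V (vfo P A) (vfo Q A)" using t [OF A] by simp
  next
    fix A B assume A: "A \<in> vob C" and B: "B \<in> vob C"
    let ?PA = "vfo P A" and ?PB = "vfo P B" and ?QA = "vfo Q A" and ?QB = "vfo Q B" and ?X = "vhom C B A"
    let ?a = "name_of ?PA (t A) ** bang V ?X" and ?b = "name_of ?PB (t B) ** bang V ?X"
    have h: "vfa Q A B \<in> ?X ~> expo V ?QA ?QB" "?a \<in> ?X ~> expo V ?PA ?QA"
      "?b \<in> ?X ~> expo V ?PB ?QB" "vfa P A B \<in> ?X ~> expo V ?PA ?PB"
      using P(2) [OF A B] Q(2) [OF A B] t [OF A] t [OF B] A B by simp_all
    note c1 = vself_comp [OF P(1) [OF A] Q(1) [OF A] Q(1) [OF B] h(1,2)]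
    note c2 = vself_comp [OF P(1) [OF A] P(1) [OF B] Q(1) [OF B] h(3,4)]
    let ?p = "pr1 V ?X ?PA" and ?q = "pr2 V ?X ?PA"
    have pq: "?p \<in> prd V ?X ?PA ~> ?X" "?q \<in> prd V ?X ?PA ~> ?PA" using P(1) [OF A] A B by simp_all
    show "vcomp (vself V) ?PA ?QA ?QB ** pair V (vfa Q A B) ?a = vcomp (vself V) ?PA ?PB ?QB ** pair V ?b (vfa P A B)"
    proof (rule expo_eqI [of ?PA ?QB _ ?X])
      show "eval_map V ?PA ?QB ** pair V ((vcomp (vself V) ?PA ?QA ?QB ** pair V (vfa Q A B) ?a) ** ?p) ?q =
        eval_map V ?PA ?QB ** pair V ((vcomp (vself V) ?PA ?PB ?QB ** pair V ?b (vfa P A B)) ** ?p) ?q"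
        unfolding c1(2) [OF pq] c2(2) [OF pq]
        using n [OF A B pq] t [OF A] t [OF B] P(1) [OF A] P(1) [OF B] Q(1) [OF A] Q(1) [OF B] h A B by simp
    qed (use c1(1) c2(1) P(1) [OF A] Q(1) [OF B] in \<open>simp_all del: Hom_iff\<close>)
  qed
qed

lemma vhom_functor_simps:
  assumes L: "L \<in> vob C" and A: "A \<in> vob C" and B: "B \<in> vob C"
  shows "vfo (vhom_functor V C L) A = vhom C A L"
    "vfa (vhom_functor V C L) A B \<in> vhom C B A ~> expo V (vhom C A L) (vhom C B L)"
    "\<And>u y W. u \<in> W ~> vhom C B A \<Longrightarrow> y \<in> W ~> vhom C A L \<Longrightarrow>
      eval_map V (vhom C A L) (vhom C B L) ** pair V (vfa (vhom_functor V C L) A B ** u) y = vc B A L y u"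
  using assms by (simp_all add: vhom_functor_def mk_vfun_def vc_def)

end

locale cone_setup = funcat V U I C
  for V :: "('o, 'm) cat" (structure) and U :: "'u set"
    and I :: "('i, 'o, 'm) vcat" and C :: "('c, 'o, 'm) vcat" +
  fixes G :: "('i, 'c, 'm) vfun" and L :: 'c and l :: "'i \<Rightarrow> 'm"
  assumes G [simp]: "vfunctor V I C G" and L [simp]: "L \<in> vob C"
    and l: "vnat V I C (const_vfun V I C L) G l"
begin

abbreviation dg :: "'c \<Rightarrow> 'c \<Rightarrow> 'm" where
  "dg \<equiv> vfa (vdiag V I C)"

definition cone :: 'm where
  "cone = vnat_elem V I C (cdiag L) G l"

lemma cone_simps [simp]:
  "cone \<in> Arr V" "Dom V cone = pt" "Cod V cone = vhom D (cdiag L) G"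
proof -
  note Gs = vfunctor_simps [OF G]
  have l1: "l i \<in> pt ~> vhom C L (vfo G i)" if "i \<in> vob I" for i
    using l that by (simp add: vnat_def)
  have l2: "C.vc L (vfo G i) (vfo G j) (vfa G i j) (l i ** bang V (vhom I i j)) =
      C.vc L L (vfo G j) (l j ** bang V (vhom I i j)) (vid C L ** bang V (vhom I i j))"
    if i: "i \<in> vob I" "j \<in> vob I" for i j
  proof -
    have "vcomp C (vfo (cdiag L) i) (vfo G i) (vfo G j) ** pair V (vfa G i j) (l i ** bang V (vhom I i j)) =
        vcomp C (vfo (cdiag L) i) (vfo (cdiag L) j) (vfo G j) **
          pair V (l j ** bang V (vhom I i j)) (vfa (cdiag L) i j)"
      using l i unfolding vnat_def by blast
    then show ?thesis using i by (simp add: C.vc_def)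
  qed
  have "is_wedge V I C (cdiag L) G pt l"
    unfolding wedge_iff [OF const_vfunctor [OF L] G term_ob_Obj]
  proof (intro conjI ballI allI impI)
    fix i j W u k assume i: "i \<in> vob I" "j \<in> vob I" and u: "u \<in> W ~> vhom I i j" "k \<in> W ~> pt"
    have k: "k = bang V W" using u(2) by (simp add: bang_unique)
    have W: "W \<in> Obj V" using u Hom_Obj1 by blast
    have "C.vc L (vfo G i) (vfo G j) (vfa G i j) (l i ** bang V (vhom I i j)) ** u =
      C.vc L L (vfo G j) (l j ** bang V (vhom I i j)) (vid C L ** bang V (vhom I i j)) ** u"
      using l2 [OF i] by simp
    then show "C.vc (vfo (cdiag L) i) (vfo G i) (vfo G j) (vfa G i j ** u) (l i ** k) =
       C.vc (vfo (cdiag L) i) (vfo (cdiag L) j) (vfo G j) (l j ** k) (vfa (cdiag L) i j ** u)"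
      unfolding k using i u Gs l1 [OF i(1)] l1 [OF i(2)] W by simp
  qed (use l1 in simp)
  from vend_lift(1) [OF const_vfunctor [OF L] G term_ob_Obj this]
  show "cone \<in> Arr V" "Dom V cone = pt" "Cod V cone = vhom D (cdiag L) G"
    by (simp_all add: cone_def vnat_elem_def)
qed

text \<open>The map \<open>C(A,L) \<rightarrow> C\<^sup>I(\<Delta>A,G)\<close> given by composition with the cone.\<close>

definition cone_map :: "'c \<Rightarrow> 'm" where
  "cone_map A = D.vc (cdiag A) (cdiag L) G (cone ** bang V (vhom C A L)) (dg A L)"

lemma dg_simps [simp]:
  assumes "A \<in> vob C" "B \<in> vob C"
  shows "dg A B \<in> Arr V" "Dom V (dg A B) = vhom C A B" "Cod V (dg A B) = vhom D (cdiag A) (cdiag B)"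
  using vdiag_arr(1) [OF assms] by simp_all

lemma dg_vc:
  assumes "A \<in> vob C" "B \<in> vob C" "E \<in> vob C" "u \<in> W ~> vhom C A B" "v \<in> W ~> vhom C B E"
  shows "dg A E ** C.vc A B E v u = D.vc (cdiag A) (cdiag B) (cdiag E) (dg B E ** v) (dg A B ** u)"
  using Dg.vfunctor_comp [OF vdiag_vfunctor assms] assms by simp

lemma cone_map_simps [simp]:
  assumes A: "A \<in> vob C"
  shows "cone_map A \<in> Arr V" "Dom V (cone_map A) = vhom C A L" "Cod V (cone_map A) = vhom D (cdiag A) G"
    "\<And>f. f \<in> Arr V \<Longrightarrow> Cod V f = vhom C A L \<Longrightarrow>
      cone_map A ** f = D.vc (cdiag A) (cdiag L) G (cone ** bang V (Dom V f)) (dg A L ** f)"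
  using A by (simp_all add: cone_map_def)

lemma cone_map_natural:
  assumes A: "A \<in> vob C" and B: "B \<in> vob C" and u: "u \<in> W ~> vhom C B A" and v: "v \<in> W ~> vhom C A L"
  shows "D.vc (cdiag B) (cdiag A) G (cone_map A ** v) (dg B A ** u) = cone_map B ** C.vc B A L v u"
proof -
  have W: "W \<in> Obj V" using u Hom_Obj1 by blast
  have 1: "D.vc (cdiag B) (cdiag A) G (D.vc (cdiag A) (cdiag L) G (cone ** bang V W) (dg A L ** v)) (dg B A ** u) =
    D.vc (cdiag B) (cdiag L) G (cone ** bang V W) (D.vc (cdiag B) (cdiag A) (cdiag L) (dg A L ** v) (dg B A ** u))"
    by (rule D.vc_assoc) (use A B u v W in simp_all)
  show ?thesis using 1 A B u v W dg_vc [OF B A L u v] by simp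
qed

text \<open>
  The components of the transformation that corresponds to the cone by the Yoneda lemma are the names of the
  maps \<open>cone_map\<close>.  If these are invertible, the inverses are natural as well.
\<close>

lemma vlimit_iff: "vlimit V I C G L l \<longleftrightarrow> (\<forall>A\<in>vob C. iso V (cone_map A))"
proof -
  define R where "R = vfun_comp V (vop V C) (vhom_functor V D G) (vfun_op C (vdiag V I C))"
  let ?S = "vhom_functor V C L"
  have Rs: "vfo R A = vhom D (cdiag A) G" if "A \<in> vob C" for A
    using that by (simp add: R_def vfun_comp_def vfun_op_def vop_def mk_vfun_def vhom_functor_def)
  have Rf: "vfa R A B = vfa (vhom_functor V D G) (cdiag A) (cdiag B) ** dg B A" if "A \<in> vob C" "B \<in> vob C" for A B
    using that by (simp_all add: R_def vfun_comp_def vfun_op_def vop_def mk_vfun_def vhom_functor_def)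
  have Ra: "vfa R A B \<in> vhom C B A ~> expo V (vfo R A) (vfo R B)"
    "\<And>u y W. u \<in> W ~> vhom C B A \<Longrightarrow> y \<in> W ~> vfo R A \<Longrightarrow>
      eval_map V (vfo R A) (vfo R B) ** pair V (vfa R A B ** u) y = D.vc (cdiag B) (cdiag A) G y (dg B A ** u)"
    if A: "A \<in> vob C" and B: "B \<in> vob C" for A B
  proof -
    have d: "G \<in> vob D" "cdiag A \<in> vob D" "cdiag B \<in> vob D" using A B by simp_all
    note v = D.vhom_functor_simps [OF d]
    show "vfa R A B \<in> vhom C B A ~> expo V (vfo R A) (vfo R B)"
      using v(2) A B by (simp add: Rs Rf)
    fix u y W assume "u \<in> W ~> vhom C B A" "y \<in> W ~> vfo R A"
    then show "eval_map V (vfo R A) (vfo R B) ** pair V (vfa R A B ** u) y = D.vc (cdiag B) (cdiag A) G y (dg B A ** u)"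
      using v(2) v(3) [of "dg B A ** u" W y] A B by (simp add: Rs Rf)
  qed
  have So: "vfo ?S A = vhom C A L" if "A \<in> vob C" for A using C.vhom_functor_simps(1) [OF L that that] .
  have Y: "vyoneda V C R L cone A = name_of (vhom C A L) (cone_map A)" if A: "A \<in> vob C" for A
  proof -
    let ?X = "vhom C A L"
    let ?P = "prd V pt ?X" and ?q = "pr2 V pt ?X"
    have "eval_map V (vfo R L) (vfo R A) ** pair V (vfa R L A ** ?q) (cone ** bang V ?P) = cone_map A ** ?q"
      using A by (subst Ra(2) [OF L A, of _ ?P]) (simp_all add: Rs)
    moreover have "pair V (vfa R L A) (cone ** bang V ?X) ** ?q = pair V (vfa R L A ** ?q) (cone ** bang V ?P)"
      using Ra(1) [OF L A] A by simp
    ultimately show ?thesis unfolding vyoneda_def name_of_def by simp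
  qed
  have vidn: "vid (vself V) X = name_of X (Ident V X)" if "X \<in> Obj V" for X
    using that by (simp add: vself_def name_of_def)
  have vs: "vhom (vself V) = expo V" by (simp add: vself_def)
  have al: "vnat V (vop V C) (vself V) ?S R (\<lambda>A. name_of (vfo ?S A) (cone_map A))"
    by (rule C.vnat_names)
      (use C.vhom_functor_simps [OF L] Ra cone_map_natural in \<open>simp_all add: Rs So del: cone_map_simps(4)\<close>)
  have aY: "vnat V (vop V C) (vself V) ?S R (vyoneda V C R L cone)"
    using al Y So unfolding vnat_def by (simp add: vop_def)
  have "vlimit V I C G L l \<longleftrightarrow> vnat_iso V (vop V C) (vself V) ?S R (vyoneda V C R L cone)"
    unfolding vlimit_def vrepresentable_by_def R_def [symmetric] cone_def [symmetric]
    using Rs [OF L] by simp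
  also have "\<dots> \<longleftrightarrow> (\<forall>A\<in>vob C. iso V (cone_map A))"
  proof
    assume "vnat_iso V (vop V C) (vself V) ?S R (vyoneda V C R L cone)"
    then obtain \<beta> where b: "vnat V (vop V C) (vself V) R ?S \<beta>"
      and bi: "\<And>A. A \<in> vob C \<Longrightarrow> vcomp (vself V) (vfo ?S A) (vfo R A) (vfo ?S A) ** pair V (\<beta> A) (vyoneda V C R L cone A) =
          vid (vself V) (vfo ?S A) \<and>
        vcomp (vself V) (vfo R A) (vfo ?S A) (vfo R A) ** pair V (vyoneda V C R L cone A) (\<beta> A) = vid (vself V) (vfo R A)"
      unfolding vnat_iso_def by (auto simp: vop_def)
    show "\<forall>A\<in>vob C. iso V (cone_map A)"
    proof
      fix A assume A: "A \<in> vob C"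
      let ?X = "vhom C A L" and ?Y = "vhom D (cdiag A) G"
      have t: "cone_map A \<in> ?X ~> ?Y" using A by simp
      have "\<beta> A \<in> pt ~> expo V ?Y ?X"
        using b A unfolding vnat_def vs by (simp add: vop_def So Rs)
      then obtain f where f: "f \<in> ?Y ~> ?X" "\<beta> A = name_of ?Y f"
        using name_of_surj A by (metis C.vhom_Obj G L const_vfunctor vhom_D_Obj)
      have "name_of ?X (f ** cone_map A) = name_of ?X (Ident V ?X)"
        using bi [OF A] vself_comp_names [OF t f(1)] f(2) A by (simp add: Y So Rs vidn)
      then have 1: "f ** cone_map A = Ident V ?X"
        by (rule name_of_inj [rotated 2, of _ _ _ ?X]) (use t f(1) A in \<open>simp_all del: cone_map_simps(4)\<close>)
      have "name_of ?Y (cone_map A ** f) = name_of ?Y (Ident V ?Y)"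
        using bi [OF A] vself_comp_names [OF f(1) t] f(2) A
        by (simp add: Y So Rs vidn del: cone_map_simps(4))
      then have 2: "cone_map A ** f = Ident V ?Y"
        by (rule name_of_inj [rotated 2, of _ _ _ ?Y]) (use t f(1) A in \<open>simp_all del: cone_map_simps(4)\<close>)
      show "iso V (cone_map A)" by (rule isoI [OF t f(1) 1 2])
    qed
  next
    assume i: "\<forall>A\<in>vob C. iso V (cone_map A)"
    have "\<exists>f. f \<in> vhom D (cdiag A) G ~> vhom C A L \<and> f ** cone_map A = Ident V (vhom C A L) \<and>
        cone_map A ** f = Ident V (vhom D (cdiag A) G)" if A: "A \<in> vob C" for A
      by (rule isoE [of "cone_map A" "vhom C A L" "vhom D (cdiag A) G"])
        (use i A in \<open>auto simp del: cone_map_simps(4)\<close>)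
    then obtain f where f: "\<And>A. A \<in> vob C \<Longrightarrow> f A \<in> vhom D (cdiag A) G ~> vhom C A L"
      "\<And>A. A \<in> vob C \<Longrightarrow> f A ** cone_map A = Ident V (vhom C A L)"
      "\<And>A. A \<in> vob C \<Longrightarrow> cone_map A ** f A = Ident V (vhom D (cdiag A) G)" by metis
    have be: "vnat V (vop V C) (vself V) R ?S (\<lambda>A. name_of (vfo R A) (f A))"
    proof (rule C.vnat_names)
      fix A B W u v assume A: "A \<in> vob C" and B: "B \<in> vob C" and u: "u \<in> W ~> vhom C B A"
        and v: "v \<in> W ~> vfo R A"
      have v': "v \<in> W ~> vhom D (cdiag A) G" using v Rs [OF A] by simp
      have fv: "f A ** v \<in> W ~> vhom C A L" using f(1) [OF A] v' by simp
      let ?w = "C.vc B A L (f A ** v) u"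
      have w: "?w \<in> W ~> vhom C B L" using fv u A B by simp
      have "cone_map A ** (f A ** v) = v"
        using comp_ext [OF f(3) [OF A], of v] f(1) [OF A] v' A by (simp del: cone_map_simps(4))
      then have "D.vc (cdiag B) (cdiag A) G v (dg B A ** u) = cone_map B ** ?w"
        using cone_map_natural [OF A B u fv] by simp
      then have "f B ** D.vc (cdiag B) (cdiag A) G v (dg B A ** u) = f B ** (cone_map B ** ?w)" by simp
      also have "\<dots> = ?w"
        using comp_ext [OF f(2) [OF B], of ?w] f(1) [OF B] w B by (simp del: cone_map_simps(4))
      finally have "?w = f B ** D.vc (cdiag B) (cdiag A) G v (dg B A ** u)" by simp
      then show "eval_map V (vfo ?S A) (vfo ?S B) ** pair V (vfa ?S A B ** u) (f A ** v) =
        f B ** (eval_map V (vfo R A) (vfo R B) ** pair V (vfa R A B ** u) v)"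
        unfolding Ra(2) [OF A B u v] So [OF A] So [OF B] using C.vhom_functor_simps(3) [OF L A B u fv] by simp
    qed (use C.vhom_functor_simps [OF L] Ra f in \<open>simp_all add: Rs So\<close>)
    show "vnat_iso V (vop V C) (vself V) ?S R (vyoneda V C R L cone)"
      unfolding vnat_iso_def
    proof (intro conjI exI ballI)
      fix A assume "A \<in> vob (vop V C)"
      then have A: "A \<in> vob C" by (simp add: vop_def)
      let ?X = "vhom C A L" and ?Y = "vhom D (cdiag A) G"
      have t: "cone_map A \<in> ?X ~> ?Y" using A by simp
      show "vcomp (vself V) (vfo ?S A) (vfo R A) (vfo ?S A) ** pair V (name_of (vfo R A) (f A)) (vyoneda V C R L cone A) =
          vid (vself V) (vfo ?S A)"
        using vself_comp_names [OF t f(1) [OF A]] f(2) [OF A] A by (simp add: Y So Rs vidn)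
      show "vcomp (vself V) (vfo R A) (vfo ?S A) (vfo R A) ** pair V (vyoneda V C R L cone A) (name_of (vfo R A) (f A)) =
          vid (vself V) (vfo R A)"
        using vself_comp_names [OF f(1) [OF A] t] f(3) [OF A] A
        by (simp add: Y So Rs vidn del: cone_map_simps(4))
    qed (use aY be in blast)+
  qed
  finally show ?thesis .
qed

end


section \<open>Internal categories, elementwise\<close>

context ccc
begin

lemma Cat_Obj_iff: "A \<in> Obj CV \<longleftrightarrow> icategory V A"
  and Cat_Arr_iff: "F \<in> Arr CV \<longleftrightarrow> ifunctor V F"
  and Cat_Dom: "Dom CV F = idom F"
  and Cat_Cod: "Cod CV F = icod F"
  by (simp_all add: Cat_def)

lemma icat_simps [simp]:
  assumes "A \<in> Obj CV"
  shows "iob A \<in> Obj V" "iar A \<in> Obj V"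
    "isrc A \<in> Arr V" "Dom V (isrc A) = iar A" "Cod V (isrc A) = iob A"
    "itgt A \<in> Arr V" "Dom V (itgt A) = iar A" "Cod V (itgt A) = iob A"
    "iid A \<in> Arr V" "Dom V (iid A) = iob A" "Cod V (iid A) = iar A"
    "isrc A ** iid A = Ident V (iob A)" "itgt A ** iid A = Ident V (iob A)"
  using assms by (simp_all add: Cat_Obj_iff icategory_def)

lemma iid_comp [simp]:
  assumes "A \<in> Obj CV" "a \<in> Arr V" "Cod V a = iob A"
  shows "isrc A ** (iid A ** a) = a" "itgt A ** (iid A ** a) = a"
  using comp_ext [OF icat_simps(12) [OF assms(1)], of a] comp_ext [OF icat_simps(13) [OF assms(1)], of a] assms
  by simp_all

lemma ic_simps [simp]:
  assumes A: "A \<in> Obj CV" and "g \<in> Arr V" "f \<in> Arr V" "Dom V g = Dom V f" "Cod V g = iar A" "Cod V f = iar A"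
    "isrc A ** g = itgt A ** f"
  shows "ic A g f \<in> Arr V" "Dom V (ic A g f) = Dom V f" "Cod V (ic A g f) = iar A"
    "isrc A ** ic A g f = isrc A ** f" "itgt A ** ic A g f = itgt A ** g"
    "\<And>h. h \<in> Arr V \<Longrightarrow> Cod V h = Dom V f \<Longrightarrow> ic A g f ** h = ic A (g ** h) (f ** h)"
proof -
  have c: "icomp A \<in> pb V (isrc A) (itgt A) ~> iar A"
    "isrc A ** icomp A = isrc A ** pb2 V (isrc A) (itgt A)"
    "itgt A ** icomp A = itgt A ** pb1 V (isrc A) (itgt A)"
    using A unfolding Cat_Obj_iff icategory_def by blast+
  have p: "pb_pair V (isrc A) (itgt A) g f \<in> Dom V f ~> pb V (isrc A) (itgt A)"
    "pb1 V (isrc A) (itgt A) ** pb_pair V (isrc A) (itgt A) g f = g"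
    "pb2 V (isrc A) (itgt A) ** pb_pair V (isrc A) (itgt A) g f = f"
    using assms by simp_all
  show "ic A g f \<in> Arr V" "Dom V (ic A g f) = Dom V f" "Cod V (ic A g f) = iar A"
    using c(1) p(1) by (simp_all add: icompose_def)
  show "isrc A ** ic A g f = isrc A ** f" "itgt A ** ic A g f = itgt A ** g"
    using comp_ext [OF c(2), of "pb_pair V (isrc A) (itgt A) g f"]
      comp_ext [OF c(3), of "pb_pair V (isrc A) (itgt A) g f"] c(1) p A
    by (simp_all add: icompose_def)
  show "ic A g f ** h = ic A (g ** h) (f ** h)" if "h \<in> Arr V" "Cod V h = Dom V f" for h
    using c(1) assms that by (simp add: icompose_def)
qed

lemma ic_assoc:
  assumes A: "A \<in> Obj CV" and f: "f \<in> W ~> iar A" and g: "g \<in> W ~> iar A" and h: "h \<in> W ~> iar A"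
    and gf: "isrc A ** g = itgt A ** f" and hg: "isrc A ** h = itgt A ** g"
  shows "ic A (ic A h g) f = ic A h (ic A g f)"
proof -
  let ?s = "isrc A" and ?t = "itgt A"
  define g' where "g' = pb1 V ?s ?t"
  define f' where "f' = pb2 V ?s ?t"
  define k where "k = pb1 V (?s ** f') ?t"
  define r where "r = pb2 V (?s ** f') ?t"
  define Q where "Q = pb V (?s ** f') ?t"
  have g'f': "g' \<in> pb V ?s ?t ~> iar A" "f' \<in> pb V ?s ?t ~> iar A" "?s ** g' = ?t ** f'"
    using A pb_comm [of ?s ?t] by (simp_all add: g'_def f'_def)
  have kr: "k \<in> Q ~> pb V ?s ?t" "r \<in> Q ~> iar A" "?s ** (f' ** k) = ?t ** r"
    using A g'f' pb_comm [of "?s ** f'" ?t] by (simp_all add: k_def r_def Q_def)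
  have gk: "?s ** (g' ** k) = ?t ** (f' ** k)" using comp_ext [OF g'f'(3), of k] g'f' kr A by simp
  have "ic A (ic A (g' ** k) (f' ** k)) r = ic A (g' ** k) (ic A (f' ** k) r)"
    using A unfolding Cat_Obj_iff icategory_def Let_def g'_def f'_def k_def r_def by blast
  moreover define q where "q = pb_pair V ?s ?t h g"
  have q: "q \<in> W ~> pb V ?s ?t" "g' ** q = h" "f' ** q = g" using A h g hg by (simp_all add: q_def g'_def f'_def)
  moreover define x where "x = pb_pair V (?s ** f') ?t q f"
  have "(?s ** f') ** q = ?t ** f" using q gf g'f' A by simp
  then have x: "x \<in> W ~> Q" "k ** x = q" "r ** x = f"
    using A q f g'f' by (simp_all add: x_def k_def r_def Q_def)
  ultimately have "ic A (ic A (g' ** k) (f' ** k)) r ** x = ic A (g' ** k) (ic A (f' ** k) r) ** x"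
    by simp
  then show ?thesis using A g'f'(1,2) kr gk x q by simp
qed

lemma ic_id_left [simp]:
  assumes A: "A \<in> Obj CV" and f: "f \<in> Arr V" "Cod V f = iar A" and b: "b = itgt A ** f"
  shows "ic A (iid A ** b) f = f"
proof -
  have "ic A (iid A ** itgt A) (Ident V (iar A)) = Ident V (iar A)"
    using A unfolding Cat_Obj_iff icategory_def by blast
  then have "ic A (iid A ** itgt A) (Ident V (iar A)) ** f = Ident V (iar A) ** f" by simp
  then show ?thesis using A f b by simp
qed

lemma ic_id_right [simp]:
  assumes A: "A \<in> Obj CV" and f: "f \<in> Arr V" "Cod V f = iar A" and b: "b = isrc A ** f"
  shows "ic A f (iid A ** b) = f"
proof -
  have "ic A (Ident V (iar A)) (iid A ** isrc A) = Ident V (iar A)"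
    using A unfolding Cat_Obj_iff icategory_def by blast
  then have "ic A (Ident V (iar A)) (iid A ** isrc A) ** f = Ident V (iar A) ** f" by simp
  then show ?thesis using A f b by simp
qed

text \<open>
  By Yoneda, an internal category may be given by a composition of generalised elements that is
  natural in the stage.
\<close>

definition mk_icat :: "'o \<Rightarrow> 'o \<Rightarrow> 'm \<Rightarrow> 'm \<Rightarrow> 'm \<Rightarrow> ('m \<Rightarrow> 'm \<Rightarrow> 'm) \<Rightarrow> ('o, 'm) icat" where
  "mk_icat X R s t i m = \<lparr>iob = X, iar = R, isrc = s, itgt = t, iid = i, icomp = m (pb1 V s t) (pb2 V s t)\<rparr>"

lemma mk_icat_simps [simp]:
  "iob (mk_icat X R s t i m) = X" "iar (mk_icat X R s t i m) = R" "isrc (mk_icat X R s t i m) = s"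
  "itgt (mk_icat X R s t i m) = t" "iid (mk_icat X R s t i m) = i"
  by (simp_all add: mk_icat_def)

lemma mk_icat:
  assumes s: "s \<in> R ~> X" and t: "t \<in> R ~> X" and i: "i \<in> X ~> R"
    and si: "s ** i = Ident V X" "t ** i = Ident V X"
    and m: "\<And>W g f. g \<in> W ~> R \<Longrightarrow> f \<in> W ~> R \<Longrightarrow> s ** g = t ** f \<Longrightarrow>
      m g f \<in> W ~> R \<and> s ** m g f = s ** f \<and> t ** m g f = t ** g"
    and n: "\<And>W Z g f h. g \<in> W ~> R \<Longrightarrow> f \<in> W ~> R \<Longrightarrow> s ** g = t ** f \<Longrightarrow> h \<in> Z ~> W \<Longrightarrow>
      m g f ** h = m (g ** h) (f ** h)"
    and a: "\<And>W f g h. f \<in> W ~> R \<Longrightarrow> g \<in> W ~> R \<Longrightarrow> h \<in> W ~> R \<Longrightarrow> s ** g = t ** f \<Longrightarrow> s ** h = t ** g \<Longrightarrow>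
      m (m h g) f = m h (m g f)"
    and l: "\<And>W f. f \<in> W ~> R \<Longrightarrow> m (i ** (t ** f)) f = f"
    and r: "\<And>W f. f \<in> W ~> R \<Longrightarrow> m f (i ** (s ** f)) = f"
  shows "mk_icat X R s t i m \<in> Obj CV"
    and "\<And>W g f. g \<in> W ~> R \<Longrightarrow> f \<in> W ~> R \<Longrightarrow> s ** g = t ** f \<Longrightarrow> ic (mk_icat X R s t i m) g f = m g f"
proof -
  let ?A = "mk_icat X R s t i m"
  have st: "s \<in> Arr V" "t \<in> Arr V" "Cod V s = Cod V t" using s t by simp_all
  have o: "X \<in> Obj V" "R \<in> Obj V" using i Hom_Obj1 Hom_Obj2 by blast+
  let ?p = "pb1 V s t" and ?q = "pb2 V s t" and ?P = "pb V s t"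
  have pq: "?p \<in> ?P ~> R" "?q \<in> ?P ~> R" using pb_simps [OF st] s t by simp_all
  have mpq: "m ?p ?q \<in> ?P ~> R" "s ** m ?p ?q = s ** ?q" "t ** m ?p ?q = t ** ?p"
    using m [OF pq pb_comm [OF st]] by simp_all
  have c: "ic ?A g f = m g f" if g: "g \<in> W ~> R" and f: "f \<in> W ~> R" and e: "s ** g = t ** f" for W g f
  proof -
    have p: "pb_pair V s t g f \<in> W ~> ?P" "?p ** pb_pair V s t g f = g" "?q ** pb_pair V s t g f = f"
      using pb_pair_simps [OF st, of g f] g f e s t by simp_all
    then show ?thesis using n [OF pq pb_comm [OF st] p(1)] unfolding icompose_def by (simp add: mk_icat_def)
  qed
  then show "\<And>W g f. g \<in> W ~> R \<Longrightarrow> f \<in> W ~> R \<Longrightarrow> s ** g = t ** f \<Longrightarrow> ic ?A g f = m g f" .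
  define k where "k = pb1 V (s ** ?q) t"
  define u where "u = pb2 V (s ** ?q) t"
  define Q where "Q = pb V (s ** ?q) t"
  have sq: "s ** ?q \<in> Arr V" "t \<in> Arr V" "Cod V (s ** ?q) = Cod V t" "Dom V (s ** ?q) = ?P" "Dom V t = R"
    using s t pq by simp_all
  have ku: "k \<in> Q ~> ?P" "u \<in> Q ~> R" "(s ** ?q) ** k = t ** u"
    using pb_simps [OF sq(1-3)] pb_comm [OF sq(1-3)] sq by (simp_all add: k_def u_def Q_def)
  have kk: "?p ** k \<in> Q ~> R" "?q ** k \<in> Q ~> R" "s ** (?q ** k) = t ** u" using ku pq s by simp_all
  have k3: "s ** (?p ** k) = t ** (?q ** k)" using comp_ext [OF pb_comm [OF st], of k] pq ku s t by simp
  have mk: "m (?p ** k) (?q ** k) \<in> Q ~> R" "s ** m (?p ** k) (?q ** k) = s ** (?q ** k)"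
    "m (?q ** k) u \<in> Q ~> R" "t ** m (?q ** k) u = t ** (?q ** k)"
    using m [OF kk(1,2) k3] m [OF kk(2) ku(2) kk(3)] by blast+
  have A1: "ic ?A (ic ?A (?p ** k) (?q ** k)) u = ic ?A (?p ** k) (ic ?A (?q ** k) u)"
    unfolding c [OF kk(1,2) k3] c [OF kk(2) ku(2) kk(3)]
    by (subst c [OF mk(1) ku(2)], (simp add: mk(2) kk(3)), subst c [OF kk(1) mk(3)], (simp add: mk(4) k3),
        rule a [OF ku(2) kk(2,1,3) k3])
  have it: "i ** t \<in> R ~> R" "i ** s \<in> R ~> R" using i s t by simp_all
  have st1: "s ** (i ** t) = t ** Ident V R" "s ** Ident V R = t ** (i ** s)"
    using comp_ext [OF si(1), of t] comp_ext [OF si(2), of s] i s t by simp_all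
  have IR: "Ident V R \<in> R ~> R" using o by simp
  have A2: "ic ?A (i ** t) (Ident V R) = Ident V R" "ic ?A (Ident V R) (i ** s) = Ident V R"
    unfolding c [OF it(1) IR st1(1)] c [OF IR it(2) st1(2)]
    using l [OF IR] r [OF IR] s t by simp_all
  show "?A \<in> Obj CV"
    unfolding Cat_Obj_iff icategory_def mk_icat_simps Let_def
    using s t i si o mpq A1 A2 by (simp add: mk_icat_def k_def u_def)
qed

lemma ifun_simps [simp]:
  assumes F: "F \<in> Arr CV"
  shows "if0 F \<in> Arr V" "Dom V (if0 F) = iob (Dom CV F)" "Cod V (if0 F) = iob (Cod CV F)"
    "if1 F \<in> Arr V" "Dom V (if1 F) = iar (Dom CV F)" "Cod V (if1 F) = iar (Cod CV F)"
    "Dom CV F \<in> Obj CV" "Cod CV F \<in> Obj CV"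
  using F by (simp_all add: Cat_Arr_iff ifunctor_def Let_def Cat_Dom Cat_Cod Cat_Obj_iff)

lemma ifun_src [simp]:
  assumes F: "F \<in> Arr CV" and B: "Cod CV F = B"
  shows "isrc B ** if1 F = if0 F ** isrc (Dom CV F)" "itgt B ** if1 F = if0 F ** itgt (Dom CV F)"
  using F unfolding B [symmetric] Cat_Arr_iff ifunctor_def Let_def Cat_Dom Cat_Cod by blast+

lemma ifun_id [simp]:
  assumes F: "F \<in> Arr CV" and A: "Dom CV F = A"
  shows "if1 F ** iid A = iid (Cod CV F) ** if0 F"
  using F unfolding A [symmetric] Cat_Arr_iff ifunctor_def Let_def Cat_Dom Cat_Cod by blast

lemma ifun_src_comp [simp]:
  assumes F: "F \<in> Arr CV" and B: "Cod CV F = B" and u: "u \<in> Arr V" "Cod V u = iar (Dom CV F)"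
  shows "isrc B ** (if1 F ** u) = if0 F ** (isrc (Dom CV F) ** u)"
    "itgt B ** (if1 F ** u) = if0 F ** (itgt (Dom CV F) ** u)"
  using comp_ext [OF ifun_src(1) [OF F B], of u] comp_ext [OF ifun_src(2) [OF F B], of u] F B u
  by auto

lemma ifun_id_comp [simp]:
  assumes F: "F \<in> Arr CV" and A: "Dom CV F = A" and a: "a \<in> Arr V" "Cod V a = iob A"
  shows "if1 F ** (iid A ** a) = iid (Cod CV F) ** (if0 F ** a)"
  using comp_ext [OF ifun_id [OF F A], of a] F A a by auto

lemma ifun_comp [simp]:
  assumes F: "F \<in> Arr CV" and A: "Dom CV F = A" and gf: "g \<in> Arr V" "f \<in> Arr V" "Dom V g = Dom V f"
    "Cod V g = iar A" "Cod V f = iar A" "isrc A ** g = itgt A ** f"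
  shows "if1 F ** ic A g f = ic (Cod CV F) (if1 F ** g) (if1 F ** f)"
proof -
  let ?B = "Cod CV F" and ?s = "isrc A" and ?t = "itgt A"
  have o: "A \<in> Obj CV" "?B \<in> Obj CV" using F A by auto
  have c: "icomp A \<in> pb V ?s ?t ~> iar A" using o unfolding Cat_Obj_iff icategory_def by blast
  have e: "if1 F ** icomp A = ic ?B (if1 F ** pb1 V ?s ?t) (if1 F ** pb2 V ?s ?t)"
    using F unfolding A [symmetric] Cat_Arr_iff ifunctor_def Let_def Cat_Dom Cat_Cod by blast
  let ?x = "pb_pair V ?s ?t g f"
  have x: "?x \<in> Dom V f ~> pb V ?s ?t" "pb1 V ?s ?t ** ?x = g" "pb2 V ?s ?t ** ?x = f" using o gf by simp_all
  have s: "isrc ?B ** (if1 F ** pb1 V ?s ?t) = itgt ?B ** (if1 F ** pb2 V ?s ?t)"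
    using o F A pb_comm [of ?s ?t] by simp
  have "if1 F ** ic A g f = (if1 F ** icomp A) ** ?x"
    unfolding icompose_def using c x F A by simp
  also have "\<dots> = ic ?B (if1 F ** pb1 V ?s ?t) (if1 F ** pb2 V ?s ?t) ** ?x" unfolding e ..
  also have "\<dots> = ic ?B (if1 F ** g) (if1 F ** f)" using s o F A x by simp
  finally show ?thesis .
qed

lemma ifunctorI:
  assumes A: "A \<in> Obj CV" and B: "B \<in> Obj CV" and f0: "f0 \<in> iob A ~> iob B" and f1: "f1 \<in> iar A ~> iar B"
    and s: "isrc B ** f1 = f0 ** isrc A" "itgt B ** f1 = f0 ** itgt A" and i: "f1 ** iid A = iid B ** f0"
    and c: "\<And>W g f. g \<in> W ~> iar A \<Longrightarrow> f \<in> W ~> iar A \<Longrightarrow> isrc A ** g = itgt A ** f \<Longrightarrow>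
      f1 ** ic A g f = ic B (f1 ** g) (f1 ** f)"
  shows "\<lparr>idom = A, icod = B, if0 = f0, if1 = f1\<rparr> \<in> Hom CV A B"
proof -
  let ?p = "pb1 V (isrc A) (itgt A)" and ?q = "pb2 V (isrc A) (itgt A)"
  have "f1 ** ic A ?p ?q = ic B (f1 ** ?p) (f1 ** ?q)"
    by (rule c [of _ "pb V (isrc A) (itgt A)"]) (use A pb_comm [of "isrc A" "itgt A"] in simp_all)
  moreover have "ic A ?p ?q = icomp A"
  proof -
    have "icomp A \<in> pb V (isrc A) (itgt A) ~> iar A"
      using A unfolding Cat_Obj_iff icategory_def by blast
    then show ?thesis using A by (simp add: icompose_def)
  qed
  ultimately show ?thesis
    unfolding Hom_iff Cat_Arr_iff ifunctor_def Cat_Dom Cat_Cod ifun.simps Let_def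
    using assms(1-7) Cat_Obj_iff by simp
qed

lemma ifun_eqI:
  assumes "F \<in> Hom CV A B" "G \<in> Hom CV A B" "if0 F = if0 G" "if1 F = if1 G"
  shows "F = G"
  using assms by (simp add: Cat_Dom Cat_Cod ifun.equality)

lemma Cat_comp_simps [simp]:
  "if0 (G \<odot> F) = if0 G ** if0 F" "if1 (G \<odot> F) = if1 G ** if1 F"
  "if0 (Ident CV A) = Ident V (iob A)" "if1 (Ident CV A) = Ident V (iar A)"
  by (simp_all add: Cat_def)

lemma category_Cat: "category CV"
proof -
  have c: "G \<odot> F \<in> Hom CV X Z" if F: "F \<in> Hom CV X Y" and G: "G \<in> Hom CV Y Z" for F G X Y Z
  proof -
    have "G \<odot> F = \<lparr>idom = X, icod = Z, if0 = if0 G ** if0 F, if1 = if1 G ** if1 F\<rparr>"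
      using F G by (simp add: Cat_def)
    also have "\<dots> \<in> Hom CV X Z"
    proof (rule ifunctorI)
      fix W g f assume gf: "g \<in> W ~> iar X" "f \<in> W ~> iar X" "isrc X ** g = itgt X ** f"
      have X: "X \<in> Obj CV" "Y \<in> Obj CV" using F by auto
      show "(if1 G ** if1 F) ** ic X g f = ic Z ((if1 G ** if1 F) ** g) ((if1 G ** if1 F) ** f)"
        using gf X F G by simp
    next
      have X: "X \<in> Obj CV" "Y \<in> Obj CV" "Z \<in> Obj CV" using F G by auto
      have FF: "isrc Y ** if1 F = if0 F ** isrc X" "itgt Y ** if1 F = if0 F ** itgt X" "if1 F ** iid X = iid Y ** if0 F"
        using ifun_src [of F Y] ifun_id [of F X] F by simp_all
      show "isrc Z ** (if1 G ** if1 F) = (if0 G ** if0 F) ** isrc X" "itgt Z ** (if1 G ** if1 F) = (if0 G ** if0 F) ** itgt X"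
        "(if1 G ** if1 F) ** iid X = iid Z ** (if0 G ** if0 F)"
        using F G X FF by simp_all
    qed (use F G in auto)
    finally show ?thesis .
  qed
  have i: "Ident CV X \<in> Hom CV X X" if X: "X \<in> Obj CV" for X
  proof -
    have "Ident CV X = \<lparr>idom = X, icod = X, if0 = Ident V (iob X), if1 = Ident V (iar X)\<rparr>" by (simp add: Cat_def)
    also have "\<dots> \<in> Hom CV X X" by (rule ifunctorI) (use X in simp_all)
    finally show ?thesis .
  qed
  show ?thesis unfolding category_def
  proof (intro conjI ballI allI)
    fix X Y F assume F: "F \<in> Hom CV X Y"
    then have XY: "X \<in> Obj CV" "Y \<in> Obj CV" by auto
    show "Ident CV Y \<odot> F = F" by (rule ifun_eqI [OF c [OF F i] F]) (use F XY in simp_all)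
    show "F \<odot> Ident CV X = F" by (rule ifun_eqI [OF c [OF i F] F]) (use F XY in simp_all)
  next
    fix W X Y Z F G H assume F: "F \<in> Hom CV W X" and G: "G \<in> Hom CV X Y" and H: "H \<in> Hom CV Y Z"
    show "(H \<odot> G) \<odot> F = H \<odot> (G \<odot> F)"
      by (rule ifun_eqI [OF c [OF F c [OF G H]] c [OF c [OF F G] H]]) (use F G H in simp_all)
  qed (use c i ifun_simps(7,8) in blast)+
qed

end

sublocale ccc \<subseteq> Cat: cat "Cat V"
  by unfold_locales (rule category_Cat)

context ccc
begin

lemma Cat_iso_components:
  assumes F: "F \<in> Hom CV A B" and i: "iso CV F"
  shows "iso V (if0 F)" "iso V (if1 F)"
proof -
  obtain G where G: "G \<in> Hom CV B A" "G \<odot> F = Ident CV A" "F \<odot> G = Ident CV B"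
    using Cat.isoE [OF i F] by metis
  have "if0 (G \<odot> F) = Ident V (iob A)" "if0 (F \<odot> G) = Ident V (iob B)"
    "if1 (G \<odot> F) = Ident V (iar A)" "if1 (F \<odot> G) = Ident V (iar B)"
    unfolding G(2,3) by simp_all
  then show "iso V (if0 F)" "iso V (if1 F)"
    using F G(1) by (auto intro: isoI [of "if0 F" "iob A" "iob B" "if0 G"] isoI [of "if1 F" "iar A" "iar B" "if1 G"])
qed

text \<open>The inverses on objects and on arrows respect the structure because the given maps do.\<close>

lemma Cat_isoI:
  assumes F: "F \<in> Hom CV A B" and i: "iso V (if0 F)" "iso V (if1 F)"
  shows "iso CV F"
proof -
  have o: "A \<in> Obj CV" "B \<in> Obj CV" using F Cat.Hom_Obj1 Cat.Hom_Obj2 by blast+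
  have F01: "if0 F \<in> iob A ~> iob B" "if1 F \<in> iar A ~> iar B" using F by simp_all
  obtain g0 where g0: "g0 \<in> iob B ~> iob A" "g0 ** if0 F = Ident V (iob A)" "if0 F ** g0 = Ident V (iob B)"
    using isoE [OF i(1) F01(1)] by metis
  obtain g1 where g1: "g1 \<in> iar B ~> iar A" "g1 ** if1 F = Ident V (iar A)" "if1 F ** g1 = Ident V (iar B)"
    using isoE [OF i(2) F01(2)] by metis
  have e0: "if0 F ** (g0 ** x) = x" if "x \<in> W ~> iob B" for x W
    using comp_ext [OF g0(3), of x] F01 g0(1) that by simp
  have e1: "if1 F ** (g1 ** x) = x" if "x \<in> W ~> iar B" for x W
    using comp_ext [OF g1(3), of x] F01 g1(1) that by simp
  let ?G = "\<lparr>idom = B, icod = A, if0 = g0, if1 = g1\<rparr>"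
  note c0 = iso_cancel_left [OF i(1)] and c1 = iso_cancel_left [OF i(2)]
  have G: "?G \<in> Hom CV B A"
  proof (rule ifunctorI [OF o(2,1) g0(1) g1(1)])
    have "if0 F ** (isrc A ** g1) = isrc B ** (if1 F ** g1)" "if0 F ** (itgt A ** g1) = itgt B ** (if1 F ** g1)"
      using F g1(1) by simp_all
    moreover have "isrc B ** (if1 F ** g1) = isrc B" "itgt B ** (if1 F ** g1) = itgt B" unfolding g1(3) using o by simp_all
    ultimately have e: "if0 F ** (isrc A ** g1) = if0 F ** (g0 ** isrc B)" "if0 F ** (itgt A ** g1) = if0 F ** (g0 ** itgt B)"
      using e0 [of "isrc B" "iar B"] e0 [of "itgt B" "iar B"] o by simp_all
    show "isrc A ** g1 = g0 ** isrc B" by (rule c0 [OF e(1), of "iar B"]) (use g1(1) g0(1) F o in simp_all)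
    show "itgt A ** g1 = g0 ** itgt B" by (rule c0 [OF e(2), of "iar B"]) (use g1(1) g0(1) F o in simp_all)
    have "if1 F ** (g1 ** iid B) = iid B" "if1 F ** (iid A ** g0) = iid B"
      using e1 [of "iid B" "iob B"] g0 F o by simp_all
    then have e: "if1 F ** (g1 ** iid B) = if1 F ** (iid A ** g0)" by metis
    show "g1 ** iid B = iid A ** g0" by (rule c1 [OF e, of "iob B"]) (use g1(1) g0(1) F o in simp_all)
    fix W g f assume gf: "g \<in> W ~> iar B" "f \<in> W ~> iar B" "isrc B ** g = itgt B ** f"
    have s: "isrc A ** (g1 ** g) = itgt A ** (g1 ** f)"
    proof (rule c0 [of _ _ W])
      have "if0 F ** (isrc A ** (g1 ** g)) = isrc B ** (if1 F ** (g1 ** g))"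
        "if0 F ** (itgt A ** (g1 ** f)) = itgt B ** (if1 F ** (g1 ** f))" using F g1(1) gf by simp_all
      then show "if0 F ** (isrc A ** (g1 ** g)) = if0 F ** (itgt A ** (g1 ** f))"
        using e1 [OF gf(1)] e1 [OF gf(2)] gf(3) by simp
    qed (use g1(1) gf F o in simp_all)
    show "g1 ** ic B g f = ic A (g1 ** g) (g1 ** f)"
    proof (rule c1 [of _ _ W])
      have "if1 F ** (g1 ** ic B g f) = ic B g f" using gf o by (intro e1) simp
      then show "if1 F ** (g1 ** ic B g f) = if1 F ** ic A (g1 ** g) (g1 ** f)"
        using s F g1(1) gf o e1 [OF gf(1)] e1 [OF gf(2)] by simp
    qed (use g1(1) gf F o s in simp_all)
  qed
  have "?G \<odot> F = Ident CV A"
    by (rule ifun_eqI [of _ A A]) (use F G o g0 g1 in simp_all)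
  moreover have "F \<odot> ?G = Ident CV B"
    by (rule ifun_eqI [of _ B B]) (use F G o g0 g1 in simp_all)
  ultimately show ?thesis by (rule Cat.isoI [OF F G])
qed

lemma Cat_iso_iff:
  "F \<in> Hom CV A B \<Longrightarrow> iso CV F \<longleftrightarrow> iso V (if0 F) \<and> iso V (if1 F)"
  using Cat_iso_components Cat_isoI by blast

end


subsection \<open>Limits of internal categories\<close>

context ccc
begin

lemma cst_simps [simp]:
  "iob (cst V X) = X" "iar (cst V X) = X" "isrc (cst V X) = Ident V X" "itgt (cst V X) = Ident V X"
  "iid (cst V X) = Ident V X" "iob (ione V) = pt" "iar (ione V) = pt"
  "isrc (ione V) = Ident V pt" "itgt (ione V) = Ident V pt"
  "iid (ione V) = Ident V pt"
  by (simp_all add: cst_def ione_def)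

lemma cst_icat [simp]:
  assumes X: "X \<in> Obj V"
  shows "cst V X \<in> Obj CV"
    and "\<And>g f. g \<in> Arr V \<Longrightarrow> Cod V g = X \<Longrightarrow> f = g \<Longrightarrow> ic (cst V X) g f = g"
proof -
  have c: "cst V X = mk_icat X X (Ident V X) (Ident V X) (Ident V X) (\<lambda>g f. g)"
    by (simp add: cst_def mk_icat_def)
  have "mk_icat X X (Ident V X) (Ident V X) (Ident V X) (\<lambda>g f. g) \<in> Obj CV"
    by (rule mk_icat(1)) (use X in simp_all)
  then show "cst V X \<in> Obj CV" unfolding c .
  fix g f assume g: "g \<in> Arr V" "Cod V g = X" "f = g"
  have "ic (mk_icat X X (Ident V X) (Ident V X) (Ident V X) (\<lambda>g f. g)) g f = g"
    by (rule mk_icat(2) [of _ X X _ _ _ _ "Dom V g"]) (use g X in simp_all)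
  then show "ic (cst V X) g f = g" unfolding c .
qed

lemma ione_icat [simp]: "ione V \<in> Obj CV"
  by (simp add: ione_def)

lemma ibang_Hom [simp]:
  assumes A: "A \<in> Obj CV"
  shows "ibang V A \<in> Arr CV" "Dom CV (ibang V A) = A" "Cod CV (ibang V A) = ione V"
    "if0 (ibang V A) = bang V (iob A)" "if1 (ibang V A) = bang V (iar A)"
proof -
  have "\<lparr>idom = A, icod = ione V, if0 = bang V (iob A), if1 = bang V (iar A)\<rparr> \<in> Hom CV A (ione V)"
  proof (rule ifunctorI)
    fix W g f assume "g \<in> W ~> iar A" "f \<in> W ~> iar A" "isrc A ** g = itgt A ** f"
    moreover from this have "W \<in> Obj V" using Hom_Obj1 by blast
    ultimately show "bang V (iar A) ** ic A g f = ic (ione V) (bang V (iar A) ** g) (bang V (iar A) ** f)"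
      using A by (simp add: ione_def)
  qed (use A in simp_all)
  then show "ibang V A \<in> Arr CV" "Dom CV (ibang V A) = A" "Cod CV (ibang V A) = ione V"
    by (simp_all add: ibang_def)
  show "if0 (ibang V A) = bang V (iob A)" "if1 (ibang V A) = bang V (iar A)" by (simp_all add: ibang_def)
qed

text \<open>
  The structure maps of the componentwise pullback are induced by those of \<open>A\<close> and \<open>B\<close>, and equations between
  them are checked after the two projections.
\<close>

lemma Cat_pullback_exists:
  assumes F: "F \<in> Hom CV A C" and G: "G \<in> Hom CV B C"
  obtains P p q where "is_pullback CV F G (P, p, q)"
    "is_pullback V (if0 F) (if0 G) (iob P, if0 p, if0 q)" "is_pullback V (if1 F) (if1 G) (iar P, if1 p, if1 q)"
proof -
  have o: "A \<in> Obj CV" "B \<in> Obj CV" "C \<in> Obj CV" using F G Cat.Hom_Obj1 Cat.Hom_Obj2 by blast+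
  have FG: "F \<in> Arr CV" "Dom CV F = A" "Cod CV F = C" "G \<in> Arr CV" "Dom CV G = B" "Cod CV G = C"
    using F G by simp_all
  define X where "X = pb V (if0 F) (if0 G)"
  define R where "R = pb V (if1 F) (if1 G)"
  define p0 where "p0 = pb1 V (if0 F) (if0 G)"
  define q0 where "q0 = pb2 V (if0 F) (if0 G)"
  define p1 where "p1 = pb1 V (if1 F) (if1 G)"
  define q1 where "q1 = pb2 V (if1 F) (if1 G)"
  define h0 where "h0 = pb_pair V (if0 F) (if0 G)"
  define h1 where "h1 = pb_pair V (if1 F) (if1 G)"
  have t [simp]: "X \<in> Obj V" "R \<in> Obj V" "p0 \<in> Arr V" "Dom V p0 = X" "Cod V p0 = iob A" "q0 \<in> Arr V" "Dom V q0 = X"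
    "Cod V q0 = iob B" "p1 \<in> Arr V" "Dom V p1 = R" "Cod V p1 = iar A" "q1 \<in> Arr V" "Dom V q1 = R" "Cod V q1 = iar B"
    using FG by (simp_all add: X_def R_def p0_def q0_def p1_def q1_def)
  have pc0: "if0 F ** (p0 ** x) = if0 G ** (q0 ** x)" if "x \<in> W ~> X" for x W
    using pb_comm_comp [of "if0 F" "if0 G" x] FG that by (simp add: p0_def q0_def X_def)
  have pc1: "if1 F ** (p1 ** x) = if1 G ** (q1 ** x)" if "x \<in> W ~> R" for x W
    using pb_comm_comp [of "if1 F" "if1 G" x] FG that by (simp add: p1_def q1_def R_def)
  have h0: "h0 a b \<in> W ~> X" "p0 ** h0 a b = a" "q0 ** h0 a b = b"
    "\<And>k Z. k \<in> Z ~> W \<Longrightarrow> h0 a b ** k = h0 (a ** k) (b ** k)"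
    if "a \<in> W ~> iob A" "b \<in> W ~> iob B" "if0 F ** a = if0 G ** b" for a b W
    using FG that by (simp_all add: h0_def p0_def q0_def X_def)
  have h1: "h1 a b \<in> W ~> R" "p1 ** h1 a b = a" "q1 ** h1 a b = b"
    "\<And>k Z. k \<in> Z ~> W \<Longrightarrow> h1 a b ** k = h1 (a ** k) (b ** k)"
    if "a \<in> W ~> iar A" "b \<in> W ~> iar B" "if1 F ** a = if1 G ** b" for a b W
    using FG that by (simp_all add: h1_def p1_def q1_def R_def)
  have e0: "x = y" if "x \<in> W ~> X" "y \<in> W ~> X" "p0 ** x = p0 ** y" "q0 ** x = q0 ** y" for x y W
    by (rule pb_eqI [of "if0 F" "if0 G" _ W]) (use FG that in \<open>simp_all add: p0_def q0_def X_def\<close>)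
  have e1: "x = y" if "x \<in> W ~> R" "y \<in> W ~> R" "p1 ** x = p1 ** y" "q1 ** x = q1 ** y" for x y W
    by (rule pb_eqI [of "if1 F" "if1 G" _ W]) (use FG that in \<open>simp_all add: p1_def q1_def R_def\<close>)
  have s1: "if0 F ** (isrc A ** (p1 ** x)) = if0 G ** (isrc B ** (q1 ** x))"
    "if0 F ** (itgt A ** (p1 ** x)) = if0 G ** (itgt B ** (q1 ** x))" if x: "x \<in> W ~> R" for x W
  proof -
    have "isrc C ** (if1 F ** (p1 ** x)) = isrc C ** (if1 G ** (q1 ** x))"
      "itgt C ** (if1 F ** (p1 ** x)) = itgt C ** (if1 G ** (q1 ** x))" using pc1 [OF x] by simp_all
    then show "if0 F ** (isrc A ** (p1 ** x)) = if0 G ** (isrc B ** (q1 ** x))"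
      "if0 F ** (itgt A ** (p1 ** x)) = if0 G ** (itgt B ** (q1 ** x))" using FG x o by simp_all
  qed
  define s where "s = h0 (isrc A ** p1) (isrc B ** q1)"
  define u where "u = h0 (itgt A ** p1) (itgt B ** q1)"
  define i where "i = h1 (iid A ** p0) (iid B ** q0)"
  define m where "m = (\<lambda>g f. h1 (ic A (p1 ** g) (p1 ** f)) (ic B (q1 ** g) (q1 ** f)))"
  have IR: "Ident V R \<in> R ~> R" "Ident V X \<in> X ~> X" by simp_all
  have s: "s \<in> R ~> X" "p0 ** s = isrc A ** p1" "q0 ** s = isrc B ** q1"
    unfolding s_def using s1(1) [OF IR(1)] o by (intro h0; simp)+
  have u: "u \<in> R ~> X" "p0 ** u = itgt A ** p1" "q0 ** u = itgt B ** q1"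
    unfolding u_def using s1(2) [OF IR(1)] o by (intro h0; simp)+
  have i: "i \<in> X ~> R" "p1 ** i = iid A ** p0" "q1 ** i = iid B ** q0"
    unfolding i_def using pc0 [OF IR(2)] o FG by (intro h1; simp)+
  have sx: "p0 ** (s ** x) = isrc A ** (p1 ** x)" "q0 ** (s ** x) = isrc B ** (q1 ** x)"
    "p0 ** (u ** x) = itgt A ** (p1 ** x)" "q0 ** (u ** x) = itgt B ** (q1 ** x)" if "x \<in> W ~> R" for x W
    using comp_ext [OF s(2), of x] comp_ext [OF s(3), of x]
      comp_ext [OF u(2), of x] comp_ext [OF u(3), of x] s(1) u(1) o that by simp_all
  have ix: "p1 ** (i ** x) = iid A ** (p0 ** x)" "q1 ** (i ** x) = iid B ** (q0 ** x)" if "x \<in> W ~> X" for x W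
    using comp_ext [OF i(2), of x] comp_ext [OF i(3), of x] i(1) o that by simp_all
  have cc: "isrc A ** (p1 ** g) = itgt A ** (p1 ** f)" "isrc B ** (q1 ** g) = itgt B ** (q1 ** f)"
    if "g \<in> W ~> R" "f \<in> W ~> R" "s ** g = u ** f" for g f W
    using sx [OF that(1)] sx [OF that(2)] that(3) by metis+
  have m: "m g f \<in> W ~> R" "p1 ** m g f = ic A (p1 ** g) (p1 ** f)" "q1 ** m g f = ic B (q1 ** g) (q1 ** f)"
    "\<And>k Z. k \<in> Z ~> W \<Longrightarrow> m g f ** k = m (g ** k) (f ** k)"
    if gf: "g \<in> W ~> R" "f \<in> W ~> R" "s ** g = u ** f" for g f W
  proof -
    have b: "if1 F ** ic A (p1 ** g) (p1 ** f) = if1 G ** ic B (q1 ** g) (q1 ** f)"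
      using FG cc [OF gf] gf(1,2) o pc1 [OF gf(1)] pc1 [OF gf(2)] by simp
    have ab: "ic A (p1 ** g) (p1 ** f) \<in> W ~> iar A" "ic B (q1 ** g) (q1 ** f) \<in> W ~> iar B"
      using cc [OF gf] gf(1,2) o by simp_all
    note hh = h1 [OF ab b]
    show "m g f \<in> W ~> R" "p1 ** m g f = ic A (p1 ** g) (p1 ** f)" "q1 ** m g f = ic B (q1 ** g) (q1 ** f)"
      unfolding m_def by (rule hh)+
    show "m g f ** k = m (g ** k) (f ** k)" if k: "k \<in> Z ~> W" for k Z
      using hh(4) [OF k] k cc [OF gf] gf(1,2) o by (simp add: m_def)
  qed
  define P where "P = mk_icat X R s u i m"
  have Pm: "P \<in> Obj CV" "\<And>W g f. g \<in> W ~> R \<Longrightarrow> f \<in> W ~> R \<Longrightarrow> s ** g = u ** f \<Longrightarrow> ic P g f = m g f"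
  proof -
    have 1: "s ** i = Ident V X"
      by (rule e0 [of _ X]) (use s(1) i(1) sx [OF i(1)] i o in simp_all)
    have 2: "u ** i = Ident V X"
      by (rule e0 [of _ X]) (use u(1) i(1) sx [OF i(1)] i o in simp_all)
    have 3: "m g f \<in> W ~> R \<and> s ** m g f = s ** f \<and> u ** m g f = u ** g"
      if gf: "g \<in> W ~> R" "f \<in> W ~> R" "s ** g = u ** f" for g f W
    proof (intro conjI)
      note mm = m [OF gf]
      show "m g f \<in> W ~> R" by (rule mm(1))
      show "s ** m g f = s ** f"
        by (rule e0 [of _ W]) (use s(1) mm sx [OF mm(1)] sx [OF gf(2)] gf(1,2) cc [OF gf] o in simp_all)
      show "u ** m g f = u ** g"
        by (rule e0 [of _ W]) (use u(1) mm sx [OF mm(1)] sx [OF gf(1)] gf(1,2) cc [OF gf] o in simp_all)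
    qed
    have 4: "m (m h g) f = m h (m g f)"
      if f: "f \<in> W ~> R" and g: "g \<in> W ~> R" and h: "h \<in> W ~> R" and gf: "s ** g = u ** f" and hg: "s ** h = u ** g" for W f g h
    proof -
      note c = cc [OF g f gf] cc [OF h g hg]
      note m1 = m [OF g f gf] and m2 = m [OF h g hg]
      have g1: "s ** m h g = u ** f" "s ** h = u ** m g f" using 3 [OF h g hg] 3 [OF g f gf] gf hg by simp_all
      note m3 = m [OF m2(1) f g1(1)] and m4 = m [OF h m1(1) g1(2)]
      show ?thesis
      proof (rule e1 [OF m3(1) m4(1)])
        show "p1 ** m (m h g) f = p1 ** m h (m g f)"
          unfolding m3(2) m4(2) m1(2) m2(2) by (rule ic_assoc [of _ _ W]) (use f g h c o in simp_all)
        show "q1 ** m (m h g) f = q1 ** m h (m g f)"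
          unfolding m3(3) m4(3) m1(3) m2(3) by (rule ic_assoc [of _ _ W]) (use f g h c o in simp_all)
      qed
    qed
    have 5: "m (i ** (u ** f)) f = f \<and> m f (i ** (s ** f)) = f" if f: "f \<in> W ~> R" for f W
    proof -
      have uf: "u ** f \<in> W ~> X" "s ** f \<in> W ~> X" using u s f by simp_all
      have iu: "i ** (u ** f) \<in> W ~> R" "i ** (s ** f) \<in> W ~> R" using uf i(1) by simp_all
      have c: "s ** (i ** (u ** f)) = u ** f" "s ** f = u ** (i ** (s ** f))"
        using comp_ext [OF 1, of "u ** f"] comp_ext [OF 2, of "s ** f"] uf i(1) s(1) u(1) by simp_all
      note m1 = m [OF iu(1) f c(1)] and m2 = m [OF f iu(2) c(2)]
      have "m (i ** (u ** f)) f = f"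
        by (rule e1 [OF m1(1) f], unfold m1(2,3)) (use sx [OF f] ix [OF uf(1)] f o in simp_all)
      moreover have "m f (i ** (s ** f)) = f"
        by (rule e1 [OF m2(1) f], unfold m2(2,3)) (use sx [OF f] ix [OF uf(2)] f o in simp_all)
      ultimately show ?thesis by blast
    qed
    show "P \<in> Obj CV" unfolding P_def
      by (rule mk_icat(1) [OF s(1) u(1) i(1) 1 2]) ((fact 3) | (fact m(4)) | (fact 4) | (use 5 in blast))+
    fix W g f assume gf: "g \<in> W ~> R" "f \<in> W ~> R" "s ** g = u ** f"
    show "ic P g f = m g f" unfolding P_def
      by (rule mk_icat(2) [OF s(1) u(1) i(1) 1 2 _ _ _ _ _ gf]) ((fact 3) | (fact m(4)) | (fact 4) | (use 5 in blast))+
  qed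
  have Ps [simp]: "iob P = X" "iar P = R" "isrc P = s" "itgt P = u" "iid P = i" by (simp_all add: P_def)
  define p where "p = \<lparr>idom = P, icod = A, if0 = p0, if1 = p1\<rparr>"
  define q where "q = \<lparr>idom = P, icod = B, if0 = q0, if1 = q1\<rparr>"
  have p: "p \<in> Hom CV P A" unfolding p_def
  proof (rule ifunctorI [OF Pm(1) o(1)], unfold Ps)
    fix W g f assume gf: "g \<in> W ~> R" "f \<in> W ~> R" "s ** g = u ** f"
    show "p1 ** ic P g f = ic A (p1 ** g) (p1 ** f)" unfolding Pm(2) [OF gf] by (rule m(2) [OF gf])
  qed (use s u i in simp_all)
  have q: "q \<in> Hom CV P B" unfolding q_def
  proof (rule ifunctorI [OF Pm(1) o(2)], unfold Ps)
    fix W g f assume gf: "g \<in> W ~> R" "f \<in> W ~> R" "s ** g = u ** f"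
    show "q1 ** ic P g f = ic B (q1 ** g) (q1 ** f)" unfolding Pm(2) [OF gf] by (rule m(3) [OF gf])
  qed (use s u i in simp_all)
  have pqs: "if0 p = p0" "if1 p = p1" "if0 q = q0" "if1 q = q1" by (simp_all add: p_def q_def)
  have Fp: "F \<odot> p = G \<odot> q"
    by (rule ifun_eqI [of _ P C]) (use p q FG pc0 [OF IR(2)] pc1 [OF IR(1)] in \<open>simp_all add: pqs\<close>)
  have univ: "\<exists>!h. h \<in> Hom CV Z P \<and> p \<odot> h = a \<and> q \<odot> h = b"
    if Z: "Z \<in> Obj CV" and a: "a \<in> Hom CV Z A" and b: "b \<in> Hom CV Z B"
      and ab: "F \<odot> a = G \<odot> b" for Z a b
  proof -
    have ab0: "if0 F ** if0 a = if0 G ** if0 b" "if1 F ** if1 a = if1 G ** if1 b"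
      using arg_cong [OF ab, of if0] arg_cong [OF ab, of if1] by simp_all
    have a01: "if0 a \<in> iob Z ~> iob A" "if0 b \<in> iob Z ~> iob B" "if1 a \<in> iar Z ~> iar A"
      "if1 b \<in> iar Z ~> iar B" using a b by simp_all
    note H0 = h0 [OF a01(1,2) ab0(1)] and H1 = h1 [OF a01(3,4) ab0(2)]
    have P0: "p0 ** (h0 (if0 a) (if0 b) ** x) = if0 a ** x" "q0 ** (h0 (if0 a) (if0 b) ** x) = if0 b ** x"
      if "x \<in> W ~> iob Z" for x W
      using comp_ext [OF H0(2), of x] comp_ext [OF H0(3), of x] H0(1) that by simp_all
    have P1: "p1 ** (h1 (if1 a) (if1 b) ** x) = if1 a ** x" "q1 ** (h1 (if1 a) (if1 b) ** x) = if1 b ** x"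
      if "x \<in> W ~> iar Z" for x W
      using comp_ext [OF H1(2), of x] comp_ext [OF H1(3), of x] H1(1) that by simp_all
    let ?ha = "h0 (if0 a) (if0 b)" and ?hb = "h1 (if1 a) (if1 b)"
    let ?H = "\<lparr>idom = Z, icod = P, if0 = ?ha, if1 = ?hb\<rparr>"
    have st: "s ** ?hb = ?ha ** isrc Z" "u ** ?hb = ?ha ** itgt Z"
    proof -
      show "s ** ?hb = ?ha ** isrc Z"
        by (rule e0 [of _ "iar Z"]) (use sx [OF H1(1)] P0 [of "isrc Z" "iar Z"] H0(1) H1 s(1) Z a b in simp_all)
      show "u ** ?hb = ?ha ** itgt Z"
        by (rule e0 [of _ "iar Z"]) (use sx [OF H1(1)] P0 [of "itgt Z" "iar Z"] H0(1) H1 u(1) Z a b in simp_all)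
    qed
    have h: "?H \<in> Hom CV Z P"
    proof (rule ifunctorI [OF Z Pm(1)], unfold Ps)
      show "?hb ** iid Z = i ** ?ha"
        by (rule e1 [of _ "iob Z"]) (use P1 [of "iid Z" "iob Z"] ix [OF H0(1)] H0 H1(1) i(1) Z a b in simp_all)
      fix W g f assume gf: "g \<in> W ~> iar Z" "f \<in> W ~> iar Z" "isrc Z ** g = itgt Z ** f"
      have hg: "?hb ** g \<in> W ~> R" "?hb ** f \<in> W ~> R" using H1(1) gf by simp_all
      have c: "s ** (?hb ** g) = u ** (?hb ** f)"
        using comp_ext [OF st(1), of g] comp_ext [OF st(2), of f] s(1) u(1) H0(1) H1(1) gf Z by simp
      have k: "ic Z g f \<in> W ~> iar Z" using gf Z by simp
      note mm = m [OF hg c]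
      have "?hb ** ic Z g f = m (?hb ** g) (?hb ** f)"
        by (rule e1 [OF _ mm(1)], unfold mm(2,3) P1(1) [OF k] P1(2) [OF k] P1(1) [OF gf(1)] P1(2) [OF gf(1)]
            P1(1) [OF gf(2)] P1(2) [OF gf(2)]) (use gf a b H1(1) k in simp_all)
      then show "?hb ** ic Z g f = ic P (?hb ** g) (?hb ** f)" using Pm(2) [OF hg c] by simp
    qed (use H0 H1 st in simp_all)
    show ?thesis
    proof (rule ex1I [of _ ?H], intro conjI)
      show "?H \<in> Hom CV Z P" by (rule h)
      show "p \<odot> ?H = a" by (rule ifun_eqI [of _ Z A]) (use p h a H0 H1 in \<open>simp_all add: pqs\<close>)
      show "q \<odot> ?H = b" by (rule ifun_eqI [of _ Z B]) (use q h b H0 H1 in \<open>simp_all add: pqs\<close>)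
      fix k assume k: "k \<in> Hom CV Z P \<and> p \<odot> k = a \<and> q \<odot> k = b"
      have k0: "p0 ** if0 k = if0 a" "q0 ** if0 k = if0 b" "p1 ** if1 k = if1 a" "q1 ** if1 k = if1 b"
        using k by (auto simp: pqs [symmetric] simp flip: Cat_comp_simps)
      have kk: "if0 k \<in> iob Z ~> X" "if1 k \<in> iar Z ~> R" using k by simp_all
      have "if0 k = ?ha" by (rule e0 [OF kk(1) H0(1)]) (use k0 H0(2,3) in simp_all)
      moreover have "if1 k = ?hb" by (rule e1 [OF kk(2) H1(1)]) (use k0 H1(2,3) in simp_all)
      ultimately show "k = ?H" by - (rule ifun_eqI [of _ Z P], use k h in simp_all)
    qed
  qed
  have "is_pullback CV F G (P, p, q)"
    unfolding is_pullback_def prod.case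
    using Pm(1) p q FG Fp univ by (simp del: Hom_iff)
  moreover have "is_pullback V (if0 F) (if0 G) (iob P, if0 p, if0 q)"
    using pb_is_pullback [of "if0 F" "if0 G"] FG by (simp add: pqs p0_def q0_def X_def)
  moreover have "is_pullback V (if1 F) (if1 G) (iar P, if1 p, if1 q)"
    using pb_is_pullback [of "if1 F" "if1 G"] FG by (simp add: pqs p1_def q1_def R_def)
  ultimately show ?thesis using that by blast
qed

lemma ibang_unique: "F \<in> Hom CV A (ione V) \<Longrightarrow> F = ibang V A"
  by (rule ifun_eqI [of _ A "ione V"]) (auto simp: bang_unique)

lemma Cat_product_exists:
  assumes A: "A \<in> Obj CV" and B: "B \<in> Obj CV"
  obtains P p q where "is_product CV A B (P, p, q)"
    "is_product V (iob A) (iob B) (iob P, if0 p, if0 q)" "is_product V (iar A) (iar B) (iar P, if1 p, if1 q)"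
proof -
  obtain P p q where P: "is_pullback CV (ibang V A) (ibang V B) (P, p, q)"
    "is_pullback V (if0 (ibang V A)) (if0 (ibang V B)) (iob P, if0 p, if0 q)"
    "is_pullback V (if1 (ibang V A)) (if1 (ibang V B)) (iar P, if1 p, if1 q)"
    using Cat_pullback_exists [of "ibang V A" A "ione V" "ibang V B" B] A B by auto
  have "ibang V A \<odot> F = ibang V B \<odot> G" if "F \<in> Hom CV Z A" "G \<in> Hom CV Z B" for F G Z
    using ibang_unique [of "ibang V A \<odot> F" Z] ibang_unique [of "ibang V B \<odot> G" Z] that A B by simp
  then have "is_product CV A B (P, p, q)"
    using P(1) A B unfolding is_product_def is_pullback_def prod.case by (simp del: Hom_iff)
  moreover have "is_product V (iob A) (iob B) (iob P, if0 p, if0 q)" "is_product V (iar A) (iar B) (iar P, if1 p, if1 q)"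
    using P(2,3) A B unfolding is_product_def is_pullback_def prod.case by simp_all
  ultimately show ?thesis using that by blast
qed

end

sublocale ccc \<subseteq> Cat: lcat "Cat V"
proof unfold_locales
  show "\<exists>t. is_product (Cat V) X Y t" if "X \<in> Obj (Cat V)" "Y \<in> Obj (Cat V)" for X Y
    using Cat_product_exists [OF that] by metis
  show "\<exists>t. is_pullback (Cat V) f g t" if "f \<in> Arr (Cat V)" "g \<in> Arr (Cat V)" "Cod (Cat V) f = Cod (Cat V) g" for f g
    using Cat_pullback_exists [of f "Dom (Cat V) f" "Cod (Cat V) f" g "Dom (Cat V) g"] that by (metis Hom_iff)
qed


context ccc
begin

lemma pullback_along_iso:
  assumes P: "is_pullback V f g (P, p, q)" and h: "h \<in> Q ~> P" "iso V h"
    and fg: "f \<in> Arr V" "g \<in> Arr V"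
  shows "is_pullback V f g (Q, p ** h, q ** h)"
proof -
  obtain k where k: "k \<in> P ~> Q" "k ** h = Ident V Q" "h ** k = Ident V P" using isoE [OF h(2,1)] by metis
  have Po: "p \<in> P ~> Dom V f" "q \<in> P ~> Dom V g" "f ** p = g ** q"
    using P by (auto simp: is_pullback_def)
  have c: "Cod V f = Cod V g"
    using arg_cong [OF Po(3), of "Cod V"] Po(1,2) fg by simp
  have Qo: "Q \<in> Obj V" using h Hom_Obj1 by blast
  have hk: "h ** (k ** m) = m" if "m \<in> Z ~> P" for m Z
    using comp_ext [OF k(3), of m] h(1) k(1) that by simp
  have kh: "k ** (h ** m) = m" if "m \<in> Z ~> Q" for m Z
    using comp_ext [OF k(2), of m] h(1) k(1) that by simp
  show ?thesis
    unfolding is_pullback_def prod.case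
  proof (intro conjI ballI impI)
    show "f ** (p ** h) = g ** (q ** h)" using comp_ext [OF Po(3), of h] Po(1,2) h(1) fg c by simp
    fix Z a b assume Z: "Z \<in> Obj V" "a \<in> Z ~> Dom V f" "b \<in> Z ~> Dom V g" "f ** a = g ** b"
    then have u: "\<exists>!m. m \<in> Z ~> P \<and> p ** m = a \<and> q ** m = b" using P unfolding is_pullback_def prod.case by blast
    then obtain m where m: "m \<in> Z ~> P" "p ** m = a" "q ** m = b" by blast
    show "\<exists>!m. m \<in> Z ~> Q \<and> (p ** h) ** m = a \<and> (q ** h) ** m = b"
    proof (rule ex1I [of _ "k ** m"])
      show "k ** m \<in> Z ~> Q \<and> (p ** h) ** (k ** m) = a \<and> (q ** h) ** (k ** m) = b"
        using hk [OF m(1)] m k(1) h(1) Po by simp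
      fix n assume n: "n \<in> Z ~> Q \<and> (p ** h) ** n = a \<and> (q ** h) ** n = b"
      then have nH: "n \<in> Z ~> Q" and np: "(p ** h) ** n = a" "(q ** h) ** n = b" by blast+
      have "p ** (h ** n) = a" "q ** (h ** n) = b" using np nH h(1) Po by simp_all
      then have "h ** n = m" by - (rule ex1_unique [OF u], use nH m h(1) in simp_all)
      then show "n = k ** m" using kh [of n Z] n by simp
    qed
  qed (use Po h Qo in simp_all)
qed

lemma product_iff_pullback:
  assumes "X \<in> Obj V" "Y \<in> Obj V"
  shows "is_product V X Y (P, p, q) \<longleftrightarrow> is_pullback V (bang V X) (bang V Y) (P, p, q)"
proof -
  have "bang V X ** a = bang V Y ** b" if "a \<in> Z ~> X" "b \<in> Z ~> Y" for a b Z
    using that assms by simp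
  then show ?thesis
    unfolding is_product_def is_pullback_def prod.case bang_simps(2) [OF assms(1)] bang_simps(2) [OF assms(2)] by blast
qed

text \<open>The chosen pullback of internal categories is isomorphic to the componentwise one, hence is one itself.\<close>

lemma Cat_pb_components:
  assumes F: "F \<in> Hom CV A C" and G: "G \<in> Hom CV B C"
  shows "is_pullback V (if0 F) (if0 G)
      (iob (pb CV F G), if0 (pb1 CV F G), if0 (pb2 CV F G))" (is ?P)
    "is_pullback V (if1 F) (if1 G)
      (iar (pb CV F G), if1 (pb1 CV F G), if1 (pb2 CV F G))" (is ?Q)
proof -
  have FG: "F \<in> Arr CV" "G \<in> Arr CV" "Cod CV F = Cod CV G" using F G by simp_all
  obtain P p q where P: "is_pullback CV F G (P, p, q)"
    "is_pullback V (if0 F) (if0 G) (iob P, if0 p, if0 q)" "is_pullback V (if1 F) (if1 G) (iar P, if1 p, if1 q)"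
    using Cat_pullback_exists [OF F G] by metis
  obtain h where h: "h \<in> Hom CV (pb CV F G) P" "iso CV h"
    "p \<odot> h = pb1 CV F G" "q \<odot> h = pb2 CV F G"
    using Cat.pullback_unique [OF P(1) FG] by metis
  note hi = Cat_iso_components [OF h(1,2)]
  have "is_pullback V (if0 F) (if0 G) (iob (pb CV F G), if0 p ** if0 h, if0 q ** if0 h)"
    by (rule pullback_along_iso [OF P(2) _ hi(1)]) (use h(1) FG in simp_all)
  then show ?P by (simp flip: h(3,4))
  have "is_pullback V (if1 F) (if1 G) (iar (pb CV F G), if1 p ** if1 h, if1 q ** if1 h)"
    by (rule pullback_along_iso [OF P(3) _ hi(2)]) (use h(1) FG in simp_all)
  then show ?Q by (simp flip: h(3,4))
qed

lemma Cat_prd_components: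
  assumes A: "A \<in> Obj CV" and B: "B \<in> Obj CV"
  shows "is_product V (iob A) (iob B) (iob (prd CV A B), if0 (pr1 CV A B), if0 (pr2 CV A B))" (is ?P)
    "is_product V (iar A) (iar B) (iar (prd CV A B), if1 (pr1 CV A B), if1 (pr2 CV A B))" (is ?Q)
proof -
  obtain P p q where P: "is_product CV A B (P, p, q)"
    "is_product V (iob A) (iob B) (iob P, if0 p, if0 q)" "is_product V (iar A) (iar B) (iar P, if1 p, if1 q)"
    using Cat_product_exists [OF A B] by metis
  obtain h where h: "h \<in> Hom CV (prd CV A B) P" "iso CV h"
    "p \<odot> h = pr1 CV A B" "q \<odot> h = pr2 CV A B"
    using Cat.product_unique [OF P(1) A B] by metis
  note hi = Cat_iso_components [OF h(1,2)]
  have "is_product V (iob A) (iob B) (iob (prd CV A B), if0 p ** if0 h, if0 q ** if0 h)"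
    using pullback_along_iso [OF P(2) [unfolded product_iff_pullback [OF icat_simps(1) [OF A] icat_simps(1) [OF B]]] _ hi(1)]
      h(1) A B by (simp add: product_iff_pullback)
  then show ?P
    by (simp flip: h(3,4))
  have "is_product V (iar A) (iar B) (iar (prd CV A B), if1 p ** if1 h, if1 q ** if1 h)"
    using pullback_along_iso [OF P(3) [unfolded product_iff_pullback [OF icat_simps(2) [OF A] icat_simps(2) [OF B]]] _ hi(2)]
      h(1) A B by (simp add: product_iff_pullback)
  then show ?Q
    by (simp flip: h(3,4))
qed

text \<open>
  The components of the chosen product of internal categories are products in \<open>V\<close>, but need not be the chosen
  ones, to which \<open>pair\<close> refers.
\<close>

definition gpair :: "'o \<times> 'm \<times> 'm \<Rightarrow> 'm \<Rightarrow> 'm \<Rightarrow> 'm" where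
  "gpair t a b = (THE h. h \<in> Dom V a ~> fst t \<and> fst (snd t) ** h = a \<and> snd (snd t) ** h = b)"

lemma gpair:
  assumes P: "is_product V X Y (P, p, q)" and ab: "a \<in> W ~> X" "b \<in> W ~> Y"
  shows "gpair (P, p, q) a b \<in> W ~> P" "p ** gpair (P, p, q) a b = a" "q ** gpair (P, p, q) a b = b"
proof -
  have "W \<in> Obj V" using ab Hom_Obj1 by blast
  then have "\<exists>!h. h \<in> Dom V a ~> P \<and> p ** h = a \<and> q ** h = b"
    using P ab unfolding is_product_def by simp
  from theI' [OF this]
  show "gpair (P, p, q) a b \<in> W ~> P" "p ** gpair (P, p, q) a b = a" "q ** gpair (P, p, q) a b = b"
    using ab(1) by (simp_all add: gpair_def)
qed

lemma gpair_eqI: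
  assumes P: "is_product V X Y (P, p, q)" and xy: "x \<in> W ~> P" "y \<in> W ~> P" "p ** x = p ** y" "q ** x = q ** y"
  shows "x = y"
proof -
  have "W \<in> Obj V" using xy Hom_Obj1 by blast
  moreover have "p \<in> P ~> X" "q \<in> P ~> Y" using P by (simp_all add: is_product_def)
  ultimately have "\<exists>!h. h \<in> W ~> P \<and> p ** h = p ** y \<and> q ** h = q ** y"
    using P xy(2) unfolding is_product_def by simp
  then show ?thesis by (rule ex1_unique) (use xy in blast)+
qed

definition pp0 :: "('o, 'm) icat \<Rightarrow> ('o, 'm) icat \<Rightarrow> 'm \<Rightarrow> 'm \<Rightarrow> 'm" where
  "pp0 A B = gpair (iob (prd CV A B), if0 (pr1 CV A B), if0 (pr2 CV A B))"

definition pp1 :: "('o, 'm) icat \<Rightarrow> ('o, 'm) icat \<Rightarrow> 'm \<Rightarrow> 'm \<Rightarrow> 'm" where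
  "pp1 A B = gpair (iar (prd CV A B), if1 (pr1 CV A B), if1 (pr2 CV A B))"

lemma pp0_eqI:
  assumes "A \<in> Obj CV" "B \<in> Obj CV" "x \<in> W ~> iob (prd CV A B)" "y \<in> W ~> iob (prd CV A B)"
    "if0 (pr1 CV A B) ** x = if0 (pr1 CV A B) ** y" "if0 (pr2 CV A B) ** x = if0 (pr2 CV A B) ** y"
  shows "x = y"
  by (rule gpair_eqI [OF Cat_prd_components(1) [OF assms(1,2)] assms(3-6)])

lemma pp1_eqI:
  assumes "A \<in> Obj CV" "B \<in> Obj CV" "x \<in> W ~> iar (prd CV A B)" "y \<in> W ~> iar (prd CV A B)"
    "if1 (pr1 CV A B) ** x = if1 (pr1 CV A B) ** y" "if1 (pr2 CV A B) ** x = if1 (pr2 CV A B) ** y"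
  shows "x = y"
  by (rule gpair_eqI [OF Cat_prd_components(2) [OF assms(1,2)] assms(3-6)])

lemma pp0_simps [simp]:
  assumes A: "A \<in> Obj CV" "B \<in> Obj CV" and a: "a \<in> Arr V" "b \<in> Arr V" "Dom V a = Dom V b"
    "Cod V a = iob A" "Cod V b = iob B"
  shows "pp0 A B a b \<in> Arr V" "Dom V (pp0 A B a b) = Dom V b" "Cod V (pp0 A B a b) = iob (prd CV A B)"
    "if0 (pr1 CV A B) ** pp0 A B a b = a" "if0 (pr2 CV A B) ** pp0 A B a b = b"
    "\<And>k. k \<in> Arr V \<Longrightarrow> Cod V k = Dom V b \<Longrightarrow> pp0 A B a b ** k = pp0 A B (a ** k) (b ** k)"
proof -
  note g = gpair [OF Cat_prd_components(1) [OF A], folded pp0_def]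
  have 1: "pp0 A B a b \<in> Dom V b ~> iob (prd CV A B) \<and> if0 (pr1 CV A B) ** pp0 A B a b = a \<and>
      if0 (pr2 CV A B) ** pp0 A B a b = b"
    using g [of a "Dom V b" b] a by simp
  then show s: "pp0 A B a b \<in> Arr V" "Dom V (pp0 A B a b) = Dom V b" "Cod V (pp0 A B a b) = iob (prd CV A B)"
    "if0 (pr1 CV A B) ** pp0 A B a b = a" "if0 (pr2 CV A B) ** pp0 A B a b = b" by simp_all
  fix k assume k: "k \<in> Arr V" "Cod V k = Dom V b"
  have 2: "if0 (pr1 CV A B) ** (pp0 A B a b ** k) = a ** k" "if0 (pr2 CV A B) ** (pp0 A B a b ** k) = b ** k"
    using comp_ext [OF s(4), of k] comp_ext [OF s(5), of k] s(1-3) A k by simp_all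
  show "pp0 A B a b ** k = pp0 A B (a ** k) (b ** k)"
    by (rule pp0_eqI [OF A, of _ "Dom V k"]) (use g [of "a ** k" "Dom V k" "b ** k"] 2 s(1-3) a k in simp_all)
qed

lemma pp1_simps [simp]:
  assumes A: "A \<in> Obj CV" "B \<in> Obj CV" and a: "a \<in> Arr V" "b \<in> Arr V" "Dom V a = Dom V b"
    "Cod V a = iar A" "Cod V b = iar B"
  shows "pp1 A B a b \<in> Arr V" "Dom V (pp1 A B a b) = Dom V b" "Cod V (pp1 A B a b) = iar (prd CV A B)"
    "if1 (pr1 CV A B) ** pp1 A B a b = a" "if1 (pr2 CV A B) ** pp1 A B a b = b"
    "\<And>k. k \<in> Arr V \<Longrightarrow> Cod V k = Dom V b \<Longrightarrow> pp1 A B a b ** k = pp1 A B (a ** k) (b ** k)"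
    "isrc (prd CV A B) ** pp1 A B a b = pp0 A B (isrc A ** a) (isrc B ** b)"
    "itgt (prd CV A B) ** pp1 A B a b = pp0 A B (itgt A ** a) (itgt B ** b)"
proof -
  note g = gpair [OF Cat_prd_components(2) [OF A], folded pp1_def]
  have 1: "pp1 A B a b \<in> Dom V b ~> iar (prd CV A B) \<and> if1 (pr1 CV A B) ** pp1 A B a b = a \<and>
      if1 (pr2 CV A B) ** pp1 A B a b = b"
    using g [of a "Dom V b" b] a by simp
  then show s: "pp1 A B a b \<in> Arr V" "Dom V (pp1 A B a b) = Dom V b" "Cod V (pp1 A B a b) = iar (prd CV A B)"
    "if1 (pr1 CV A B) ** pp1 A B a b = a" "if1 (pr2 CV A B) ** pp1 A B a b = b" by simp_all
  show "pp1 A B a b ** k = pp1 A B (a ** k) (b ** k)" if k: "k \<in> Arr V" "Cod V k = Dom V b" for k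
  proof -
    have 2: "if1 (pr1 CV A B) ** (pp1 A B a b ** k) = a ** k" "if1 (pr2 CV A B) ** (pp1 A B a b ** k) = b ** k"
      using comp_ext [OF s(4), of k] comp_ext [OF s(5), of k] s(1-3) A k by simp_all
    show ?thesis
      by (rule pp1_eqI [OF A, of _ "Dom V k"]) (use g [of "a ** k" "Dom V k" "b ** k"] 2 s(1-3) a k in simp_all)
  qed
  let ?P = "prd CV A B"
  have 3: "if0 (pr1 CV A B) ** (isrc ?P ** pp1 A B a b) = isrc A ** a" "if0 (pr2 CV A B) ** (isrc ?P ** pp1 A B a b) = isrc B ** b"
    "if0 (pr1 CV A B) ** (itgt ?P ** pp1 A B a b) = itgt A ** a" "if0 (pr2 CV A B) ** (itgt ?P ** pp1 A B a b) = itgt B ** b"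
    using ifun_src_comp [of "pr1 CV A B" A "pp1 A B a b"] ifun_src_comp [of "pr2 CV A B" B "pp1 A B a b"] A s
    by simp_all
  show "isrc (prd CV A B) ** pp1 A B a b = pp0 A B (isrc A ** a) (isrc B ** b)"
    "itgt (prd CV A B) ** pp1 A B a b = pp0 A B (itgt A ** a) (itgt B ** b)"
    by (rule pp0_eqI [OF A, of _ "Dom V b"]; use s(1-3) 3 A a in simp)+
qed

lemma pp_eta [simp]:
  assumes A: "A \<in> Obj CV" "B \<in> Obj CV" and x: "x \<in> Arr V"
  shows "Cod V x = iob (prd CV A B) \<Longrightarrow>
      pp0 A B (if0 (pr1 CV A B) ** x) (if0 (pr2 CV A B) ** x) = x"
    "Cod V x = iar (prd CV A B) \<Longrightarrow>
      pp1 A B (if1 (pr1 CV A B) ** x) (if1 (pr2 CV A B) ** x) = x"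
proof -
  assume "Cod V x = iob (prd CV A B)"
  then show "pp0 A B (if0 (pr1 CV A B) ** x) (if0 (pr2 CV A B) ** x) = x"
    by - (rule pp0_eqI [OF A, of _ "Dom V x"], use A x in simp_all)
next
  assume "Cod V x = iar (prd CV A B)"
  then show "pp1 A B (if1 (pr1 CV A B) ** x) (if1 (pr2 CV A B) ** x) = x"
    by - (rule pp1_eqI [OF A, of _ "Dom V x"], use A x in simp_all)
qed

lemma pp_iid [simp]:
  assumes A: "A \<in> Obj CV" "B \<in> Obj CV" and a: "a \<in> Arr V" "b \<in> Arr V" "Dom V a = Dom V b"
    "Cod V a = iob A" "Cod V b = iob B"
  shows "iid (prd CV A B) ** pp0 A B a b = pp1 A B (iid A ** a) (iid B ** b)"
  by (rule pp1_eqI [OF A, of _ "Dom V b"]) (use A a in simp_all)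

lemma pp_icompose [simp]:
  assumes A: "A \<in> Obj CV" "B \<in> Obj CV" and a: "a \<in> Arr V" "b \<in> Arr V" "Dom V a = Dom V b"
    "Cod V a = iar A" "Cod V b = iar B" and c: "c \<in> Arr V" "d \<in> Arr V" "Dom V c = Dom V d"
    "Cod V c = iar A" "Cod V d = iar B" and e: "isrc A ** a = itgt A ** c" "isrc B ** b = itgt B ** d" "Dom V b = Dom V d"
  shows "ic (prd CV A B) (pp1 A B a b) (pp1 A B c d) = pp1 A B (ic A a c) (ic B b d)"
  by (rule pp1_eqI [OF A, of _ "Dom V d"]) (use A a c e in simp_all)

lemma if_pair [simp]:
  assumes F: "F \<in> Arr CV" "G \<in> Arr CV" "Dom CV F = Dom CV G"
  shows "if0 (pair CV F G) = pp0 (Cod CV F) (Cod CV G) (if0 F) (if0 G)"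
    "if1 (pair CV F G) = pp1 (Cod CV F) (Cod CV G) (if1 F) (if1 G)"
proof -
  let ?A = "Cod CV F" and ?B = "Cod CV G"
  have o: "?A \<in> Obj CV" "?B \<in> Obj CV" using F by simp_all
  have 1: "pr1 CV ?A ?B \<odot> pair CV F G = F" "pr2 CV ?A ?B \<odot> pair CV F G = G"
    using F by simp_all
  have 2: "if0 (pr1 CV ?A ?B) ** if0 (pair CV F G) = if0 F" "if0 (pr2 CV ?A ?B) ** if0 (pair CV F G) = if0 G"
    "if1 (pr1 CV ?A ?B) ** if1 (pair CV F G) = if1 F" "if1 (pr2 CV ?A ?B) ** if1 (pair CV F G) = if1 G"
    using arg_cong [OF 1(1), of if0] arg_cong [OF 1(2), of if0] arg_cong [OF 1(1), of if1] arg_cong [OF 1(2), of if1]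
    unfolding Cat_comp_simps by blast+
  show "if0 (pair CV F G) = pp0 ?A ?B (if0 F) (if0 G)"
    by (rule pp0_eqI [OF o, of _ "iob (Dom CV F)"]) (use 2 F in simp_all)
  show "if1 (pair CV F G) = pp1 ?A ?B (if1 F) (if1 G)"
    by (rule pp1_eqI [OF o, of _ "iar (Dom CV F)"]) (use 2 F in simp_all)
qed

end


section \<open>Internalisation\<close>

locale small_vcat = ext_ccc V U + vcat V C
  for V :: "('o, 'm) cat" (structure) and U :: "'u set" and C :: "('c, 'o, 'm) vcat" +
  assumes small_vob: "small U (vob C)"
begin

abbreviation "J \<equiv> Internal V C"
abbreviation "jo \<equiv> int_ob_inj V C"
abbreviation "ja \<equiv> int_ar_inj V C"

lemma J_objects: "is_coproduct V (vob C) (\<lambda>_. pt) (iob J, jo)"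
proof -
  have "\<exists>t. is_coproduct V (vob C) (\<lambda>_. pt) t" by (rule small_coproduct_exists [OF small_vob]) simp
  from coprd_is_coproduct [OF this] show ?thesis
    by (simp add: Internal_def int_ob_def int_ob_inj_def [abs_def])
qed

lemma small_pairs: "small U (vob C \<times> vob C)" "small U ((vob C \<times> vob C) \<times> vob C)"
  by (intro small_Times universe small_vob)+

lemma J_arrows: "is_coproduct V (vob C \<times> vob C) (\<lambda>(A, B). vhom C A B) (iar J, \<lambda>(A, B). ja A B)"
proof -
  have "\<exists>t. is_coproduct V (vob C \<times> vob C) (\<lambda>(A, B). vhom C A B) t"
    by (rule small_coproduct_exists [OF small_pairs(1)]) auto
  from coprd_is_coproduct [OF this] show ?thesis
    by (simp add: Internal_def int_ar_def int_ar_inj_def case_prod_unfold)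
qed

lemma J_ob_arr [simp]: "iob J \<in> Obj V" "iar J \<in> Obj V"
  using coproductD(1) [OF J_objects] coproductD(1) [OF J_arrows] by simp_all

lemma jo_simps [simp]:
  assumes "A \<in> vob C"
  shows "jo A \<in> Arr V" "Dom V (jo A) = pt" "Cod V (jo A) = iob J"
  using coproductD [OF J_objects] assms by simp_all

lemma ja_simps [simp]:
  assumes "A \<in> vob C" "B \<in> vob C"
  shows "ja A B \<in> Arr V" "Dom V (ja A B) = vhom C A B" "Cod V (ja A B) = iar J"
  using coproductD(2-4) [OF J_arrows, of "(A, B)"] assms by simp_all

lemma J_src_tgt_raw:
  "isrc J \<in> iar J ~> iob J" "itgt J \<in> iar J ~> iob J"
  "\<And>A B. A \<in> vob C \<Longrightarrow> B \<in> vob C \<Longrightarrow> isrc J ** ja A B = jo A ** bang V (vhom C A B)"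
  "\<And>A B. A \<in> vob C \<Longrightarrow> B \<in> vob C \<Longrightarrow> itgt J ** ja A B = jo B ** bang V (vhom C A B)"
proof -
  let ?X = "\<lambda>(A, B). vhom C A B"
  have e: "\<exists>t. is_coproduct V (vob C \<times> vob C) ?X t" using J_arrows by blast
  have o: "int_ob V C = iob J" "int_ar V C = iar J" "coprd V (vob C \<times> vob C) ?X = iar J"
    by (simp_all add: Internal_def int_ar_def)
  have c: "coinj V (vob C \<times> vob C) ?X (A, B) = ja A B" for A B by (simp add: int_ar_inj_def)
  have "\<And>i. i \<in> vob C \<times> vob C \<Longrightarrow> (case i of (A, B) \<Rightarrow> jo A ** bang V (vhom C A B)) \<in> ?X i ~> iob J"
    "\<And>i. i \<in> vob C \<times> vob C \<Longrightarrow> (case i of (A, B) \<Rightarrow> jo B ** bang V (vhom C A B)) \<in> ?X i ~> iob J"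
    by auto
  note p = copair_props [OF e this(1) J_ob_arr(1)] copair_props [OF e this(2) J_ob_arr(1)]
  have s: "isrc J = copair V (vob C \<times> vob C) ?X (iob J) (\<lambda>(A, B). jo A ** bang V (vhom C A B))"
    "itgt J = copair V (vob C \<times> vob C) ?X (iob J) (\<lambda>(A, B). jo B ** bang V (vhom C A B))"
    by (simp_all add: Internal_def int_src_def int_tgt_def)
  show "isrc J \<in> iar J ~> iob J" "itgt J \<in> iar J ~> iob J"
    using p(1,3) unfolding s o by simp_all
  fix A B assume "A \<in> vob C" "B \<in> vob C"
  then show "isrc J ** ja A B = jo A ** bang V (vhom C A B)" "itgt J ** ja A B = jo B ** bang V (vhom C A B)"
    using p(2) [of "(A, B)"] p(4) [of "(A, B)"] unfolding s c by simp_all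
qed

lemma J_src_tgt [simp]:
  "isrc J \<in> Arr V" "Dom V (isrc J) = iar J" "Cod V (isrc J) = iob J"
  "itgt J \<in> Arr V" "Dom V (itgt J) = iar J" "Cod V (itgt J) = iob J"
  using J_src_tgt_raw(1,2) by simp_all

lemma J_src_ja [simp]:
  assumes A: "A \<in> vob C" "B \<in> vob C" and f: "f \<in> Arr V" "Cod V f = vhom C A B"
  shows "isrc J ** (ja A B ** f) = jo A ** bang V (Dom V f)" "itgt J ** (ja A B ** f) = jo B ** bang V (Dom V f)"
  using comp_ext [OF J_src_tgt_raw(3) [OF A], of f] comp_ext [OF J_src_tgt_raw(4) [OF A], of f] A f by simp_all

text \<open>
  An arrow of \<open>Int C\<close> with constant source \<open>A\<close> and target \<open>B\<close> is a generalised element of \<open>C(A,B)\<close>.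
\<close>

lemma ja_factor:
  assumes A: "A \<in> vob C" "B \<in> vob C" and h: "h \<in> W ~> iar J"
    and s: "isrc J ** h = jo A ** bang V W" "itgt J ** h = jo B ** bang V W"
  shows "\<exists>!f. f \<in> W ~> vhom C A B \<and> ja A B ** f = h"
proof -
  have W: "W \<in> Obj V" using h Hom_Obj1 by blast
  have "\<exists>!f. f \<in> W ~> (case (A, B) of (A, B) \<Rightarrow> vhom C A B) \<and> (case (A, B) of (A, B) \<Rightarrow> ja A B) ** f = h"
  proof (rule factor_through_summand [OF small_pairs(1) J_arrows copower_product [OF J_objects J_objects],
        of "pair V (isrc J) (itgt J)"])
    fix k assume "k \<in> vob C \<times> vob C"
    then show "pair V (isrc J) (itgt J) ** (case k of (A, B) \<Rightarrow> ja A B) =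
        (case k of (k, l) \<Rightarrow> pair V (jo k) (jo l)) ** bang V (case k of (A, B) \<Rightarrow> vhom C A B)"
      using J_src_tgt_raw(3,4) by auto
  qed (use A h s W in simp_all)
  then show ?thesis by simp
qed

lemma ja_mono:
  assumes A: "A \<in> vob C" "B \<in> vob C" and f: "f \<in> W ~> vhom C A B" "g \<in> W ~> vhom C A B" "ja A B ** f = ja A B ** g"
  shows "f = g"
  using summand_mono [OF small_pairs(1) J_arrows, of "(A, B)" f W g] A f by simp

text \<open>Equations may be checked locally, where all objects and arrows of \<open>Int C\<close> are constant.\<close>

lemma J_cover0:
  assumes a: "a \<in> W ~> iob J" and xy: "x \<in> W ~> Y" "y \<in> W ~> Y"
    and e: "\<And>A Z j. A \<in> vob C \<Longrightarrow> j \<in> Z ~> W \<Longrightarrow> a ** j = jo A ** bang V Z \<Longrightarrow> x ** j = y ** j"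
  shows "x = y"
  by (rule eq_by_cover [OF small_vob J_objects a xy]) (rule e)

lemma J_cover1:
  assumes u: "u \<in> W ~> iar J" and xy: "x \<in> W ~> Y" "y \<in> W ~> Y"
    and e: "\<And>A B Z j f. A \<in> vob C \<Longrightarrow> B \<in> vob C \<Longrightarrow> j \<in> Z ~> W \<Longrightarrow> f \<in> Z ~> vhom C A B \<Longrightarrow>
      u ** j = ja A B ** f \<Longrightarrow> x ** j = y ** j"
  shows "x = y"
proof (rule J_cover0 [of "isrc J ** u", OF _ xy])
  fix A Z j assume A: "A \<in> vob C" and j: "j \<in> Z ~> W" and aj: "(isrc J ** u) ** j = jo A ** bang V Z"
  show "x ** j = y ** j"
  proof (rule J_cover0 [of "itgt J ** (u ** j)" Z])
    fix B Z' k assume B: "B \<in> vob C" and k: "k \<in> Z' ~> Z" and bk: "(itgt J ** (u ** j)) ** k = jo B ** bang V Z'"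
    have Z: "Z \<in> Obj V" using j Hom_Obj1 by blast
    have "((isrc J ** u) ** j) ** k = (jo A ** bang V Z) ** k" unfolding aj ..
    then have "isrc J ** (u ** (j ** k)) = jo A ** bang V Z'" using u j k A Z by simp
    moreover have "itgt J ** (u ** (j ** k)) = jo B ** bang V Z'" using bk u j k by simp
    ultimately obtain f where "f \<in> Z' ~> vhom C A B" "ja A B ** f = u ** (j ** k)"
      using ja_factor [OF A B, of "u ** (j ** k)" Z'] u j k by auto
    then have "x ** (j ** k) = y ** (j ** k)" using e [OF A B, of "j ** k" Z' f] j k by simp
    then show "(x ** j) ** k = (y ** j) ** k" using xy j k by simp
  qed (use u j xy in simp_all)
qed (use u in simp)

lemma J_cover2:
  assumes u: "u \<in> W ~> iar J" and v: "v \<in> W ~> iar J" and vu: "isrc J ** v = itgt J ** u"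
    and xy: "x \<in> W ~> Y" "y \<in> W ~> Y"
    and e: "\<And>A B E Z j f g. A \<in> vob C \<Longrightarrow> B \<in> vob C \<Longrightarrow> E \<in> vob C \<Longrightarrow> j \<in> Z ~> W \<Longrightarrow>
      f \<in> Z ~> vhom C A B \<Longrightarrow> g \<in> Z ~> vhom C B E \<Longrightarrow>
      u ** j = ja A B ** f \<Longrightarrow> v ** j = ja B E ** g \<Longrightarrow> x ** j = y ** j"
  shows "x = y"
proof (rule J_cover1 [OF u xy])
  fix A B Z j f assume A: "A \<in> vob C" "B \<in> vob C" and j: "j \<in> Z ~> W" and f: "f \<in> Z ~> vhom C A B"
    and uj: "u ** j = ja A B ** f"
  show "x ** j = y ** j"
  proof (rule J_cover0 [of "itgt J ** (v ** j)" Z])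
    fix E Z' k assume E: "E \<in> vob C" and k: "k \<in> Z' ~> Z" and bk: "(itgt J ** (v ** j)) ** k = jo E ** bang V Z'"
    have ujk: "u ** (j ** k) = ja A B ** (f ** k)" using comp_ext [OF uj, of k] u j f k A by simp
    have "isrc J ** (v ** (j ** k)) = itgt J ** (u ** (j ** k))"
      using comp_ext [OF vu, of "j ** k"] u v j k by simp
    then have "isrc J ** (v ** (j ** k)) = jo B ** bang V Z'" unfolding ujk using f k A by simp
    moreover have "itgt J ** (v ** (j ** k)) = jo E ** bang V Z'" using bk v j k by simp
    ultimately obtain g where "g \<in> Z' ~> vhom C B E" "ja B E ** g = v ** (j ** k)"
      using ja_factor [OF A(2) E, of "v ** (j ** k)" Z'] v j k by auto
    then have "x ** (j ** k) = y ** (j ** k)"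
      using e [OF A E, of "j ** k" Z' "f ** k" g] j k f ujk by simp
    then show "(x ** j) ** k = (y ** j) ** k" using xy j k by simp
  qed (use v j xy in simp_all)
qed

text \<open>
  Composable pairs form the coproduct of the \<open>C(B,E) \<times> C(A,B)\<close>, as they have the right generalised
  elements; so the composition of \<open>Int C\<close> exists.
\<close>

lemma J_comp_raw:
  "icomp J \<in> pb V (isrc J) (itgt J) ~> iar J"
  "\<And>A B E W f g. A \<in> vob C \<Longrightarrow> B \<in> vob C \<Longrightarrow> E \<in> vob C \<Longrightarrow> f \<in> W ~> vhom C A B \<Longrightarrow> g \<in> W ~> vhom C B E \<Longrightarrow>
    ic J (ja B E ** g) (ja A B ** f) = ja A E ** vc A B E g f"
proof -
  let ?s = "isrc J" and ?t = "itgt J"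
  let ?P = "pb V ?s ?t" and ?g = "pb1 V ?s ?t" and ?f = "pb2 V ?s ?t"
  have gf: "?g \<in> ?P ~> iar J" "?f \<in> ?P ~> iar J" "?s ** ?g = ?t ** ?f" using pb_comm [of ?s ?t] by simp_all
  define Q where "Q = (\<lambda>((A, B), E). prd V (vhom C B E) (vhom C A B))"
  define q where "q = (\<lambda>((A, B), E). pb_pair V ?s ?t (ja B E ** pr1 V (vhom C B E) (vhom C A B))
              (ja A B ** pr2 V (vhom C B E) (vhom C A B)))"
  have q: "q ((A, B), E) \<in> prd V (vhom C B E) (vhom C A B) ~> ?P"
    "?g ** q ((A, B), E) = ja B E ** pr1 V (vhom C B E) (vhom C A B)"
    "?f ** q ((A, B), E) = ja A B ** pr2 V (vhom C B E) (vhom C A B)"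
    if "A \<in> vob C" "B \<in> vob C" "E \<in> vob C" for A B E
    using that by (simp_all add: q_def)
  have qx: "q ((A, B), E) ** pair V g f = pb_pair V ?s ?t (ja B E ** g) (ja A B ** f)"
    if "A \<in> vob C" "B \<in> vob C" "E \<in> vob C" "f \<in> W ~> vhom C A B" "g \<in> W ~> vhom C B E" for A B E W f g
    using that by (simp add: q_def)
  have T: "is_coproduct V ((vob C \<times> vob C) \<times> vob C) (\<lambda>_. pt) (prd V (prd V (iob J) (iob J)) (iob J),
      \<lambda>(k, l). pair V ((\<lambda>(k, l). pair V (jo k) (jo l)) k) (jo l))"
    by (rule copower_product [OF copower_product [OF J_objects J_objects] J_objects])
  define \<kappa> where "\<kappa> = pair V (pair V (?s ** ?f) (?t ** ?f)) (?t ** ?g)"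
  have k: "\<kappa> \<in> ?P ~> prd V (prd V (iob J) (iob J)) (iob J)" using gf by (simp add: \<kappa>_def)
  have kh: "\<kappa> ** h = pair V (pair V (?s ** (?f ** h)) (?t ** (?f ** h))) (?t ** (?g ** h))" if "h \<in> W ~> ?P" for h W
    using gf that by (simp add: \<kappa>_def)
  have c: "is_coproduct V ((vob C \<times> vob C) \<times> vob C) Q (?P, q)"
  proof (rule coproduct_by_elements [OF small_pairs(2) T k])
    fix i assume "i \<in> (vob C \<times> vob C) \<times> vob C"
    then obtain A B E where i: "i = ((A, B), E)" and A: "A \<in> vob C" "B \<in> vob C" "E \<in> vob C" by auto
    show "q i \<in> Q i ~> ?P" unfolding i Q_def using q(1) [OF A] by simp
    show "\<kappa> ** q i = (case i of (k, l) \<Rightarrow> pair V (case k of (k, l) \<Rightarrow> pair V (jo k) (jo l)) (jo l)) ** bang V (Q i)"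
      unfolding i Q_def kh [OF q(1) [OF A]] q(2,3) [OF A] using A by simp
    fix W h assume h: "h \<in> W ~> ?P"
      and e: "\<kappa> ** h = (case i of (k, l) \<Rightarrow> pair V (case k of (k, l) \<Rightarrow> pair V (jo k) (jo l)) (jo l)) ** bang V W"
    have W: "W \<in> Obj V" using h Hom_Obj1 by blast
    have fh: "?f ** h \<in> W ~> iar J" "?g ** h \<in> W ~> iar J" using gf h by simp_all
    have "pair V (pair V (?s ** (?f ** h)) (?t ** (?f ** h))) (?t ** (?g ** h)) =
      pair V (pair V (jo A ** bang V W) (jo B ** bang V W)) (jo E ** bang V W)"
      using e unfolding i kh [OF h] using A W by simp
    then have st: "?s ** (?f ** h) = jo A ** bang V W" "?t ** (?f ** h) = jo B ** bang V W" "?t ** (?g ** h) = jo E ** bang V W"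
      using fh A W by (simp_all add: pair_eq_iff del: assoc)
    moreover have "?s ** (?g ** h) = ?t ** (?f ** h)" using pb_comm_comp [of ?s ?t h] h by simp
    ultimately have sg: "?s ** (?g ** h) = jo B ** bang V W" by simp
    obtain f where f: "f \<in> W ~> vhom C A B" "ja A B ** f = ?f ** h"
      using ja_factor [OF A(1,2) fh(1) st(1,2)] by blast
    obtain g where g: "g \<in> W ~> vhom C B E" "ja B E ** g = ?g ** h"
      using ja_factor [OF A(2,3) fh(2) sg st(3)] by blast
    show "\<exists>!w. w \<in> W ~> Q i \<and> q i ** w = h"
    proof (rule ex1I [of _ "pair V g f"])
      have "q i ** pair V g f = h" unfolding i qx [OF A f(1) g(1)] f(2) g(2) using h by simp
      then show "pair V g f \<in> W ~> Q i \<and> q i ** pair V g f = h" using f(1) g(1) by (simp add: i Q_def)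
      fix w assume w: "w \<in> W ~> Q i \<and> q i ** w = h"
      let ?p1 = "pr1 V (vhom C B E) (vhom C A B)" and ?p2 = "pr2 V (vhom C B E) (vhom C A B)"
      have w1: "w \<in> W ~> prd V (vhom C B E) (vhom C A B)" "q ((A, B), E) ** w = h" using w by (simp_all add: i Q_def)
      have wp: "?p1 ** w \<in> W ~> vhom C B E" "?p2 ** w \<in> W ~> vhom C A B" using w1(1) A by simp_all
      have "ja B E ** (?p1 ** w) = ja B E ** g" "ja A B ** (?p2 ** w) = ja A B ** f"
        using comp_ext [OF q(2) [OF A], of w] comp_ext [OF q(3) [OF A], of w] q(1) [OF A] w1 f(2) g(2) gf A
        by simp_all
      then have "?p1 ** w = g" "?p2 ** w = f" using ja_mono A wp f(1) g(1) by blast+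
      then show "w = pair V g f" using pair_eta [of w "vhom C B E" "vhom C A B"] w1(1) A by simp
    qed
  qed
  have cf: "\<And>i. i \<in> (vob C \<times> vob C) \<times> vob C \<Longrightarrow> (case i of ((A, B), E) \<Rightarrow> ja A E ** vcomp C A B E) \<in> Q i ~> iar J"
    by (auto simp: Q_def)
  have c1: "\<exists>!c. c \<in> ?P ~> iar J \<and> (\<forall>A\<in>vob C. \<forall>B\<in>vob C. \<forall>E\<in>vob C. c ** q ((A, B), E) = ja A E ** vcomp C A B E)"
  proof -
    have eq: "(\<forall>i\<in>(vob C \<times> vob C) \<times> vob C. c ** q i = (case i of ((A, B), E) \<Rightarrow> ja A E ** vcomp C A B E)) \<longleftrightarrow>
        (\<forall>A\<in>vob C. \<forall>B\<in>vob C. \<forall>E\<in>vob C. c ** q ((A, B), E) = ja A E ** vcomp C A B E)" for c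
      by auto
    show ?thesis using coproduct_universal [OF c J_ob_arr(2) cf] unfolding eq .
  qed
  have st: "?s = int_src V C" "?t = int_tgt V C" "iar J = int_ar V C" by (simp_all add: Internal_def)
  have "icomp J = (THE c. c \<in> ?P ~> iar J \<and> (\<forall>A\<in>vob C. \<forall>B\<in>vob C. \<forall>E\<in>vob C. c ** q ((A, B), E) = ja A E ** vcomp C A B E))"
    unfolding st q_def by (simp add: Internal_def int_comp_def)
  with theI' [OF c1] have ic: "icomp J \<in> ?P ~> iar J"
    "\<And>A B E. A \<in> vob C \<Longrightarrow> B \<in> vob C \<Longrightarrow> E \<in> vob C \<Longrightarrow> icomp J ** q ((A, B), E) = ja A E ** vcomp C A B E" by auto
  show "icomp J \<in> pb V (isrc J) (itgt J) ~> iar J" by (rule ic(1))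
  fix A B E W f g assume A: "A \<in> vob C" "B \<in> vob C" "E \<in> vob C" and f: "f \<in> W ~> vhom C A B" and g: "g \<in> W ~> vhom C B E"
  have "ic J (ja B E ** g) (ja A B ** f) = icomp J ** (q ((A, B), E) ** pair V g f)"
    unfolding icompose_def qx [OF A f g] ..
  also have "\<dots> = ja A E ** vc A B E g f"
    using comp_ext [OF ic(2) [OF A], of "pair V g f"] q(1) [OF A] ic(1) A f g by (simp add: vc_def)
  finally show "ic J (ja B E ** g) (ja A B ** f) = ja A E ** vc A B E g f" .
qed

lemma J_iid_raw:
  "iid J \<in> iob J ~> iar J" "\<And>A. A \<in> vob C \<Longrightarrow> iid J ** jo A = ja A A ** vid C A"
proof -
  have e: "\<exists>t. is_coproduct V (vob C) (\<lambda>_. pt) t" using J_objects by blast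
  have "\<And>A. A \<in> vob C \<Longrightarrow> ja A A ** vid C A \<in> pt ~> iar J" by simp
  note p = copair_props [OF e this J_ob_arr(2)]
  have o: "coprd V (vob C) (\<lambda>_. pt) = iob J" "int_ar V C = iar J" by (simp_all add: Internal_def int_ob_def)
  have i: "iid J = copair V (vob C) (\<lambda>_. pt) (iar J) (\<lambda>A. ja A A ** vid C A)" by (simp add: Internal_def)
  show "iid J \<in> iob J ~> iar J" "\<And>A. A \<in> vob C \<Longrightarrow> iid J ** jo A = ja A A ** vid C A"
    using p unfolding i o by (simp_all add: int_ob_inj_def)
qed

lemma J_iid_jo [simp]:
  assumes A: "A \<in> vob C" and w: "w \<in> Arr V" "Cod V w = pt"
  shows "iid J ** (jo A ** w) = ja A A ** (vid C A ** w)"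
  using comp_ext [OF J_iid_raw(2) [OF A], of w] J_iid_raw(1) A w by simp

text \<open>Where all objects are constant, the axioms are those of \<open>C\<close>.\<close>

lemma J_icat [simp]: "J \<in> Obj CV"
proof -
  let ?s = "isrc J" and ?t = "itgt J" and ?i = "iid J"
  let ?m = "ic J"
  have i: "?i \<in> iob J ~> iar J" by (rule J_iid_raw)
  have 1: "?s ** ?i = Ident V (iob J)"
    by (rule coproduct_eqI [OF J_objects, of _ "iob J"]) (use i J_iid_raw(2) in simp_all)
  have 2: "?t ** ?i = Ident V (iob J)"
    by (rule coproduct_eqI [OF J_objects, of _ "iob J"]) (use i J_iid_raw(2) in simp_all)
  have n: "?m g f \<in> W ~> iar J" "\<And>Z h. h \<in> Z ~> W \<Longrightarrow> ?m g f ** h = ?m (g ** h) (f ** h)"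
    if "g \<in> W ~> iar J" "f \<in> W ~> iar J" "?s ** g = ?t ** f" for g f W
    using that J_comp_raw(1) by (simp_all add: icompose_def)
  have m: "?m g f \<in> W ~> iar J \<and> ?s ** ?m g f = ?s ** f \<and> ?t ** ?m g f = ?t ** g"
    if gf: "g \<in> W ~> iar J" "f \<in> W ~> iar J" "?s ** g = ?t ** f" for g f W
  proof (intro conjI)
    show mm: "?m g f \<in> W ~> iar J" by (rule n(1) [OF gf])
    show "?s ** ?m g f = ?s ** f"
    proof (rule J_cover2 [OF gf(2,1,3), of _ "iob J"])
      fix A B E Z j f' g' assume A: "A \<in> vob C" "B \<in> vob C" "E \<in> vob C" and j: "j \<in> Z ~> W"
        and f': "f' \<in> Z ~> vhom C A B" and g': "g' \<in> Z ~> vhom C B E"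
        and e: "f ** j = ja A B ** f'" "g ** j = ja B E ** g'"
      show "(?s ** ?m g f) ** j = (?s ** f) ** j"
        using mm gf(1,2) j A f' g' e by (simp add: n(2) [OF gf j] J_comp_raw(2) [OF A f' g'])
    qed (use mm gf in simp_all)
    show "?t ** ?m g f = ?t ** g"
    proof (rule J_cover2 [OF gf(2,1,3), of _ "iob J"])
      fix A B E Z j f' g' assume A: "A \<in> vob C" "B \<in> vob C" "E \<in> vob C" and j: "j \<in> Z ~> W"
        and f': "f' \<in> Z ~> vhom C A B" and g': "g' \<in> Z ~> vhom C B E"
        and e: "f ** j = ja A B ** f'" "g ** j = ja B E ** g'"
      show "(?t ** ?m g f) ** j = (?t ** g) ** j"
        using mm gf(1,2) j A f' g' e by (simp add: n(2) [OF gf j] J_comp_raw(2) [OF A f' g'])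
    qed (use mm gf in simp_all)
  qed
  have a: "?m (?m h g) f = ?m h (?m g f)"
    if f: "f \<in> W ~> iar J" and g: "g \<in> W ~> iar J" and h: "h \<in> W ~> iar J"
      and gf: "?s ** g = ?t ** f" and hg: "?s ** h = ?t ** g" for W f g h
  proof -
    note m1 = m [OF g f gf] and m2 = m [OF h g hg]
    have c1: "?m h g \<in> W ~> iar J" "?s ** ?m h g = ?t ** f" and c2: "?m g f \<in> W ~> iar J" "?s ** h = ?t ** ?m g f"
      using m1 m2 gf hg by (simp_all del: Hom_iff)
    note n1 = n [OF c1(1) f c1(2)] and n2 = n [OF h c2]
    show ?thesis
    proof (rule J_cover2 [OF f g gf n1(1) n2(1)])
      fix A B E Z j f' g' assume A: "A \<in> vob C" "B \<in> vob C" "E \<in> vob C" and j: "j \<in> Z ~> W"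
        and f': "f' \<in> Z ~> vhom C A B" and g': "g' \<in> Z ~> vhom C B E"
        and e: "f ** j = ja A B ** f'" "g ** j = ja B E ** g'"
      have Z: "Z \<in> Obj V" using j Hom_Obj1 by blast
      show "?m (?m h g) f ** j = ?m h (?m g f) ** j"
      proof (rule J_cover0 [of "?t ** (h ** j)" Z])
        fix K Y k assume K: "K \<in> vob C" and k: "k \<in> Y ~> Z" and tk: "(?t ** (h ** j)) ** k = jo K ** bang V Y"
        have jk: "j ** k \<in> Y ~> W" using j k by simp
        have fk: "f ** (j ** k) = ja A B ** (f' ** k)" "g ** (j ** k) = ja B E ** (g' ** k)"
          using comp_ext [OF e(1), of k] comp_ext [OF e(2), of k] f g j k f' g' A by simp_all
        have "?s ** (h ** (j ** k)) = ?t ** (g ** (j ** k))"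
          using comp_ext [OF hg, of "j ** k"] h g j k by simp
        then have "?s ** (h ** (j ** k)) = jo E ** bang V Y" unfolding fk using g' k A by simp
        moreover have "?t ** (h ** (j ** k)) = jo K ** bang V Y" using tk h j k by simp
        moreover have "h ** (j ** k) \<in> Y ~> iar J" using h j k by simp
        ultimately obtain h' where h': "h' \<in> Y ~> vhom C E K" "ja E K ** h' = h ** (j ** k)"
          using ja_factor [OF A(3) K] by metis
        have fgk: "f' ** k \<in> Y ~> vhom C A B" "g' ** k \<in> Y ~> vhom C B E" using f' g' k by simp_all
        have "?m (?m h g) f ** (j ** k) = ?m (?m (ja E K ** h') (ja B E ** (g' ** k))) (ja A B ** (f' ** k))"
          unfolding n1(2) [OF jk] n(2) [OF h g hg jk] fk h'(2) ..
        also have "\<dots> = ja A K ** vc A B K (vc B E K h' (g' ** k)) (f' ** k)"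
          unfolding J_comp_raw(2) [OF A(2,3) K fgk(2) h'(1)]
          by (rule J_comp_raw(2) [OF A(1,2) K fgk(1)]) (use A K fgk h' in simp)
        also have "\<dots> = ja A K ** vc A E K h' (vc A B E (g' ** k) (f' ** k))"
          unfolding vc_assoc [OF A K fgk h'(1)] ..
        also have "\<dots> = ?m (ja E K ** h') (ja A E ** vc A B E (g' ** k) (f' ** k))"
          by (rule J_comp_raw(2) [symmetric, OF A(1,3) K _ h'(1)]) (use A fgk in simp)
        also have "\<dots> = ?m h (?m g f) ** (j ** k)"
          unfolding n2(2) [OF jk] n(2) [OF g f gf jk] fk h'(2) J_comp_raw(2) [OF A fgk] ..
        finally show "(?m (?m h g) f ** j) ** k = (?m h (?m g f) ** j) ** k"
          using n1(1) n2(1) j k by simp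
      qed (use h j n1(1) n2(1) in simp_all)
    qed
  qed
  have lr: "?m (?i ** (?t ** f)) f = f \<and> ?m f (?i ** (?s ** f)) = f" if f: "f \<in> W ~> iar J" for W f
  proof -
    have st: "?t ** f \<in> W ~> iob J" "?s ** f \<in> W ~> iob J" using f by simp_all
    have c: "?s ** (?i ** (?t ** f)) = ?t ** f" "?s ** f = ?t ** (?i ** (?s ** f))"
      using comp_ext [OF 1, of "?t ** f"] comp_ext [OF 2, of "?s ** f"] st i f by simp_all
    have it: "?i ** (?t ** f) \<in> W ~> iar J" "?i ** (?s ** f) \<in> W ~> iar J" using i f by simp_all
    note n1 = n [OF it(1) f c(1)] and n2 = n [OF f it(2) c(2)]
    show ?thesis
    proof
      show "?m (?i ** (?t ** f)) f = f"
      proof (rule J_cover1 [OF f n1(1) f])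
        fix A B Z j f' assume A: "A \<in> vob C" "B \<in> vob C" and j: "j \<in> Z ~> W"
          and f': "f' \<in> Z ~> vhom C A B" and e: "f ** j = ja A B ** f'"
        have Z: "Z \<in> Obj V" using j Hom_Obj1 by blast
        have v: "vid C B ** bang V Z \<in> Z ~> vhom C B B" using A Z by simp
        show "?m (?i ** (?t ** f)) f ** j = f ** j"
          using J_comp_raw(2) [OF A A(2) f' v] vc_id_left [OF A f'] n1(2) [OF j] e i f j A f' Z by simp
      qed
      show "?m f (?i ** (?s ** f)) = f"
      proof (rule J_cover1 [OF f n2(1) f])
        fix A B Z j f' assume A: "A \<in> vob C" "B \<in> vob C" and j: "j \<in> Z ~> W"
          and f': "f' \<in> Z ~> vhom C A B" and e: "f ** j = ja A B ** f'"
        have Z: "Z \<in> Obj V" using j Hom_Obj1 by blast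
        have v: "vid C A ** bang V Z \<in> Z ~> vhom C A A" using A Z by simp
        show "?m f (?i ** (?s ** f)) ** j = f ** j"
          using J_comp_raw(2) [OF A(1,1,2) v f'] vc_id_right [OF A f'] n2(2) [OF j] e i f j A f' Z by simp
      qed
    qed
  qed
  have st: "?s \<in> iar J ~> iob J" "?t \<in> iar J ~> iob J" by simp_all
  have "icomp J = ?m (pb1 V ?s ?t) (pb2 V ?s ?t)" using J_comp_raw(1) by (simp add: icompose_def)
  then have "J = mk_icat (iob J) (iar J) ?s ?t ?i ?m" by (simp add: mk_icat_def)
  also have "\<dots> \<in> Obj CV"
    by (rule mk_icat(1) [OF st i 1 2]) ((fact m) | (fact n(2)) | (fact a) | (use lr in blast))+
  finally show ?thesis .
qed

end

locale two_small_vcats = A: small_vcat V U A + B: small_vcat V U B + two_vcats V A B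
  for V :: "('o, 'm) cat" (structure) and U :: "'u set" and A :: "('a, 'o, 'm) vcat" and B :: "('b, 'o, 'm) vcat"
begin

lemma Internal_fun_props:
  assumes F: "vfunctor V A B F"
  shows "Internal_fun V A B F \<in> Hom (Cat V) (Internal V A) (Internal V B)"
    "\<And>X w. X \<in> vob A \<Longrightarrow> w \<in> Arr V \<Longrightarrow> Cod V w = (term_ob V) \<Longrightarrow>
      if0 (Internal_fun V A B F) ** (A.jo X ** w) = B.jo (vfo F X) ** w"
    "\<And>X Y f. X \<in> vob A \<Longrightarrow> Y \<in> vob A \<Longrightarrow> f \<in> Arr V \<Longrightarrow> Cod V f = vhom A X Y \<Longrightarrow>
      if1 (Internal_fun V A B F) ** (A.ja X Y ** f) = B.ja (vfo F X) (vfo F Y) ** (vfa F X Y ** f)"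
proof -
  note Fs = vfunctor_simps [OF F]
  let ?I = "Internal_fun V A B F"
  define f0 where "f0 = if0 ?I"
  define f1 where "f1 = if1 ?I"
  have o: "coprd V (vob A) (\<lambda>_. (term_ob V)) = iob A.J" "int_ob V B = iob B.J" "int_ar V B = iar B.J"
    "coprd V (vob A \<times> vob A) (\<lambda>(X, Y). vhom A X Y) = iar A.J" by (simp_all add: Internal_def int_ob_def int_ar_def)
  have e0: "\<exists>t. is_coproduct V (vob A) (\<lambda>_. (term_ob V)) t" using A.J_objects by blast
  have e1: "\<exists>t. is_coproduct V (vob A \<times> vob A) (\<lambda>(X, Y). vhom A X Y) t" using A.J_arrows by blast
  have "\<And>X. X \<in> vob A \<Longrightarrow> B.jo (vfo F X) \<in> (term_ob V) ~> iob B.J" using Fs by simp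
  note p = A.copair_props [OF e0 this B.J_ob_arr(1)]
  have "\<And>i. i \<in> vob A \<times> vob A \<Longrightarrow> (case i of (X, Y) \<Rightarrow> B.ja (vfo F X) (vfo F Y) ** vfa F X Y) \<in>
      (case i of (X, Y) \<Rightarrow> vhom A X Y) ~> iar B.J" using Fs by auto
  note q = A.copair_props [OF e1 this B.J_ob_arr(2)]
  have f0: "f0 \<in> iob A.J ~> iob B.J" "\<And>X. X \<in> vob A \<Longrightarrow> f0 ** A.jo X = B.jo (vfo F X)"
    using p unfolding f0_def o by (simp_all add: Internal_fun_def o int_ob_inj_def)
  have f1: "f1 \<in> iar A.J ~> iar B.J"
    "\<And>X Y. X \<in> vob A \<Longrightarrow> Y \<in> vob A \<Longrightarrow> f1 ** A.ja X Y = B.ja (vfo F X) (vfo F Y) ** vfa F X Y"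
  proof -
    show "f1 \<in> iar A.J ~> iar B.J" using q(1) unfolding f1_def o by (simp add: Internal_fun_def o)
    show "f1 ** A.ja X Y = B.ja (vfo F X) (vfo F Y) ** vfa F X Y" if "X \<in> vob A" "Y \<in> vob A" for X Y
      using q(2) [of "(X, Y)"] that unfolding f1_def o by (simp add: Internal_fun_def o int_ar_inj_def)
  qed
  have f0w: "f0 ** (A.jo X ** w) = B.jo (vfo F X) ** w" if "X \<in> vob A" "w \<in> Arr V" "Cod V w = (term_ob V)" for X w
    using A.comp_ext [OF f0(2) [OF that(1)], of w] f0(1) that by simp
  have f1f: "f1 ** (A.ja X Y ** f) = B.ja (vfo F X) (vfo F Y) ** (vfa F X Y ** f)"
    if "X \<in> vob A" "Y \<in> vob A" "f \<in> Arr V" "Cod V f = vhom A X Y" for X Y f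
    using A.comp_ext [OF f1(2) [OF that(1,2)], of f] f1(1) Fs that by simp
  then show "\<And>X Y f. X \<in> vob A \<Longrightarrow> Y \<in> vob A \<Longrightarrow> f \<in> Arr V \<Longrightarrow> Cod V f = vhom A X Y \<Longrightarrow>
      if1 ?I ** (A.ja X Y ** f) = B.ja (vfo F X) (vfo F Y) ** (vfa F X Y ** f)" unfolding f1_def .
  show "\<And>X w. X \<in> vob A \<Longrightarrow> w \<in> Arr V \<Longrightarrow> Cod V w = (term_ob V) \<Longrightarrow>
      if0 ?I ** (A.jo X ** w) = B.jo (vfo F X) ** w" using f0w unfolding f0_def .
  have "?I = \<lparr>idom = A.J, icod = B.J, if0 = f0, if1 = f1\<rparr>" by (simp add: f0_def f1_def Internal_fun_def)
  also have "\<dots> \<in> Hom (Cat V) A.J B.J"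
  proof (rule A.ifunctorI [OF A.J_icat B.J_icat f0(1) f1(1)])
    show "isrc B.J ** f1 = f0 ** isrc A.J"
      by (rule A.coproduct_eqI [OF A.J_arrows, of _ "iob B.J"])
        (use f0(1) f0w f1 Fs A.J_src_tgt_raw(3) in auto)
    show "itgt B.J ** f1 = f0 ** itgt A.J"
      by (rule A.coproduct_eqI [OF A.J_arrows, of _ "iob B.J"])
        (use f0(1) f0w f1 Fs A.J_src_tgt_raw(4) in auto)
    show "f1 ** iid A.J = iid B.J ** f0"
    proof (rule A.coproduct_eqI [OF A.J_objects, of _ "iar B.J"])
      fix X assume X: "X \<in> vob A"
      have "f1 ** (iid A.J ** A.jo X) = f1 ** (A.ja X X ** vid A X)" using A.J_iid_raw(2) [OF X] by simp
      also have "\<dots> = iid B.J ** (f0 ** A.jo X)"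
        using f1f [OF X X, of "vid A X"] Fs(2) [OF X] B.J_iid_raw(2) Fs(1) [OF X] f0(2) X by simp
      finally show "(f1 ** iid A.J) ** A.jo X = (iid B.J ** f0) ** A.jo X" using f1(1) f0(1) X by simp
    qed (use f0(1) f1(1) in simp_all)
    fix W g f assume gf: "g \<in> W ~> iar A.J" "f \<in> W ~> iar A.J" "isrc A.J ** g = itgt A.J ** f"
    have s: "isrc B.J ** (f1 ** g) = itgt B.J ** (f1 ** f)"
    proof -
      have "isrc B.J ** f1 = f0 ** isrc A.J" by fact
      moreover have "itgt B.J ** f1 = f0 ** itgt A.J" by fact
      ultimately show ?thesis
        using A.comp_ext [of "isrc B.J" f1 _ g] A.comp_ext [of "itgt B.J" f1 _ f] gf f0(1) f1(1) by simp
    qed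
    show "f1 ** icompose V A.J g f = icompose V B.J (f1 ** g) (f1 ** f)"
    proof (rule A.J_cover2 [OF gf(2,1,3), of _ "iar B.J"])
      fix X Y Z T j f' g' assume X: "X \<in> vob A" "Y \<in> vob A" "Z \<in> vob A" and j: "j \<in> T ~> W"
        and f': "f' \<in> T ~> vhom A X Y" and g': "g' \<in> T ~> vhom A Y Z"
        and e: "f ** j = A.ja X Y ** f'" "g ** j = A.ja Y Z ** g'"
      have Ff: "vfa F X Y ** f' \<in> T ~> vhom B (vfo F X) (vfo F Y)" "vfa F Y Z ** g' \<in> T ~> vhom B (vfo F Y) (vfo F Z)"
        using f' g' Fs X by simp_all
      have "(f1 ** icompose V A.J g f) ** j = f1 ** icompose V A.J (A.ja Y Z ** g') (A.ja X Y ** f')"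
        using gf j f1(1) e by simp
      also have "\<dots> = B.ja (vfo F X) (vfo F Z) ** (vfa F X Z ** A.vc X Y Z g' f')"
        unfolding A.J_comp_raw(2) [OF X f' g'] using f1f [OF X(1,3), of "A.vc X Y Z g' f'"] X f' g' by simp
      also have "\<dots> = icompose V B.J (B.ja (vfo F Y) (vfo F Z) ** (vfa F Y Z ** g')) (B.ja (vfo F X) (vfo F Y) ** (vfa F X Y ** f'))"
        unfolding vfunctor_comp [OF F X f' g'] B.J_comp_raw(2) [OF Fs(1) [OF X(1)] Fs(1) [OF X(2)] Fs(1) [OF X(3)] Ff] ..
      also have "\<dots> = icompose V B.J (f1 ** (g ** j)) (f1 ** (f ** j))"
        unfolding e using f1f X f' g' by simp
      also have "\<dots> = icompose V B.J (f1 ** g) (f1 ** f) ** j" using s gf j f1(1) by simp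
      finally show "(f1 ** icompose V A.J g f) ** j = icompose V B.J (f1 ** g) (f1 ** f) ** j" .
    qed (use gf f1(1) s in simp_all)
  qed
  finally show "?I \<in> Hom (Cat V) A.J B.J" .
qed

end


section \<open>The arrow category is the exponential by the walking arrow\<close>

context ext_ccc
begin

lemma vtwo_simps [simp]:
  "vob (vtwo V) = UNIV" "vhom (vtwo V) a b = (if a \<le> b then pt else init_ob V)"
  "vid (vtwo V) a = Ident V pt"
  by (simp_all add: vtwo_def Let_def)

lemma vtwo_hom_Obj [simp]: "vhom (vtwo V) a b \<in> Obj V"
  by simp

text \<open>The hom-objects are subterminal, which makes all axioms automatic.\<close>

lemma vtwo_hom_eqI:
  assumes "x \<in> W ~> vhom (vtwo V) a b" "y \<in> W ~> vhom (vtwo V) a b"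
  shows "x = y"
proof (cases "a \<le> b")
  case True then show ?thesis using assms by (intro term_eqI) simp_all
next
  case False then show ?thesis using assms init_strict [of x W x "init_ob V" y] by simp
qed

lemma vcategory_two: "vcategory V (vtwo V)"
proof (rule vcategoryI)
  have c: "vcomp (vtwo V) a b d \<in> prd V (vhom (vtwo V) b d) (vhom (vtwo V) a b) ~> vhom (vtwo V) a d" for a b d
  proof (cases "a \<le> d")
    case True then show ?thesis by (simp add: vtwo_def Let_def)
  next
    case False then show ?thesis by (cases b) (simp_all add: vtwo_def Let_def)
  qed
  then show "vcomp (vtwo V) a b d \<in> prd V (vhom (vtwo V) b d) (vhom (vtwo V) a b) ~> vhom (vtwo V) a d" for a b d .
  have m: "vcomp (vtwo V) a b d ** pair V g f \<in> W ~> vhom (vtwo V) a d"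
    if "f \<in> W ~> vhom (vtwo V) a b" "g \<in> W ~> vhom (vtwo V) b d" for a b d W f g
    using c [of a b d] that by (simp del: vtwo_simps)
  show "vcomp (vtwo V) a b e ** pair V (vcomp (vtwo V) b d e ** pair V h g) f =
      vcomp (vtwo V) a d e ** pair V h (vcomp (vtwo V) a b d ** pair V g f)"
    if "f \<in> W ~> vhom (vtwo V) a b" "g \<in> W ~> vhom (vtwo V) b d" "h \<in> W ~> vhom (vtwo V) d e"
    for a b d e W f g h
    by (rule vtwo_hom_eqI [OF m [OF that(1) m [OF that(2,3)]] m [OF m [OF that(1,2)] that(3)]])
  have v: "vid (vtwo V) a ** bang V W \<in> W ~> vhom (vtwo V) a a" if "f \<in> W ~> X" for a W f X
    using that Hom_Obj1 [OF that] by simp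
  show "vcomp (vtwo V) a b b ** pair V (vid (vtwo V) b ** bang V W) f = f"
    "vcomp (vtwo V) a a b ** pair V f (vid (vtwo V) a ** bang V W) = f"
    if f: "f \<in> W ~> vhom (vtwo V) a b" for a b W f
    by (rule vtwo_hom_eqI [OF m [OF f v [OF f]] f], rule vtwo_hom_eqI [OF m [OF v [OF f] f] f])
qed simp_all

end

sublocale ext_ccc \<subseteq> two: small_vcat V U "vtwo V"
  by unfold_locales (rule vcategory_two, rule small_finite [OF universe], simp)

context ext_ccc
begin

lemma itwo_J [simp]: "Internal V (vtwo V) = itwo V"
  by (simp add: itwo_def)

lemma itwo_Obj [simp]: "itwo V \<in> Obj CV"
  using two.J_icat by (simp add: itwo_J)

abbreviation "ob2 \<equiv> int_ob_inj V (vtwo V)"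
abbreviation "ar2 \<equiv> int_ar_inj V (vtwo V)"

lemma ob2_simps [simp]: "ob2 b \<in> Arr V" "Dom V (ob2 b) = pt" "Cod V (ob2 b) = iob (itwo V)"
  using two.jo_simps [of b] by (simp_all add: itwo_J)

text \<open>\<open>le2\<close> stops the simplifier from unfolding the order on \<open>bool\<close> into an implication.\<close>

definition le2 :: "bool \<Rightarrow> bool \<Rightarrow> bool" where
  "le2 a b \<longleftrightarrow> a \<le> b"

lemma le2_simps [simp]: "le2 a a" "le2 False b" "le2 a True" "\<not> le2 True False"
  by (simp_all add: le2_def)

lemma le2_trans: "le2 a b \<Longrightarrow> le2 b d \<Longrightarrow> le2 a d"
  by (auto simp: le2_def)

lemma ar2_simps [simp]:
  assumes "le2 a b"
  shows "ar2 a b \<in> Arr V" "Dom V (ar2 a b) = pt" "Cod V (ar2 a b) = iar (itwo V)"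
    "\<And>w. w \<in> Arr V \<Longrightarrow> Cod V w = pt \<Longrightarrow> isrc (itwo V) ** (ar2 a b ** w) = ob2 a ** w"
    "\<And>w. w \<in> Arr V \<Longrightarrow> Cod V w = pt \<Longrightarrow> itgt (itwo V) ** (ar2 a b ** w) = ob2 b ** w"
  using two.ja_simps [of a b] two.J_src_ja [of a b] assms bang_unique by (simp_all add: le2_def)

lemma iid_ob2 [simp]: "w \<in> Arr V \<Longrightarrow> Cod V w = pt \<Longrightarrow> iid (itwo V) ** (ob2 b ** w) = ar2 b b ** w"
  using two.J_iid_jo [of b w] by (simp add: itwo_J)

lemma ar2_comp [simp]:
  assumes "le2 a b" "le2 b e" "f \<in> Arr V" "g \<in> Arr V" "Cod V f = pt" "Cod V g = pt" "Dom V g = Dom V f"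
  shows "ic (itwo V) (ar2 b e ** g) (ar2 a b ** f) = ar2 a e ** f"
proof -
  have f: "f \<in> Dom V f ~> vhom (vtwo V) a b" and g: "g \<in> Dom V f ~> vhom (vtwo V) b e"
    and f': "f \<in> Dom V f ~> vhom (vtwo V) a e"
    using assms by (auto simp: le2_def)
  have "two.vc a b e g f = f"
    by (rule vtwo_hom_eqI [of _ "Dom V f" a e]) (use f g f' two.vc_simps [of a b e f g] in \<open>simp_all del: vtwo_simps(2)\<close>)
  then show ?thesis using two.J_comp_raw(2) [of a b e f "Dom V f" g] f g by (simp add: itwo_J del: vtwo_simps(2))
qed

lemma two_cover0:
  assumes a: "a \<in> W ~> iob (itwo V)" and xy: "x \<in> W ~> Y" "y \<in> W ~> Y"
    and e: "\<And>b Z j. j \<in> Z ~> W \<Longrightarrow> Z \<in> Obj V \<Longrightarrow> a ** j = ob2 b ** bang V Z \<Longrightarrow> x ** j = y ** j"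
  shows "x = y"
proof (rule two.J_cover0 [of a W, OF _ xy])
  show "a \<in> W ~> iob (Internal V (vtwo V))" using a by (simp add: itwo_J)
  fix b Z j assume "j \<in> Z ~> W" "a ** j = ob2 b ** bang V Z"
  then show "x ** j = y ** j" using e Hom_Obj1 by blast
qed

text \<open>The hom-object \<open>2(1,0)\<close> being strictly initial, the case of an arrow from \<open>1\<close> to \<open>0\<close> is void.\<close>

lemma two_hom_cases:
  assumes f: "f \<in> Z ~> vhom (vtwo V) a b" and x: "x \<in> Z ~> Y" and y: "y \<in> Z ~> Y"
    and e: "le2 a b \<Longrightarrow> f = bang V Z \<Longrightarrow> x = y"
  shows "x = y"
proof (cases "le2 a b")
  case True then show ?thesis using f by (intro e) (simp_all add: bang_unique le2_def)
next
  case False then show ?thesis using f x y init_strict [of f Z x Y y] by (simp add: le2_def)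
qed

lemma two_cover1:
  assumes u: "u \<in> W ~> iar (itwo V)" and xy: "x \<in> W ~> Y" "y \<in> W ~> Y"
    and e: "\<And>a b Z j. le2 a b \<Longrightarrow> j \<in> Z ~> W \<Longrightarrow> Z \<in> Obj V \<Longrightarrow> u ** j = ar2 a b ** bang V Z \<Longrightarrow> x ** j = y ** j"
  shows "x = y"
proof (rule two.J_cover1 [of u W, OF _ xy])
  show "u \<in> W ~> iar (Internal V (vtwo V))" using u by (simp add: itwo_J)
  fix a b Z j f assume j: "j \<in> Z ~> W" and f: "f \<in> Z ~> vhom (vtwo V) a b" and uj: "u ** j = ar2 a b ** f"
  show "x ** j = y ** j"
    by (rule two_hom_cases [OF f, of _ Y]) (use e [of a b j Z] j uj xy Hom_Obj1 [OF j] in simp_all)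
qed

lemma two_cover2:
  assumes u: "u \<in> W ~> iar (itwo V)" and v: "v \<in> W ~> iar (itwo V)"
    and vu: "isrc (itwo V) ** v = itgt (itwo V) ** u"
    and xy: "x \<in> W ~> Y" "y \<in> W ~> Y"
    and e: "\<And>a b d Z j. le2 a b \<Longrightarrow> le2 b d \<Longrightarrow> j \<in> Z ~> W \<Longrightarrow> Z \<in> Obj V \<Longrightarrow> u ** j = ar2 a b ** bang V Z \<Longrightarrow>
      v ** j = ar2 b d ** bang V Z \<Longrightarrow> x ** j = y ** j"
  shows "x = y"
proof (rule two.J_cover2 [of u W v, OF _ _ _ xy])
  show "u \<in> W ~> iar (Internal V (vtwo V))" "v \<in> W ~> iar (Internal V (vtwo V))"
    "isrc (Internal V (vtwo V)) ** v = itgt (Internal V (vtwo V)) ** u"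
    using u v vu by (simp_all add: itwo_J)
  fix a b d Z j f g assume j: "j \<in> Z ~> W" and f: "f \<in> Z ~> vhom (vtwo V) a b"
    and g: "g \<in> Z ~> vhom (vtwo V) b d" and uj: "u ** j = ar2 a b ** f" and vj: "v ** j = ar2 b d ** g"
  have xj: "x ** j \<in> Z ~> Y" "y ** j \<in> Z ~> Y" using xy j by simp_all
  show "x ** j = y ** j"
  proof (rule two_hom_cases [OF f xj])
    assume ab: "le2 a b" and fb: "f = bang V Z"
    show "x ** j = y ** j"
      by (rule two_hom_cases [OF g xj]) (use e [of a b d j Z] ab fb j uj vj Hom_Obj1 [OF j] in simp_all)
  qed
qed

end

text \<open>
  The object \<open>R\<close> of commutative squares \<open>y \<circ> p = q \<circ> x\<close> in \<open>B\<close>, given by its universal property; these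
  are the arrows \<open>x \<rightarrow> y\<close> of the arrow category of \<open>B\<close>.
\<close>

locale squares = ext_ccc V U for V :: "('o, 'm) cat" (structure) and U :: "'u set" +
  fixes B :: "('o, 'm) icat" and R :: 'o and y p q x :: 'm
  assumes B [simp]: "B \<in> Obj (Cat V)" and R [simp]: "R \<in> Obj V"
    and square_typing: "y \<in> Hom V R (iar B)" "p \<in> Hom V R (iar B)" "q \<in> Hom V R (iar B)" "x \<in> Hom V R (iar B)"
    and square_ends: "isrc B \<cdot> y = itgt B \<cdot> p" "isrc B \<cdot> q = itgt B \<cdot> x"
    and square_comm: "icompose V B y p = icompose V B q x"
    and square_univ: "\<And>W y' p' q' x'. y' \<in> Hom V W (iar B) \<Longrightarrow> p' \<in> Hom V W (iar B) \<Longrightarrow> q' \<in> Hom V W (iar B) \<Longrightarrow>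
      x' \<in> Hom V W (iar B) \<Longrightarrow> isrc B \<cdot> y' = itgt B \<cdot> p' \<Longrightarrow> isrc B \<cdot> q' = itgt B \<cdot> x' \<Longrightarrow>
      icompose V B y' p' = icompose V B q' x' \<Longrightarrow>
      \<exists>!h. h \<in> Hom V W R \<and> y \<cdot> h = y' \<and> p \<cdot> h = p' \<and> q \<cdot> h = q' \<and> x \<cdot> h = x'"
begin

lemma square_arr [simp]:
  "y \<in> Arr V" "Dom V y = R" "Cod V y = iar B" "p \<in> Arr V" "Dom V p = R" "Cod V p = iar B"
  "q \<in> Arr V" "Dom V q = R" "Cod V q = iar B" "x \<in> Arr V" "Dom V x = R" "Cod V x = iar B"
  using square_typing by simp_all

lemma square_elements [simp]:
  assumes s: "s \<in> Arr V" "Cod V s = R"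
  shows "itgt B ** (p ** s) = isrc B ** (y ** s)" "isrc B ** (q ** s) = itgt B ** (x ** s)"
    "isrc B ** (p ** s) = isrc B ** (x ** s)" "itgt B ** (q ** s) = itgt B ** (y ** s)"
    "ic B (q ** s) (x ** s) = ic B (y ** s) (p ** s)"
proof -
  show 1: "itgt B ** (p ** s) = isrc B ** (y ** s)" "isrc B ** (q ** s) = itgt B ** (x ** s)"
    using comp_ext [OF square_ends(1), of s] comp_ext [OF square_ends(2), of s] s by simp_all
  have "ic B q x ** s = ic B y p ** s" using square_comm by simp
  then show 2: "ic B (q ** s) (x ** s) = ic B (y ** s) (p ** s)"
    using square_ends s by simp
  have "isrc B ** ic B (q ** s) (x ** s) = isrc B ** ic B (y ** s) (p ** s)"
    "itgt B ** ic B (q ** s) (x ** s) = itgt B ** ic B (y ** s) (p ** s)" using 2 by simp_all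
  then show "isrc B ** (p ** s) = isrc B ** (x ** s)" "itgt B ** (q ** s) = itgt B ** (y ** s)" using 1 s by simp_all
qed

lemma square_eqI:
  assumes h: "h \<in> W ~> R" "k \<in> W ~> R" "y ** h = y ** k" "p ** h = p ** k" "q ** h = q ** k" "x ** h = x ** k"
  shows "h = k"
proof -
  have "\<exists>!m. m \<in> W ~> R \<and> y ** m = y ** k \<and> p ** m = p ** k \<and> q ** m = q ** k \<and> x ** m = x ** k"
    by (rule square_univ) (use h(2) in simp_all)
  then show ?thesis by (rule ex1_unique) (use h in blast)+
qed

definition sq :: "'m \<Rightarrow> 'm \<Rightarrow> 'm \<Rightarrow> 'm \<Rightarrow> 'm" where
  "sq y' p' q' x' = (THE h. h \<in> Dom V y' ~> R \<and> y ** h = y' \<and> p ** h = p' \<and> q ** h = q' \<and> x ** h = x')"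

lemma sq:
  assumes "y' \<in> W ~> iar B" "p' \<in> W ~> iar B" "q' \<in> W ~> iar B" "x' \<in> W ~> iar B"
    "isrc B ** y' = itgt B ** p'" "isrc B ** q' = itgt B ** x'" "ic B y' p' = ic B q' x'"
  shows "sq y' p' q' x' \<in> W ~> R" "y ** sq y' p' q' x' = y'" "p ** sq y' p' q' x' = p'"
    "q ** sq y' p' q' x' = q'" "x ** sq y' p' q' x' = x'"
proof -
  have "\<exists>!h. h \<in> Dom V y' ~> R \<and> y ** h = y' \<and> p ** h = p' \<and> q ** h = q' \<and> x ** h = x'"
    using square_univ [OF assms] assms(1) by simp
  from theI' [OF this]
  show "sq y' p' q' x' \<in> W ~> R" "y ** sq y' p' q' x' = y'" "p ** sq y' p' q' x' = p'"
    "q ** sq y' p' q' x' = q'" "x ** sq y' p' q' x' = x'"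
    unfolding sq_def using assms(1) by simp_all
qed

definition sqid :: 'm where
  "sqid = sq (Ident V (iar B)) (iid B ** isrc B) (iid B ** itgt B) (Ident V (iar B))"

lemma sqid [simp]:
  "sqid \<in> Arr V" "Dom V sqid = iar B" "Cod V sqid = R"
  "\<And>a. a \<in> Arr V \<Longrightarrow> Cod V a = iar B \<Longrightarrow> y ** (sqid ** a) = a"
  "\<And>a. a \<in> Arr V \<Longrightarrow> Cod V a = iar B \<Longrightarrow> x ** (sqid ** a) = a"
  "\<And>a. a \<in> Arr V \<Longrightarrow> Cod V a = iar B \<Longrightarrow> p ** (sqid ** a) = iid B ** (isrc B ** a)"
  "\<And>a. a \<in> Arr V \<Longrightarrow> Cod V a = iar B \<Longrightarrow> q ** (sqid ** a) = iid B ** (itgt B ** a)"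
  "y ** sqid = Ident V (iar B)" "x ** sqid = Ident V (iar B)"
proof -
  have s: "sqid \<in> iar B ~> R" "y ** sqid = Ident V (iar B)" "p ** sqid = iid B ** isrc B"
    "q ** sqid = iid B ** itgt B" "x ** sqid = Ident V (iar B)"
    unfolding sqid_def by (rule sq; simp)+
  then show "sqid \<in> Arr V" "Dom V sqid = iar B" "Cod V sqid = R" "y ** sqid = Ident V (iar B)" "x ** sqid = Ident V (iar B)"
    by simp_all
  fix a assume a: "a \<in> Arr V" "Cod V a = iar B"
  show "y ** (sqid ** a) = a" "x ** (sqid ** a) = a" "p ** (sqid ** a) = iid B ** (isrc B ** a)"
    "q ** (sqid ** a) = iid B ** (itgt B ** a)"
    using comp_ext [OF s(2), of a] comp_ext [OF s(3), of a] comp_ext [OF s(4), of a]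
      comp_ext [OF s(5), of a] s(1) a by simp_all
qed

definition sqcomp :: "'m \<Rightarrow> 'm \<Rightarrow> 'm" where
  "sqcomp g f = sq (y ** g) (ic B (p ** g) (p ** f)) (ic B (q ** g) (q ** f)) (x ** f)"

lemma sqcomp:
  assumes g: "g \<in> W ~> R" and f: "f \<in> W ~> R" and gf: "x ** g = y ** f"
  shows "sqcomp g f \<in> W ~> R" "y ** sqcomp g f = y ** g" "x ** sqcomp g f = x ** f"
    "p ** sqcomp g f = ic B (p ** g) (p ** f)" "q ** sqcomp g f = ic B (q ** g) (q ** f)"
    "\<And>Z h. h \<in> Z ~> W \<Longrightarrow> sqcomp g f ** h = sqcomp (g ** h) (f ** h)"
proof -
  have 1: "ic B (y ** g) (ic B (p ** g) (p ** f)) = ic B (ic B (q ** g) (q ** f)) (x ** f)"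
    if g: "g \<in> W ~> R" and f: "f \<in> W ~> R" and gf: "x ** g = y ** f" for g f W
  proof -
    have "ic B (y ** g) (ic B (p ** g) (p ** f)) = ic B (ic B (y ** g) (p ** g)) (p ** f)"
      by (rule ic_assoc [symmetric, of _ _ W]) (use g f gf in simp_all)
    also have "\<dots> = ic B (ic B (q ** g) (x ** g)) (p ** f)" using g by simp
    also have "\<dots> = ic B (q ** g) (ic B (x ** g) (p ** f))"
      by (rule ic_assoc [of _ _ W]) (use g f gf in simp_all)
    also have "\<dots> = ic B (q ** g) (ic B (q ** f) (x ** f))" using f gf by simp
    also have "\<dots> = ic B (ic B (q ** g) (q ** f)) (x ** f)"
      by (rule ic_assoc [symmetric, of _ _ W]) (use g f gf in simp_all)
    finally show ?thesis .
  qed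
  have s: "sqcomp g f \<in> W ~> R \<and> y ** sqcomp g f = y ** g \<and> x ** sqcomp g f = x ** f \<and>
      p ** sqcomp g f = ic B (p ** g) (p ** f) \<and> q ** sqcomp g f = ic B (q ** g) (q ** f)"
    if g: "g \<in> W ~> R" and f: "f \<in> W ~> R" and gf: "x ** g = y ** f" for g f W
    unfolding sqcomp_def
    by (intro conjI; rule sq; use 1 [OF that] g f gf in simp)
  show "sqcomp g f \<in> W ~> R" "y ** sqcomp g f = y ** g" "x ** sqcomp g f = x ** f"
    "p ** sqcomp g f = ic B (p ** g) (p ** f)" "q ** sqcomp g f = ic B (q ** g) (q ** f)"
    using s [OF assms] by blast+
  fix Z h assume h: "h \<in> Z ~> W"
  have gh: "g ** h \<in> Z ~> R" "f ** h \<in> Z ~> R" "x ** (g ** h) = y ** (f ** h)"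
    using comp_ext [OF gf, of h] g f h by simp_all
  have e: "r ** (sqcomp g f ** h) = (r ** sqcomp g f) ** h" if "r \<in> Arr V" "Dom V r = R" for r
    using s [OF assms] h that by simp
  have c: "ic B (p ** g) (p ** f) ** h = ic B (p ** (g ** h)) (p ** (f ** h))"
    "ic B (q ** g) (q ** f) ** h = ic B (q ** (g ** h)) (q ** (f ** h))" using g f gf h by simp_all
  show "sqcomp g f ** h = sqcomp (g ** h) (f ** h)"
  proof (rule square_eqI [of _ Z])
    show "sqcomp g f ** h \<in> Z ~> R" "sqcomp (g ** h) (f ** h) \<in> Z ~> R"
      using s [OF assms] s [OF gh] h by simp_all
    show "y ** (sqcomp g f ** h) = y ** sqcomp (g ** h) (f ** h)" "x ** (sqcomp g f ** h) = x ** sqcomp (g ** h) (f ** h)"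
      "p ** (sqcomp g f ** h) = p ** sqcomp (g ** h) (f ** h)" "q ** (sqcomp g f ** h) = q ** sqcomp (g ** h) (f ** h)"
      using s [OF assms] s [OF gh] c g f h by (simp_all add: e)
  qed
qed

definition arrows :: "('o, 'm) icat" where
  "arrows = mk_icat (iar B) R x y sqid sqcomp"

lemma arrows_simps [simp]:
  "iob arrows = iar B" "iar arrows = R" "isrc arrows = x" "itgt arrows = y" "iid arrows = sqid"
  by (simp_all add: arrows_def)

lemma arrows_icat:
  "arrows \<in> Obj CV"
  "\<And>W g f. g \<in> W ~> R \<Longrightarrow> f \<in> W ~> R \<Longrightarrow> x ** g = y ** f \<Longrightarrow> ic arrows g f = sqcomp g f"
proof -
  have t: "x \<in> R ~> iar B" "y \<in> R ~> iar B" "sqid \<in> iar B ~> R"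
    "x ** sqid = Ident V (iar B)" "y ** sqid = Ident V (iar B)" by simp_all
  have m: "sqcomp g f \<in> W ~> R \<and> x ** sqcomp g f = x ** f \<and> y ** sqcomp g f = y ** g"
    if "g \<in> W ~> R" "f \<in> W ~> R" "x ** g = y ** f" for W g f using sqcomp [OF that] by blast
  have a: "sqcomp (sqcomp h g) f = sqcomp h (sqcomp g f)"
    if f: "f \<in> W ~> R" and g: "g \<in> W ~> R" and h: "h \<in> W ~> R" and gf: "x ** g = y ** f" and hg: "x ** h = y ** g" for W f g h
  proof -
    note 1 = sqcomp [OF g f gf] and 2 = sqcomp [OF h g hg]
    have c: "x ** sqcomp h g = y ** f" "x ** h = y ** sqcomp g f" using 1 2 gf hg by simp_all
    note 3 = sqcomp [OF 2(1) f c(1)] and 4 = sqcomp [OF h 1(1) c(2)]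
    have e: "ic B (ic B (r ** h) (r ** g)) (r ** f) = ic B (r ** h) (ic B (r ** g) (r ** f))"
      if "r = p \<or> r = q" for r
      by (rule ic_assoc [of _ _ W]) (use that f g h gf hg in auto)
    show ?thesis
      by (rule square_eqI [OF 3(1) 4(1)]; use 1 2 3 4 e in \<open>simp del: Hom_iff\<close>)
  qed
  have lr: "sqcomp (sqid ** (y ** f)) f = f \<and> sqcomp f (sqid ** (x ** f)) = f" if f: "f \<in> W ~> R" for W f
  proof -
    have i: "sqid ** (y ** f) \<in> W ~> R" "x ** (sqid ** (y ** f)) = y ** f" "sqid ** (x ** f) \<in> W ~> R" "x ** f = y ** (sqid ** (x ** f))"
      using f by simp_all
    note 1 = sqcomp [OF i(1) f i(2)] and 2 = sqcomp [OF f i(3) i(4)]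
    have "sqcomp (sqid ** (y ** f)) f = f"
      by (rule square_eqI [OF 1(1) f], unfold 1(2-5)) (use f in simp_all)
    moreover have "sqcomp f (sqid ** (x ** f)) = f"
      by (rule square_eqI [OF 2(1) f], unfold 2(2-5)) (use f in simp_all)
    ultimately show ?thesis by blast
  qed
  show "arrows \<in> Obj CV" unfolding arrows_def
    by (rule mk_icat(1) [OF t]) ((fact m) | (fact sqcomp(6)) | (fact a) | (use lr in blast))+
  fix W g f assume gf: "g \<in> W ~> R" "f \<in> W ~> R" "x ** g = y ** f"
  show "ic arrows g f = sqcomp g f" unfolding arrows_def
    by (rule mk_icat(2) [OF t _ _ _ _ _ gf]) ((fact m) | (fact sqcomp(6)) | (fact a) | (use lr in blast))+
qed

declare arrows_icat(1) [simp]

end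


context squares
begin

declare two.ja_simps [simp del] two.J_src_ja [simp del] vtwo_simps(2) [simp del]

abbreviation "P2 \<equiv> prd CV arrows (itwo V)"
abbreviation "po \<equiv> if0 (pr1 CV arrows (itwo V))"
abbreviation "bo \<equiv> if0 (pr2 CV arrows (itwo V))"
abbreviation "pa \<equiv> if1 (pr1 CV arrows (itwo V))"
abbreviation "ba \<equiv> if1 (pr2 CV arrows (itwo V))"

text \<open>Evaluation at the two objects and at the three arrows of the walking arrow.\<close>

abbreviation (input) "ev0_rule e \<equiv> (\<And>Z j b. j \<in> Z ~> iob P2 \<Longrightarrow> bo ** j = ob2 b ** bang V Z \<Longrightarrow> e ** j = (if b then itgt B else isrc B) ** (po ** j))"

lemma ev0_exists:
  obtains ev0 where "ev0 \<in> iob P2 ~> iob B"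
    "PROP ev0_rule ev0"
proof -
  have c: "is_coproduct V UNIV (\<lambda>_. prd V pt (iar B)) (prd V (iob (itwo V)) (iar B),
      \<lambda>b. pair V (ob2 b ** pr1 V pt (iar B)) (pr2 V pt (iar B)))"
    using coproduct_times [OF two.J_objects, of "iar B"] by (simp add: itwo_J)
  obtain m where m: "m \<in> prd V (iob (itwo V)) (iar B) ~> iob B"
    "\<And>b. m ** pair V (ob2 b ** pr1 V pt (iar B)) (pr2 V pt (iar B)) =
      (if b then itgt B else isrc B) ** pr2 V pt (iar B)"
  proof (rule coproduct_obtain [OF c, of "\<lambda>b. (if b then itgt B else isrc B) ** pr2 V pt (iar B)" "iob B"])
    show "(if b then itgt B else isrc B) ** pr2 V pt (iar B) \<in> prd V pt (iar B) ~> iob B" for b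
      by (cases b) simp_all
  qed auto
  have mb: "m ** pair V (ob2 b ** bang V Z) a = (if b then itgt B else isrc B) ** a" if a: "a \<in> Z ~> iar B" for b Z a
  proof -
    have Z: "Z \<in> Obj V" using a Hom_Obj1 by blast
    show ?thesis
      using comp_ext [OF m(2) [of b], of "pair V (bang V Z) a"] m(1) a Z by (cases b) simp_all
  qed
  show ?thesis
  proof (rule that [of "m ** pair V bo po"])
    show "m ** pair V bo po \<in> iob P2 ~> iob B" using m(1) by simp
    fix Z j b assume j: "j \<in> Z ~> iob P2" and b: "bo ** j = ob2 b ** bang V Z"
    have "(m ** pair V bo po) ** j = m ** pair V (bo ** j) (po ** j)" using m(1) j by simp
    then show "(m ** pair V bo po) ** j = (if b then itgt B else isrc B) ** (po ** j)"
      unfolding b using mb [of "po ** j" Z b] j by simp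
  qed
qed

text \<open>
  The value of the evaluation at a square and the arrow \<open>a \<rightarrow> b\<close> of \<open>2\<close>: the sides \<open>p\<close> and \<open>q\<close> over the
  two identities, and over \<open>0 \<rightarrow> 1\<close> the diagonal.
\<close>

definition val :: "bool \<Rightarrow> bool \<Rightarrow> 'm \<Rightarrow> 'm" where
  "val a b s = (if a then q ** s else if b then ic B (y ** s) (p ** s) else p ** s)"

lemma val_simps [simp]:
  assumes s: "s \<in> Arr V" "Cod V s = R"
  shows "val a b s \<in> Arr V" "Dom V (val a b s) = Dom V s" "Cod V (val a b s) = iar B"
    "\<And>h. h \<in> Arr V \<Longrightarrow> Cod V h = Dom V s \<Longrightarrow> val a b s ** h = val a b (s ** h)"
  using s by (simp_all add: val_def)

abbreviation (input) "ev1_rule e \<equiv> (\<And>Z j a b. le2 a b \<Longrightarrow> j \<in> Z ~> iar P2 \<Longrightarrow> ba ** j = ar2 a b ** bang V Z \<Longrightarrow> e ** j = val a b (pa ** j))"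

lemma ev1_exists:
  obtains ev1 where "ev1 \<in> iar P2 ~> iar B"
    "PROP ev1_rule ev1"
proof -
  let ?H = "\<lambda>(a, b). vhom (vtwo V) a b"
  have c: "is_coproduct V (UNIV \<times> UNIV) (\<lambda>i. prd V (?H i) R) (prd V (iar (itwo V)) R,
      \<lambda>i. pair V ((case i of (a, b) \<Rightarrow> ar2 a b) ** pr1 V (?H i) R) (pr2 V (?H i) R))"
    using coproduct_times [OF two.J_arrows, of R] by (simp add: itwo_J split_beta del: vtwo_simps(2))
  define k where "k = (\<lambda>(a, b). if le2 a b then val a b (pr2 V pt R) else cobang V (iar B) ** pr1 V (init_ob V) R)"
  have "\<And>i. i \<in> UNIV \<times> UNIV \<Longrightarrow> k i \<in> prd V (?H i) R ~> iar B"
    by (auto simp: k_def le2_def vtwo_simps(2))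
  then obtain m where m: "m \<in> prd V (iar (itwo V)) R ~> iar B"
    "\<And>i. i \<in> UNIV \<times> UNIV \<Longrightarrow> m ** pair V ((case i of (a, b) \<Rightarrow> ar2 a b) ** pr1 V (?H i) R) (pr2 V (?H i) R) = k i"
    using coproduct_obtain [OF c, of k "iar B"] icat_simps(2) [OF B] by metis
  have mb: "m ** pair V (ar2 a b ** bang V Z) s = val a b s" if ab: "le2 a b" and s: "s \<in> Z ~> R" for a b Z s
  proof -
    have Z: "Z \<in> Obj V" using s Hom_Obj1 by blast
    have "m ** pair V (ar2 a b ** pr1 V pt R) (pr2 V pt R) = val a b (pr2 V pt R)"
    proof -
      have "vhom (vtwo V) a b = pt" using ab by (simp add: le2_def vtwo_simps(2))
      then show ?thesis using m(2) [of "(a, b)"] ab by (simp add: k_def)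
    qed
    from comp_ext [OF this, of "pair V (bang V Z) s"] show ?thesis
      using m(1) s Z ab by simp
  qed
  show ?thesis
  proof (rule that [of "m ** pair V ba pa"])
    show "m ** pair V ba pa \<in> iar P2 ~> iar B" using m(1) by simp
    fix Z j a b assume ab: "le2 a b" and j: "j \<in> Z ~> iar P2" and b: "ba ** j = ar2 a b ** bang V Z"
    have "(m ** pair V ba pa) ** j = m ** pair V (ba ** j) (pa ** j)" using m(1) j by simp
    then show "(m ** pair V ba pa) ** j = val a b (pa ** j)"
      unfolding b using mb [OF ab, of "pa ** j" Z] j by simp
  qed
qed

text \<open>
  It suffices to compose values at constant arrows of \<open>2\<close>; the composites \<open>0 \<rightarrow> 0 \<rightarrow> 1\<close> and \<open>0 \<rightarrow> 1 \<rightarrow> 1\<close>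
  are the two expressions for the diagonal of a pasting of two squares.
\<close>

lemma evaluation_exists:
  obtains ev where "ev \<in> Hom CV P2 B"
    "PROP ev0_rule (if0 ev)"
    "PROP ev1_rule (if1 ev)"
proof -
  obtain ev0 where e0: "ev0 \<in> iob P2 ~> iob B"
    "PROP ev0_rule ev0" using ev0_exists by blast
  obtain ev1 where e1: "ev1 \<in> iar P2 ~> iar B"
    "PROP ev1_rule ev1"
    using ev1_exists by blast
  have P: "P2 \<in> Obj CV" by simp
  let ?ev = "\<lparr>idom = P2, icod = B, if0 = ev0, if1 = ev1\<rparr>"
  have st: "isrc B ** ev1 = ev0 ** isrc P2" "itgt B ** ev1 = ev0 ** itgt P2"
  proof -
    show "isrc B ** ev1 = ev0 ** isrc P2"
    proof (rule two_cover1 [of ba "iar P2"])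
      fix a b Z j assume ab: "le2 a b" and j: "j \<in> Z ~> iar P2" and Z: "Z \<in> Obj V" and bj: "ba ** j = ar2 a b ** bang V Z"
      have sj: "isrc P2 ** j \<in> Z ~> iob P2" using j P by simp
      have "bo ** (isrc P2 ** j) = ob2 a ** bang V Z"
        using ifun_src_comp(1) [of "pr2 CV arrows (itwo V)" "itwo V" j] j bj ab Z by simp
      moreover have "po ** (isrc P2 ** j) = x ** (pa ** j)"
        using ifun_src_comp(1) [of "pr1 CV arrows (itwo V)" arrows j] j by simp
      ultimately have "ev0 ** (isrc P2 ** j) = (if a then itgt B else isrc B) ** (x ** (pa ** j))"
        using e0(2) [OF sj] by simp
      moreover have "isrc B ** (ev1 ** j) = (if a then itgt B else isrc B) ** (x ** (pa ** j))"
        unfolding e1(2) [OF ab j bj] val_def using j by simp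
      ultimately show "(isrc B ** ev1) ** j = (ev0 ** isrc P2) ** j" using j e0(1) e1(1) P by simp
    qed (use e0(1) e1(1) P in simp_all)
    show "itgt B ** ev1 = ev0 ** itgt P2"
    proof (rule two_cover1 [of ba "iar P2"])
      fix a b Z j assume ab: "le2 a b" and j: "j \<in> Z ~> iar P2" and Z: "Z \<in> Obj V" and bj: "ba ** j = ar2 a b ** bang V Z"
      have sj: "itgt P2 ** j \<in> Z ~> iob P2" using j P by simp
      have "bo ** (itgt P2 ** j) = ob2 b ** bang V Z"
        using ifun_src_comp(2) [of "pr2 CV arrows (itwo V)" "itwo V" j] j bj ab Z by simp
      moreover have "po ** (itgt P2 ** j) = y ** (pa ** j)"
        using ifun_src_comp(2) [of "pr1 CV arrows (itwo V)" arrows j] j by simp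
      ultimately have "ev0 ** (itgt P2 ** j) = (if b then itgt B else isrc B) ** (y ** (pa ** j))"
        using e0(2) [OF sj] by simp
      moreover have "itgt B ** (ev1 ** j) = (if b then itgt B else isrc B) ** (y ** (pa ** j))"
        unfolding e1(2) [OF ab j bj] val_def using j ab by auto
      ultimately show "(itgt B ** ev1) ** j = (ev0 ** itgt P2) ** j" using j e0(1) e1(1) P by simp
    qed (use e0(1) e1(1) P in simp_all)
  qed
  have "?ev \<in> Hom CV P2 B"
  proof (rule ifunctorI [OF P B e0(1) e1(1) st])
    show "ev1 ** iid P2 = iid B ** ev0"
    proof (rule two_cover0 [of bo "iob P2"])
      fix b Z j assume j: "j \<in> Z ~> iob P2" and Z: "Z \<in> Obj V" and bj: "bo ** j = ob2 b ** bang V Z"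
      have ij: "iid P2 ** j \<in> Z ~> iar P2" using j P by simp
      have "ba ** (iid P2 ** j) = ar2 b b ** bang V Z" using j bj Z by simp
      then have "ev1 ** (iid P2 ** j) = val b b (sqid ** (po ** j))" using e1(2) [OF le2_simps(1) ij, of b] j by simp
      then have "ev1 ** (iid P2 ** j) = iid B ** ((if b then itgt B else isrc B) ** (po ** j))"
        using j by (simp add: val_def)
      then show "(ev1 ** iid P2) ** j = (iid B ** ev0) ** j" using e0(1) e0(2) [OF j bj] e1(1) j P by simp
    qed (use e0(1) e1(1) P in simp_all)
    fix W g f assume g: "g \<in> W ~> iar P2" and f: "f \<in> W ~> iar P2" and gf: "isrc P2 ** g = itgt P2 ** f"
    have s: "isrc B ** (ev1 ** g) = itgt B ** (ev1 ** f)"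
      using comp_ext [OF st(1), of g] comp_ext [OF st(2), of f] g f gf e0(1) e1(1) P by simp
    have bs: "isrc (itwo V) ** (ba ** g) = itgt (itwo V) ** (ba ** f)" using g f gf by simp
    show "ev1 ** ic P2 g f = ic B (ev1 ** g) (ev1 ** f)"
    proof (rule two_cover2 [of "ba ** f" W "ba ** g", OF _ _ bs])
      fix a b d Z j assume ab: "le2 a b" "le2 b d" and j: "j \<in> Z ~> W" and Z: "Z \<in> Obj V"
        and bf: "(ba ** f) ** j = ar2 a b ** bang V Z" and bg: "(ba ** g) ** j = ar2 b d ** bang V Z"
      have gj: "g ** j \<in> Z ~> iar P2" "f ** j \<in> Z ~> iar P2" "ba ** (g ** j) = ar2 b d ** bang V Z"
        "ba ** (f ** j) = ar2 a b ** bang V Z" using bf bg g f j by simp_all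
      have gfj: "isrc P2 ** (g ** j) = itgt P2 ** (f ** j)" using comp_ext [OF gf, of j] g f j P by simp
      let ?c = "ic P2 (g ** j) (f ** j)"
      have c: "?c \<in> Z ~> iar P2" using gj gfj P by simp
      have bc: "ba ** ?c = ar2 a d ** bang V Z" using gj gfj ab Z by simp
      let ?g = "pa ** (g ** j)" and ?f = "pa ** (f ** j)"
      have G: "?g \<in> Z ~> R" "?f \<in> Z ~> R" using gj by simp_all
      have GF: "x ** ?g = y ** ?f"
      proof -
        have "isrc arrows ** ?g = itgt arrows ** ?f"
          using ifun_src_comp [of "pr1 CV arrows (itwo V)" arrows "g ** j"]
            ifun_src_comp [of "pr1 CV arrows (itwo V)" arrows "f ** j"] gj gfj by (simp del: arrows_simps)
        then show ?thesis by simp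
      qed
      have "pa ** ?c = ic arrows ?g ?f" using gj gfj by simp
      then have pc: "pa ** ?c = sqcomp ?g ?f" using arrows_icat(2) [OF G GF] by simp
      note sc = sqcomp [OF G GF]
      have A1: "ic B (y ** ?g) (ic B (p ** ?g) (p ** ?f)) = ic B (ic B (y ** ?g) (p ** ?g)) (p ** ?f)"
        by (rule ic_assoc [symmetric, of _ _ Z]) (use G GF in simp_all)
      have A2: "ic B (q ** ?g) (ic B (x ** ?g) (p ** ?f)) = ic B (ic B (q ** ?g) (x ** ?g)) (p ** ?f)"
        by (rule ic_assoc [symmetric, of _ _ Z]) (use G GF in simp_all)
      have A3: "ic B (q ** ?g) (y ** ?f) = ic B (y ** ?g) (p ** ?g)"
        unfolding GF [symmetric] using G by simp
      have "val a d (sqcomp ?g ?f) = ic B (val b d ?g) (val a b ?f)"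
        unfolding val_def sc(2-5) using ab A1 A2 A3 unfolding GF
        by (cases a; cases b; cases d) simp_all
      then have "ev1 ** ?c = ic B (ev1 ** (g ** j)) (ev1 ** (f ** j))"
        using e1(2) [OF le2_trans [OF ab] c bc] e1(2) [OF ab(2) gj(1,3)] e1(2) [OF ab(1) gj(2,4)] pc by simp
      then show "(ev1 ** ic P2 g f) ** j = ic B (ev1 ** g) (ev1 ** f) ** j"
        using g f gf s j e1(1) P by simp
    qed (use g f gf s e1(1) P in simp_all)
  qed
  then show ?thesis using that [of ?ev] e0(2) e1(2) by simp
qed

text \<open>
  A functor \<open>Z \<times> 2 \<rightarrow> B\<close> is determined by its values on the arrows \<open>(id, 0 \<rightarrow> 1)\<close>, which are the components
  of a natural transformation, and by its two ends.
\<close>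

lemma arrows_exponential:
  obtains ev where "is_exponential CV (itwo V) B (arrows, ev)" "ev \<in> Hom CV P2 B"
    "PROP ev0_rule (if0 ev)"
    "PROP ev1_rule (if1 ev)"
proof -
  obtain ev where ev: "ev \<in> Hom CV P2 B"
    and e0: "PROP ev0_rule (if0 ev)"
    and e1: "PROP ev1_rule (if1 ev)"
    using evaluation_exists by blast
  have e0': "if0 ev ** pp0 arrows (itwo V) a (ob2 b ** bang V Z) = (if b then itgt B else isrc B) ** a"
    if "a \<in> Z ~> iar B" for a b Z
    using e0 [of "pp0 arrows (itwo V) a (ob2 b ** bang V Z)" Z b] that Hom_Obj1 [OF that] by simp
  have e1': "if1 ev ** pp1 arrows (itwo V) s (ar2 a b ** bang V Z) = val a b s"
    if "le2 a b" "s \<in> Z ~> R" for a b s Z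
    using e1 [OF that(1), of "pp1 arrows (itwo V) s (ar2 a b ** bang V Z)" Z] that Hom_Obj1 [OF that(2)] by simp
  have "\<exists>!\<Psi>. \<Psi> \<in> Hom CV Z arrows \<and>
      ev \<odot> pair CV (\<Psi> \<odot> pr1 CV Z (itwo V)) (pr2 CV Z (itwo V)) = \<Phi>"
    if Z: "Z \<in> Obj CV" and Ph: "\<Phi> \<in> Hom CV (prd CV Z (itwo V)) B" for Z \<Phi>
  proof -
    let ?P = "prd CV Z (itwo V)" and ?q1 = "pr1 CV Z (itwo V)" and ?q2 = "pr2 CV Z (itwo V)"
    \<comment> \<open>\<open>v a b z\<close> is the value of \<open>\<Phi>\<close> at the arrow \<open>z\<close> of \<open>Z\<close> and the arrow \<open>a \<rightarrow> b\<close> of \<open>2\<close>\<close>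
    define v where "v = (\<lambda>a b z. if1 \<Phi> ** pp1 Z (itwo V) z (ar2 a b ** bang V (Dom V z)))"
    have v: "v a b z \<in> Dom V z ~> iar B" "\<And>k. k \<in> Arr V \<Longrightarrow> Cod V k = Dom V z \<Longrightarrow> v a b z ** k = v a b (z ** k)"
      "isrc B ** v a b z = if0 \<Phi> ** pp0 Z (itwo V) (isrc Z ** z) (ob2 a ** bang V (Dom V z))"
      "itgt B ** v a b z = if0 \<Phi> ** pp0 Z (itwo V) (itgt Z ** z) (ob2 b ** bang V (Dom V z))"
      if z: "z \<in> Arr V" "Cod V z = iar Z" and ab: "le2 a b" for a b z
      using Ph Z z ab by (simp_all add: v_def)
    have vc: "ic B (v b d z') (v a b z) = v a d (ic Z z' z)"
      if z: "z \<in> Arr V" "Cod V z = iar Z" "z' \<in> Arr V" "Cod V z' = iar Z" "Dom V z' = Dom V z" "isrc Z ** z' = itgt Z ** z"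
        and ab: "le2 a b" "le2 b d" for a b d z z'
    proof -
      have "v a d (ic Z z' z) = if1 \<Phi> ** ic ?P (pp1 Z (itwo V) z' (ar2 b d ** bang V (Dom V z)))
          (pp1 Z (itwo V) z (ar2 a b ** bang V (Dom V z)))"
        using Z z ab by (simp add: v_def)
      also have "\<dots> = ic B (v b d z') (v a b z)"
        using Ph Z z ab by (subst ifun_comp) (simp_all add: v_def)
      finally show ?thesis by simp
    qed
    \<comment> \<open>the component of the natural transformation at an object is the value at its identity and \<open>0 \<rightarrow> 1\<close>\<close>
    define F0 where "F0 = v False True (iid Z)"
    have F0: "F0 \<in> iob Z ~> iar B" using v(1) [of "iid Z" False True] Z by (simp add: F0_def)
    have F0z: "F0 ** z = v False True (iid Z ** z)" if "z \<in> W ~> iob Z" for z W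
      using v(2) [of "iid Z" False True z] Z that by (simp add: F0_def)
    let ?I = "Ident V (iar Z)"
    have sqc: "F0 ** itgt Z \<in> iar Z ~> iar B" "v False False ?I \<in> iar Z ~> iar B"
      "v True True ?I \<in> iar Z ~> iar B" "F0 ** isrc Z \<in> iar Z ~> iar B"
      "isrc B ** (F0 ** itgt Z) = itgt B ** v False False ?I" "isrc B ** v True True ?I = itgt B ** (F0 ** isrc Z)"
      "ic B (F0 ** itgt Z) (v False False ?I) = ic B (v True True ?I) (F0 ** isrc Z)"
    proof -
      show t: "F0 ** itgt Z \<in> iar Z ~> iar B" "v False False ?I \<in> iar Z ~> iar B"
        "v True True ?I \<in> iar Z ~> iar B" "F0 ** isrc Z \<in> iar Z ~> iar B"
        using F0 v(1) [of ?I False False] v(1) [of ?I True True] Z by simp_all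
      have f: "F0 ** itgt Z = v False True (iid Z ** itgt Z)" "F0 ** isrc Z = v False True (iid Z ** isrc Z)"
        using F0z [of "itgt Z" "iar Z"] F0z [of "isrc Z" "iar Z"] Z by simp_all
      show "isrc B ** (F0 ** itgt Z) = itgt B ** v False False ?I" "isrc B ** v True True ?I = itgt B ** (F0 ** isrc Z)"
        unfolding f using v(3,4) Z by simp_all
      have "ic B (F0 ** itgt Z) (v False False ?I) = v False True ?I"
        unfolding f using Z by (subst vc) simp_all
      moreover have "ic B (v True True ?I) (F0 ** isrc Z) = v False True ?I"
        unfolding f using Z by (subst vc) simp_all
      ultimately show "ic B (F0 ** itgt Z) (v False False ?I) = ic B (v True True ?I) (F0 ** isrc Z)" by simp
    qed
    \<comment> \<open>the naturality squares\<close>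
    define F1 where "F1 = sq (F0 ** itgt Z) (v False False ?I) (v True True ?I) (F0 ** isrc Z)"
    note S = sq [OF sqc, folded F1_def]
    have S': "y ** (F1 ** z) = F0 ** (itgt Z ** z)" "x ** (F1 ** z) = F0 ** (isrc Z ** z)"
      "p ** (F1 ** z) = v False False z" "q ** (F1 ** z) = v True True z" if z: "z \<in> W ~> iar Z" for z W
      using comp_ext [OF S(2), of z] comp_ext [OF S(3), of z] comp_ext [OF S(4), of z]
        comp_ext [OF S(5), of z] S(1) F0 z Z v(1) [of ?I False False] v(1) [of ?I True True]
        v(2) [of ?I False False z] v(2) [of ?I True True z] by simp_all
    have sv: "isrc B ** v a b (iid Z ** z) = if0 \<Phi> ** pp0 Z (itwo V) z (ob2 a ** bang V W)"
      "itgt B ** v a b (iid Z ** z) = if0 \<Phi> ** pp0 Z (itwo V) z (ob2 b ** bang V W)" if "z \<in> W ~> iob Z" "le2 a b" for z W a b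
      using v(3,4) [of "iid Z ** z" a b] Z that by simp_all
    have vi: "v b b (iid Z ** z) = iid B ** (if0 \<Phi> ** pp0 Z (itwo V) z (ob2 b ** bang V W))" if z: "z \<in> W ~> iob Z" for z W b
    proof -
      have "v b b (iid Z ** z) = if1 \<Phi> ** (iid ?P ** pp0 Z (itwo V) z (ob2 b ** bang V W))"
        using z Z Hom_Obj1 [OF z] by (simp add: v_def del: ifun_id_comp)
      also have "\<dots> = iid B ** (if0 \<Phi> ** pp0 Z (itwo V) z (ob2 b ** bang V W))"
        using z Z Ph Hom_Obj1 [OF z] by (subst ifun_id_comp) simp_all
      finally show ?thesis .
    qed
    let ?Psi = "\<lparr>idom = Z, icod = arrows, if0 = F0, if1 = F1\<rparr>"
    have Psi: "?Psi \<in> Hom CV Z arrows"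
    proof (rule ifunctorI [OF Z arrows_icat(1)], unfold arrows_simps)
      show "F0 \<in> iob Z ~> iar B" "F1 \<in> iar Z ~> R" "x ** F1 = F0 ** isrc Z" "y ** F1 = F0 ** itgt Z"
        using F0 S by simp_all
      show "F1 ** iid Z = sqid ** F0"
      proof (rule square_eqI [of _ "iob Z"])
        have i: "iid Z \<in> iob Z ~> iar Z" "Ident V (iob Z) \<in> iob Z ~> iob Z" using Z by simp_all
        have fe: "isrc B ** F0 = if0 \<Phi> ** pp0 Z (itwo V) (Ident V (iob Z)) (ob2 False ** bang V (iob Z))"
          "itgt B ** F0 = if0 \<Phi> ** pp0 Z (itwo V) (Ident V (iob Z)) (ob2 True ** bang V (iob Z))"
          using sv [OF i(2), of False True] Z by (simp_all add: F0_def)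
        have ve: "v b b (iid Z) = iid B ** (if0 \<Phi> ** pp0 Z (itwo V) (Ident V (iob Z)) (ob2 b ** bang V (iob Z)))" for b
          using vi [OF i(2), of b] Z by simp
        show "y ** (F1 ** iid Z) = y ** (sqid ** F0)" "x ** (F1 ** iid Z) = x ** (sqid ** F0)"
          "p ** (F1 ** iid Z) = p ** (sqid ** F0)" "q ** (F1 ** iid Z) = q ** (sqid ** F0)"
          unfolding S' [OF i(1)] using F0 Z by (simp_all add: fe ve)
      qed (use S(1) F0 Z in simp_all)
      fix W g f assume g: "g \<in> W ~> iar Z" and f: "f \<in> W ~> iar Z" and gf: "isrc Z ** g = itgt Z ** f"
      have Fg: "F1 ** g \<in> W ~> R" "F1 ** f \<in> W ~> R" "x ** (F1 ** g) = y ** (F1 ** f)"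
        using S' [OF g] S' [OF f] gf S(1) g f by simp_all
      have c: "ic Z g f \<in> W ~> iar Z" using g f gf Z by simp
      note sc = sqcomp [OF Fg]
      show "F1 ** ic Z g f = ic arrows (F1 ** g) (F1 ** f)"
        unfolding arrows_icat(2) [OF Fg]
      proof (rule square_eqI [OF _ sc(1)], unfold sc(2-5) S' [OF c] S' [OF g] S' [OF f])
        show "F0 ** (itgt Z ** ic Z g f) = F0 ** (itgt Z ** g)" "F0 ** (isrc Z ** ic Z g f) = F0 ** (isrc Z ** f)"
          using g f gf Z by simp_all
        show "v False False (ic Z g f) = ic B (v False False g) (v False False f)"
          "v True True (ic Z g f) = ic B (v True True g) (v True True f)"
          using vc [of f g False False False] vc [of f g True True True] g f gf by simp_all
      qed (use S(1) c in simp_all)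
    qed
    let ?T = "\<lambda>\<Psi>. ev \<odot> pair CV (\<Psi> \<odot> ?q1) ?q2"
    have T: "?T \<Psi> \<in> Hom CV ?P B" "if0 (?T \<Psi>) = if0 ev ** pp0 arrows (itwo V) (if0 \<Psi> ** if0 ?q1) (if0 ?q2)"
      "if1 (?T \<Psi>) = if1 ev ** pp1 arrows (itwo V) (if1 \<Psi> ** if1 ?q1) (if1 ?q2)" if "\<Psi> \<in> Hom CV Z arrows" for \<Psi>
      using that ev Z by simp_all
    have TPsi: "?T ?Psi = \<Phi>"
    proof (rule ifun_eqI [OF T(1) [OF Psi] Ph])
      show "if0 (?T ?Psi) = if0 \<Phi>" unfolding T(2) [OF Psi]
      proof (rule two_cover0 [of "if0 ?q2" "iob ?P"])
        fix b W j assume j: "j \<in> W ~> iob ?P" and W: "W \<in> Obj V" and bj: "if0 ?q2 ** j = ob2 b ** bang V W"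
        have z: "if0 ?q1 ** j \<in> W ~> iob Z" using j Z by simp
        have jj: "j = pp0 Z (itwo V) (if0 ?q1 ** j) (ob2 b ** bang V W)"
          using pp_eta(1) [of Z "itwo V" j] j Z bj by simp
        have Fz: "F0 ** (if0 ?q1 ** j) \<in> W ~> iar B" using F0 z by simp
        have "(if0 ev ** pp0 arrows (itwo V) (F0 ** if0 ?q1) (if0 ?q2)) ** j =
          if0 ev ** pp0 arrows (itwo V) (F0 ** (if0 ?q1 ** j)) (ob2 b ** bang V W)"
          using ev F0 j Z bj by simp
        also have "\<dots> = (if b then itgt B else isrc B) ** v False True (iid Z ** (if0 ?q1 ** j))"
          unfolding e0' [OF Fz] by (simp only: F0z [OF z])
        also have "\<dots> = if0 \<Phi> ** pp0 Z (itwo V) (if0 ?q1 ** j) (ob2 b ** bang V W)"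
          using sv [OF z, of False True] by simp
        also have "\<dots> = if0 \<Phi> ** j" using jj by simp
        finally show "(if0 ev ** pp0 arrows (itwo V) (if0 ?Psi ** if0 ?q1) (if0 ?q2)) ** j = if0 \<Phi> ** j" by simp
      qed (use ev F0 Z Ph in simp_all)
      show "if1 (?T ?Psi) = if1 \<Phi>" unfolding T(3) [OF Psi]
      proof (rule two_cover1 [of "if1 ?q2" "iar ?P"])
        fix a b W j assume ab: "le2 a b" and j: "j \<in> W ~> iar ?P" and W: "W \<in> Obj V" and bj: "if1 ?q2 ** j = ar2 a b ** bang V W"
        let ?z = "if1 ?q1 ** j"
        have z: "?z \<in> W ~> iar Z" using j Z by simp
        have jj: "j = pp1 Z (itwo V) ?z (ar2 a b ** bang V W)"
          using pp_eta(2) [of Z "itwo V" j] j Z bj by simp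
        have Fz: "F1 ** ?z \<in> W ~> R" using S(1) z by simp
        have zz: "itgt Z ** ?z \<in> W ~> iob Z" using z Z by simp
        have "v False True ?z = ic B (F0 ** (itgt Z ** ?z)) (v False False ?z)"
          unfolding F0z [OF zz] using z Z by (subst vc) simp_all
        then have "val a b (F1 ** ?z) = v a b ?z" unfolding val_def S' [OF z] using ab by auto
        moreover have "(if1 ev ** pp1 arrows (itwo V) (F1 ** if1 ?q1) (if1 ?q2)) ** j =
          if1 ev ** pp1 arrows (itwo V) (F1 ** ?z) (ar2 a b ** bang V W)"
          using ev S(1) j Z bj by simp
        moreover have "v a b ?z = if1 \<Phi> ** j" using jj z by (simp add: v_def)
        ultimately show "(if1 ev ** pp1 arrows (itwo V) (if1 ?Psi ** if1 ?q1) (if1 ?q2)) ** j = if1 \<Phi> ** j"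
          using e1' [OF ab Fz] by simp
      qed (use ev S(1) Z Ph in simp_all)
    qed
    show ?thesis
    proof (rule ex1I [of _ ?Psi])
      show "?Psi \<in> Hom CV Z arrows \<and> ?T ?Psi = \<Phi>" using Psi TPsi by blast
      fix \<Psi> assume a: "\<Psi> \<in> Hom CV Z arrows \<and> ?T \<Psi> = \<Phi>"
      then have h: "\<Psi> \<in> Hom CV Z arrows" and t: "?T \<Psi> = \<Phi>" by blast+
      have K: "val a b (if1 \<Psi> ** z) = v a b z" if ab: "le2 a b" and z: "z \<in> W ~> iar Z" for a b z W
      proof -
        have W: "W \<in> Obj V" using z Hom_Obj1 by blast
        have "v a b z = (if1 ev ** pp1 arrows (itwo V) (if1 \<Psi> ** if1 ?q1) (if1 ?q2)) ** pp1 Z (itwo V) z (ar2 a b ** bang V W)"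
          unfolding v_def T(3) [OF h, symmetric] t using z by simp
        also have "\<dots> = if1 ev ** pp1 arrows (itwo V) (if1 \<Psi> ** z) (ar2 a b ** bang V W)"
          using ev h z ab Z W by simp
        also have "\<dots> = val a b (if1 \<Psi> ** z)" using e1' [OF ab, of "if1 \<Psi> ** z" W] h z by simp
        finally show ?thesis by simp
      qed
      have 0: "if0 \<Psi> = F0"
      proof -
        have i: "iid Z \<in> iob Z ~> iar Z" using Z by simp
        have "val False True (if1 \<Psi> ** iid Z) = if0 \<Psi>"
          using h Z by (simp add: val_def)
        then show ?thesis using K [of False True, OF _ i] by (simp add: F0_def)
      qed
      have I: "?I \<in> iar Z ~> iar Z" using Z by simp
      have "if1 \<Psi> = F1"
      proof (rule square_eqI [of _ "iar Z"])
        show "y ** if1 \<Psi> = y ** F1" "x ** if1 \<Psi> = x ** F1"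
          using ifun_src [of \<Psi> arrows] h 0 S by simp_all
        show "p ** if1 \<Psi> = p ** F1" "q ** if1 \<Psi> = q ** F1"
          using K [of False False, OF _ I] K [of True True, OF _ I] h Z S by (simp_all add: val_def)
      qed (use h S(1) in simp_all)
      with 0 show "\<Psi> = ?Psi" by - (rule ifun_eqI [OF h Psi], simp_all)
    qed
  qed
  then have "is_exponential CV (itwo V) B (arrows, ev)"
    unfolding is_exponential_def prod.case using ev by (simp del: Hom_iff)
  then show ?thesis using that ev e0 e1 by blast
qed

end


context ext_ccc
begin

declare two.ja_simps [simp del] two.J_src_ja [simp del] vtwo_simps(2) [simp del]

text \<open>A commutative square is a pair of composable pairs with the same composite.\<close>

lemma squares_exist:
  assumes B: "B \<in> Obj CV"
  obtains R y p q x where "squares V U B R y p q x"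
proof -
  let ?s = "isrc B" and ?t = "itgt B" and ?c = "icomp B"
  have "?c \<in> pb V ?s ?t ~> iar B" using B unfolding Cat_Obj_iff icategory_def by blast
  then have c: "?c \<in> Arr V" "Dom V ?c = pb V ?s ?t" "Cod V ?c = iar B" by simp_all
  let ?a = "pb1 V ?c ?c" and ?b = "pb2 V ?c ?c"
  have ab: "?a \<in> Arr V" "Dom V ?a = pb V ?c ?c" "Cod V ?a = pb V ?s ?t"
    "?b \<in> Arr V" "Dom V ?b = pb V ?c ?c" "Cod V ?b = pb V ?s ?t" using c by simp_all
  have "squares V U B (pb V ?c ?c) (pb1 V ?s ?t ** ?a) (pb2 V ?s ?t ** ?a) (pb1 V ?s ?t ** ?b) (pb2 V ?s ?t ** ?b)"
  proof (intro squares.intro squares_axioms.intro ext_ccc_axioms B)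
    show "?s ** (pb1 V ?s ?t ** ?a) = ?t ** (pb2 V ?s ?t ** ?a)" "?s ** (pb1 V ?s ?t ** ?b) = ?t ** (pb2 V ?s ?t ** ?b)"
      using ab B by (simp_all add: pb_comm_comp)
    show "ic B (pb1 V ?s ?t ** ?a) (pb2 V ?s ?t ** ?a) = ic B (pb1 V ?s ?t ** ?b) (pb2 V ?s ?t ** ?b)"
      unfolding icompose_def using pb_comm [of ?c ?c] ab c B by simp
    fix W y' p' q' x'
    assume t: "y' \<in> W ~> iar B" "p' \<in> W ~> iar B" "q' \<in> W ~> iar B" "x' \<in> W ~> iar B"
      and e: "?s ** y' = ?t ** p'" "?s ** q' = ?t ** x'" and m: "ic B y' p' = ic B q' x'"
    let ?g = "pb_pair V ?s ?t y' p'" and ?f = "pb_pair V ?s ?t q' x'"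
    have gf: "?g \<in> W ~> pb V ?s ?t" "?f \<in> W ~> pb V ?s ?t" using t e B by simp_all
    have m': "?c ** ?g = ?c ** ?f" using m by (simp add: icompose_def)
    let ?h = "pb_pair V ?c ?c ?g ?f"
    have h: "?h \<in> W ~> pb V ?c ?c" "?a ** ?h = ?g" "?b ** ?h = ?f" using gf m' c by simp_all
    show "\<exists>!h. h \<in> W ~> pb V ?c ?c \<and> (pb1 V ?s ?t ** ?a) ** h = y' \<and> (pb2 V ?s ?t ** ?a) ** h = p' \<and>
      (pb1 V ?s ?t ** ?b) ** h = q' \<and> (pb2 V ?s ?t ** ?b) ** h = x'"
    proof (rule ex1I [of _ ?h])
      show "?h \<in> W ~> pb V ?c ?c \<and> (pb1 V ?s ?t ** ?a) ** ?h = y' \<and> (pb2 V ?s ?t ** ?a) ** ?h = p' \<and>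
        (pb1 V ?s ?t ** ?b) ** ?h = q' \<and> (pb2 V ?s ?t ** ?b) ** ?h = x'"
        using h ab t e B by simp
      fix k assume "k \<in> W ~> pb V ?c ?c \<and> (pb1 V ?s ?t ** ?a) ** k = y' \<and> (pb2 V ?s ?t ** ?a) ** k = p' \<and>
        (pb1 V ?s ?t ** ?b) ** k = q' \<and> (pb2 V ?s ?t ** ?b) ** k = x'"
      then have k: "k \<in> W ~> pb V ?c ?c" and k': "(pb1 V ?s ?t ** ?a) ** k = y'" "(pb2 V ?s ?t ** ?a) ** k = p'"
        "(pb1 V ?s ?t ** ?b) ** k = q'" "(pb2 V ?s ?t ** ?b) ** k = x'" by blast+
      have kk: "pb1 V ?s ?t ** (?a ** k) = y'" "pb2 V ?s ?t ** (?a ** k) = p'"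
        "pb1 V ?s ?t ** (?b ** k) = q'" "pb2 V ?s ?t ** (?b ** k) = x'"
        unfolding k' [symmetric] using k ab B by simp_all
      have "?a ** k = ?g"
        by (rule pb_eqI [of ?s ?t _ W]) (use k kk ab t e B in simp_all)
      moreover have "?b ** k = ?f"
        by (rule pb_eqI [of ?s ?t _ W]) (use k kk ab t e B in simp_all)
      ultimately show "k = ?h"
        by - (rule pb_eqI [of ?c ?c _ W], use h k c in simp_all)
    qed
  qed (use c ab B in simp_all)
  then show ?thesis by (rule that)
qed

abbreviation arrow_cat :: "('o, 'm) icat \<Rightarrow> ('o, 'm) icat" where
  "arrow_cat B \<equiv> ihom V (itwo V) B"

abbreviation arrow_eval :: "('o, 'm) icat \<Rightarrow> ('o, 'm) ifun" where
  "arrow_eval B \<equiv> eval_map CV (itwo V) B"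

text \<open>
  An object of \<open>[2, B]\<close> has an underlying arrow, and an arrow of \<open>[2, B]\<close> has a component at each end \<open>b\<close>
  of \<open>2\<close>; both are values of the evaluation.
\<close>

definition am :: "('o, 'm) icat \<Rightarrow> 'm" where
  "am B = if1 (arrow_eval B) ** pp1 (arrow_cat B) (itwo V) (iid (arrow_cat B)) (ar2 False True ** bang V (iob (arrow_cat B)))"

definition dm :: "('o, 'm) icat \<Rightarrow> bool \<Rightarrow> 'm" where
  "dm B b = if1 (arrow_eval B) **
    pp1 (arrow_cat B) (itwo V) (Ident V (iar (arrow_cat B))) (ar2 b b ** bang V (iar (arrow_cat B)))"

text \<open>
  The chosen exponential is isomorphic to the internal category of arrows and commutative squares, so its
  generalised elements are arrows and squares of \<open>B\<close>.
\<close>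

lemma arrow_category:
  assumes B: "B \<in> Obj CV"
  shows "Cat.has_expo (itwo V) B" "iso V (am B)" "am B \<in> iob (arrow_cat B) ~> iar B"
    "\<And>b. dm B b \<in> iar (arrow_cat B) ~> iar B"
    "\<And>s b W. s \<in> W ~> iar (arrow_cat B) \<Longrightarrow>
      isrc B ** (dm B b ** s) = (if b then itgt B else isrc B) ** (am B ** (isrc (arrow_cat B) ** s))"
    "\<And>s b W. s \<in> W ~> iar (arrow_cat B) \<Longrightarrow>
      itgt B ** (dm B b ** s) = (if b then itgt B else isrc B) ** (am B ** (itgt (arrow_cat B) ** s))"
    "\<And>s W. s \<in> W ~> iar (arrow_cat B) \<Longrightarrow>
      ic B (am B ** (itgt (arrow_cat B) ** s)) (dm B False ** s) =
      ic B (dm B True ** s) (am B ** (isrc (arrow_cat B) ** s))"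
    "\<And>W e e' p q. e \<in> W ~> iob (arrow_cat B) \<Longrightarrow> e' \<in> W ~> iob (arrow_cat B) \<Longrightarrow>
      p \<in> W ~> iar B \<Longrightarrow> q \<in> W ~> iar B \<Longrightarrow>
      isrc B ** (am B ** e') = itgt B ** p \<Longrightarrow> isrc B ** q = itgt B ** (am B ** e) \<Longrightarrow>
      ic B (am B ** e') p = ic B q (am B ** e) \<Longrightarrow>
      \<exists>!s. s \<in> W ~> iar (arrow_cat B) \<and> isrc (arrow_cat B) ** s = e \<and> itgt (arrow_cat B) ** s = e' \<and>
        dm B False ** s = p \<and> dm B True ** s = q"
    "\<And>W e b. e \<in> W ~> iob (arrow_cat B) \<Longrightarrow>
      if0 (arrow_eval B) ** pp0 (arrow_cat B) (itwo V) e (ob2 b ** bang V W) = (if b then itgt B else isrc B) ** (am B ** e)"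
    "\<And>W e a b. e \<in> W ~> iob (arrow_cat B) \<Longrightarrow> le2 a b \<Longrightarrow>
      if1 (arrow_eval B) ** pp1 (arrow_cat B) (itwo V) (iid (arrow_cat B) ** e) (ar2 a b ** bang V W) =
      (if \<not> a \<and> b then am B ** e else iid B ** ((if a then itgt B else isrc B) ** (am B ** e)))"
proof -
  let ?E = "arrow_cat B" and ?ev = "arrow_eval B"
  obtain R y p q x where "squares V U B R y p q x" using squares_exist [OF B] by blast
  then interpret S: squares V U B R y p q x .
  obtain ev where x: "is_exponential CV (itwo V) B (S.arrows, ev)" and ev: "ev \<in> Hom CV S.P2 B"
    and e0: "PROP S.ev0_rule (if0 ev)"
    and e1: "PROP S.ev1_rule (if1 ev)"
    using S.arrows_exponential by blast
  show ex: "Cat.has_expo (itwo V) B" unfolding Cat.has_expo_def using B x by auto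
  have E [simp]: "?E \<in> Obj CV" using Cat.expo_simps(1) [OF ex] .
  obtain h where h: "h \<in> Hom CV ?E S.arrows" "iso CV h"
    "ev \<odot> pair CV (h \<odot> pr1 CV ?E (itwo V)) (pr2 CV ?E (itwo V)) = ?ev"
    using Cat.exponential_unique [OF x itwo_Obj B] by blast
  have hi: "iso V (if0 h)" "iso V (if1 h)" using Cat_iso_components [OF h(1,2)] by blast+
  have ht [simp]: "if0 h \<in> Arr V" "Dom V (if0 h) = iob ?E" "Cod V (if0 h) = iar B"
    "if1 h \<in> Arr V" "Dom V (if1 h) = iar ?E" "Cod V (if1 h) = R" using h(1) by simp_all
  have K0: "if0 ?ev ** pp0 ?E (itwo V) e (ob2 b ** bang V W) = (if b then itgt B else isrc B) ** (if0 h ** e)"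
    if e: "e \<in> W ~> iob ?E" for e b W
  proof -
    have W: "W \<in> Obj V" using e Hom_Obj1 by blast
    have "if0 ?ev ** pp0 ?E (itwo V) e (ob2 b ** bang V W) = if0 ev ** pp0 S.arrows (itwo V) (if0 h ** e) (ob2 b ** bang V W)"
      unfolding h(3) [symmetric] using h(1) ev e W by simp
    then show ?thesis using e0 [of "pp0 S.arrows (itwo V) (if0 h ** e) (ob2 b ** bang V W)" W b] e W by simp
  qed
  have K1: "if1 ?ev ** pp1 ?E (itwo V) s (ar2 a b ** bang V W) = S.val a b (if1 h ** s)"
    if s: "s \<in> W ~> iar ?E" and ab: "le2 a b" for s a b W
  proof -
    have W: "W \<in> Obj V" using s Hom_Obj1 by blast
    have "if1 ?ev ** pp1 ?E (itwo V) s (ar2 a b ** bang V W) = if1 ev ** pp1 S.arrows (itwo V) (if1 h ** s) (ar2 a b ** bang V W)"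
      unfolding h(3) [symmetric] using h(1) ev s W ab by simp
    then show ?thesis using e1 [OF ab, of "pp1 S.arrows (itwo V) (if1 h ** s) (ar2 a b ** bang V W)" W] s W ab by simp
  qed
  have hid: "if1 h ** (iid ?E ** e) = S.sqid ** (if0 h ** e)" if "e \<in> W ~> iob ?E" for e W
    using h(1) that by simp
  have am: "am B = if0 h"
  proof -
    have "am B = S.val False True (if1 h ** (iid ?E ** Ident V (iob ?E)))"
      using K1 [of "iid ?E" "iob ?E" False True] by (simp add: am_def)
    also have "\<dots> = S.val False True (S.sqid ** if0 h)"
      using hid [of "Ident V (iob ?E)" "iob ?E"] by simp
    also have "\<dots> = if0 h" using B by (simp add: S.val_def)
    finally show ?thesis .
  qed
  have dm0: "dm B b = S.val b b (if1 h)" for b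
    using K1 [of "Ident V (iar ?E)" "iar ?E" b b] by (simp add: dm_def)
  have dm: "dm B False ** s = p ** (if1 h ** s)" "dm B True ** s = q ** (if1 h ** s)" if "s \<in> W ~> iar ?E" for s W
    using that by (simp_all add: dm0 S.val_def)
  have hs: "x ** (if1 h ** s) = if0 h ** (isrc ?E ** s)" "y ** (if1 h ** s) = if0 h ** (itgt ?E ** s)" if "s \<in> W ~> iar ?E" for s W
    using ifun_src_comp [of h S.arrows s] h(1) that by simp_all
  show "iso V (am B)" "am B \<in> iob ?E ~> iar B" using hi am by simp_all
  show "dm B b \<in> iar ?E ~> iar B" for b by (simp add: dm0)
  show "isrc B ** (dm B b ** s) = (if b then itgt B else isrc B) ** (am B ** (isrc ?E ** s))"
    "itgt B ** (dm B b ** s) = (if b then itgt B else isrc B) ** (am B ** (itgt ?E ** s))"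
    if s: "s \<in> W ~> iar ?E" for s b W
    unfolding am hs [OF s, symmetric] using dm [OF s] s by (cases b; simp)+
  show "ic B (am B ** (itgt ?E ** s)) (dm B False ** s) = ic B (dm B True ** s) (am B ** (isrc ?E ** s))"
    if s: "s \<in> W ~> iar ?E" for s W
    unfolding am hs [OF s, symmetric] dm [OF s] using s by simp
  show "\<exists>!s. s \<in> W ~> iar ?E \<and> isrc ?E ** s = e \<and> itgt ?E ** s = e' \<and> dm B False ** s = p' \<and> dm B True ** s = q'"
    if e: "e \<in> W ~> iob ?E" and e': "e' \<in> W ~> iob ?E" and p': "p' \<in> W ~> iar B" and q': "q' \<in> W ~> iar B"
      and c: "isrc B ** (am B ** e') = itgt B ** p'" "isrc B ** q' = itgt B ** (am B ** e)"
        "ic B (am B ** e') p' = ic B q' (am B ** e)" for W e e' p' q'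
  proof -
    have W: "W \<in> Obj V" using e Hom_Obj1 by blast
    have ae: "am B ** e' \<in> W ~> iar B" "am B ** e \<in> W ~> iar B" using am e e' by simp_all
    note s = S.sq [OF ae(1) p' q' ae(2) c]
    let ?t = "S.sq (am B ** e') p' q' (am B ** e)"
    have h1: "if1 h \<in> iar ?E ~> R" and h0: "if0 h \<in> iob ?E ~> iar B" by simp_all
    obtain r where r: "r \<in> W ~> iar ?E" "if1 h ** r = ?t"
      using hi(2) s(1) W unfolding iso_iff_ex1 [OF h1] by blast
    have m0: "a = b" if "a \<in> W ~> iob ?E" "b \<in> W ~> iob ?E" "if0 h ** a = if0 h ** b" for a b
    proof -
      have "\<exists>!y. y \<in> W ~> iob ?E \<and> if0 h ** y = if0 h ** b"
        using hi(1) W that(2) unfolding iso_iff_ex1 [OF h0] by simp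
      then show ?thesis by (rule ex1_unique) (use that in simp_all)
    qed
    have m1: "a = b" if "a \<in> W ~> iar ?E" "b \<in> W ~> iar ?E" "if1 h ** a = if1 h ** b" for a b
    proof -
      have "\<exists>!y. y \<in> W ~> iar ?E \<and> if1 h ** y = if1 h ** b"
        using hi(2) W that(2) unfolding iso_iff_ex1 [OF h1] by simp
      then show ?thesis by (rule ex1_unique) (use that in simp_all)
    qed
    show ?thesis
    proof (rule ex1I [of _ r])
      have "isrc ?E ** r = e" by (rule m0) (use hs [OF r(1)] r s am e in simp_all)
      moreover have "itgt ?E ** r = e'" by (rule m0) (use hs [OF r(1)] r s am e' in simp_all)
      ultimately show "r \<in> W ~> iar ?E \<and> isrc ?E ** r = e \<and> itgt ?E ** r = e' \<and> dm B False ** r = p' \<and> dm B True ** r = q'"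
        using r(1) dm [OF r(1)] r(2) s by simp
      fix k assume k: "k \<in> W ~> iar ?E \<and> isrc ?E ** k = e \<and> itgt ?E ** k = e' \<and> dm B False ** k = p' \<and> dm B True ** k = q'"
      then have k1: "k \<in> W ~> iar ?E" by blast
      have "if1 h ** k = ?t"
        by (rule S.square_eqI [of _ W]) (use k s dm [OF k1] hs [OF k1] am in simp_all)
      then show "k = r" using m1 [OF k1 r(1)] r(2) by simp
    qed
  qed
  show "if0 ?ev ** pp0 ?E (itwo V) e (ob2 b ** bang V W) = (if b then itgt B else isrc B) ** (am B ** e)"
    if "e \<in> W ~> iob ?E" for W e b using K0 [OF that] am by simp
  show "if1 ?ev ** pp1 ?E (itwo V) (iid ?E ** e) (ar2 a b ** bang V W) =
      (if \<not> a \<and> b then am B ** e else iid B ** ((if a then itgt B else isrc B) ** (am B ** e)))"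
    if e: "e \<in> W ~> iob ?E" and ab: "le2 a b" for W e a b
  proof -
    have "if1 ?ev ** pp1 ?E (itwo V) (iid ?E ** e) (ar2 a b ** bang V W) = S.val a b (S.sqid ** (if0 h ** e))"
      using K1 [of "iid ?E ** e" W a b] e ab hid [OF e] by simp
    then show ?thesis using e ab B am by (cases a; cases b) (simp_all add: S.val_def)
  qed
qed

lemma arrow_simps [simp]:
  assumes B: "B \<in> Obj CV"
  shows "Cat.has_expo (itwo V) B" "am B \<in> Arr V" "Dom V (am B) = iob (arrow_cat B)" "Cod V (am B) = iar B"
    "dm B b \<in> Arr V" "Dom V (dm B b) = iar (arrow_cat B)" "Cod V (dm B b) = iar B"
  using arrow_category(1,3,4) [OF B] by simp_all

lemma arrow_elements:
  assumes B: "B \<in> Obj CV" and f: "f \<in> W ~> iar B"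
  shows "\<exists>!e. e \<in> W ~> iob (arrow_cat B) \<and> am B ** e = f"
proof -
  have "am B \<in> iob (arrow_cat B) ~> iar B" using B by simp
  from iso_iff_ex1 [OF this] show ?thesis using arrow_category(2) [OF B] f Hom_Obj1 [OF f] by blast
qed

lemma ielem_Hom [simp]:
  assumes A: "A \<in> Obj CV" and a: "a \<in> Arr V" "Dom V a = pt" "Cod V a = iob A"
  shows "ielem V A a \<in> Arr CV" "Dom CV (ielem V A a) = ione V" "Cod CV (ielem V A a) = A"
    "if0 (ielem V A a) = a" "if1 (ielem V A a) = iid A ** a"
proof -
  have "ielem V A a \<in> Hom CV (ione V) A"
    unfolding ielem_def
  proof (rule ifunctorI [OF ione_icat A])
    fix W g f assume g: "g \<in> W ~> iar (ione V)" and f: "f \<in> W ~> iar (ione V)"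
    then have gf: "g = bang V W" "f = bang V W" using bang_unique by simp_all
    have W: "W \<in> Obj V" using g Hom_Obj1 by blast
    have "ic (ione V) g f = bang V W"
      unfolding gf ione_def using W by (intro cst_icat(2)) simp_all
    then show "(iid A ** a) ** ic (ione V) g f = ic A ((iid A ** a) ** g) ((iid A ** a) ** f)"
      using A a W gf by simp
  qed (use A a in simp_all)
  then show "ielem V A a \<in> Arr CV" "Dom CV (ielem V A a) = ione V" "Cod CV (ielem V A a) = A"
    by simp_all
qed (simp_all add: ielem_def)

lemma itwo_elem_simps [simp]:
  "itwo_elem V b \<in> Arr CV" "Dom CV (itwo_elem V b) = ione V" "Cod CV (itwo_elem V b) = itwo V"
  "if0 (itwo_elem V b) = ob2 b" "if1 (itwo_elem V b) = ar2 b b"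
  using iid_ob2 [of "Ident V pt" b] by (simp_all add: itwo_elem_def)

lemma ieval_at_simps [simp]:
  assumes B: "B \<in> Obj CV"
  shows "ieval_at V B b \<in> Arr CV" "Dom CV (ieval_at V B b) = arrow_cat B" "Cod CV (ieval_at V B b) = B"
    "if0 (ieval_at V B b) = (if b then itgt B else isrc B) ** am B" "if1 (ieval_at V B b) = dm B b"
proof -
  show "ieval_at V B b \<in> Arr CV" "Dom CV (ieval_at V B b) = arrow_cat B" "Cod CV (ieval_at V B b) = B"
    using B by (simp_all add: ieval_at_def Let_def)
  show "if0 (ieval_at V B b) = (if b then itgt B else isrc B) ** am B"
    using arrow_category(9) [OF B, of "Ident V (iob (arrow_cat B))" "iob (arrow_cat B)" b] B
    by (simp add: ieval_at_def Let_def)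
  show "if1 (ieval_at V B b) = dm B b"
    using B by (simp add: ieval_at_def Let_def dm_def)
qed

text \<open>
  The functor \<open>2 \<rightarrow> B\<close> classifying an arrow is the evaluation at the corresponding object of the arrow category.
\<close>

lemma iarrow_eq:
  assumes B: "B \<in> Obj CV" and e: "e \<in> pt ~> iob (arrow_cat B)"
  shows "iarrow V B (am B ** e) = arrow_eval B \<odot>
    pair CV (ielem V (arrow_cat B) e \<odot> ibang V (itwo V)) (Ident CV (itwo V))" (is "_ = ?F")
proof -
  let ?E = "arrow_cat B"
  have E [simp]: "?E \<in> Obj CV" using B by simp
  have F: "?F \<in> Hom CV (itwo V) B" using B e by simp
  then have F': "if0 ?F \<in> iob (itwo V) ~> iob B" "if1 ?F \<in> iar (itwo V) ~> iar B"
    "idom ?F = itwo V" "icod ?F = B" using ifun_simps [of ?F] by (simp_all add: Cat_Dom Cat_Cod del: Cat_comp_simps)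
  have F0: "if0 ?F ** ob2 b = (if b then itgt B else isrc B) ** (am B ** e)" for b
    using arrow_category(9) [OF B e, of b] B e by simp
  have F1: "if1 ?F ** ar2 a b = (if \<not> a \<and> b then am B ** e else iid B ** ((if a then itgt B else isrc B) ** (am B ** e)))"
    if "le2 a b" for a b
    using arrow_category(10) [OF B e that] B e that by simp
  have c0: "copair V UNIV (\<lambda>_. pt) (iob B) (\<lambda>a. (if a then itgt B else isrc B) ** (am B ** e)) = if0 ?F"
  proof -
    have x: "\<exists>t. is_coproduct V (UNIV :: bool set) (\<lambda>_. pt) t" using two.J_objects by auto
    have t: "(if a then itgt B else isrc B) ** (am B ** e) \<in> pt ~> iob B" for a
      using B e by (cases a) simp_all
    note cp = copair_props [OF x, of "\<lambda>a. (if a then itgt B else isrc B) ** (am B ** e)" "iob B", OF t]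
    show ?thesis
      by (rule coproduct_eqI [OF coprd_is_coproduct [OF x]])
        (use cp F0 F'(1) B in \<open>simp_all add: int_ob_inj_def itwo_def Internal_def int_ob_def del: Cat_comp_simps\<close>)
  qed
  have c1: "copair V (UNIV \<times> UNIV) (\<lambda>(a, b). vhom (vtwo V) a b) (iar B) (\<lambda>(a, b). if a \<and> \<not> b then cobang V (iar B)
      else if \<not> a \<and> b then am B ** e else iid B ** (if a then itgt B else isrc B) ** (am B ** e)) = if1 ?F"
    (is "copair V ?K ?X ?Z ?f = _")
  proof -
    have x: "\<exists>t. is_coproduct V ?K ?X t" using two.J_arrows by auto
    have t: "?f i \<in> ?X i ~> ?Z" for i
      using B e by (cases i; cases "fst i"; cases "snd i") (simp_all add: vtwo_simps(2))
    note cp = copair_props [OF x, of ?f ?Z, OF t]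
    have e: "?f (a, b) = if1 ?F ** ar2 a b" for a b
    proof (cases "le2 a b")
      case True then show ?thesis using F1 [OF True] by (simp del: Cat_comp_simps add: le2_def)
    next
      case False
      then have "?f (a, b) \<in> init_ob V ~> iar B" "if1 ?F ** ar2 a b \<in> init_ob V ~> iar B"
        using t [of "(a, b)"] two.ja_simps [of a b] F'(2) by (simp_all add: le2_def vtwo_simps(2) del: Cat_comp_simps split: if_splits)
      then show ?thesis using init_strict [of "Ident V (init_ob V)" "init_ob V" "?f (a, b)" "iar B" "if1 ?F ** ar2 a b"] by simp
    qed
    show ?thesis
    proof (rule coproduct_eqI [OF coprd_is_coproduct [OF x], of _ "iar B"])
      show "copair V ?K ?X ?Z ?f \<in> coprd V ?K ?X ~> iar B" using cp(1) B by simp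
      show "if1 ?F \<in> coprd V ?K ?X ~> iar B" using F'(2) by (simp add: itwo_def Internal_def int_ar_def del: Cat_comp_simps)
      fix i assume "i \<in> ?K"
      then show "copair V ?K ?X ?Z ?f ** coinj V ?K ?X i = if1 ?F ** coinj V ?K ?X i"
        using cp(2) [of i] e [of "fst i" "snd i"] B by (simp add: int_ar_inj_def del: Cat_comp_simps)
    qed
  qed
  show ?thesis unfolding iarrow_def c0 c1 using F'(3,4) by (simp del: Cat_comp_simps)
qed

text \<open>The object of the arrow category that names an arrow.\<close>

lemma named_arrow:
  assumes B: "B \<in> Obj CV" and f: "f \<in> pt ~> iar B"
  defines "t \<equiv> curry_map CV (ione V) (itwo V) (iarrow V B f \<odot> pr2 CV (ione V) (itwo V))"
  shows "t \<in> Hom CV (ione V) (arrow_cat B)" "am B ** if0 t = f"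
proof -
  let ?E = "arrow_cat B"
  have E [simp]: "?E \<in> Obj CV" using B by simp
  obtain e where e: "e \<in> pt ~> iob ?E" "am B ** e = f" using arrow_elements [OF B f] by blast
  let ?n = "ielem V ?E e"
  have n: "?n \<in> Hom CV (ione V) ?E" using e(1) by simp
  have ia: "iarrow V B f \<in> Hom CV (itwo V) B" unfolding e(2) [symmetric] iarrow_eq [OF B e(1)] using B e(1) by simp
  have "t = ?n"
  proof (rule Cat.expo_eqI [of "itwo V" B _ "ione V"])
    show "t \<in> Hom CV (ione V) ?E" using ia B by (simp add: t_def)
    let ?p1 = "pr1 CV (ione V) (itwo V)" and ?p2 = "pr2 CV (ione V) (itwo V)"
    have "ibang V (itwo V) \<odot> ?p2 = ?p1"
      using ibang_unique [of "ibang V (itwo V) \<odot> ?p2" "prd CV (ione V) (itwo V)"]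
        ibang_unique [of ?p1 "prd CV (ione V) (itwo V)"] by simp
    then have "iarrow V B f \<odot> ?p2 = arrow_eval B \<odot> pair CV (?n \<odot> ?p1) ?p2"
      unfolding e(2) [symmetric] iarrow_eq [OF B e(1)] using B n by simp
    moreover have "arrow_eval B \<odot> pair CV (t \<odot> ?p1) ?p2 = iarrow V B f \<odot> ?p2"
      unfolding t_def using ia B by simp
    ultimately show "arrow_eval B \<odot> pair CV (t \<odot> ?p1) ?p2 =
      arrow_eval B \<odot> pair CV (?n \<odot> ?p1) ?p2" by simp
  qed (use B n in simp_all)
  then show "t \<in> Hom CV (ione V) ?E" "am B ** if0 t = f" using n e by simp_all
qed

end


section \<open>Exponentials by a discrete internal category\<close>

context ccc
begin

definition uncurry :: "'o \<Rightarrow> 'o \<Rightarrow> 'm \<Rightarrow> 'm" where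
  "uncurry X Y g = eval_map V X Y ** pair V (g ** pr1 V (Dom V g) X) (pr2 V (Dom V g) X)"

text \<open>The map \<open>f\<^sup>X : Y\<^sup>X \<rightarrow> Z\<^sup>X\<close>.\<close>

definition post :: "'o \<Rightarrow> 'm \<Rightarrow> 'm" where
  "post X f = curry_map V (expo V X (Dom V f)) X (f ** eval_map V X (Dom V f))"

lemma uncurry_simps [simp]:
  assumes "X \<in> Obj V" "Y \<in> Obj V" "g \<in> Arr V" "Cod V g = expo V X Y"
  shows "uncurry X Y g \<in> Arr V" "Dom V (uncurry X Y g) = prd V (Dom V g) X" "Cod V (uncurry X Y g) = Y"
    "\<And>a b. a \<in> Arr V \<Longrightarrow> b \<in> Arr V \<Longrightarrow> Cod V a = Dom V g \<Longrightarrow> Cod V b = X \<Longrightarrow> Dom V a = Dom V b \<Longrightarrow>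
      uncurry X Y g ** pair V a b = eval_map V X Y ** pair V (g ** a) b"
  using assms by (simp_all add: uncurry_def)

lemma uncurry_inj:
  assumes "X \<in> Obj V" "Y \<in> Obj V" "g \<in> W ~> expo V X Y" "h \<in> W ~> expo V X Y" "uncurry X Y g = uncurry X Y h"
  shows "g = h"
  by (rule expo_eqI [of X Y _ W]) (use assms in \<open>simp_all add: uncurry_def\<close>)

lemma uncurry_curry [simp]:
  assumes "X \<in> Obj V" "W \<in> Obj V" "f \<in> Arr V" "Dom V f = prd V W X" "Cod V f = Y"
  shows "uncurry X Y (curry_map V W X f) = f"
proof -
  have "Y \<in> Obj V" using assms by auto
  then show ?thesis using assms by (simp add: uncurry_def)
qed

lemma post_simps [simp]:
  assumes "X \<in> Obj V" "f \<in> Arr V"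
  shows "post X f \<in> Arr V" "Dom V (post X f) = expo V X (Dom V f)" "Cod V (post X f) = expo V X (Cod V f)"
    "\<And>Y Z a b. Dom V f = Y \<Longrightarrow> Cod V f = Z \<Longrightarrow> a \<in> Arr V \<Longrightarrow> b \<in> Arr V \<Longrightarrow> Cod V a = expo V X Y \<Longrightarrow> Cod V b = X \<Longrightarrow>
      Dom V a = Dom V b \<Longrightarrow> eval_map V X Z ** pair V (post X f ** a) b = f ** (eval_map V X Y ** pair V a b)"
  using assms Dom_Obj [OF assms(2)] Cod_Obj [OF assms(2)] by (simp_all add: post_def)

lemma uncurry_post [simp]:
  assumes "X \<in> Obj V" "f \<in> Arr V" "Cod V f = Z" "a \<in> Arr V" "Cod V a = expo V X (Dom V f)"
  shows "uncurry X Z (post X f ** a) = f ** uncurry X (Dom V f) a"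
  using assms by (auto simp: uncurry_def)

lemma uncurry_comp [simp]:
  assumes "X \<in> Obj V" "Y \<in> Obj V" "g \<in> Arr V" "Cod V g = expo V X Y" "h \<in> Arr V" "Cod V h = Dom V g"
  shows "uncurry X Y (g ** h) = uncurry X Y g ** pair V (h ** pr1 V (Dom V h) X) (pr2 V (Dom V h) X)"
  using assms by (simp add: uncurry_def)

lemma post_eqI:
  assumes "X \<in> Obj V" "f \<in> Arr V" "g \<in> Arr V" "Cod V f = Cod V g" "a \<in> W ~> expo V X (Dom V f)"
    "b \<in> W ~> expo V X (Dom V g)" "f ** uncurry X (Dom V f) a = g ** uncurry X (Dom V g) b"
  shows "post X f ** a = post X g ** b"
  by (rule uncurry_inj [of X "Cod V g" _ W]) (use assms in \<open>simp_all del: uncurry_comp\<close>)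

text \<open>Composition in \<open>B\<close> at each element of \<open>X\<close>.\<close>

definition pwc :: "'o \<Rightarrow> ('o, 'm) icat \<Rightarrow> 'm \<Rightarrow> 'm \<Rightarrow> 'm" where
  "pwc X B g f = curry_map V (Dom V f) X (ic B (uncurry X (iar B) g) (uncurry X (iar B) f))"

definition power_icat :: "'o \<Rightarrow> ('o, 'm) icat \<Rightarrow> ('o, 'm) icat" where
  "power_icat X B = mk_icat (expo V X (iob B)) (expo V X (iar B)) (post X (isrc B)) (post X (itgt B)) (post X (iid B)) (pwc X B)"

lemma pwc:
  assumes X: "X \<in> Obj V" and B: "B \<in> Obj CV"
    and g: "g \<in> W ~> expo V X (iar B)" and f: "f \<in> W ~> expo V X (iar B)" and gf: "post X (isrc B) ** g = post X (itgt B) ** f"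
  shows "isrc B ** uncurry X (iar B) g = itgt B ** uncurry X (iar B) f"
    "pwc X B g f \<in> W ~> expo V X (iar B)"
    "uncurry X (iar B) (pwc X B g f) = ic B (uncurry X (iar B) g) (uncurry X (iar B) f)" (is ?P)
proof -
  have W: "W \<in> Obj V" using g Hom_Obj1 by blast
  show e: "isrc B ** uncurry X (iar B) g = itgt B ** uncurry X (iar B) f"
    using uncurry_post [of X "isrc B" "iob B" g] uncurry_post [of X "itgt B" "iob B" f] X B g f gf
    by (simp del: uncurry_comp)
  show "pwc X B g f \<in> W ~> expo V X (iar B)"
    ?P
    using e X B W g f by (simp_all add: pwc_def)
qed

lemma power_icat:
  assumes X: "X \<in> Obj V" and B: "B \<in> Obj CV"
  shows "power_icat X B \<in> Obj CV"
    "\<And>W g f. g \<in> W ~> expo V X (iar B) \<Longrightarrow> f \<in> W ~> expo V X (iar B) \<Longrightarrow>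
      post X (isrc B) ** g = post X (itgt B) ** f \<Longrightarrow> ic (power_icat X B) g f = pwc X B g f"
proof -
  let ?Y = "expo V X (iob B)" and ?R = "expo V X (iar B)" and ?s = "post X (isrc B)" and ?t = "post X (itgt B)"
    and ?i = "post X (iid B)" and ?m = "pwc X B" and ?u = "uncurry X (iar B)"
  note T = X B icat_simps [OF B]
  have 1: "?s ** ?i = Ident V ?Y" "?t ** ?i = Ident V ?Y"
    by (rule uncurry_inj [of X "iob B" _ ?Y]; use T in \<open>simp add: uncurry_def\<close>)+
  have 2: "?m g f \<in> W ~> ?R \<and> ?s ** ?m g f = ?s ** f \<and> ?t ** ?m g f = ?t ** g"
    if g: "g \<in> W ~> ?R" and f: "f \<in> W ~> ?R" and gf: "?s ** g = ?t ** f" for g f W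
  proof -
    note p = pwc [OF X B g f gf]
    have "?s ** ?m g f = ?s ** f" by (rule post_eqI [of _ _ _ _ W]) (use T p g f in simp_all)
    moreover have "?t ** ?m g f = ?t ** g" by (rule post_eqI [of _ _ _ _ W]) (use T p g f in simp_all)
    ultimately show ?thesis using p(2) by simp
  qed
  have 3: "?m g f ** h = ?m (g ** h) (f ** h)"
    if g: "g \<in> W ~> ?R" and f: "f \<in> W ~> ?R" and gf: "?s ** g = ?t ** f" and h: "h \<in> Z ~> W" for g f h W Z
  proof -
    note p = pwc [OF X B g f gf]
    have gh: "g ** h \<in> Z ~> ?R" "f ** h \<in> Z ~> ?R" "?s ** (g ** h) = ?t ** (f ** h)"
      using comp_ext [OF gf, of h] T g f h by simp_all
    have Z: "Z \<in> Obj V" using h Hom_Obj1 by blast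
    show ?thesis
      by (rule uncurry_inj [of X "iar B" _ Z]) (use T p pwc [OF X B gh] gh g f h Z in simp_all)
  qed
  have 4: "?m (?m h g) f = ?m h (?m g f)"
    if f: "f \<in> W ~> ?R" and g: "g \<in> W ~> ?R" and h: "h \<in> W ~> ?R" and gf: "?s ** g = ?t ** f" and hg: "?s ** h = ?t ** g"
    for f g h W
  proof -
    note p = pwc [OF X B g f gf] and q = pwc [OF X B h g hg]
    have e: "?s ** ?m h g = ?t ** f" "?s ** h = ?t ** ?m g f" using 2 [OF g f gf] 2 [OF h g hg] gf hg by simp_all
    note r = pwc [OF X B q(2) f e(1)] and s = pwc [OF X B h p(2) e(2)]
    have a: "ic B (ic B (?u h) (?u g)) (?u f) = ic B (?u h) (ic B (?u g) (?u f))"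
      by (rule ic_assoc [OF B, of _ "prd V W X"]) (use T f g h p(1) q(1) in simp_all)
    show ?thesis
      by (rule uncurry_inj [of X "iar B" _ W]) (use T r(2) s(2) in simp_all, simp only: r(3) s(3) p(3) q(3) a)
  qed
  have 5: "?m (?i ** (?t ** f)) f = f" "?m f (?i ** (?s ** f)) = f" if f: "f \<in> W ~> ?R" for f W
  proof -
    have i: "?i ** (?t ** f) \<in> W ~> ?R" "?i ** (?s ** f) \<in> W ~> ?R" using T f by simp_all
    have e: "?s ** (?i ** (?t ** f)) = ?t ** f" "?s ** f = ?t ** (?i ** (?s ** f))"
      using comp_ext [OF 1(1), of "?t ** f"] comp_ext [OF 1(2), of "?s ** f"] T f by simp_all
    note p = pwc [OF X B i(1) f e(1)] and q = pwc [OF X B f i(2) e(2)]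
    have u: "?u (?i ** (?t ** f)) = iid B ** (itgt B ** ?u f)" "?u (?i ** (?s ** f)) = iid B ** (isrc B ** ?u f)"
      using T f by (simp_all del: uncurry_comp)
    show "?m (?i ** (?t ** f)) f = f"
      by (rule uncurry_inj [OF X T(4) p(2) f], unfold p(3) u, rule ic_id_left [OF B]) (use T f in simp_all)
    show "?m f (?i ** (?s ** f)) = f"
      by (rule uncurry_inj [OF X T(4) q(2) f], unfold q(3) u, rule ic_id_right [OF B]) (use T f in simp_all)
  qed
  have t: "?s \<in> ?R ~> ?Y" "?t \<in> ?R ~> ?Y" "?i \<in> ?Y ~> ?R" using T by simp_all
  show "power_icat X B \<in> Obj CV"
    unfolding power_icat_def by (rule mk_icat(1) [OF t 1]) (rule 2 3 4 5; assumption)+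
  show "ic (power_icat X B) g f = ?m g f"
    if "g \<in> W ~> ?R" "f \<in> W ~> ?R" "?s ** g = ?t ** f" for W g f
    unfolding power_icat_def by (rule mk_icat(2) [OF t 1 _ _ _ _ _ that]) (rule 2 3 4 5; assumption)+
qed

lemma power_icat_simps [simp]:
  "iob (power_icat X B) = expo V X (iob B)" "iar (power_icat X B) = expo V X (iar B)"
  "isrc (power_icat X B) = post X (isrc B)" "itgt (power_icat X B) = post X (itgt B)" "iid (power_icat X B) = post X (iid B)"
  by (simp_all add: power_icat_def)

text \<open>
  Since all structure maps of \<open>cst X\<close> are identities, a functor \<open>Z \<times> cst X \<rightarrow> B\<close> is a pair of maps
  \<open>Z\<^sub>0 \<times> X \<rightarrow> B\<^sub>0\<close> and \<open>Z\<^sub>1 \<times> X \<rightarrow> B\<^sub>1\<close>, so the exponential is computed in \<open>V\<close>.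
\<close>

lemma power_exponential:
  assumes X: "X \<in> Obj V" and B: "B \<in> Obj CV"
  obtains ev where "is_exponential CV (cst V X) B (power_icat X B, ev)"
    "ev \<in> Hom CV (prd CV (power_icat X B) (cst V X)) B"
    "\<And>W e x. e \<in> W ~> expo V X (iob B) \<Longrightarrow> x \<in> W ~> X \<Longrightarrow>
      if0 ev ** pp0 (power_icat X B) (cst V X) e x = eval_map V X (iob B) ** pair V e x"
    "\<And>W s x. s \<in> W ~> expo V X (iar B) \<Longrightarrow> x \<in> W ~> X \<Longrightarrow>
      if1 ev ** pp1 (power_icat X B) (cst V X) s x = eval_map V X (iar B) ** pair V s x"
proof -
  let ?E = "power_icat X B" and ?c = "cst V X"
  let ?P = "prd CV ?E ?c" and ?p = "pr1 CV ?E ?c" and ?q = "pr2 CV ?E ?c"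
  have E [simp]: "?E \<in> Obj CV" and c [simp]: "?c \<in> Obj CV" using power_icat(1) [OF X B] X by simp_all
  have P [simp]: "?P \<in> Obj CV" by simp
  note T = X B icat_simps [OF B]
  let ?e0 = "eval_map V X (iob B)" and ?e1 = "eval_map V X (iar B)"
  define ev0 ev1 where "ev0 = ?e0 ** pair V (if0 ?p) (if0 ?q)" and "ev1 = ?e1 ** pair V (if1 ?p) (if1 ?q)"
  let ?ev = "\<lparr>idom = ?P, icod = B, if0 = ev0, if1 = ev1\<rparr>"
  have t: "ev0 \<in> iob ?P ~> iob B" "ev1 \<in> iar ?P ~> iar B" using T by (simp_all add: ev0_def ev1_def)
  have qs: "if0 ?q ** isrc ?P = if1 ?q" "if0 ?q ** itgt ?P = if1 ?q" "if1 ?q ** iid ?P = if0 ?q"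
    using ifun_src [of ?q ?c] ifun_id [of ?q ?P] by (simp_all del: ifun_src ifun_id)
  have ps: "if0 ?p ** isrc ?P = post X (isrc B) ** if1 ?p" "if0 ?p ** itgt ?P = post X (itgt B) ** if1 ?p"
    "if1 ?p ** iid ?P = post X (iid B) ** if0 ?p"
    using ifun_src [of ?p ?E] ifun_id [of ?p ?P] by (simp_all del: ifun_src ifun_id)
  have st: "isrc B ** ev1 = ev0 ** isrc ?P" "itgt B ** ev1 = ev0 ** itgt ?P" "ev1 ** iid ?P = iid B ** ev0"
    unfolding ev0_def ev1_def using T qs ps by (simp_all del: ifun_src ifun_id)
  have evc: "ev0 ** j = ?e0 ** pair V (if0 ?p ** j) (if0 ?q ** j)" if "j \<in> W ~> iob ?P" for j W
    using T that by (simp add: ev0_def)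
  have evc1: "ev1 ** j = ?e1 ** pair V (if1 ?p ** j) (if1 ?q ** j)" if "j \<in> W ~> iar ?P" for j W
    using T that by (simp add: ev1_def)
  have ev: "?ev \<in> Hom CV ?P B"
  proof (rule ifunctorI [OF P B t st])
    fix W g f assume g: "g \<in> W ~> iar ?P" and f: "f \<in> W ~> iar ?P" and gf: "isrc ?P ** g = itgt ?P ** f"
    have pg: "if1 ?p ** g \<in> W ~> expo V X (iar B)" "if1 ?p ** f \<in> W ~> expo V X (iar B)"
      and qg: "if1 ?q ** g \<in> W ~> X" using g f by simp_all
    have "isrc ?E ** (if1 ?p ** g) = itgt ?E ** (if1 ?p ** f)"
      using ifun_src_comp [of ?p ?E g] ifun_src_comp [of ?p ?E f] g f gf by (simp del: power_icat_simps)
    then have pgf: "post X (isrc B) ** (if1 ?p ** g) = post X (itgt B) ** (if1 ?p ** f)" by simp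
    have "isrc ?c ** (if1 ?q ** g) = itgt ?c ** (if1 ?q ** f)"
      using ifun_src_comp [of ?q ?c g] ifun_src_comp [of ?q ?c f] g f gf by (simp del: cst_simps)
    then have qgf: "if1 ?q ** f = if1 ?q ** g" using g f by simp
    have k: "ic ?P g f \<in> W ~> iar ?P" using g f gf by simp
    have "if1 ?p ** ic ?P g f = pwc X B (if1 ?p ** g) (if1 ?p ** f)"
      using ifun_comp [of ?p ?P g f] power_icat(2) [OF X B pg pgf] g f gf by simp
    moreover have "if1 ?q ** ic ?P g f = if1 ?q ** g"
      using ifun_comp [of ?q ?P g f] cst_icat(2) [of X "if1 ?q ** g" "if1 ?q ** f"] qgf X g f gf by simp
    ultimately have "ev1 ** ic ?P g f = ?e1 ** pair V (pwc X B (if1 ?p ** g) (if1 ?p ** f)) (if1 ?q ** g)"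
      unfolding evc1 [OF k] by simp
    also have "\<dots> = uncurry X (iar B) (pwc X B (if1 ?p ** g) (if1 ?p ** f)) ** pair V (Ident V W) (if1 ?q ** g)"
      using pwc(2) [OF X B pg pgf] T qg Hom_Obj1 [OF qg] by simp
    also have "\<dots> = ic B (ev1 ** g) (ev1 ** f)"
      unfolding pwc(3) [OF X B pg pgf] evc1 [OF g] evc1 [OF f]
      using pwc(1) [OF X B pg pgf] T pg qg qgf Hom_Obj1 [OF qg] by (simp del: uncurry_comp)
    finally show "ev1 ** ic ?P g f = ic B (ev1 ** g) (ev1 ** f)" .
  qed
  have E0: "if0 ?ev ** pp0 ?E ?c e x = ?e0 ** pair V e x" if "e \<in> W ~> expo V X (iob B)" "x \<in> W ~> X" for e x W
    using evc [of "pp0 ?E ?c e x" W] that by simp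
  have E1: "if1 ?ev ** pp1 ?E ?c s x = ?e1 ** pair V s x" if "s \<in> W ~> expo V X (iar B)" "x \<in> W ~> X" for s x W
    using evc1 [of "pp1 ?E ?c s x" W] that by simp
  have "\<exists>!\<Psi>. \<Psi> \<in> Hom CV Z ?E \<and> ?ev \<odot> pair CV (\<Psi> \<odot> pr1 CV Z ?c) (pr2 CV Z ?c) = \<Phi>"
    if Z: "Z \<in> Obj CV" and Ph: "\<Phi> \<in> Hom CV (prd CV Z ?c) B" for Z \<Phi>
  proof -
    let ?Q = "prd CV Z ?c" and ?q1 = "pr1 CV Z ?c" and ?q2 = "pr2 CV Z ?c"
    note Zs = icat_simps [OF Z]
    let ?T = "\<lambda>\<Psi>. ?ev \<odot> pair CV (\<Psi> \<odot> ?q1) ?q2"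
    define u0 where "u0 = (\<lambda>z x. if0 \<Phi> ** pp0 Z ?c z x)"
    define u1 where "u1 = (\<lambda>z x. if1 \<Phi> ** pp1 Z ?c z x)"
    have TT: "?T \<Psi> \<in> Hom CV ?Q B" "if0 (?T \<Psi>) = ?e0 ** pair V (if0 \<Psi> ** if0 ?q1) (if0 ?q2)"
      "if1 (?T \<Psi>) = ?e1 ** pair V (if1 \<Psi> ** if1 ?q1) (if1 ?q2)" if "\<Psi> \<in> Hom CV Z ?E" for \<Psi>
      using that ev Z E0 [of "if0 \<Psi> ** if0 ?q1" "iob ?Q" "if0 ?q2"] E1 [of "if1 \<Psi> ** if1 ?q1" "iar ?Q" "if1 ?q2"] by simp_all
    let ?QO = "prd V (iob Z) X" and ?QA = "prd V (iar Z) X"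
    define F0 F1 where "F0 = curry_map V (iob Z) X (u0 (pr1 V (iob Z) X) (pr2 V (iob Z) X))"
      and "F1 = curry_map V (iar Z) X (u1 (pr1 V (iar Z) X) (pr2 V (iar Z) X))"
    have u: "u0 (pr1 V (iob Z) X) (pr2 V (iob Z) X) \<in> ?QO ~> iob B"
      "u1 (pr1 V (iar Z) X) (pr2 V (iar Z) X) \<in> ?QA ~> iar B" using T Z Ph by (simp_all add: u0_def u1_def)
    have F: "F0 \<in> iob Z ~> expo V X (iob B)" "F1 \<in> iar Z ~> expo V X (iar B)"
      using u T Z by (simp_all add: F0_def F1_def)
    have Fe0: "?e0 ** pair V (F0 ** z) x = u0 z x" if "z \<in> W ~> iob Z" "x \<in> W ~> X" for z x W
      using u T Z that Ph by (simp add: F0_def) (simp add: u0_def)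
    have Fe1: "?e1 ** pair V (F1 ** z) x = u1 z x" if "z \<in> W ~> iar Z" "x \<in> W ~> X" for z x W
      using u T Z that Ph by (simp add: F1_def) (simp add: u1_def)
    have un0: "uncurry X (iob B) (F0 ** z) = u0 (z ** pr1 V W X) (pr2 V W X)" if "z \<in> W ~> iob Z" for z W
      using Fe0 [of "z ** pr1 V W X" "prd V W X" "pr2 V W X"] that Hom_Obj1 [OF that] F T by (simp add: uncurry_def)
    have un1: "uncurry X (iar B) (F1 ** z) = u1 (z ** pr1 V W X) (pr2 V W X)" if "z \<in> W ~> iar Z" for z W
      using Fe1 [of "z ** pr1 V W X" "prd V W X" "pr2 V W X"] that Hom_Obj1 [OF that] F T by (simp add: uncurry_def)
    have un: "uncurry X (iob B) F0 = u0 (pr1 V (iob Z) X) (pr2 V (iob Z) X)"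
      "uncurry X (iar B) F1 = u1 (pr1 V (iar Z) X) (pr2 V (iar Z) X)"
      using u T Z by (simp_all add: F0_def F1_def)
    let ?Psi = "\<lparr>idom = Z, icod = ?E, if0 = F0, if1 = F1\<rparr>"
    have us: "isrc B ** u1 z x = u0 (isrc Z ** z) x" "itgt B ** u1 z x = u0 (itgt Z ** z) x" if "z \<in> W ~> iar Z" "x \<in> W ~> X" for z x W
      using that Z Ph X by (simp_all add: u0_def u1_def)
    have Psi: "?Psi \<in> Hom CV Z ?E"
    proof (rule ifunctorI [OF Z E], unfold power_icat_simps)
      have p1: "pr1 V (iar Z) X \<in> ?QA ~> iar Z" "pr2 V (iar Z) X \<in> ?QA ~> X" using Zs X by simp_all
      show "post X (isrc B) ** F1 = F0 ** isrc Z"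
        by (rule uncurry_inj [of X "iob B" _ "iar Z"])
          (use T F Zs us [OF p1] un0 [of "isrc Z" "iar Z"] un in \<open>simp_all del: uncurry_comp\<close>)
      show "post X (itgt B) ** F1 = F0 ** itgt Z"
        by (rule uncurry_inj [of X "iob B" _ "iar Z"])
          (use T F Zs us [OF p1] un0 [of "itgt Z" "iar Z"] un in \<open>simp_all del: uncurry_comp\<close>)
      have "u1 (iid Z ** pr1 V (iob Z) X) (pr2 V (iob Z) X) = if1 \<Phi> ** (iid ?Q ** pp0 Z ?c (pr1 V (iob Z) X) (pr2 V (iob Z) X))"
        unfolding u1_def using Z X by (simp del: ifun_id_comp)
      also have "\<dots> = iid B ** u0 (pr1 V (iob Z) X) (pr2 V (iob Z) X)"
        unfolding u0_def using Z X Ph by (subst ifun_id_comp) simp_all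
      finally show "F1 ** iid Z = post X (iid B) ** F0"
        by - (rule uncurry_inj [of X "iar B" _ "iob Z"],
          use T F Zs un1 [of "iid Z" "iob Z"] un in \<open>simp_all del: uncurry_comp\<close>)
      fix W g f assume g: "g \<in> W ~> iar Z" and f: "f \<in> W ~> iar Z" and gf: "isrc Z ** g = itgt Z ** f"
      have W: "W \<in> Obj V" using g Hom_Obj1 by blast
      have Fg: "F1 ** g \<in> W ~> expo V X (iar B)" "F1 ** f \<in> W ~> expo V X (iar B)" using F g f by simp_all
      let ?w = "pr1 V W X" and ?x = "pr2 V W X"
      have wx: "?w \<in> prd V W X ~> W" "?x \<in> prd V W X ~> X" using W X by simp_all
      have gw: "g ** ?w \<in> prd V W X ~> iar Z" "f ** ?w \<in> prd V W X ~> iar Z" using g f wx by simp_all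
      have gfw: "isrc Z ** (g ** ?w) = itgt Z ** (f ** ?w)" using comp_ext [OF gf, of ?w] g f wx Z by simp
      have c: "ic Z g f \<in> W ~> iar Z" using g f gf Z by simp
      have s: "post X (isrc B) ** (F1 ** g) = post X (itgt B) ** (F1 ** f)"
        by (rule post_eqI [of _ _ _ _ W])
          (use T Fg un1 [OF g] un1 [OF f] us [OF gw(1) wx(2)] us [OF gw(2) wx(2)] gfw in \<open>simp_all del: uncurry_comp\<close>)
      have "u1 (ic Z g f ** ?w) ?x = if1 \<Phi> ** ic ?Q (pp1 Z ?c (g ** ?w) ?x) (pp1 Z ?c (f ** ?w) ?x)"
        unfolding u1_def using Z gw gfw wx X g f gf by (simp add: cst_icat(2) del: ifun_comp)
      also have "\<dots> = ic B (u1 (g ** ?w) ?x) (u1 (f ** ?w) ?x)"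
        unfolding u1_def using Z gw gfw wx X Ph by (subst ifun_comp) simp_all
      finally have uc: "u1 (ic Z g f ** ?w) ?x = ic B (u1 (g ** ?w) ?x) (u1 (f ** ?w) ?x)" .
      show "F1 ** ic Z g f = ic ?E (F1 ** g) (F1 ** f)"
        unfolding power_icat(2) [OF X B Fg s]
        by (rule uncurry_inj [of X "iar B" _ W])
          (use T F c pwc [OF X B Fg s] un1 [OF c] un1 [OF g] un1 [OF f] uc in \<open>simp_all del: uncurry_comp\<close>)
    qed (use F in simp_all)
    have TPsi: "?T ?Psi = \<Phi>"
    proof (rule ifun_eqI [OF TT(1) [OF Psi] Ph])
      show "if0 (?T ?Psi) = if0 \<Phi>" unfolding TT(2) [OF Psi]
        using Fe0 [of "if0 ?q1" "iob ?Q" "if0 ?q2"] Z Ph pp_eta(1) [of Z ?c "Ident V (iob ?Q)"] by (simp add: u0_def)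
      show "if1 (?T ?Psi) = if1 \<Phi>" unfolding TT(3) [OF Psi]
        using Fe1 [of "if1 ?q1" "iar ?Q" "if1 ?q2"] Z Ph pp_eta(2) [of Z ?c "Ident V (iar ?Q)"] by (simp add: u1_def)
    qed
    show ?thesis
    proof (rule ex1I [of _ ?Psi])
      show "?Psi \<in> Hom CV Z ?E \<and> ?T ?Psi = \<Phi>" using Psi TPsi by blast
      fix \<Psi> assume "\<Psi> \<in> Hom CV Z ?E \<and> ?T \<Psi> = \<Phi>"
      then have h: "\<Psi> \<in> Hom CV Z ?E" and t: "?T \<Psi> = \<Phi>" by blast+
      show "\<Psi> = ?Psi"
      proof (rule ifun_eqI [OF h Psi])
        have "u0 z x = ?e0 ** pair V (if0 \<Psi> ** z) x" if "z \<in> W ~> iob Z" "x \<in> W ~> X" for z x W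
          unfolding u0_def t [symmetric] TT(2) [OF h] using h that T Z by simp
        then have "uncurry X (iob B) (if0 \<Psi>) = u0 (pr1 V (iob Z) X) (pr2 V (iob Z) X)"
          unfolding uncurry_def using h X Zs by simp
        then show "if0 \<Psi> = if0 ?Psi"
          by - (rule uncurry_inj [of X "iob B" _ "iob Z"], use T F h un in simp_all)
        have "u1 z x = ?e1 ** pair V (if1 \<Psi> ** z) x" if "z \<in> W ~> iar Z" "x \<in> W ~> X" for z x W
          unfolding u1_def t [symmetric] TT(3) [OF h] using h that T Z by simp
        then have "uncurry X (iar B) (if1 \<Psi>) = u1 (pr1 V (iar Z) X) (pr2 V (iar Z) X)"
          unfolding uncurry_def using h X Zs by simp
        then show "if1 \<Psi> = if1 ?Psi"
          by - (rule uncurry_inj [of X "iar B" _ "iar Z"], use T F h un in simp_all)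
      qed
    qed
  qed
  then have "is_exponential CV (cst V X) B (?E, ?ev)"
    unfolding is_exponential_def prod.case using ev by (simp del: Hom_iff)
  then show ?thesis using that ev E0 E1 by blast
qed

text \<open>Generalised elements of the exponential by \<open>cst X\<close>, transposed to maps out of a product with \<open>X\<close>.\<close>

definition un0 :: "'o \<Rightarrow> ('o, 'm) icat \<Rightarrow> 'm \<Rightarrow> 'm" where
  "un0 X B e = if0 (eval_map CV (cst V X) B) **
    pp0 (ihom V (cst V X) B) (cst V X) (e ** pr1 V (Dom V e) X) (pr2 V (Dom V e) X)"

definition un1 :: "'o \<Rightarrow> ('o, 'm) icat \<Rightarrow> 'm \<Rightarrow> 'm" where
  "un1 X B e = if1 (eval_map CV (cst V X) B) **
    pp1 (ihom V (cst V X) B) (cst V X) (e ** pr1 V (Dom V e) X) (pr2 V (Dom V e) X)"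

lemma cst_exponential:
  assumes X: "X \<in> Obj V" and B: "B \<in> Obj CV"
  defines "E \<equiv> ihom V (cst V X) B"
  shows "Cat.has_expo (cst V X) B"
    "\<And>W k. W \<in> Obj V \<Longrightarrow> k \<in> prd V W X ~> iob B \<Longrightarrow> \<exists>!e. e \<in> W ~> iob E \<and> un0 X B e = k"
    "\<And>W k. W \<in> Obj V \<Longrightarrow> k \<in> prd V W X ~> iar B \<Longrightarrow> \<exists>!s. s \<in> W ~> iar E \<and> un1 X B s = k"
proof -
  let ?c = "cst V X"
  obtain ev where x: "is_exponential CV ?c B (power_icat X B, ev)"
    and ev: "ev \<in> Hom CV (prd CV (power_icat X B) (cst V X)) B"
    and e0: "\<And>W e x. e \<in> W ~> expo V X (iob B) \<Longrightarrow> x \<in> W ~> X \<Longrightarrow>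
      if0 ev ** pp0 (power_icat X B) ?c e x = eval_map V X (iob B) ** pair V e x"
    and e1: "\<And>W s x. s \<in> W ~> expo V X (iar B) \<Longrightarrow> x \<in> W ~> X \<Longrightarrow>
      if1 ev ** pp1 (power_icat X B) ?c s x = eval_map V X (iar B) ** pair V s x"
    using power_exponential [OF X B] by blast
  have c: "?c \<in> Obj CV" using X by simp
  show ex: "Cat.has_expo ?c B" unfolding Cat.has_expo_def using B c x by blast
  have E [simp]: "E \<in> Obj CV" using Cat.expo_simps(1) [OF ex] unfolding E_def .
  have P [simp]: "power_icat X B \<in> Obj CV" using power_icat(1) [OF X B] .
  obtain h where h: "h \<in> Hom CV E (power_icat X B)" "iso CV h"
    "ev \<odot> pair CV (h \<odot> pr1 CV E ?c) (pr2 CV E ?c) = eval_map CV ?c B"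
    unfolding E_def using Cat.exponential_unique [OF x c B] by blast
  have hi: "iso V (if0 h)" "iso V (if1 h)" using Cat_iso_components [OF h(1,2)] by blast+
  have ht: "if0 h \<in> iob E ~> expo V X (iob B)" "if1 h \<in> iar E ~> expo V X (iar B)"
    using h(1) by simp_all
  have U0: "un0 X B e = uncurry X (iob B) (if0 h ** e)" if e: "e \<in> W ~> iob E" for e W
  proof -
    have W: "W \<in> Obj V" using e Hom_Obj1 by blast
    have "un0 X B e = if0 ev ** pp0 (power_icat X B) ?c ((if0 h ** e) ** pr1 V W X) (pr2 V W X)"
      unfolding un0_def h(3) [symmetric] E_def [symmetric] using h(1) ev e W X c by simp
    then show ?thesis using e0 [of "(if0 h ** e) ** pr1 V W X" "prd V W X" "pr2 V W X"] ht e W X by (simp add: uncurry_def)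
  qed
  have U1: "un1 X B e = uncurry X (iar B) (if1 h ** e)" if e: "e \<in> W ~> iar E" for e W
  proof -
    have W: "W \<in> Obj V" using e Hom_Obj1 by blast
    have "un1 X B e = if1 ev ** pp1 (power_icat X B) ?c ((if1 h ** e) ** pr1 V W X) (pr2 V W X)"
      unfolding un1_def h(3) [symmetric] E_def [symmetric] using h(1) ev e W X c by simp
    then show ?thesis using e1 [of "(if1 h ** e) ** pr1 V W X" "prd V W X" "pr2 V W X"] ht e W X by (simp add: uncurry_def)
  qed
  have gen: "\<exists>!e. e \<in> W ~> S \<and> u e = k"
    if W: "W \<in> Obj V" and f: "f \<in> S ~> expo V X Y" "iso V f" and Y: "Y \<in> Obj V" and k: "k \<in> prd V W X ~> Y"
      and u: "\<And>e. e \<in> W ~> S \<Longrightarrow> u e = uncurry X Y (f ** e)" for W S Y f k u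
  proof -
    let ?g = "curry_map V W X k"
    have g: "?g \<in> W ~> expo V X Y" "uncurry X Y ?g = k" using W k X Y by simp_all
    have x: "\<exists>!e. e \<in> W ~> S \<and> f ** e = ?g" using f(2) g(1) W unfolding iso_iff_ex1 [OF f(1)] by blast
    have "u e = k \<longleftrightarrow> f ** e = ?g" if "e \<in> W ~> S" for e
      using u [OF that] g uncurry_inj [OF X Y, of "f ** e" W ?g] that f by auto
    then show ?thesis using x by (metis (no_types, lifting))
  qed
  show "\<exists>!e. e \<in> W ~> iob E \<and> un0 X B e = k" if "W \<in> Obj V" "k \<in> prd V W X ~> iob B" for W k
    by (rule gen [OF that(1) ht(1) hi(1) _ that(2) U0]) (use B in simp_all)
  show "\<exists>!e. e \<in> W ~> iar E \<and> un1 X B e = k" if "W \<in> Obj V" "k \<in> prd V W X ~> iar B" for W k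
    by (rule gen [OF that(1) ht(2) hi(2) _ that(2) U1]) (use B in simp_all)
qed

lemma un_simps:
  assumes X: "X \<in> Obj V" and B: "B \<in> Obj CV"
  defines "E \<equiv> ihom V (cst V X) B"
  shows "\<And>W e. e \<in> W ~> iob E \<Longrightarrow> un0 X B e \<in> prd V W X ~> iob B"
    "\<And>W s. s \<in> W ~> iar E \<Longrightarrow> un1 X B s \<in> prd V W X ~> iar B"
    "\<And>W s. s \<in> W ~> iar E \<Longrightarrow> isrc B ** un1 X B s = un0 X B (isrc E ** s)"
    "\<And>W s. s \<in> W ~> iar E \<Longrightarrow> itgt B ** un1 X B s = un0 X B (itgt E ** s)"
    "\<And>W Z e h. e \<in> W ~> iob E \<Longrightarrow> h \<in> Z ~> W \<Longrightarrow>
      un0 X B (e ** h) = un0 X B e ** pair V (h ** pr1 V Z X) (pr2 V Z X)"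
    "\<And>W k. k \<in> W ~> iob B \<Longrightarrow> un0 X B (if0 (const_ifun V X B) ** k) = k ** pr1 V W X"
    "const_ifun V X B \<in> Hom CV B E"
proof -
  let ?c = "cst V X" and ?ev = "eval_map CV (cst V X) B"
  note ex = cst_exponential(1) [OF X B]
  have c [simp]: "?c \<in> Obj CV" using X by simp
  have E [simp]: "E \<in> Obj CV" using Cat.expo_simps(1) [OF ex] unfolding E_def .
  have ev: "?ev \<in> Hom CV (prd CV E ?c) B" using Cat.expo_simps [OF ex] by (simp add: E_def)
  show "un0 X B e \<in> prd V W X ~> iob B" if "e \<in> W ~> iob E" for e W
    using that X ev Hom_Obj1 [OF that] unfolding un0_def E_def [symmetric] by simp
  show "un1 X B s \<in> prd V W X ~> iar B" "isrc B ** un1 X B s = un0 X B (isrc E ** s)"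
    "itgt B ** un1 X B s = un0 X B (itgt E ** s)" if "s \<in> W ~> iar E" for s W
    using that X ev Hom_Obj1 [OF that] unfolding un0_def un1_def E_def [symmetric] by simp_all
  show "un0 X B (e ** h) = un0 X B e ** pair V (h ** pr1 V Z X) (pr2 V Z X)" if "e \<in> W ~> iob E" "h \<in> Z ~> W" for e h W Z
    using that X ev Hom_Obj1 [OF that(1)] Hom_Obj1 [OF that(2)] unfolding un0_def E_def [symmetric] by simp
  have k: "const_ifun V X B \<in> Hom CV B E"
    "?ev \<odot> pair CV (const_ifun V X B \<odot> pr1 CV B ?c) (pr2 CV B ?c) = pr1 CV B ?c"
    using Cat.curry_props [of ?c "pr1 CV B ?c" B] ex B by (simp_all add: const_ifun_def E_def)
  then show "const_ifun V X B \<in> Hom CV B E" by blast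
  show "un0 X B (if0 (const_ifun V X B) ** a) = a ** pr1 V W X" if a: "a \<in> W ~> iob B" for a W
  proof -
    have W: "W \<in> Obj V" using a Hom_Obj1 by blast
    have "if0 (pr1 CV B ?c) ** pp0 B ?c (a ** pr1 V W X) (pr2 V W X) =
      if0 ?ev ** pp0 E ?c (if0 (const_ifun V X B) ** (a ** pr1 V W X)) (pr2 V W X)"
      by (subst k(2) [symmetric]) (use k(1) ev a W X B in simp)
    then show ?thesis using a W X B k(1) unfolding un0_def E_def [symmetric] by simp
  qed
qed

end


section \<open>Comma internal categories and internal terminal objects\<close>

text \<open>Used when generalised elements of two kinds correspond to each other bijectively.\<close>

lemma ex1_transfer:
  assumes "\<And>y. R y \<Longrightarrow> \<exists>!x. P x \<and> u x = y" "\<And>x. P x \<Longrightarrow> R (u x)"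
  shows "(\<exists>!x. P x) \<longleftrightarrow> (\<exists>!y. R y)"
proof
  assume "\<exists>!x. P x"
  then obtain x where x: "P x" "\<And>z. P z \<Longrightarrow> z = x" by blast
  show "\<exists>!y. R y"
  proof (rule ex1I [of _ "u x"])
    show "R (u x)" using assms(2) x(1) .
    fix y assume "R y"
    then obtain z where "P z" "u z = y" using assms(1) by blast
    then show "y = u x" using x(2) by blast
  qed
next
  assume "\<exists>!y. R y"
  then obtain y where y: "R y" "\<And>z. R z \<Longrightarrow> z = y" by blast
  have "P x \<longleftrightarrow> P x \<and> u x = y" for x using assms(2) y(2) by blast
  then show "\<exists>!x. P x" using assms(1) [OF y(1)] by simp
qed

context ext_ccc
begin

lemma pp_eq_iff:
  assumes A: "A \<in> Obj CV" "B \<in> Obj CV"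
  shows "\<And>W a b c d. a \<in> W ~> iob A \<Longrightarrow> c \<in> W ~> iob A \<Longrightarrow> b \<in> W ~> iob B \<Longrightarrow> d \<in> W ~> iob B \<Longrightarrow>
      pp0 A B a b = pp0 A B c d \<longleftrightarrow> a = c \<and> b = d"
    "\<And>W a b c d. a \<in> W ~> iar A \<Longrightarrow> c \<in> W ~> iar A \<Longrightarrow> b \<in> W ~> iar B \<Longrightarrow> d \<in> W ~> iar B \<Longrightarrow>
      pp1 A B a b = pp1 A B c d \<longleftrightarrow> a = c \<and> b = d"
proof -
  fix W a b c d assume a: "a \<in> W ~> iob A" "c \<in> W ~> iob A" "b \<in> W ~> iob B" "d \<in> W ~> iob B"
  then have "if0 (pr1 CV A B) ** pp0 A B a b = a" "if0 (pr2 CV A B) ** pp0 A B a b = b"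
    "if0 (pr1 CV A B) ** pp0 A B c d = c" "if0 (pr2 CV A B) ** pp0 A B c d = d" using A by simp_all
  then show "pp0 A B a b = pp0 A B c d \<longleftrightarrow> a = c \<and> b = d" by metis
next
  fix W a b c d assume a: "a \<in> W ~> iar A" "c \<in> W ~> iar A" "b \<in> W ~> iar B" "d \<in> W ~> iar B"
  then have "if1 (pr1 CV A B) ** pp1 A B a b = a" "if1 (pr2 CV A B) ** pp1 A B a b = b"
    "if1 (pr1 CV A B) ** pp1 A B c d = c" "if1 (pr2 CV A B) ** pp1 A B c d = d" using A by simp_all
  then show "pp1 A B a b = pp1 A B c d \<longleftrightarrow> a = c \<and> b = d" by metis
qed

end

locale comma_cat = ext_ccc V U for V :: "('o, 'm) cat" (structure) and U :: "'u set" +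
  fixes A B :: "('o, 'm) icat" and H b :: "('o, 'm) ifun"
  assumes H: "H \<in> Hom (Cat V) A B" and b: "b \<in> Hom (Cat V) (ione V) B"
begin

abbreviation "cm \<equiv> comma V H b"
abbreviation "cp \<equiv> comma_proj V H b"
abbreviation "cq \<equiv> pb2 CV (comma_leg V H b) (endpoints V B)"

text \<open>The component at the object \<open>(a, f)\<close> of the comma category is \<open>f\<close>.\<close>

definition ar :: 'm where
  "ar = am B ** if0 cq"

lemma AB [simp]: "A \<in> Obj CV" "B \<in> Obj CV" "icod H = B" "idom H = A"
  using ifun_simps(7,8) [of H] H by (simp_all add: Cat_Dom Cat_Cod)

lemma Hb [simp]: "H \<in> Arr CV" "Dom CV H = A" "Cod CV H = B"
  "b \<in> Arr CV" "Dom CV b = ione V" "Cod CV b = B" "if1 b = iid B ** if0 b"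
  using H b ifun_id [of b "ione V"] by simp_all

lemma leg [simp]:
  "comma_leg V H b \<in> Arr CV" "Dom CV (comma_leg V H b) = A" "Cod CV (comma_leg V H b) = prd CV B B"
  "if0 (comma_leg V H b) = pp0 B B (if0 H) (if0 b ** bang V (iob A))"
  "if1 (comma_leg V H b) = pp1 B B (if1 H) (iid B ** (if0 b ** bang V (iar A)))"
  by (simp_all add: comma_leg_def)

lemma ends [simp]:
  "endpoints V B \<in> Arr CV" "Dom CV (endpoints V B) = arrow_cat B" "Cod CV (endpoints V B) = prd CV B B"
  "if0 (endpoints V B) = pp0 B B (isrc B ** am B) (itgt B ** am B)" "if1 (endpoints V B) = pp1 B B (dm B False) (dm B True)"
  by (simp_all add: endpoints_def)

lemma cm_simps [simp]:
  "cm \<in> Obj CV" "cp \<in> Arr CV" "Dom CV cp = cm" "Cod CV cp = A"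
  "cq \<in> Arr CV" "Dom CV cq = cm" "Cod CV cq = arrow_cat B"
  by (simp_all add: comma_def comma_proj_def)

lemma ar_simps [simp]: "ar \<in> Arr V" "Dom V ar = iob cm" "Cod V ar = iar B"
  by (simp_all add: ar_def)

lemma cm_pullbacks:
  "is_pullback V (if0 (comma_leg V H b)) (if0 (endpoints V B)) (iob cm, if0 cp, if0 cq)"
  "is_pullback V (if1 (comma_leg V H b)) (if1 (endpoints V B)) (iar cm, if1 cp, if1 cq)"
  using Cat_pb_components [of "comma_leg V H b" A "prd CV B B" "endpoints V B" "arrow_cat B"]
  by (simp_all add: comma_def comma_proj_def del: leg(4,5) ends(4,5))

lemma cm_comm: "comma_leg V H b \<odot> cp = endpoints V B \<odot> cq"
  unfolding comma_proj_def AB by (rule Cat.pb_comm) simp_all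

lemma cm_obj:
  assumes k: "k \<in> W ~> iob cm"
  shows "isrc B ** (ar ** k) = if0 H ** (if0 cp ** k)" "itgt B ** (ar ** k) = if0 b ** bang V W"
proof -
  have W: "W \<in> Obj V" using k Hom_Obj1 by blast
  have "if0 (comma_leg V H b) ** if0 cp = if0 (endpoints V B) ** if0 cq"
    using arg_cong [OF cm_comm, of if0] by (simp del: leg(4) ends(4))
  then have "(if0 (comma_leg V H b) ** if0 cp) ** k = (if0 (endpoints V B) ** if0 cq) ** k" by simp
  then have "pp0 B B (if0 H ** (if0 cp ** k)) (if0 b ** bang V W) = pp0 B B (isrc B ** (ar ** k)) (itgt B ** (ar ** k))"
    using k W by (simp add: ar_def)
  then show "isrc B ** (ar ** k) = if0 H ** (if0 cp ** k)" "itgt B ** (ar ** k) = if0 b ** bang V W"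
    using k W by (subst (asm) pp_eq_iff(1) [of B B _ W]; simp)+
qed

lemma cm_arr:
  assumes s: "s \<in> W ~> iar cm"
  shows "dm B False ** (if1 cq ** s) = if1 H ** (if1 cp ** s)" "dm B True ** (if1 cq ** s) = iid B ** (if0 b ** bang V W)"
proof -
  have W: "W \<in> Obj V" using s Hom_Obj1 by blast
  have "if1 (comma_leg V H b) ** if1 cp = if1 (endpoints V B) ** if1 cq"
    using arg_cong [OF cm_comm, of if1] by (simp del: leg(5) ends(5))
  then have "(if1 (comma_leg V H b) ** if1 cp) ** s = (if1 (endpoints V B) ** if1 cq) ** s" by simp
  then have "pp1 B B (if1 H ** (if1 cp ** s)) (iid B ** (if0 b ** bang V W)) = pp1 B B (dm B False ** (if1 cq ** s)) (dm B True ** (if1 cq ** s))"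
    using s W by simp
  then show "dm B False ** (if1 cq ** s) = if1 H ** (if1 cp ** s)" "dm B True ** (if1 cq ** s) = iid B ** (if0 b ** bang V W)"
    using s W by (subst (asm) pp_eq_iff(2) [of B B _ W]; simp)+
qed

lemma cq_ends:
  assumes s: "s \<in> W ~> iar cm"
  shows "am B ** (isrc (arrow_cat B) ** (if1 cq ** s)) = ar ** (isrc cm ** s)"
    "am B ** (itgt (arrow_cat B) ** (if1 cq ** s)) = ar ** (itgt cm ** s)"
  using s by (simp_all add: ar_def)

lemma cm_commutes:
  assumes s: "s \<in> W ~> iar cm"
  shows "ic B (ar ** (itgt cm ** s)) (if1 H ** (if1 cp ** s)) = ar ** (isrc cm ** s)"
proof -
  have t: "if1 cq ** s \<in> W ~> iar (arrow_cat B)" using s by simp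
  have "ic B (ar ** (itgt cm ** s)) (if1 H ** (if1 cp ** s)) = ic B (iid B ** (if0 b ** bang V W)) (ar ** (isrc cm ** s))"
    using arrow_category(7) [OF AB(2) t] unfolding cm_arr [OF s] cq_ends [OF s] .
  also have "\<dots> = ar ** (isrc cm ** s)"
    by (rule ic_id_left [OF AB(2)]) (use cm_obj(2) [of "isrc cm ** s" W] s in simp_all)
  finally show ?thesis .
qed

lemma cm_obj_eqI:
  assumes k: "k \<in> W ~> iob cm" "k' \<in> W ~> iob cm" "if0 cp ** k = if0 cp ** k'" "ar ** k = ar ** k'"
  shows "k = k'"
proof -
  have W: "W \<in> Obj V" using k Hom_Obj1 by blast
  have f: "ar ** k' \<in> W ~> iar B" using k by simp
  have q: "if0 cq ** k = if0 cq ** k'"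
    by (rule ex1_unique [OF arrow_elements [OF AB(2) f]]) (use k in \<open>simp_all add: ar_def\<close>)
  have "if0 (comma_leg V H b) ** (if0 cp ** k') = if0 (endpoints V B) ** (if0 cq ** k')"
    using cm_obj [OF k(2)] k W by (simp add: ar_def)
  moreover have "if0 cp ** k' \<in> W ~> Dom V (if0 (comma_leg V H b))" "if0 cq ** k' \<in> W ~> Dom V (if0 (endpoints V B))"
    using k by (simp_all del: leg(4) ends(4))
  ultimately have "\<exists>!h. h \<in> W ~> iob cm \<and> if0 cp ** h = if0 cp ** k' \<and> if0 cq ** h = if0 cq ** k'"
    using cm_pullbacks(1) W unfolding is_pullback_def prod.case by blast
  then show ?thesis by (rule ex1_unique) (use k q in simp_all)
qed

text \<open>An object of the comma category is an object \<open>a\<close> of \<open>A\<close> with an arrow \<open>H a \<rightarrow> b\<close>.\<close>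

lemma cm_obj_ex:
  assumes a: "a \<in> W ~> iob A" and f: "f \<in> W ~> iar B"
    and e: "isrc B ** f = if0 H ** a" "itgt B ** f = if0 b ** bang V W"
  obtains k where "k \<in> W ~> iob cm" "if0 cp ** k = a" "ar ** k = f"
proof -
  have W: "W \<in> Obj V" using a Hom_Obj1 by blast
  obtain u where u: "u \<in> W ~> iob (arrow_cat B)" "am B ** u = f" using arrow_elements [OF AB(2) f] by blast
  have "if0 (comma_leg V H b) ** a = if0 (endpoints V B) ** u" using a u e W by simp
  moreover have "a \<in> W ~> Dom V (if0 (comma_leg V H b))" "u \<in> W ~> Dom V (if0 (endpoints V B))"
    using a u by (simp_all del: leg(4) ends(4))
  ultimately obtain k where "k \<in> W ~> iob cm" "if0 cp ** k = a" "if0 cq ** k = u"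
    using cm_pullbacks(1) W unfolding is_pullback_def prod.case by blast
  then show ?thesis using that [of k] u by (simp add: ar_def)
qed

text \<open>An arrow \<open>(a, f) \<rightarrow> (a', f')\<close> of the comma category is an arrow \<open>u : a \<rightarrow> a'\<close> with \<open>f' \<circ> H u = f\<close>.\<close>

lemma cm_arr_ex1:
  assumes k: "k \<in> W ~> iob cm" "k' \<in> W ~> iob cm" and u: "u \<in> W ~> iar A"
    and e: "isrc A ** u = if0 cp ** k" "itgt A ** u = if0 cp ** k'" and c: "ic B (ar ** k') (if1 H ** u) = ar ** k"
  shows "\<exists>!s. (s \<in> W ~> iar cm \<and> isrc cm ** s = k \<and> itgt cm ** s = k') \<and> if1 cp ** s = u"
proof -
  let ?E = "arrow_cat B" and ?i = "iid B ** (if0 b ** bang V W)"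
  have W: "W \<in> Obj V" using k Hom_Obj1 by blast
  have ak: "am B ** (if0 cq ** k) = ar ** k" "am B ** (if0 cq ** k') = ar ** k'" using k by (simp_all add: ar_def)
  have ic: "ic B ?i (ar ** k) = ar ** k" by (rule ic_id_left [OF AB(2)]) (use cm_obj(2) [OF k(1)] k in simp_all)
  have ex: "\<exists>!s. s \<in> W ~> iar ?E \<and> isrc ?E ** s = if0 cq ** k \<and> itgt ?E ** s = if0 cq ** k' \<and>
      dm B False ** s = if1 H ** u \<and> dm B True ** s = ?i"
    by (rule arrow_category(8) [OF AB(2)], unfold ak)
      (use k u W cm_obj [OF k(1)] cm_obj [OF k(2)] e c ic in simp_all)
  then obtain s where s: "s \<in> W ~> iar ?E" "isrc ?E ** s = if0 cq ** k" "itgt ?E ** s = if0 cq ** k'"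
      "dm B False ** s = if1 H ** u" "dm B True ** s = ?i" by blast
  have "if1 (comma_leg V H b) ** u = if1 (endpoints V B) ** s" using u s W by simp
  moreover have "u \<in> W ~> Dom V (if1 (comma_leg V H b))" "s \<in> W ~> Dom V (if1 (endpoints V B))"
    using u s by (simp_all del: leg(5) ends(5))
  ultimately have ex': "\<exists>!h. h \<in> W ~> iar cm \<and> if1 cp ** h = u \<and> if1 cq ** h = s"
    using cm_pullbacks(2) W unfolding is_pullback_def prod.case by blast
  then obtain m where m: "m \<in> W ~> iar cm" "if1 cp ** m = u" "if1 cq ** m = s" by blast
  show ?thesis
  proof (rule ex1I [of _ m])
    have p: "if0 cp ** (isrc cm ** m) = isrc A ** (if1 cp ** m)" "if0 cp ** (itgt cm ** m) = itgt A ** (if1 cp ** m)"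
      using m(1) by simp_all
    have "isrc cm ** m = k"
      by (rule cm_obj_eqI [of _ W]) (use m(1) k p m e cq_ends [OF m(1)] s ak in simp_all)
    moreover have "itgt cm ** m = k'"
      by (rule cm_obj_eqI [of _ W]) (use m(1) k p m e cq_ends [OF m(1)] s ak in simp_all)
    ultimately show "(m \<in> W ~> iar cm \<and> isrc cm ** m = k \<and> itgt cm ** m = k') \<and> if1 cp ** m = u" using m by blast
    fix n assume "(n \<in> W ~> iar cm \<and> isrc cm ** n = k \<and> itgt cm ** n = k') \<and> if1 cp ** n = u"
    then have n: "n \<in> W ~> iar cm" "isrc cm ** n = k" "itgt cm ** n = k'" "if1 cp ** n = u" by blast+
    have q: "if1 cq ** n \<in> W ~> iar ?E" "isrc ?E ** (if1 cq ** n) = if0 cq ** k" "itgt ?E ** (if1 cq ** n) = if0 cq ** k'"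
      using n(1-3) by simp_all
    have "if1 cq ** n = s"
      by (rule ex1_unique [OF ex]) (use q cm_arr [OF n(1)] n(4) s in simp_all)
    then show "n = m" by - (rule ex1_unique [OF ex'], use m n in simp_all)
  qed
qed

lemma cm_elem:
  assumes a: "a \<in> Hom CV (ione V) A" and f: "f \<in> pt ~> iar B"
    and e: "isrc B ** f = if0 H ** if0 a" "itgt B ** f = if0 b"
  shows "comma_elem V H b a f \<in> Hom CV (ione V) cm" (is ?P)
    "if0 cp ** if0 (comma_elem V H b a f) = if0 a" "ar ** if0 (comma_elem V H b a f) = f"
proof -
  let ?t = "curry_map CV (ione V) (itwo V) (iarrow V B f \<odot> pr2 CV (ione V) (itwo V))"
  note t = named_arrow [OF AB(2) f]
  have st: "isrc B ** (am B ** if0 ?t) = if0 H ** if0 a" "itgt B ** (am B ** if0 ?t) = if0 b" unfolding t(2) by (fact e)+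
  have ta: "?t \<in> Arr CV" "Dom CV ?t = ione V" "Cod CV ?t = arrow_cat B"
    "a \<in> Arr CV" "Dom CV a = ione V" "Cod CV a = A" using t(1) a by simp_all
  have "comma_leg V H b \<odot> a = endpoints V B \<odot> ?t"
  proof (rule ifun_eqI [of _ "ione V" "prd CV B B"])
    have "if1 a = iid A ** if0 a" "if1 ?t = iid (arrow_cat B) ** if0 ?t"
      using ifun_id [of a "ione V"] ifun_id [of ?t "ione V"] ta by simp_all
    moreover show 0: "if0 (comma_leg V H b \<odot> a) = if0 (endpoints V B \<odot> ?t)" using ta st by simp
    ultimately show "if1 (comma_leg V H b \<odot> a) = if1 (endpoints V B \<odot> ?t)"
      using ifun_id_comp [of "comma_leg V H b" A "if0 a"] ifun_id_comp [of "endpoints V B" "arrow_cat B" "if0 ?t"] ta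
      by (simp del: leg(4,5) ends(4,5) ifun_id_comp)
  qed (use ta in simp_all)
  then have c: ?P "cp \<odot> comma_elem V H b a f = a"
    "cq \<odot> comma_elem V H b a f = ?t"
    using ta by (simp_all add: comma_elem_def comma_def comma_proj_def)
  then show ?P by blast
  show "if0 cp ** if0 (comma_elem V H b a f) = if0 a" using arg_cong [OF c(2), of if0] by simp
  show "ar ** if0 (comma_elem V H b a f) = f"
    using arg_cong [OF c(3), of if0] c(1) t(2) by (simp add: ar_def)
qed

end

context ext_ccc
begin

abbreviation (input) arrow_into :: "('o, 'm) icat \<Rightarrow> 'm \<Rightarrow> 'o \<Rightarrow> 'm \<Rightarrow> 'm \<Rightarrow> bool" where
  "arrow_into K t W k s \<equiv> s \<in> W ~> iar K \<and> isrc K ** s = k \<and> itgt K ** s = t ** bang V W"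

definition elementwise_terminal :: "('o, 'm) icat \<Rightarrow> 'm \<Rightarrow> bool" where
  "elementwise_terminal K t \<longleftrightarrow> (\<forall>W\<in>Obj V. \<forall>k\<in>W ~> iob K.
    \<exists>!s. arrow_into K t W k s)"

text \<open>
  An object of the slice is an arrow into \<open>t\<close>, so the projection of the slice is an isomorphism on objects
  exactly if there is precisely one arrow from each generalised object to \<open>t\<close>; it is then also an isomorphism
  on arrows, the commutativity of triangles over \<open>t\<close> being automatic.
\<close>

lemma internal_terminal_iff:
  assumes K: "K \<in> Obj CV" and t: "t \<in> Hom CV (ione V) K"
  shows "internal_terminal V K t \<longleftrightarrow> elementwise_terminal K (if0 t)"
proof -
  interpret S: comma_cat V U K K "Ident CV K" t
    by unfold_locales (use K t in simp_all)
  have cp: "S.cp \<in> Hom CV S.cm K" by simp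
  have c0: "if0 S.cp \<in> iob S.cm ~> iob K" and c1: "if1 S.cp \<in> iar S.cm ~> iar K" by simp_all
  have so: "isrc K ** (S.ar ** z) = if0 S.cp ** z" "itgt K ** (S.ar ** z) = if0 t ** bang V W" if "z \<in> W ~> iob S.cm" for z W
    using S.cm_obj [OF that] that K by simp_all
  have sx: "\<exists>!z. z \<in> W ~> iob S.cm \<and> S.ar ** z = s"
    if s: "s \<in> W ~> iar K" "itgt K ** s = if0 t ** bang V W" for s W
  proof -
    obtain z where z: "z \<in> W ~> iob S.cm" "if0 S.cp ** z = isrc K ** s" "S.ar ** z = s"
      using S.cm_obj_ex [of "isrc K ** s" W s] s K by auto
    show ?thesis
    proof (rule ex1I [of _ z])
      fix y assume y: "y \<in> W ~> iob S.cm \<and> S.ar ** y = s"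
      then have y1: "y \<in> W ~> iob S.cm" by blast
      have "if0 S.cp ** y = if0 S.cp ** z" using so(1) [OF y1] so(1) [OF z(1)] y z by simp
      then show "y = z" by - (rule S.cm_obj_eqI [OF y1 z(1)], use y z in simp_all)
    qed (use z in blast)
  qed
  have tr: "(\<exists>!z. z \<in> W ~> iob S.cm \<and> if0 S.cp ** z = k) \<longleftrightarrow>
      (\<exists>!s. arrow_into K (if0 t) W k s)" for W k
  proof (rule ex1_transfer [of _ _ "\<lambda>z. S.ar ** z"])
    fix s assume s: "arrow_into K (if0 t) W k s"
    have "\<exists>!z. z \<in> W ~> iob S.cm \<and> S.ar ** z = s" using sx s by blast
    moreover have "if0 S.cp ** z = k" if "z \<in> W ~> iob S.cm" "S.ar ** z = s" for z
      using so(1) [OF that(1)] that s by simp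
    ultimately show "\<exists>!z. (z \<in> W ~> iob S.cm \<and> if0 S.cp ** z = k) \<and> S.ar ** z = s" by (metis (no_types, lifting))
  next
    fix z assume z: "z \<in> W ~> iob S.cm \<and> if0 S.cp ** z = k"
    then have "z \<in> W ~> iob S.cm" by blast
    from so [OF this] z show "S.ar ** z \<in> W ~> iar K \<and> isrc K ** (S.ar ** z) = k \<and> itgt K ** (S.ar ** z) = if0 t ** bang V W"
      by simp
  qed
  have i0: "iso V (if0 S.cp) \<longleftrightarrow> elementwise_terminal K (if0 t)"
    unfolding iso_iff_ex1 [OF c0] elementwise_terminal_def tr ..
  moreover have "iso V (if1 S.cp)" if el: "elementwise_terminal K (if0 t)"
    unfolding iso_iff_ex1 [OF c1]
  proof (intro ballI)
    fix W u assume W: "W \<in> Obj V" and u: "u \<in> W ~> iar K"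
    have ez: "\<exists>!z. z \<in> W ~> iob S.cm \<and> if0 S.cp ** z = k" if "k \<in> W ~> iob K" for k
      unfolding tr using el W that unfolding elementwise_terminal_def by blast
    have uk: "isrc K ** u \<in> W ~> iob K" "itgt K ** u \<in> W ~> iob K" using u K by simp_all
    obtain z where z: "z \<in> W ~> iob S.cm" "if0 S.cp ** z = isrc K ** u" using ez [OF uk(1)] by blast
    obtain z' where z': "z' \<in> W ~> iob S.cm" "if0 S.cp ** z' = itgt K ** u" using ez [OF uk(2)] by blast
    have st: "isrc K ** (S.ar ** z') = itgt K ** u" using so(1) [OF z'(1)] z' by simp
    have "\<exists>!s. arrow_into K (if0 t) W (isrc K ** u) s"
      using el W uk(1) unfolding elementwise_terminal_def by blast
    then have c: "ic K (S.ar ** z') u = S.ar ** z"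
      by (rule ex1_unique) (use so [OF z(1)] so [OF z'(1)] z z' u K st in simp_all)
    have ex: "\<exists>!s. (s \<in> W ~> iar S.cm \<and> isrc S.cm ** s = z \<and> itgt S.cm ** s = z') \<and> if1 S.cp ** s = u"
      by (rule S.cm_arr_ex1 [OF z(1) z'(1) u]) (use z z' c u in simp_all)
    have "isrc S.cm ** s = z \<and> itgt S.cm ** s = z'" if s: "s \<in> W ~> iar S.cm" "if1 S.cp ** s = u" for s
    proof
      have p: "if0 S.cp ** (isrc S.cm ** s) = isrc K ** (if1 S.cp ** s)" "if0 S.cp ** (itgt S.cm ** s) = itgt K ** (if1 S.cp ** s)"
        using s(1) by simp_all
      show "isrc S.cm ** s = z" by (rule ex1_unique [OF ez [OF uk(1)]]) (use p s z in simp_all)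
      show "itgt S.cm ** s = z'" by (rule ex1_unique [OF ez [OF uk(2)]]) (use p s z' in simp_all)
    qed
    then show "\<exists>!y. y \<in> W ~> iar S.cm \<and> if1 S.cp ** y = u" using ex by (metis (no_types, lifting))
  qed
  ultimately show ?thesis
    unfolding internal_terminal_def Cat_iso_iff [OF cp] using t by blast
qed

text \<open>
  The elements at stage \<open>W\<close> of a hom-object of \<open>Und [cst X, K]\<close> are arrows of \<open>K\<close> at stage \<open>W \<times> X\<close>
  between objects that do not depend on \<open>W\<close>.
\<close>

lemma und_terminal_iff:
  assumes K: "K \<in> Obj CV" and t: "t \<in> Hom CV (ione V) K" and X: "X \<in> Obj V"
  shows "vterminal V (Und V (ihom V (cst V X) K)) (und_elem V X K t) \<longleftrightarrow>
    (\<forall>a\<in>prd V pt X ~> iob K. \<forall>W\<in>Obj V. \<exists>!s. arrow_into K (if0 t) (prd V W X) (a ** pair V (bang V (prd V W X)) (pr2 V W X)) s)"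
proof -
  let ?E = "ihom V (cst V X) K" and ?st = "pair V (isrc (ihom V (cst V X) K)) (itgt (ihom V (cst V X) K))"
  note c = cst_exponential [OF X K] and u = un_simps [OF X K]
  have E [simp]: "?E \<in> Obj CV" using Cat.expo_simps(1) [OF c(1)] .
  let ?\<tau> = "und_elem V X K t"
  have t0: "if0 t \<in> pt ~> iob K" using t by simp
  have \<tau>: "?\<tau> = if0 (const_ifun V X K) ** if0 t" by (simp add: und_elem_def)
  have \<tau>H: "?\<tau> \<in> pt ~> iob ?E" using u(7) t0 by (simp add: \<tau>)
  have tau_un: "un0 X K (?\<tau> ** bang V W) = if0 t ** bang V (prd V W X)" if "W \<in> Obj V" for W
    using u(6) [of "if0 t ** bang V W" W] u(7) t0 that X by (simp add: \<tau>)
  have un_inj: "un0 X K e = un0 X K e' \<longleftrightarrow> e = e'" if e: "e \<in> W ~> iob ?E" "e' \<in> W ~> iob ?E" for e e' W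
  proof
    assume eq: "un0 X K e = un0 X K e'"
    show "e = e'" by (rule ex1_unique [OF c(2) [OF Hom_Obj1 [OF e(1)] u(1) [OF e(2)]]]) (use e eq in blast)+
  qed simp
  have main: "iso V (bang V (vhom (Und V ?E) e ?\<tau>)) \<longleftrightarrow> (\<forall>W\<in>Obj V. \<exists>!s. arrow_into K (if0 t) (prd V W X) (un0 X K e ** pair V (bang V (prd V W X)) (pr2 V W X)) s)"
    if e: "e \<in> pt ~> iob ?E" for e
  proof -
    let ?h = "pb V ?st (pair V e ?\<tau>)"
    have pt: "pair V e ?\<tau> \<in> pt ~> prd V (iob ?E) (iob ?E)" using e \<tau>H by simp
    have st: "?st \<in> iar ?E ~> prd V (iob ?E) (iob ?E)" by simp
    have h: "vhom (Und V ?E) e ?\<tau> = ?h" by (simp add: Und_def Let_def)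
    have ho: "?h \<in> Obj V" using pt st by simp
    have "(\<exists>!z. z \<in> W ~> ?h) \<longleftrightarrow> (\<exists>!s. arrow_into K (if0 t) (prd V W X) (un0 X K e ** pair V (bang V (prd V W X)) (pr2 V W X)) s)"
      if W: "W \<in> Obj V" for W
    proof -
      have eW: "e ** bang V W \<in> W ~> iob ?E" "?\<tau> ** bang V W \<in> W ~> iob ?E" using e \<tau>H W by simp_all
      have "(\<exists>!z. z \<in> W ~> ?h) \<longleftrightarrow>
        (\<exists>!s. arrow_into ?E ?\<tau> W (e ** bang V W) s)"
      proof (rule ex1_transfer [of _ _ "\<lambda>z. pb1 V ?st (pair V e ?\<tau>) ** z"])
        fix s assume "arrow_into ?E ?\<tau> W (e ** bang V W) s"
        then have s: "s \<in> W ~> iar ?E" and eq: "isrc ?E ** s = e ** bang V W" "itgt ?E ** s = ?\<tau> ** bang V W" by blast+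
        have q: "?st ** s = pair V e ?\<tau> ** bang V W" using s eq e \<tau>H W by simp
        let ?z = "pb_pair V ?st (pair V e ?\<tau>) s (bang V W)"
        have g: "?st \<in> Arr V" "pair V e ?\<tau> \<in> Arr V" "Cod V ?st = Cod V (pair V e ?\<tau>)" using st pt by simp_all
        have zt: "?z \<in> W ~> ?h" "pb1 V ?st (pair V e ?\<tau>) ** ?z = s" "pb2 V ?st (pair V e ?\<tau>) ** ?z = bang V W"
          using pb_pair_props [OF g, of s "bang V W"] s q st pt W by simp_all
        show "\<exists>!z. z \<in> W ~> ?h \<and> pb1 V ?st (pair V e ?\<tau>) ** z = s"
        proof (rule ex1I)
          show "?z \<in> W ~> ?h \<and> pb1 V ?st (pair V e ?\<tau>) ** ?z = s" using zt by blast
          fix z assume "z \<in> W ~> ?h \<and> pb1 V ?st (pair V e ?\<tau>) ** z = s"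
          then have z: "z \<in> W ~> ?h" "pb1 V ?st (pair V e ?\<tau>) ** z = s" by blast+
          have "pb2 V ?st (pair V e ?\<tau>) ** z = bang V W" using z(1) pt st by (intro bang_unique) simp_all
          then show "z = ?z" by - (rule pb_eqI [OF g z(1) zt(1)], simp_all only: z(2) zt(2,3))
        qed
      next
        fix z assume z: "z \<in> W ~> ?h"
        let ?s = "pb1 V ?st (pair V e ?\<tau>) ** z"
        have s: "?s \<in> W ~> iar ?E" using z pt st by simp
        have "pb2 V ?st (pair V e ?\<tau>) ** z = bang V W" using z pt st by (intro bang_unique) simp_all
        then have "?st ** ?s = pair V e ?\<tau> ** bang V W" using pb_comm_comp [of ?st "pair V e ?\<tau>" z] z pt st by simp
        then have "pair V (isrc ?E ** ?s) (itgt ?E ** ?s) = pair V (e ** bang V W) (?\<tau> ** bang V W)" using s e \<tau>H W by simp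
        then have "isrc ?E ** ?s = e ** bang V W \<and> itgt ?E ** ?s = ?\<tau> ** bang V W"
          by (subst (asm) pair_eq_iff) (use s e \<tau>H W in simp_all)
        then show "?s \<in> W ~> iar ?E \<and> isrc ?E ** ?s = e ** bang V W \<and> itgt ?E ** ?s = ?\<tau> ** bang V W" using s by blast
      qed
      also have "\<dots> \<longleftrightarrow> (\<exists>!s. arrow_into K (if0 t) (prd V W X) (un0 X K e ** pair V (bang V (prd V W X)) (pr2 V W X)) s)"
      proof -
        have eu: "un0 X K (e ** bang V W) = un0 X K e ** pair V (bang V (prd V W X)) (pr2 V W X)"
          using u(5) [OF e, of "bang V W" W] W X by simp
        have eqv: "isrc ?E ** s = e ** bang V W \<and> itgt ?E ** s = ?\<tau> ** bang V W \<longleftrightarrow>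
          isrc K ** un1 X K s = un0 X K e ** pair V (bang V (prd V W X)) (pr2 V W X) \<and>
          itgt K ** un1 X K s = if0 t ** bang V (prd V W X)" if s: "s \<in> W ~> iar ?E" for s
        proof -
          have "isrc ?E ** s \<in> W ~> iob ?E" "itgt ?E ** s \<in> W ~> iob ?E" using s by simp_all
          then show ?thesis
            unfolding u(3) [OF s] u(4) [OF s] eu [symmetric] tau_un [OF W, symmetric]
            using un_inj [OF _ eW(1)] un_inj [OF _ eW(2)] by blast
        qed
        show ?thesis
        proof (rule ex1_transfer [of _ _ "un1 X K"])
          fix y assume y: "arrow_into K (if0 t) (prd V W X) (un0 X K e ** pair V (bang V (prd V W X)) (pr2 V W X)) y"
          then have "\<exists>!s. s \<in> W ~> iar ?E \<and> un1 X K s = y" using c(3) [OF W] by blast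
          then show "\<exists>!s. (arrow_into ?E ?\<tau> W (e ** bang V W) s) \<and> un1 X K s = y"
            using eqv y by (metis (no_types, lifting))
        next
          fix s assume s: "arrow_into ?E ?\<tau> W (e ** bang V W) s"
          then show "un1 X K s \<in> prd V W X ~> iar K \<and>
            isrc K ** un1 X K s = un0 X K e ** pair V (bang V (prd V W X)) (pr2 V W X) \<and> itgt K ** un1 X K s = if0 t ** bang V (prd V W X)"
            using eqv [of s] u(2) [of s W] by blast
        qed
      qed
      finally show ?thesis .
    qed
    then show ?thesis unfolding h iso_bang_iff [OF ho] by blast
  qed
  have vo: "vob (Und V ?E) = pt ~> iob ?E" by (simp add: Und_def Let_def)
  let ?P = "\<lambda>a. \<forall>W\<in>Obj V. \<exists>!s. arrow_into K (if0 t) (prd V W X) (a ** pair V (bang V (prd V W X)) (pr2 V W X)) s"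
  have "vterminal V (Und V ?E) ?\<tau> \<longleftrightarrow> (\<forall>e\<in>pt ~> iob ?E. ?P (un0 X K e))"
    unfolding vterminal_def vo using main \<tau>H by (simp only: simp_thms cong: ball_cong)
  also have "\<dots> \<longleftrightarrow> (\<forall>a\<in>prd V pt X ~> iob K. ?P a)"
  proof
    assume l: "\<forall>e\<in>pt ~> iob ?E. ?P (un0 X K e)"
    show "\<forall>a\<in>prd V pt X ~> iob K. ?P a"
    proof
      fix a assume a: "a \<in> prd V pt X ~> iob K"
      obtain e where "e \<in> pt ~> iob ?E" "un0 X K e = a" using c(2) [OF term_ob_Obj a] by blast
      then show "?P a" using l by blast
    qed
  next
    assume r: "\<forall>a\<in>prd V pt X ~> iob K. ?P a"
    show "\<forall>e\<in>pt ~> iob ?E. ?P (un0 X K e)"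
    proof
      fix e assume "e \<in> pt ~> iob ?E"
      then show "?P (un0 X K e)" using r u(1) by blast
    qed
  qed
  finally show ?thesis .
qed

text \<open>
  The generalised objects of stage \<open>X\<close> in \<open>\<G>\<close> suffice, as the condition at all stages says that the object of
  arrows into \<open>t\<close> maps isomorphically to the object of objects.
\<close>

lemma terminal_iff_conservative:
  assumes K: "K \<in> Obj CV" and t: "t \<in> Hom CV (ione V) K" and G: "conservative_family V \<G>"
  shows "elementwise_terminal K (if0 t) \<longleftrightarrow>
    (\<forall>X\<in>\<G>. vterminal V (Und V (ihom V (cst V X) K)) (und_elem V X K t))"
proof
  have GO: "X \<in> Obj V" if "X \<in> \<G>" for X using G that unfolding conservative_family_def by blast
  have t0: "if0 t \<in> pt ~> iob K" using t by simp
  {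
    assume el: "elementwise_terminal K (if0 t)"
    show "\<forall>X\<in>\<G>. vterminal V (Und V (ihom V (cst V X) K)) (und_elem V X K t)"
    proof
      fix X assume "X \<in> \<G>"
      then have X: "X \<in> Obj V" using GO by blast
      show "vterminal V (Und V (ihom V (cst V X) K)) (und_elem V X K t)"
        unfolding und_terminal_iff [OF K t X]
      proof (intro ballI)
        fix a W assume a: "a \<in> prd V pt X ~> iob K" and W: "W \<in> Obj V"
        then have "prd V W X \<in> Obj V" "a ** pair V (bang V (prd V W X)) (pr2 V W X) \<in> prd V W X ~> iob K"
          using X by simp_all
        then show "\<exists>!s. arrow_into K (if0 t) (prd V W X) (a ** pair V (bang V (prd V W X)) (pr2 V W X)) s" using el unfolding elementwise_terminal_def by blast
      qed
    qed
  next
    assume r: "\<forall>X\<in>\<G>. vterminal V (Und V (ihom V (cst V X) K)) (und_elem V X K t)"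
    \<comment> \<open>the object of arrows into \<open>t\<close>, with the source map \<open>?\<phi>\<close>\<close>
    let ?P = "pb V (itgt K) (if0 t)" and ?p = "pb1 V (itgt K) (if0 t)"
    let ?\<phi> = "isrc K ** ?p"
    have g: "itgt K \<in> Arr V" "if0 t \<in> Arr V" "Cod V (itgt K) = Cod V (if0 t)" using K t0 by simp_all
    have ph: "?\<phi> \<in> ?P ~> iob K" using g K by simp
    have tr: "(\<exists>!z. z \<in> W ~> ?P \<and> ?\<phi> ** z = k) \<longleftrightarrow>
      (\<exists>!s. arrow_into K (if0 t) W k s)" for W k
    proof (rule ex1_transfer [of _ _ "\<lambda>z. ?p ** z"])
      fix s assume "arrow_into K (if0 t) W k s"
      then have s: "s \<in> W ~> iar K" and eq: "isrc K ** s = k" "itgt K ** s = if0 t ** bang V W" by blast+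
      have W: "W \<in> Obj V" using s Hom_Obj1 by blast
      let ?z = "pb_pair V (itgt K) (if0 t) s (bang V W)"
      have z: "?z \<in> W ~> ?P" "?p ** ?z = s" "pb2 V (itgt K) (if0 t) ** ?z = bang V W" using s eq t0 K W by simp_all
      show "\<exists>!z. (z \<in> W ~> ?P \<and> ?\<phi> ** z = k) \<and> ?p ** z = s"
      proof (rule ex1I [of _ ?z])
        show "(?z \<in> W ~> ?P \<and> ?\<phi> ** ?z = k) \<and> ?p ** ?z = s" using z eq g K by simp
        fix y assume y: "(y \<in> W ~> ?P \<and> ?\<phi> ** y = k) \<and> ?p ** y = s"
        then have y1: "y \<in> W ~> ?P" "?p ** y = s" by blast+
        have "pb2 V (itgt K) (if0 t) ** y = bang V W" using y1(1) g t0 by (intro bang_unique) simp_all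
        then show "y = ?z" by - (rule pb_eqI [OF g y1(1) z(1)], use y1 z in simp_all)
      qed
    next
      fix z assume "z \<in> W ~> ?P \<and> ?\<phi> ** z = k"
      then have z: "z \<in> W ~> ?P" and e: "?\<phi> ** z = k" by blast+
      have "pb2 V (itgt K) (if0 t) ** z = bang V W" using z g t0 by (intro bang_unique) simp_all
      then have "itgt K ** (?p ** z) = if0 t ** bang V W" using pb_comm_comp [OF g, of z] z by simp
      moreover have "?p ** z \<in> W ~> iar K" "isrc K ** (?p ** z) = ?\<phi> ** z" using z g K by simp_all
      ultimately show "?p ** z \<in> W ~> iar K \<and> isrc K ** (?p ** z) = k \<and> itgt K ** (?p ** z) = if0 t ** bang V W"
        using e by simp
    qed
    have "bij_betw (\<lambda>z. ?\<phi> ** z) (X ~> ?P) (X ~> iob K)" if XG: "X \<in> \<G>" for X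
    proof -
      have X: "X \<in> Obj V" using GO XG .
      have ex: "\<exists>!z. z \<in> X ~> ?P \<and> ?\<phi> ** z = k" if k: "k \<in> X ~> iob K" for k
        unfolding tr
      proof -
        let ?T = "prd V pt X" and ?q = "pr2 V pt X"
        let ?d = "pair V (bang V X) (Ident V X)"
        have q: "?q \<in> ?T ~> X" "?d \<in> X ~> ?T" "?q ** ?d = Ident V X" using X by simp_all
        have dq: "?d ** ?q = Ident V ?T"
          by (rule prod_eqI [of _ ?T "pt" X]) (use X in \<open>simp_all add: term_eqI\<close>)
        have kq: "k ** ?q \<in> ?T ~> iob K" using k q by simp
        have kk: "(k ** ?q) ** pair V (bang V ?T) ?q = k ** ?q" using k X by simp
        have "vterminal V (Und V (ihom V (cst V X) K)) (und_elem V X K t)" using r XG by blast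
        from bspec [OF bspec [OF this [unfolded und_terminal_iff [OF K t X]] kq] term_ob_Obj]
        have ex: "\<exists>!s. arrow_into K (if0 t) ?T (k ** ?q) s"
          unfolding kk .
        have "(\<exists>!s. arrow_into K (if0 t) X k s) \<longleftrightarrow>
          (\<exists>!s. arrow_into K (if0 t) ?T (k ** ?q) s)"
        proof (rule ex1_transfer [of _ _ "\<lambda>s. s ** ?q"])
          fix y assume "y \<in> ?T ~> iar K \<and> isrc K ** y = k ** ?q \<and> itgt K ** y = if0 t ** bang V ?T"
          then have y: "y \<in> ?T ~> iar K" and ye: "isrc K ** y = k ** ?q" "itgt K ** y = if0 t ** bang V ?T" by blast+
          show "\<exists>!x. (x \<in> X ~> iar K \<and> isrc K ** x = k \<and> itgt K ** x = if0 t ** bang V X) \<and> x ** ?q = y"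
          proof (rule ex1I [of _ "y ** ?d"])
            show "(y ** ?d \<in> X ~> iar K \<and> isrc K ** (y ** ?d) = k \<and> itgt K ** (y ** ?d) = if0 t ** bang V X) \<and> (y ** ?d) ** ?q = y"
              using comp_ext [OF ye(1), of ?d] comp_ext [OF ye(2), of ?d] y q dq k t0 K X
              by (simp del: pair_comp)
            fix x assume x: "(x \<in> X ~> iar K \<and> isrc K ** x = k \<and> itgt K ** x = if0 t ** bang V X) \<and> x ** ?q = y"
            then have x1: "x \<in> X ~> iar K" and x2: "y = x ** ?q" by blast+
            show "x = y ** ?d" unfolding x2 using x1 X by simp
          qed
        next
          fix x assume x: "x \<in> X ~> iar K \<and> isrc K ** x = k \<and> itgt K ** x = if0 t ** bang V X"
          then have x1: "x \<in> X ~> iar K" and xe: "isrc K ** x = k" "itgt K ** x = if0 t ** bang V X" by blast+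
          show "x ** ?q \<in> ?T ~> iar K \<and> isrc K ** (x ** ?q) = k ** ?q \<and> itgt K ** (x ** ?q) = if0 t ** bang V ?T"
            using comp_ext [OF xe(1), of ?q] comp_ext [OF xe(2), of ?q] x1 q t0 K X by simp
        qed
        then show "\<exists>!s. arrow_into K (if0 t) X k s" using ex by blast
      qed
      show ?thesis
        unfolding bij_betw_def
      proof
        show "inj_on (\<lambda>z. ?\<phi> ** z) (X ~> ?P)"
        proof (rule inj_onI)
          fix z z' assume z: "z \<in> X ~> ?P" "z' \<in> X ~> ?P" and e: "?\<phi> ** z = ?\<phi> ** z'"
          have "?\<phi> ** z' \<in> X ~> iob K" using z ph by simp
          from ex [OF this] show "z = z'" by (rule ex1_unique) (use z e in blast)+
        qed
        show "(\<lambda>z. ?\<phi> ** z) ` (X ~> ?P) = X ~> iob K"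
        proof
          show "(\<lambda>z. ?\<phi> ** z) ` (X ~> ?P) \<subseteq> X ~> iob K"
          proof
            fix w assume "w \<in> (\<lambda>z. ?\<phi> ** z) ` (X ~> ?P)"
            then obtain z where "z \<in> X ~> ?P" "w = ?\<phi> ** z" by blast
            then show "w \<in> X ~> iob K" using ph by simp
          qed
          show "X ~> iob K \<subseteq> (\<lambda>z. ?\<phi> ** z) ` (X ~> ?P)" using ex by blast
        qed
      qed
    qed
    moreover have "?P \<in> Obj V" "iob K \<in> Obj V" using g K by simp_all
    ultimately have "iso V ?\<phi>" using G ph unfolding conservative_family_def by blast
    then show "elementwise_terminal K (if0 t)"
      unfolding iso_iff_ex1 [OF ph] tr elementwise_terminal_def .
  }
qed

end

section \<open>Limits as terminal cones\<close>

sublocale cone_setup \<subseteq> T: two_small_vcats V U C "vfun_cat V I C"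
  by unfold_locales (rule smallC, rule small_vfunctors)

context cone_setup
begin

abbreviation "ce \<equiv> cone_elem V I C G L l"
abbreviation "JC \<equiv> Internal V C"
abbreviation "JD \<equiv> Internal V D"
abbreviation "DH \<equiv> Internal_fun V C D (vdiag V I C)"
abbreviation "GE \<equiv> ielem V JD (T.B.jo G)"

lemma DH_simps [simp]:
  "DH \<in> Arr CV" "Dom CV DH = JC" "Cod CV DH = JD"
  "\<And>A w. A \<in> vob C \<Longrightarrow> w \<in> Arr V \<Longrightarrow> Cod V w = pt \<Longrightarrow> if0 DH ** (T.A.jo A ** w) = T.B.jo (cdiag A) ** w"
  "\<And>A B f. A \<in> vob C \<Longrightarrow> B \<in> vob C \<Longrightarrow> f \<in> Arr V \<Longrightarrow> Cod V f = vhom C A B \<Longrightarrow>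
    if1 DH ** (T.A.ja A B ** f) = T.B.ja (cdiag A) (cdiag B) ** (dg A B ** f)"
  using T.Internal_fun_props [OF vdiag_vfunctor] by simp_all

end

sublocale cone_setup \<subseteq> K: comma_cat V U "Internal V C" "Internal V (vfun_cat V I C)"
  "Internal_fun V C (vfun_cat V I C) (vdiag V I C)" "ielem V (Internal V (vfun_cat V I C)) (int_ob_inj V (vfun_cat V I C) G)"
  by unfold_locales simp_all

context cone_setup
begin

lemma cone_elem:
  "ce \<in> Hom CV (ione V) K.cm"
  "if0 K.cp ** if0 ce = T.A.jo L"
  "K.ar ** if0 ce = T.B.ja (cdiag L) G ** cone"
proof -
  have a: "ielem V JC (T.A.jo L) \<in> Hom CV (ione V) JC" by simp
  have f: "T.B.ja (cdiag L) G ** cone \<in> pt ~> iar JD" by simp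
  have "if0 DH ** T.A.jo L = T.B.jo (cdiag L)" using DH_simps(4) [of L "Ident V pt"] by simp
  then have e: "isrc JD ** (T.B.ja (cdiag L) G ** cone) = if0 DH ** if0 (ielem V JC (T.A.jo L))"
    "itgt JD ** (T.B.ja (cdiag L) G ** cone) = if0 GE" by simp_all
  note c = K.cm_elem [OF a f e]
  show "ce \<in> Hom CV (ione V) K.cm"
    "if0 K.cp ** if0 ce = T.A.jo L"
    "K.ar ** if0 ce = T.B.ja (cdiag L) G ** cone"
    using c unfolding cone_elem_def cone_def by simp_all
qed

text \<open>A map \<open>u\<close> into \<open>L\<close> along which the cone \<open>f\<close> with vertex \<open>a\<close> factors through the given cone.\<close>

definition factors :: "'o \<Rightarrow> 'm \<Rightarrow> 'm \<Rightarrow> 'm \<Rightarrow> bool" where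
  "factors W a f u \<longleftrightarrow> u \<in> W ~> iar JC \<and> isrc JC ** u = a \<and> itgt JC ** u = T.A.jo L ** bang V W \<and>
    ic JD (T.B.ja (cdiag L) G ** (cone ** bang V W)) (if1 DH ** u) = f"

lemma DH_tgt:
  assumes u: "u \<in> W ~> iar JC" "itgt JC ** u = T.A.jo L ** bang V W"
  shows "if1 DH ** u \<in> W ~> iar JD"
    "T.B.ja (cdiag L) G ** (cone ** bang V W) \<in> W ~> iar JD"
    "isrc JD ** (T.B.ja (cdiag L) G ** (cone ** bang V W)) = itgt JD ** (if1 DH ** u)"
  using u Hom_Obj1 [OF u(1)] by simp_all

lemma factors_comp:
  assumes F: "factors W a f u" and h: "h \<in> Z ~> W"
  shows "factors Z (a ** h) (f ** h) (u ** h)"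
proof -
  have u: "u \<in> W ~> iar JC" "itgt JC ** u = T.A.jo L ** bang V W" and a: "isrc JC ** u = a"
    and f: "ic JD (T.B.ja (cdiag L) G ** (cone ** bang V W)) (if1 DH ** u) = f"
    using F unfolding factors_def by blast+
  have W: "W \<in> Obj V" using u Hom_Obj1 by blast
  show ?thesis
    unfolding factors_def a [symmetric] f [symmetric]
    using comp_ext [OF u(2), of h] DH_tgt [OF u] u(1) h W by simp
qed

text \<open>An arrow of the comma category into \<open>(L, \<lambda>)\<close> is a factorisation through \<open>\<lambda>\<close>.\<close>

lemma terminal_iff_factors:
  assumes k: "k \<in> W ~> iob K.cm"
  shows "(\<exists>!s. arrow_into K.cm (if0 ce) W k s) \<longleftrightarrow>
    (\<exists>!u. factors W (if0 K.cp ** k) (K.ar ** k) u)"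
proof (rule ex1_transfer [of _ _ "\<lambda>s. if1 K.cp ** s"])
  let ?t = "if0 ce"
  have W: "W \<in> Obj V" using k Hom_Obj1 by blast
  have t: "?t \<in> pt ~> iob K.cm" using cone_elem(1) by simp
  have tb: "?t ** bang V W \<in> W ~> iob K.cm" "if0 K.cp ** (?t ** bang V W) = T.A.jo L ** bang V W"
    "K.ar ** (?t ** bang V W) = T.B.ja (cdiag L) G ** (cone ** bang V W)"
    using comp_ext [OF cone_elem(2), of "bang V W"] comp_ext [OF cone_elem(3), of "bang V W"] t W by simp_all
  {
    fix u assume "factors W (if0 K.cp ** k) (K.ar ** k) u"
    then show "\<exists>!s. (s \<in> W ~> iar K.cm \<and> isrc K.cm ** s = k \<and> itgt K.cm ** s = ?t ** bang V W) \<and> if1 K.cp ** s = u"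
      unfolding factors_def by (intro K.cm_arr_ex1 [OF k tb(1)]) (simp_all add: tb)
  next
    fix s assume "s \<in> W ~> iar K.cm \<and> isrc K.cm ** s = k \<and> itgt K.cm ** s = ?t ** bang V W"
    then have s: "s \<in> W ~> iar K.cm" and e: "isrc K.cm ** s = k" "itgt K.cm ** s = ?t ** bang V W" by blast+
    have "isrc JC ** (if1 K.cp ** s) = if0 K.cp ** (isrc K.cm ** s)" "itgt JC ** (if1 K.cp ** s) = if0 K.cp ** (itgt K.cm ** s)"
      using s by simp_all
    then show "factors W (if0 K.cp ** k) (K.ar ** k) (if1 K.cp ** s)"
      unfolding factors_def using K.cm_commutes [OF s, unfolded e tb] s e tb by simp
  }
qed

text \<open>If the vertex is constant, the factorising maps are the elements of \<open>C(A,L)\<close>.\<close>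

lemma factors_at_object:
  assumes A: "A \<in> vob C" and g: "g \<in> W ~> vhom D (cdiag A) G"
  shows "(\<exists>!v. v \<in> W ~> vhom C A L \<and> cone_map A ** v = g) \<longleftrightarrow>
    (\<exists>!u. factors W (T.A.jo A ** bang V W) (T.B.ja (cdiag A) G ** g) u)"
proof (rule ex1_transfer [of _ _ "\<lambda>v. T.A.ja A L ** v"])
  have W: "W \<in> Obj V" using g Hom_Obj1 by blast
  have dA: "cdiag A \<in> vob D" "cdiag L \<in> vob D" "G \<in> vob D" using A by simp_all
  have c: "ic JD (T.B.ja (cdiag L) G ** (cone ** bang V W)) (if1 DH ** (T.A.ja A L ** v)) = T.B.ja (cdiag A) G ** (cone_map A ** v)"
    if v: "v \<in> W ~> vhom C A L" for v
    using T.B.J_comp_raw(2) [OF dA, of "dg A L ** v" W "cone ** bang V W"] v A W by simp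
  {
    fix u assume "factors W (T.A.jo A ** bang V W) (T.B.ja (cdiag A) G ** g) u"
    then have u: "u \<in> W ~> iar JC" "isrc JC ** u = T.A.jo A ** bang V W" "itgt JC ** u = T.A.jo L ** bang V W"
      and f: "ic JD (T.B.ja (cdiag L) G ** (cone ** bang V W)) (if1 DH ** u) = T.B.ja (cdiag A) G ** g"
      unfolding factors_def by blast+
    have ex: "\<exists>!v. v \<in> W ~> vhom C A L \<and> T.A.ja A L ** v = u" by (rule T.A.ja_factor [OF A L u])
    have "cone_map A ** v = g" if v: "v \<in> W ~> vhom C A L" "T.A.ja A L ** v = u" for v
    proof (rule T.B.ja_mono [OF dA(1,3) _ g])
      show "cone_map A ** v \<in> W ~> vhom D (cdiag A) G"
        using comp_arr [of v "cone_map A"] v(1) A by (simp del: cone_map_simps(4))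
      show "T.B.ja (cdiag A) G ** (cone_map A ** v) = T.B.ja (cdiag A) G ** g" using c [OF v(1)] f v(2) by simp
    qed
    then show "\<exists>!v. (v \<in> W ~> vhom C A L \<and> cone_map A ** v = g) \<and> T.A.ja A L ** v = u"
      using ex by (metis (no_types, lifting))
  next
    fix v assume "v \<in> W ~> vhom C A L \<and> cone_map A ** v = g"
    then have v: "v \<in> W ~> vhom C A L" and e: "cone_map A ** v = g" by blast+
    show "factors W (T.A.jo A ** bang V W) (T.B.ja (cdiag A) G ** g) (T.A.ja A L ** v)"
      unfolding factors_def c [OF v] e using v A by simp
  }
qed

text \<open>
  By extensivity a generalised cone of stage \<open>W\<close> splits \<open>W\<close> into the parts on which its vertex is constant.  The
  factorisations over the parts, which are given by the limit property at each object, are glued together.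
\<close>

lemma limit_iff_terminal:
  "(\<forall>A\<in>vob C. iso V (cone_map A)) \<longleftrightarrow> elementwise_terminal K.cm (if0 ce)"
proof
  have cm: "cone_map A \<in> vhom C A L ~> vhom D (cdiag A) G" if "A \<in> vob C" for A using that by simp
  {
    assume el: "elementwise_terminal K.cm (if0 ce)"
    show "\<forall>A\<in>vob C. iso V (cone_map A)"
    proof
      fix A assume A: "A \<in> vob C"
      show "iso V (cone_map A)"
        unfolding iso_iff_ex1 [OF cm [OF A]]
      proof (intro ballI)
        fix W g assume W: "W \<in> Obj V" and g: "g \<in> W ~> vhom D (cdiag A) G"
        obtain k where k: "k \<in> W ~> iob K.cm" "if0 K.cp ** k = T.A.jo A ** bang V W" "K.ar ** k = T.B.ja (cdiag A) G ** g"
          by (rule K.cm_obj_ex [of "T.A.jo A ** bang V W" W "T.B.ja (cdiag A) G ** g"]) (use A W g in simp_all)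
        show "\<exists>!v. v \<in> W ~> vhom C A L \<and> cone_map A ** v = g"
          unfolding factors_at_object [OF A g] k(2,3) [symmetric] terminal_iff_factors [OF k(1), symmetric]
          using el k(1) W unfolding elementwise_terminal_def by blast
      qed
    qed
  next
    assume lim: "\<forall>A\<in>vob C. iso V (cone_map A)"
    show "elementwise_terminal K.cm (if0 ce)"
      unfolding elementwise_terminal_def
    proof (intro ballI)
      fix W k assume W: "W \<in> Obj V" and k: "k \<in> W ~> iob K.cm"
      define a f where "a = if0 K.cp ** k" and "f = K.ar ** k"
      have a: "a \<in> W ~> iob JC" and f: "f \<in> W ~> iar JD"
        and fe: "isrc JD ** f = if0 DH ** a" "itgt JD ** f = T.B.jo G ** bang V W"
        using K.cm_obj [OF k] k by (simp_all add: a_def f_def)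
      obtain Z j where Z: "is_coproduct V (vob C) Z (W, j)"
        and aj: "\<And>A. A \<in> vob C \<Longrightarrow> a ** j A = T.A.jo A ** bang V (Z A)"
        using decompose [OF smallC T.A.J_objects a] by blast
      have j: "j A \<in> Z A ~> W" if "A \<in> vob C" for A using coproductD [OF Z] that by simp
      have ex: "\<exists>!u. factors (Z A) (a ** j A) (f ** j A) u" if A: "A \<in> vob C" for A
      proof -
        note jA = j [OF A]
        have ZA: "Z A \<in> Obj V" using jA Hom_Obj1 by blast
        have fj: "f ** j A \<in> Z A ~> iar JD" using f jA by simp
        have "isrc JD ** (f ** j A) = T.B.jo (cdiag A) ** bang V (Z A)" "itgt JD ** (f ** j A) = T.B.jo G ** bang V (Z A)"
          using comp_ext [OF fe(1), of "j A"] comp_ext [OF fe(2), of "j A"] f a jA aj [OF A] A W ZA by simp_all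
        then obtain g where g: "g \<in> Z A ~> vhom D (cdiag A) G" "T.B.ja (cdiag A) G ** g = f ** j A"
          using T.B.ja_factor [of "cdiag A" G "f ** j A" "Z A"] fj A by auto
        have "\<exists>!v. v \<in> Z A ~> vhom C A L \<and> cone_map A ** v = g"
          using bspec [OF lim A] ZA g(1) unfolding iso_iff_ex1 [OF cm [OF A]] by blast
        then show ?thesis unfolding factors_at_object [OF A g(1)] g(2) aj [OF A] .
      qed
      then obtain v where v: "\<And>A. A \<in> vob C \<Longrightarrow> factors (Z A) (a ** j A) (f ** j A) (v A)" by metis
      have vt: "\<And>A. A \<in> vob C \<Longrightarrow> v A \<in> Z A ~> iar JC" using v unfolding factors_def by blast
      obtain u where u: "u \<in> W ~> iar JC" "\<And>A. A \<in> vob C \<Longrightarrow> u ** j A = v A"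
        using coproduct_obtain [OF Z, of v "iar JC"] vt by auto
      have u1: "isrc JC ** u = a"
      proof (rule coproduct_eqI [OF Z])
        fix A assume A: "A \<in> vob C"
        show "(isrc JC ** u) ** j A = a ** j A" using v [OF A] u j [OF A] A unfolding factors_def by simp
      qed (use u a in simp_all)
      have u2: "itgt JC ** u = T.A.jo L ** bang V W"
      proof (rule coproduct_eqI [OF Z])
        fix A assume A: "A \<in> vob C"
        show "(itgt JC ** u) ** j A = (T.A.jo L ** bang V W) ** j A" using v [OF A] u j [OF A] A W unfolding factors_def by simp
      qed (use u W in simp_all)
      note D = DH_tgt [OF u(1) u2]
      have "ic JD (T.B.ja (cdiag L) G ** (cone ** bang V W)) (if1 DH ** u) = f"
      proof (rule coproduct_eqI [OF Z])
        fix A assume A: "A \<in> vob C"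
        have "ic JD (T.B.ja (cdiag L) G ** (cone ** bang V W)) (if1 DH ** u) ** j A =
          ic JD (T.B.ja (cdiag L) G ** (cone ** bang V (Z A))) (if1 DH ** v A)"
          using D u j [OF A] A W by simp
        then show "ic JD (T.B.ja (cdiag L) G ** (cone ** bang V W)) (if1 DH ** u) ** j A = f ** j A"
          using v [OF A] unfolding factors_def by simp
      qed (use D f u(1) in simp_all)
      then have uf: "factors W a f u" unfolding factors_def using u(1) u1 u2 by blast
      have "\<exists>!u. factors W a f u"
      proof (rule ex1I)
        show "factors W a f u" by (rule uf)
        fix u' assume u': "factors W a f u'"
        show "u' = u"
        proof (rule coproduct_eqI [OF Z])
          show "u' \<in> W ~> iar JC" "u \<in> W ~> iar JC" using u' u unfolding factors_def by blast+
          fix A assume A: "A \<in> vob C"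
          show "u' ** j A = u ** j A"
            by (rule ex1_unique [OF ex [OF A]]) (rule factors_comp [OF u' j [OF A]], rule factors_comp [OF uf j [OF A]])
        qed
      qed
      then show "\<exists>!s. arrow_into K.cm (if0 ce) W k s"
        unfolding terminal_iff_factors [OF k] a_def f_def .
    qed
  }
qed

end

theorem corollary8p8:
  fixes U :: "'u set"
    and V :: "('o, 'm) cat"
    and \<G> :: "'o set"
    and I :: "('i, 'o, 'm) vcat"
    and C :: "('c, 'o, 'm) vcat"
    and G :: "('i, 'c, 'm) vfun"
    and L :: 'c
    and l :: "'i \<Rightarrow> 'm"
  assumes "universe U"
    and "category V" and "locally_small V U"
    and "extensive U V" and "cartesian_closed V" and "has_pullbacks V"
    and "conservative_family V \<G>"
    and "vcategory V I" and "small U (vob I)"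
    and "vcategory V C" and "small U (vob C)"
    and "vfunctor V I C G"
    and "L \<in> vob C"
    and "vnat V I C (const_vfun V I C L) G l"
  shows "(vlimit V I C G L l \<longleftrightarrow>
            internal_terminal V (cone_cat V I C G) (cone_elem V I C G L l)) \<and>
         (internal_terminal V (cone_cat V I C G) (cone_elem V I C G L l) \<longleftrightarrow>
            (\<forall>X\<in>\<G>. vterminal V (Und V (ihom V (cst V X) (cone_cat V I C G)))
               (und_elem V X (cone_cat V I C G) (cone_elem V I C G L l))))"
proof -
  interpret cone_setup V U I C G L l
    by unfold_locales (use assms in \<open>auto simp: cartesian_closed_def has_pullbacks_def\<close>)
  have K: "cone_cat V I C G = K.cm" by (simp add: cone_cat_def)
  have "internal_terminal V K.cm (cone_elem V I C G L l) \<longleftrightarrow> elementwise_terminal K.cm (if0 (cone_elem V I C G L l))"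
    by (rule internal_terminal_iff [OF K.cm_simps(1) cone_elem(1)])
  then show ?thesis
    unfolding K vlimit_iff limit_iff_terminal
    using terminal_iff_conservative [OF K.cm_simps(1) cone_elem(1) assms(7)] by blast
qed


end
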